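(* For every $n\ge1$, $(C_*(P_{n+1}),\Delta_P,\partial)$ is a DG coalgebra (not required to be coassociative, cocommutative or counital; i.e. $\Delta_P$ is a chain map), and the cellular projection $\rho_{n+1}:P_{n+1}\to I^n$ induces a DG coalgebra map $$(\rho_{n+1})_*:C_*(P_{n+1})\to C_*(I^n).$$
   Context: **Permutahedra and chains.** Let $\underline{m}=\{1,\dots,m\}$. A partition of a finite set of positive integers is an ordered partition $U_1|\cdots|U_p$ into non-empty blocks. The permutahedron $P_{n+1}$ is the $n$-dimensional polytope whose $(n+1-p)$-dimensional faces are indexed by the partitions $U_1|\cdots|U_p$ of $\underline{n+1}$; the top cell is $\underline{n+1}$. $C_*(P_{n+1})$ is the free abelian group on faces. The face $U_1|\cdots|U_p$ is identified with $P_{\#U_1}\times\cdots\times P_{\#U_p}$, so its chains are $C_*(U_1)\otimes\cdots\otimes C_*(U_p)$, where $C_*(U)$ is the chain complex of the permutahedron on $U$ (faces are the partitions of $U$); tensors are written with bars. For disjoint $M,N$, $\mathrm{shuff}(M;N)$ is the sign of the permutation taking $M\cup N$ in increasing order to $M$ (increasing) followed by $N$ (increasing). The boundary is $$\partial(U_1|\cdots|U_p)=\sum_{k=1}^p\ \sum_{\varnothing\ne M\subsetneq U_k}(-1)^{m_1+\cdots+m_{k-1}+\#M}\,\mathrm{shuff}(M;U_k\setminus M)\;U_1|\cdots|U_{k-1}|M|U_k\setminus M|U_{k+1}|\cdots|U_p,\qquad m_i=\#U_i-1.$$ On tensor products $\partial(a\otimes b)=\partial a\otimes b+(-1)^{\dim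 a}a\otimes\partial b$. **Matrices.** An ordered matrix is a $q\times p$ matrix of non-negative integers whose non-zero entries are exactly $1,\dots,p+q-1$, each occurring once, with no zero row or column, whose non-zero entries increase left to right in each row and top to bottom in each column. If $U_j$ (resp. $V_i$) is the set of non-zero entries of column $j$ (resp. row $i$, row 1 being the top row) of $O$, put $c(O)=U_1|\cdots|U_p$ and $r(O)=V_q|\cdots|V_1$, both partitions of $\underline{p+q-1}$. A step matrix is an ordered matrix in which the non-zero entries of each row lie in consecutive columns, the non-zero entries of each column lie in consecutive rows, and each diagonal $\{j-i=\text{const}\}$ (sub, main and super) contains exactly one non-zero entry. **Configuration matrices.** Let $E$ be a $q\times p$ step matrix with column sets $A_1,\dots,A_p$ and row sets $B_1,\dots,B_q$. Let $M_0=M_p=N_0=N_q=\varnothing$ and choose, successively, (possibly empty) proper subsets $M_j\subset A_j\cup M_{j-1}$ ($1\le j\le p-1$) with every element of $M_j$ larger than $\max A_{j+1}$, and proper subsets $N_i\subset B_i\cup N_{i-1}$ ($1\le i\le q-1$) with every element of $N_i$ larger than $\max B_{i+1}$. Starting with $E$, move the elements of $M_1$ one column to the right (within their rows), then those of $M_2$, ..., $M_{p-1}$; then move the elements of $N_1$ one row down (within their columns), then those of $N_2,\dots,N_{q-1}$. The resulting matrix $F$ (whose column sets are $U_j=(A_j\cup M_{j-1})\setminus M_j$ and row sets are $V_i=(B_i\cup N_{i-1})\setminus N_i$) is called a configuration matrix derived from $E$. Let $\mathcal C^{q\times p}$ be the set of $q\times p$ configuration matrices. **Signs.** For $u=U_1|\cdots|U_p$: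 $psgn(u)$ is the sign of the permutation taking the increasing order on $\bigcup U_i$ to the concatenation of the blocks $U_1,\dots,U_p$, each increasing; $sgn_1(u)=(-1)^{\sum_{i=1}^{p-1}i\,\#U_{p-i}}psgn(u)$; $sgn_2(u)=(-1)^{\binom{p-1}{2}}sgn_1(u)$; $rsgn(u)=\prod_i(-1)^{\#U_i(\#U_i-1)/2}$. For $F\in\mathcal C^{q\times p}$ derived from the step matrix $E$, $$csgn(F)=(-1)^{\binom q2}\,rsgn(c(E))\cdot sgn_1(r(F))\cdot sgn_2(c(E))\cdot sgn_2(c(F)).$$ **The map $\Delta_P$.** For each $n\ge0$, $$\Delta_P(\underline{n+1})=\sum_{1\le q\le n+1}\ \sum_{F\in\mathcal C^{q\times(n-q+2)}}csgn(F)\;c(F)\otimes r(F).$$ On a finite set $U$ in place of $\underline{\#U}$, use the order-preserving relabelling. On proper faces use the comultiplicative extension $\Delta_P(U_1|\cdots|U_p)=\Delta_P(U_1)|\cdots|\Delta_P(U_p)$, where $(a\otimes b)|(a'\otimes b')=(-1)^{\dim a'\dim b}(a|a')\otimes(b|b')$. **The cube and $\rho_{n+1}$.** Regard $I^n$ as the product $P_{\{1,2\}}\times P_{\{2,3\}}\times\cdots\times P_{\{n,n+1\}}$ of $n$ intervals, where in $P_{\{i,i+1\}}$ the vertex $i|i{+}1$ is the endpoint $0$ and $i{+}1|i$ is the endpoint $1$; $C_*(I^n)$ is the tensor product of the $n$ interval complexes, with $\partial e=[1]-[0]$ for the edge $e$, and with the standard (Serre) diagonal, i.e. the tensor product (Koszul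 signs) of the coproducts $\Delta[0]=[0]\otimes[0]$, $\Delta[1]=[1]\otimes[1]$, $\Delta e=[0]\otimes e+e\otimes[1]$. The cellular map $\rho_{n+1}$ sends the face $A_1|\cdots|A_k$ onto the product over $i=1,\dots,n$ of the restrictions of $A_1|\cdots|A_k$ to $\{i,i+1\}$: the whole edge if $i,i+1$ lie in the same block, $i|i{+}1$ if the block containing $i$ precedes that containing $i+1$, and $i{+}1|i$ otherwise. On cellular chains, $(\rho_{n+1})_*(A_1|\cdots|A_k)=0$ unless every block consists of consecutive integers, in which case it equals this product cell multiplied by the sign of the permutation sorting into increasing order of $i$ the edge indices listed block by block ($A_1$ first, then $A_2$, ..., increasing within each block). *)

theory Defs
  imports
    "HOL-Algebra.Free_Abelian_Groups"
    "HOL-Combinatorics.Permutations"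
    "HOL-Library.Disjoint_Sets"
    "Jordan_Normal_Form.Matrix"
begin

section \<open>Differential graded coalgebras on based free abelian groups\<close>

text \<open>
  The graded group is the free abelian group on a set \<open>B\<close> of cells graded by \<open>deg\<close>; its
  tensor square is the free abelian group on pairs of cells. No coassociativity,
  cocommutativity or counit is required.
\<close>

definition tensor :: "('a \<Rightarrow>\<^sub>0 int) \<Rightarrow> ('b \<Rightarrow>\<^sub>0 int) \<Rightarrow> (('a \<times> 'b) \<Rightarrow>\<^sub>0 int)" where
  "tensor x y = frag_extend (\<lambda>a. frag_extend (\<lambda>b. frag_of (a, b)) y) x"

definition tensor_map ::
  "(('a \<Rightarrow>\<^sub>0 int) \<Rightarrow> ('c \<Rightarrow>\<^sub>0 int)) \<Rightarrow> (('b \<Rightarrow>\<^sub>0 int) \<Rightarrow> ('d \<Rightarrow>\<^sub>0 int)) \<Rightarrow>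
   (('a \<times> 'b) \<Rightarrow>\<^sub>0 int) \<Rightarrow> (('c \<times> 'd) \<Rightarrow>\<^sub>0 int)" where
  "tensor_map f g = frag_extend (\<lambda>(a, b). tensor (f (frag_of a)) (g (frag_of b)))"

definition tensor_boundary ::
  "('a \<Rightarrow> nat) \<Rightarrow> (('a \<Rightarrow>\<^sub>0 int) \<Rightarrow> ('a \<Rightarrow>\<^sub>0 int)) \<Rightarrow> (('a \<times> 'a) \<Rightarrow>\<^sub>0 int) \<Rightarrow> (('a \<times> 'a) \<Rightarrow>\<^sub>0 int)" where
  "tensor_boundary deg bd = frag_extend (\<lambda>(a, b).
     tensor (bd (frag_of a)) (frag_of b) +
     frag_cmul ((-1) ^ deg a) (tensor (frag_of a) (bd (frag_of b))))"

locale dg_coalgebra =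
  fixes B :: "'a set"
    and deg :: "'a \<Rightarrow> nat"
    and bd :: "('a \<Rightarrow>\<^sub>0 int) \<Rightarrow> ('a \<Rightarrow>\<^sub>0 int)"
    and cop :: "('a \<Rightarrow>\<^sub>0 int) \<Rightarrow> (('a \<times> 'a) \<Rightarrow>\<^sub>0 int)"
  assumes bd_hom: "bd \<in> hom (free_Abelian_group B) (free_Abelian_group B)"
    and bd_degree: "b \<in> B \<Longrightarrow>
      bd (frag_of b) \<in> carrier (free_Abelian_group {a \<in> B. deg a + 1 = deg b})"
    and bd_bd: "c \<in> carrier (free_Abelian_group B) \<Longrightarrow> bd (bd c) = 0"
    and cop_hom: "cop \<in> hom (free_Abelian_group B) (free_Abelian_group (B \<times> B))"
    and cop_degree: "b \<in> B \<Longrightarrow>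
      cop (frag_of b) \<in> carrier (free_Abelian_group {(x, y) \<in> B \<times> B. deg x + deg y = deg b})"
    and cop_bd: "c \<in> carrier (free_Abelian_group B) \<Longrightarrow>
      cop (bd c) = tensor_boundary deg bd (cop c)"

locale dg_coalgebra_map =
  src: dg_coalgebra B deg bd cop + tgt: dg_coalgebra B' deg' bd' cop'
  for B :: "'a set" and deg bd cop and B' :: "'b set" and deg' bd' cop' +
  fixes f :: "('a \<Rightarrow>\<^sub>0 int) \<Rightarrow> ('b \<Rightarrow>\<^sub>0 int)"
  assumes map_hom: "f \<in> hom (free_Abelian_group B) (free_Abelian_group B')"
    and map_degree: "b \<in> B \<Longrightarrow>
      f (frag_of b) \<in> carrier (free_Abelian_group {a \<in> B'. deg' a = deg b})"
    and map_bd: "c \<in> carrier (free_Abelian_group B) \<Longrightarrow> f (bd c) = bd' (f c)"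
    and map_cop: "c \<in> carrier (free_Abelian_group B) \<Longrightarrow> cop' (f c) = tensor_map f f (cop c)"

text \<open>
  Cells of a product are lists of cells of the factors, and the product of cells is
  concatenation: \<open>(a \<otimes> b)|(a' \<otimes> b') = (-1)^(deg a' * deg b) (a|a') \<otimes> (b|b')\<close>.
\<close>

definition bar_product ::
  "('a list \<Rightarrow> nat) \<Rightarrow> (('a list \<times> 'a list) \<Rightarrow>\<^sub>0 int) \<Rightarrow> (('a list \<times> 'a list) \<Rightarrow>\<^sub>0 int) \<Rightarrow>
   (('a list \<times> 'a list) \<Rightarrow>\<^sub>0 int)" where
  "bar_product deg x y = frag_extend (\<lambda>(a, b). frag_extend (\<lambda>(a', b').
     frag_cmul ((-1) ^ (deg a' * deg b)) (frag_of (a @ a', b @ b'))) y) x"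


section \<open>Cellular chains of permutahedra\<close>

text \<open>The ordered partition \<open>U\<^sub>1|\<dots>|U\<^sub>p\<close> is the list of its blocks, so \<open>U\<^sub>k\<close> is entry \<open>k - 1\<close>.\<close>

definition ordered_partitions :: "nat set \<Rightarrow> nat set list set" where
  "ordered_partitions U = {u. distinct u \<and> partition_on U (set u)}"

definition perm_faces :: "nat \<Rightarrow> nat set list set" where
  "perm_faces m = ordered_partitions {1..m}"

definition part_dim :: "nat set list \<Rightarrow> nat" where
  "part_dim u = (\<Sum>U\<leftarrow>u. card U - 1)"

text \<open>Sign of the permutation taking the increasing order of a distinct list to the list.\<close>

definition list_sign :: "nat list \<Rightarrow> int" where
  "list_sign xs = sign (permutation_of_list (zip (sort xs) xs))"

definition psgn :: "nat set list \<Rightarrow> int" where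
  "psgn u = list_sign (concat (map sorted_list_of_set u))"

definition shuff :: "nat set \<Rightarrow> nat set \<Rightarrow> int" where
  "shuff M N = list_sign (sorted_list_of_set M @ sorted_list_of_set N)"

definition perm_boundary_face :: "nat set list \<Rightarrow> (nat set list \<Rightarrow>\<^sub>0 int)" where
  "perm_boundary_face u = (\<Sum>k<length u. \<Sum>M | M \<noteq> {} \<and> M \<subset> u ! k.
     frag_cmul ((-1) ^ ((\<Sum>i<k. card (u ! i) - 1) + card M) * shuff M (u ! k - M))
       (frag_of (take k u @ [M, u ! k - M] @ drop (Suc k) u)))"

definition perm_boundary :: "(nat set list \<Rightarrow>\<^sub>0 int) \<Rightarrow> (nat set list \<Rightarrow>\<^sub>0 int)" where
  "perm_boundary = frag_extend perm_boundary_face"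


section \<open>Ordered, step and configuration matrices\<close>

text \<open>Matrix indices start at 0, and row 0 is the top row.\<close>

definition support :: "nat mat \<Rightarrow> (nat \<times> nat) set" where
  "support F = {(i, j). i < dim_row F \<and> j < dim_col F \<and> F $$ (i, j) \<noteq> 0}"

definition row_set :: "nat mat \<Rightarrow> nat \<Rightarrow> nat set" where
  "row_set F i = {F $$ (i, j) | j. (i, j) \<in> support F}"

definition col_set :: "nat mat \<Rightarrow> nat \<Rightarrow> nat set" where
  "col_set F j = {F $$ (i, j) | i. (i, j) \<in> support F}"

definition col_part :: "nat mat \<Rightarrow> nat set list" where
  "col_part F = map (col_set F) [0..<dim_col F]"

definition row_part :: "nat mat \<Rightarrow> nat set list" where
  "row_part F = rev (map (row_set F) [0..<dim_row F])"

definition ordered_matrix :: "nat \<Rightarrow> nat \<Rightarrow> nat mat \<Rightarrow> bool" where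
  "ordered_matrix q p F \<longleftrightarrow>
     F \<in> carrier_mat q p \<and> 1 \<le> q \<and> 1 \<le> p \<and>
     bij_betw (\<lambda>ij. F $$ ij) (support F) {1..p + q - 1} \<and>
     (\<forall>i<q. row_set F i \<noteq> {}) \<and> (\<forall>j<p. col_set F j \<noteq> {}) \<and>
     (\<forall>i j k. (i, j) \<in> support F \<and> (i, k) \<in> support F \<and> j < k \<longrightarrow> F $$ (i, j) < F $$ (i, k)) \<and>
     (\<forall>i k j. (i, j) \<in> support F \<and> (k, j) \<in> support F \<and> i < k \<longrightarrow> F $$ (i, j) < F $$ (k, j))"

definition step_matrix :: "nat \<Rightarrow> nat \<Rightarrow> nat mat \<Rightarrow> bool" where
  "step_matrix q p E \<longleftrightarrow>
     ordered_matrix q p E \<and>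
     (\<forall>i j k l. (i, j) \<in> support E \<and> (i, l) \<in> support E \<and> j < k \<and> k < l \<longrightarrow> (i, k) \<in> support E) \<and>
     (\<forall>j i k l. (i, j) \<in> support E \<and> (l, j) \<in> support E \<and> i < k \<and> k < l \<longrightarrow> (k, j) \<in> support E) \<and>
     (\<forall>d \<in> {1 - int q..int p - 1}. \<exists>!ij. ij \<in> support E \<and> int (snd ij) - int (fst ij) = d)"

text \<open>
  Since entries are distinct, the elements to be moved are specified by value alone.
\<close>

definition shift_right :: "nat set \<Rightarrow> nat mat \<Rightarrow> nat mat" where
  "shift_right S F = mat (dim_row F) (dim_col F) (\<lambda>(i, j).
     if 0 < j \<and> F $$ (i, j - 1) \<in> S then F $$ (i, j - 1)
     else if F $$ (i, j) \<in> S then 0 else F $$ (i, j))"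

definition shift_down :: "nat set \<Rightarrow> nat mat \<Rightarrow> nat mat" where
  "shift_down S F = mat (dim_row F) (dim_col F) (\<lambda>(i, j).
     if 0 < i \<and> F $$ (i - 1, j) \<in> S then F $$ (i - 1, j)
     else if F $$ (i, j) \<in> S then 0 else F $$ (i, j))"

text \<open>
  \<open>M 1, M 2, \<dots>\<close> are numbered from 1, with \<open>M 0 = {}\<close>, whereas the list \<open>A\<close> is indexed from 0:
  \<open>A ! (j - 1)\<close> is \<open>A\<^sub>j\<close> and \<open>A ! j\<close> is \<open>A\<^sub>j\<^sub>+\<^sub>1\<close>.
\<close>

definition admissible :: "nat set list \<Rightarrow> (nat \<Rightarrow> nat set) \<Rightarrow> bool" where
  "admissible A M \<longleftrightarrow> M 0 = {} \<and>
     (\<forall>j \<in> {1..<length A}. M j \<subset> A ! (j - 1) \<union> M (j - 1) \<and> (\<forall>x \<in> M j. Max (A ! j) < x))"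

definition derived_from :: "nat mat \<Rightarrow> nat mat \<Rightarrow> bool" where
  "derived_from E F \<longleftrightarrow> (\<exists>M N.
     admissible (map (col_set E) [0..<dim_col E]) M \<and>
     admissible (map (row_set E) [0..<dim_row E]) N \<and>
     F = fold (\<lambda>i. shift_down (N i)) [1..<dim_row E]
           (fold (\<lambda>j. shift_right (M j)) [1..<dim_col E] E))"

definition config_matrices :: "nat \<Rightarrow> nat \<Rightarrow> nat mat set" where
  "config_matrices q p = {F. \<exists>E. step_matrix q p E \<and> derived_from E F}"


section \<open>Signs and the diagonal\<close>

definition sgn1 :: "nat set list \<Rightarrow> int" where
  "sgn1 u = (-1) ^ (\<Sum>i = 1..<length u. i * card (u ! (length u - i - 1))) * psgn u"

definition sgn2 :: "nat set list \<Rightarrow> int" where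
  "sgn2 u = (-1) ^ ((length u - 1) choose 2) * sgn1 u"

definition rsgn :: "nat set list \<Rightarrow> int" where
  "rsgn u = (\<Prod>U\<leftarrow>u. (-1) ^ (card U * (card U - 1) div 2))"

text \<open>The step matrix from which a configuration matrix is derived is unique.\<close>

definition source_step :: "nat mat \<Rightarrow> nat mat" where
  "source_step F = (SOME E. step_matrix (dim_row F) (dim_col F) E \<and> derived_from E F)"

definition csgn :: "nat mat \<Rightarrow> int" where
  "csgn F = (let E = source_step F in
     (-1) ^ (dim_row F choose 2) * rsgn (col_part E) * sgn1 (row_part F) *
     sgn2 (col_part E) * sgn2 (col_part F))"

definition perm_diag_top :: "nat \<Rightarrow> ((nat set list \<times> nat set list) \<Rightarrow>\<^sub>0 int)" where
  "perm_diag_top n = (\<Sum>q = 1..n + 1. \<Sum>F \<in> config_matrices q (n + 2 - q).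
     frag_cmul (csgn F) (frag_of (col_part F, row_part F)))"

text \<open>\<open>relabel U\<close> transports partitions along the order isomorphism from \<open>{1..card U}\<close> onto \<open>U\<close>.\<close>

definition relabel :: "nat set \<Rightarrow> nat set list \<Rightarrow> nat set list" where
  "relabel U = map (image (\<lambda>k. sorted_list_of_set U ! (k - 1)))"

definition perm_diag_block :: "nat set \<Rightarrow> ((nat set list \<times> nat set list) \<Rightarrow>\<^sub>0 int)" where
  "perm_diag_block U =
     frag_extend (\<lambda>(a, b). frag_of (relabel U a, relabel U b)) (perm_diag_top (card U - 1))"

definition perm_diag_face :: "nat set list \<Rightarrow> ((nat set list \<times> nat set list) \<Rightarrow>\<^sub>0 int)" where
  "perm_diag_face u =
     foldr (\<lambda>U. bar_product part_dim (perm_diag_block U)) u (frag_of ([], []))"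

definition perm_diag :: "(nat set list \<Rightarrow>\<^sub>0 int) \<Rightarrow> ((nat set list \<times> nat set list) \<Rightarrow>\<^sub>0 int)" where
  "perm_diag = frag_extend perm_diag_face"


section \<open>The cube and the projection\<close>

text \<open>
  In the \<open>i\<close>-th factor, \<open>End0\<close> is the vertex \<open>i|i+1\<close>, \<open>End1\<close> the vertex \<open>i+1|i\<close>. A cell of the
  \<open>n\<close>-cube is a list of \<open>n\<close> interval cells.
\<close>

datatype interval_cell = End0 | End1 | Edge

primrec interval_dim :: "interval_cell \<Rightarrow> nat" where
  "interval_dim End0 = 0"
| "interval_dim End1 = 0"
| "interval_dim Edge = 1"

primrec interval_boundary :: "interval_cell \<Rightarrow> (interval_cell \<Rightarrow>\<^sub>0 int)" where
  "interval_boundary End0 = 0"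
| "interval_boundary End1 = 0"
| "interval_boundary Edge = frag_of End1 - frag_of End0"

primrec interval_diag :: "interval_cell \<Rightarrow> ((interval_cell list \<times> interval_cell list) \<Rightarrow>\<^sub>0 int)" where
  "interval_diag End0 = frag_of ([End0], [End0])"
| "interval_diag End1 = frag_of ([End1], [End1])"
| "interval_diag Edge = frag_of ([End0], [Edge]) + frag_of ([Edge], [End1])"

definition cube_cells :: "nat \<Rightarrow> interval_cell list set" where
  "cube_cells n = {c. length c = n}"

definition cube_dim :: "interval_cell list \<Rightarrow> nat" where
  "cube_dim c = (\<Sum>e\<leftarrow>c. interval_dim e)"

primrec cube_boundary_cell :: "interval_cell list \<Rightarrow> (interval_cell list \<Rightarrow>\<^sub>0 int)" where
  "cube_boundary_cell [] = 0"
| "cube_boundary_cell (e # c) =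
     frag_extend (\<lambda>e'. frag_of (e' # c)) (interval_boundary e) +
     frag_cmul ((-1) ^ interval_dim e) (frag_extend (\<lambda>c'. frag_of (e # c')) (cube_boundary_cell c))"

definition cube_boundary :: "(interval_cell list \<Rightarrow>\<^sub>0 int) \<Rightarrow> (interval_cell list \<Rightarrow>\<^sub>0 int)" where
  "cube_boundary = frag_extend cube_boundary_cell"

definition cube_diag_cell ::
  "interval_cell list \<Rightarrow> ((interval_cell list \<times> interval_cell list) \<Rightarrow>\<^sub>0 int)" where
  "cube_diag_cell c = foldr (\<lambda>e. bar_product cube_dim (interval_diag e)) c (frag_of ([], []))"

definition cube_diag ::
  "(interval_cell list \<Rightarrow>\<^sub>0 int) \<Rightarrow> ((interval_cell list \<times> interval_cell list) \<Rightarrow>\<^sub>0 int)" where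
  "cube_diag = frag_extend cube_diag_cell"

text \<open>The cellular map from the permutahedron on \<open>{1..n + 1}\<close> to the \<open>n\<close>-cube, on faces.\<close>

definition rho_cell :: "nat \<Rightarrow> nat set list \<Rightarrow> interval_cell list" where
  "rho_cell n u = map (\<lambda>i.
     if \<exists>A \<in> set u. i \<in> A \<and> i + 1 \<in> A then Edge
     else if \<exists>j k. j < k \<and> k < length u \<and> i \<in> u ! j \<and> i + 1 \<in> u ! k then End0
     else End1) [1..<n + 1]"

text \<open>
  The edge indices, block by block. The permutation sorting this list is inverse to the one
  defining \<open>list_sign\<close> and has the same sign.
\<close>

definition edge_indices :: "nat set list \<Rightarrow> nat list" where
  "edge_indices u = concat (map (\<lambda>A. sorted_list_of_set {i \<in> A. i + 1 \<in> A}) u)"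

definition rho_chain :: "nat \<Rightarrow> (nat set list \<Rightarrow>\<^sub>0 int) \<Rightarrow> (interval_cell list \<Rightarrow>\<^sub>0 int)" where
  "rho_chain n = frag_extend (\<lambda>u.
     if \<forall>A \<in> set u. \<exists>a b. A = {a..b}
     then frag_cmul (list_sign (edge_indices u)) (frag_of (rho_cell n u))
     else 0)"

end

theory Submission
  imports Defs "HOL-Combinatorics.Multiset_Permutations"
begin

text \<open>
  Everything is reduced to removing the largest element. For an arbitrary finite set \<open>S\<close> with all
  elements below \<open>m\<close>, the diagonal of the top cell \<open>S \<union> {m}\<close> is the signed sum, over all ordered
  splittings \<open>S = B \<squnion> A\<close>, of \<open>R (\<Delta> B) | L (\<Delta> A)\<close>, where \<open>R\<close> (resp. \<open>L\<close>) inserts \<open>m\<close> in all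
  possible ways into a block of the second (resp. first) tensor factor, and gives the new block \<open>{m}\<close>
  if \<open>B\<close> (resp. \<open>A\<close>) is empty. Insertion of \<open>m\<close> commutes with the boundary up to the two terms in
  which \<open>{m}\<close> is added at one end, so that \<open>\<Delta>\<close> is a chain map by a telescoping cancellation.

  To see that the configuration matrices satisfy this recursion, read a step matrix along its
  staircase: it becomes a word without repetitions whose descending runs are its columns and whose
  ascending runs are its rows. The right shifts and the down shifts act independently on the columns
  and on the rows, and inserting \<open>m\<close> in a block corresponds to the choice of how far \<open>m\<close> is moved.

  The projection to the cube is treated by the same induction: after insertion of \<open>m\<close>, only
  the terms in which \<open>m\<close> lies in a block by itself or together with \<open>m - 1\<close> survive.
\<close>

text \<open>The convention for an empty \<open>B\<close> or \<open>A\<close> shapes the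
  cancellation: it turns the two end terms in the boundary of an insertion into ordinary summands
  with an empty half. Writing \<open>D\<close> for the diagonal, the boundary of
  \<open>R B | L A\<close> then consists of four families, \<open>D P | R Q | L A\<close>,
  \<open>R P | D Q | L A\<close>, \<open>R B | D P | L Q\<close> and \<open>R B | L P | D Q\<close>.
  The middle two cancel by associativity of splittings; the outer two are the faces of the top cell
  whose second, respectively first, block contains \<open>m\<close>. The sign of an insertion, -1 to
  the dimension of the later blocks, is forced: it is the change of \<open>sgn1\<close> when a block
  receives the maximum. The other obstacle is that \<open>csgn\<close> refers to a step matrix
  picked by \<open>SOME\<close>. A sum over matrices becomes a sum over words only once a matrix is
  known to determine its word. The argument is connectivity: column and row blocks of a
  configuration form a connected incidence graph, and a second way of cutting the word at
  \<open>m\<close> would give a proper closed subset in one half. Arbitrary finite sets are needed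
  because the recursion passes to subsets; naturality under increasing maps leads back to the
  relabelled blocks.\<close>

section \<open>Linear maps between free abelian groups\<close>

text \<open>Agreement is asked only on the cells that occur in \<open>c\<close>, so an identity
  whose sign depends on degree or membership extends by linearity to every \<open>c\<close> whose
  cells satisfy the condition. Applied to one argument after the other, this proves most bilinear
  identities below.\<close>

lemma frag_additive_eqI:
  assumes "\<And>x y. F (x - y) = F x - F y" "\<And>x y. G (x - y) = G x - G y" "F 0 = 0" "G 0 = 0"
    and "\<And>a. a \<in> Poly_Mapping.keys c \<Longrightarrow> F (frag_of a) = G (frag_of a)"
  shows "F c = (G c :: 'b::ab_group_add)"
  by (rule frag_induction[of c "Poly_Mapping.keys c"]) (use assms in auto)

lemma frag_extend_fun_add: "frag_extend (\<lambda>a. f a + g a) x = frag_extend f x + frag_extend g x"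
  by (simp add: frag_extend_def frag_cmul_distrib2 sum.distrib)

lemma frag_extend_fun_cmul: "frag_extend (\<lambda>a. frag_cmul k (f a)) x = frag_cmul k (frag_extend f x)"
  by (simp add: frag_extend_def frag_cmul_sum mult.commute)

lemma frag_extend_fun_minus: "frag_extend (\<lambda>a. - f a) x = - frag_extend f x"
  using frag_extend_fun_cmul[of "-1" f x] by simp

lemma frag_extend_fun_diff: "frag_extend (\<lambda>a. f a - g a) x = frag_extend f x - frag_extend g x"
  using frag_extend_fun_add[of f "\<lambda>a. - g a" x] by (simp add: frag_extend_fun_minus)

lemma frag_extend_fun_zero [simp]: "frag_extend (\<lambda>a. 0) x = 0"
  by (simp add: frag_extend_def)

lemma frag_extend_fun_sum: "frag_extend (\<lambda>a. \<Sum>i\<in>I. f i a) x = (\<Sum>i\<in>I. frag_extend (f i) x)"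
  by (induction I rule: infinite_finite_induct) (simp_all add: frag_extend_fun_add)

lemma frag_extend_sum': "frag_extend f (\<Sum>i\<in>I. g i) = (\<Sum>i\<in>I. frag_extend f (g i))"
  by (induction I rule: infinite_finite_induct) (simp_all add: frag_extend_add)

lemma frag_extend_extend:
  "frag_extend f (frag_extend g x) = frag_extend (\<lambda>a. frag_extend f (g a)) x"
  by (rule frag_additive_eqI) (auto simp: frag_extend_diff)

lemma keys_frag_extend_subset:
  assumes "\<And>a. a \<in> Poly_Mapping.keys x \<Longrightarrow> Poly_Mapping.keys (f a) \<subseteq> S"
  shows "Poly_Mapping.keys (frag_extend f x) \<subseteq> S"
  using keys_frag_extend[of f x] assms by fastforce

lemma keys_sum_subset:
  assumes "\<And>i. i \<in> I \<Longrightarrow> Poly_Mapping.keys (f i) \<subseteq> S"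
  shows "Poly_Mapping.keys (\<Sum>i\<in>I. f i) \<subseteq> S"
  using keys_sum[of f I] assms by fastforce

lemma keys_add_subset:
  assumes "Poly_Mapping.keys x \<subseteq> S" "Poly_Mapping.keys y \<subseteq> S"
  shows "Poly_Mapping.keys (x + y) \<subseteq> S"
  using assms Poly_Mapping.keys_add[of x y] by auto

lemma keys_frag_cmul_subset:
  "Poly_Mapping.keys x \<subseteq> S \<Longrightarrow> Poly_Mapping.keys (frag_cmul k x) \<subseteq> S"
  using keys_cmul[of k x] by auto

lemma frag_extend_hom:
  assumes "\<And>a. a \<in> S \<Longrightarrow> Poly_Mapping.keys (f a) \<subseteq> T"
  shows "frag_extend f \<in> hom (free_Abelian_group S) (free_Abelian_group T)"
  by (rule homI) (use assms in \<open>auto simp: frag_extend_add intro!: keys_frag_extend_subset\<close>)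

lemma frag_cmul_diff_distrib2: "frag_cmul k (x - y) = frag_cmul k x - frag_cmul k y"
  by (rule poly_mapping_eqI) (simp add: lookup_minus algebra_simps)

lemma minus_one_power_eqI: "even (a + b) \<Longrightarrow> (-1::int) ^ a = (-1) ^ b"
  by (auto simp: minus_one_power_iff)

section \<open>Bilinear products of chains\<close>

lemma tensor_frag_of [simp]: "tensor (frag_of a) (frag_of b) = frag_of (a, b)"
  by (simp add: tensor_def)

lemma tensor_add_left: "tensor (x + x') y = tensor x y + tensor x' y"
  by (simp add: tensor_def frag_extend_add)

lemma tensor_add_right: "tensor x (y + y') = tensor x y + tensor x y'"
  by (simp add: tensor_def frag_extend_add frag_extend_fun_add)

lemma tensor_cmul_left: "tensor (frag_cmul k x) y = frag_cmul k (tensor x y)"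
  by (simp add: tensor_def frag_extend_cmul)

lemma tensor_cmul_right: "tensor x (frag_cmul k y) = frag_cmul k (tensor x y)"
  by (simp add: tensor_def frag_extend_cmul frag_extend_fun_cmul)

lemma tensor_diff_left: "tensor (x - x') y = tensor x y - tensor x' y"
  by (simp add: tensor_def frag_extend_diff)

lemma tensor_diff_right: "tensor x (y - y') = tensor x y - tensor x y'"
  by (simp add: tensor_def frag_extend_diff frag_extend_fun_diff)

lemma tensor_zero [simp]: "tensor 0 y = 0" "tensor x 0 = 0"
  by (simp_all add: tensor_def)

lemma keys_tensor:
  assumes "Poly_Mapping.keys x \<subseteq> S" "Poly_Mapping.keys y \<subseteq> T"
  shows "Poly_Mapping.keys (tensor x y) \<subseteq> S \<times> T"
  unfolding tensor_def
  by (intro keys_frag_extend_subset) (use assms in \<open>auto simp: keys_frag_of\<close>)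

text \<open>The multiplication of the free ring on words, that is, the bar between chains. It
  carries no sign; signs enter only with \<open>bar_product\<close>, where factors of two pairs are
  interchanged.\<close>

definition concat_product :: "('a list \<Rightarrow>\<^sub>0 int) \<Rightarrow> ('a list \<Rightarrow>\<^sub>0 int) \<Rightarrow> ('a list \<Rightarrow>\<^sub>0 int)" where
  "concat_product x y = frag_extend (\<lambda>a. frag_extend (\<lambda>b. frag_of (a @ b)) y) x"

lemma concat_product_frag_of [simp]: "concat_product (frag_of a) (frag_of b) = frag_of (a @ b)"
  by (simp add: concat_product_def)

lemma concat_product_add_left: "concat_product (x + x') y = concat_product x y + concat_product x' y"
  by (simp add: concat_product_def frag_extend_add)

lemma concat_product_add_right: "concat_product x (y + y') = concat_product x y + concat_product x y'"
  by (simp add: concat_product_def frag_extend_add frag_extend_fun_add)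

lemma concat_product_diff_left: "concat_product (x - x') y = concat_product x y - concat_product x' y"
  by (simp add: concat_product_def frag_extend_diff)

lemma concat_product_diff_right: "concat_product x (y - y') = concat_product x y - concat_product x y'"
  by (simp add: concat_product_def frag_extend_diff frag_extend_fun_diff)

lemma concat_product_cmul_left: "concat_product (frag_cmul k x) y = frag_cmul k (concat_product x y)"
  by (simp add: concat_product_def frag_extend_cmul)

lemma concat_product_cmul_right: "concat_product x (frag_cmul k y) = frag_cmul k (concat_product x y)"
  by (simp add: concat_product_def frag_extend_cmul frag_extend_fun_cmul)

lemma concat_product_zero [simp]: "concat_product 0 y = 0" "concat_product x 0 = 0"
  by (simp_all add: concat_product_def)

lemma concat_product_sum_left: "concat_product (\<Sum>i\<in>I. f i) y = (\<Sum>i\<in>I. concat_product (f i) y)"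
  by (simp add: concat_product_def frag_extend_sum')

lemma concat_product_sum_right: "concat_product x (\<Sum>i\<in>I. f i) = (\<Sum>i\<in>I. concat_product x (f i))"
  by (simp add: concat_product_def frag_extend_sum' frag_extend_fun_sum)

lemma concat_product_Nil [simp]:
  "concat_product (frag_of []) x = x" "concat_product x (frag_of []) = x"
  using frag_expansion[of x] by (simp_all add: concat_product_def)

lemma concat_product_assoc:
  "concat_product (concat_product x y) z = concat_product x (concat_product y z)"
  by (simp add: concat_product_def frag_extend_extend)

lemma keys_concat_product:
  assumes "\<And>a b. a \<in> Poly_Mapping.keys x \<Longrightarrow> b \<in> Poly_Mapping.keys y \<Longrightarrow> a @ b \<in> S"
  shows "Poly_Mapping.keys (concat_product x y) \<subseteq> S"
  unfolding concat_product_def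
  by (intro keys_frag_extend_subset) (use assms in \<open>auto simp: keys_frag_of\<close>)

lemma bar_product_frag_of:
  "bar_product deg (frag_of (a, b)) (frag_of (a', b')) =
    frag_cmul ((-1) ^ (deg a' * deg b)) (frag_of (a @ a', b @ b'))"
  by (simp add: bar_product_def)

lemma bar_product_add_left: "bar_product d (x + x') y = bar_product d x y + bar_product d x' y"
  by (simp add: bar_product_def frag_extend_add)

lemma bar_product_add_right: "bar_product d x (y + y') = bar_product d x y + bar_product d x y'"
  by (simp add: bar_product_def frag_extend_add frag_extend_fun_add split_def)

lemma bar_product_diff_left: "bar_product d (x - x') y = bar_product d x y - bar_product d x' y"
  by (simp add: bar_product_def frag_extend_diff)

lemma bar_product_diff_right: "bar_product d x (y - y') = bar_product d x y - bar_product d x y'"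
  by (simp add: bar_product_def frag_extend_diff frag_extend_fun_diff split_def)

lemma bar_product_cmul_left: "bar_product d (frag_cmul k x) y = frag_cmul k (bar_product d x y)"
  by (simp add: bar_product_def frag_extend_cmul)

lemma bar_product_cmul_right: "bar_product d x (frag_cmul k y) = frag_cmul k (bar_product d x y)"
  by (simp add: bar_product_def frag_extend_cmul frag_extend_fun_cmul split_def)

lemma bar_product_zero [simp]: "bar_product d 0 y = 0" "bar_product d x 0 = 0"
  by (simp_all add: bar_product_def split_def)

lemma bar_product_sum_left: "bar_product d (\<Sum>i\<in>I. f i) y = (\<Sum>i\<in>I. bar_product d (f i) y)"
  by (simp add: bar_product_def frag_extend_sum')

lemma bar_product_sum_right: "bar_product d x (\<Sum>i\<in>I. f i) = (\<Sum>i\<in>I. bar_product d x (f i))"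
  by (simp add: bar_product_def frag_extend_sum' frag_extend_fun_sum split_def)

lemma keys_bar_product:
  assumes "\<And>a b a' b'. (a, b) \<in> Poly_Mapping.keys x \<Longrightarrow> (a', b') \<in> Poly_Mapping.keys y \<Longrightarrow>
     (a @ a', b @ b') \<in> S"
  shows "Poly_Mapping.keys (bar_product d x y) \<subseteq> S"
  unfolding bar_product_def split_def
  by (intro keys_frag_extend_subset keys_frag_cmul_subset) (use assms in \<open>auto simp: keys_frag_of\<close>)

section \<open>Differential graded rings of words and multiplicative diagonals\<close>

text \<open>Faces of permutahedra are words in blocks and cells of the cube are words in interval
  cells; the formal part of both coalgebras is done once, for graded words.\<close>

locale graded_words =
  fixes deg :: "'a list \<Rightarrow> nat"
  assumes deg_append: "deg (u @ v) = deg u + deg v"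
begin

lemma deg_Nil [simp]: "deg [] = 0"
  using deg_append[of "[]" "[]"] by simp

abbreviation bar where "bar \<equiv> bar_product deg"

lemma bar_Nil [simp]: "bar (frag_of ([], [])) x = x" "bar x (frag_of ([], [])) = x"
  using frag_expansion[of x] by (simp_all add: bar_product_def case_prod_unfold)

text \<open>Both bracketings interchange the same three pairs of factors, so the exponents agree
  because \<open>deg\<close> is additive.\<close>

lemma bar_assoc: "bar (bar x y) z = bar x (bar y z)"
proof -
  have *: "bar (bar (frag_of p) (frag_of q)) (frag_of r) = bar (frag_of p) (bar (frag_of q) (frag_of r))"
    for p q r
    by (cases p; cases q; cases r)
      (simp add: bar_product_frag_of bar_product_cmul_left bar_product_cmul_right deg_append
        power_add[symmetric] algebra_simps)
  have 1: "bar (bar (frag_of p) (frag_of q)) z = bar (frag_of p) (bar (frag_of q) z)" for p q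
    by (rule frag_additive_eqI) (use * in \<open>auto simp: bar_product_diff_right\<close>)
  have 2: "bar (bar (frag_of p) y) z = bar (frag_of p) (bar y z)" for p
    by (rule frag_additive_eqI[where c = y]) (use 1 in \<open>auto simp: bar_product_diff_right bar_product_diff_left\<close>)
  show ?thesis
    by (rule frag_additive_eqI[where c = x]) (use 2 in \<open>auto simp: bar_product_diff_left\<close>)
qed

text \<open>The Koszul sign that an operator of odd degree produces when it passes a chain of the
  tensor square. It is an operator, and not a power of -1, because chains need not be
  homogeneous.\<close>

definition twist :: "(('a list \<times> 'a list) \<Rightarrow>\<^sub>0 int) \<Rightarrow> (('a list \<times> 'a list) \<Rightarrow>\<^sub>0 int)" where
  "twist = frag_extend (\<lambda>(a, b). frag_cmul ((-1) ^ (deg a + deg b)) (frag_of (a, b)))"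

lemma twist_homogeneous:
  assumes "\<And>a b. (a, b) \<in> Poly_Mapping.keys x \<Longrightarrow> deg a + deg b = d"
  shows "twist x = frag_cmul ((-1) ^ d) x"
proof -
  have "twist x = frag_extend (\<lambda>p. frag_cmul ((-1) ^ d) (frag_of p)) x"
    unfolding twist_def by (rule frag_extend_eq) (use assms in auto)
  then show ?thesis
    using frag_expansion[of x] by (simp add: frag_extend_fun_cmul)
qed

end

text \<open>A boundary that obeys the Leibniz rule on words. That its square vanishes is assumed on
  single letters and propagates to words.\<close>

locale dg_words = graded_words deg for deg :: "'a list \<Rightarrow> nat" +
  fixes bdc :: "'a list \<Rightarrow> ('a list \<Rightarrow>\<^sub>0 int)"
  assumes bdc_append: "bdc (u @ v) = concat_product (bdc u) (frag_of v) +
      frag_cmul ((-1) ^ deg u) (concat_product (frag_of u) (bdc v))"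
    and bdc_degree: "x \<in> Poly_Mapping.keys (bdc u) \<Longrightarrow> deg x + 1 = deg u"
    and bdc_bdc_single: "frag_extend bdc (bdc [a]) = 0"
begin

abbreviation bd where "bd \<equiv> frag_extend bdc"

lemma bdc_Nil [simp]: "bdc [] = 0"
  using bdc_append[of "[]" "[]"] by simp

lemma bd_concat_product:
  assumes "\<And>a. a \<in> Poly_Mapping.keys x \<Longrightarrow> deg a = d"
  shows "bd (concat_product x y) =
    concat_product (bd x) y + frag_cmul ((-1) ^ d) (concat_product x (bd y))"
proof -
  have 1: "bd (concat_product (frag_of a) y) =
      concat_product (bdc a) y + frag_cmul ((-1) ^ deg a) (concat_product (frag_of a) (bd y))"
    for a
    by (rule frag_additive_eqI[where c = y])
      (simp_all add: bdc_append concat_product_diff_right frag_extend_diff frag_cmul_diff_distrib2)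
  show ?thesis
    by (rule frag_additive_eqI[where c = x])
      (simp_all add: 1 assms concat_product_diff_left frag_extend_diff frag_cmul_diff_distrib2)
qed

text \<open>In the square of the boundary of \<open>a # u\<close> the mixed term, with both
  \<open>[a]\<close> and \<open>u\<close> differentiated, occurs twice, with exponents
  \<open>deg [a] - 1\<close> and \<open>deg [a]\<close>.\<close>

lemma bd_bd: "bd (bd x) = 0"
proof -
  have "bd (bdc u) = 0" for u
  proof (induction u)
    case (Cons a u)
    have "bdc (a # u) = concat_product (bdc [a]) (frag_of u) +
        frag_cmul ((-1) ^ deg [a]) (concat_product (frag_of [a]) (bdc u))"
      using bdc_append[of "[a]" u] by simp
    moreover have "bd (concat_product (bdc [a]) (frag_of u)) =
        frag_cmul ((-1) ^ (deg [a] - 1)) (concat_product (bdc [a]) (bdc u))"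
      using bdc_degree[of _ "[a]"]
      by (subst bd_concat_product[where d = "deg [a] - 1"]) (force simp: bdc_bdc_single)+
    moreover have "bd (concat_product (frag_of [a]) (bdc u)) = concat_product (bdc [a]) (bdc u)"
      by (subst bd_concat_product[where d = "deg [a]"]) (simp_all add: Cons)
    \<comment> \<open>The exponent \<open>deg [a] - 1\<close> is truncated when the degree is 0; in
      that case the mixed term vanishes since no cell has smaller degree.\<close>
    moreover have "bdc [a] = 0" if "deg [a] = 0"
      using bdc_degree[of _ "[a]"] that by (metis Suc_eq_plus1 keys_eq_empty nat.simps(3) ex_in_conv)
    ultimately show ?case
      by (cases "deg [a]") (simp_all add: frag_extend_add frag_extend_cmul flip: frag_cmul_distrib)
  qed simp
  then show ?thesis
    by (simp add: frag_extend_extend)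
qed

abbreviation tbd where "tbd \<equiv> tensor_boundary deg bd"

lemma tbd_frag_of:
  "tbd (frag_of (a, b)) = tensor (bdc a) (frag_of b) + frag_cmul ((-1) ^ deg a) (tensor (frag_of a) (bdc b))"
  by (simp add: tensor_boundary_def)

lemma bar_tensor_left1:
  "bar (tensor x (frag_of b)) (frag_of (a', b')) =
    frag_cmul ((-1) ^ (deg a' * deg b)) (tensor (concat_product x (frag_of a')) (frag_of (b @ b')))"
  by (rule frag_additive_eqI[where c = x])
    (simp_all add: tensor_diff_left bar_product_diff_left concat_product_diff_left
      frag_cmul_diff_distrib2 bar_product_frag_of)

text \<open>The hypothesis fixes only the parity of the degrees in \<open>y\<close>. In this form
  the lemma serves boundaries, which lower the degree by one, as well as insertions, which raise
  it.\<close>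

lemma bar_tensor_left2:
  assumes "\<And>c. c \<in> Poly_Mapping.keys y \<Longrightarrow> even (deg c + d)"
  shows "bar (tensor (frag_of a) y) (frag_of (a', b')) =
    frag_cmul ((-1) ^ (deg a' * d)) (tensor (frag_of (a @ a')) (concat_product y (frag_of b')))"
proof (rule frag_additive_eqI[where c = y])
  fix c assume "c \<in> Poly_Mapping.keys y"
  then have "(-1::int) ^ (deg a' * deg c) = (-1) ^ (deg a' * d)"
    using assms[of c] by (intro minus_one_power_eqI) auto
  then show "bar (tensor (frag_of a) (frag_of c)) (frag_of (a', b')) =
    frag_cmul ((-1) ^ (deg a' * d)) (tensor (frag_of (a @ a')) (concat_product (frag_of c) (frag_of b')))"
    by (simp add: bar_product_frag_of)
qed (simp_all add: tensor_diff_right bar_product_diff_left concat_product_diff_left frag_cmul_diff_distrib2)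

lemma bar_tensor_right1:
  assumes "\<And>c. c \<in> Poly_Mapping.keys x \<Longrightarrow> even (deg c + d)"
  shows "bar (frag_of (a, b)) (tensor x (frag_of b')) =
    frag_cmul ((-1) ^ (d * deg b)) (tensor (concat_product (frag_of a) x) (frag_of (b @ b')))"
proof (rule frag_additive_eqI[where c = x])
  fix c assume "c \<in> Poly_Mapping.keys x"
  then have "(-1::int) ^ (deg c * deg b) = (-1) ^ (d * deg b)"
    using assms[of c] by (intro minus_one_power_eqI) auto
  then show "bar (frag_of (a, b)) (tensor (frag_of c) (frag_of b')) =
    frag_cmul ((-1) ^ (d * deg b)) (tensor (concat_product (frag_of a) (frag_of c)) (frag_of (b @ b')))"
    by (simp add: bar_product_frag_of)
qed (simp_all add: tensor_diff_left bar_product_diff_right concat_product_diff_right frag_cmul_diff_distrib2)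

lemma bar_tensor_right2:
  "bar (frag_of (a, b)) (tensor (frag_of a') y) =
    frag_cmul ((-1) ^ (deg a' * deg b)) (tensor (frag_of (a @ a')) (concat_product (frag_of b) y))"
  by (rule frag_additive_eqI[where c = y])
    (simp_all add: tensor_diff_right bar_product_diff_right concat_product_diff_right
      frag_cmul_diff_distrib2 bar_product_frag_of)

lemma tbd_diff: "tbd (x - y) = tbd x - tbd y"
  by (simp add: tensor_boundary_def frag_extend_diff)

lemma tbd_zero [simp]: "tbd 0 = 0"
  by (simp add: tensor_boundary_def)

lemma tbd_cmul: "tbd (frag_cmul k x) = frag_cmul k (tbd x)"
  by (simp add: tensor_boundary_def frag_extend_cmul)

lemma tbd_add: "tbd (x + y) = tbd x + tbd y"
  by (simp add: tensor_boundary_def frag_extend_add)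

lemma tbd_sum: "tbd (\<Sum>i\<in>I. f i) = (\<Sum>i\<in>I. tbd (f i))"
  by (simp add: tensor_boundary_def frag_extend_sum')

lemma twist_diff: "twist (x - y) = twist x - twist y"
  by (simp add: twist_def frag_extend_diff)

lemma twist_zero [simp]: "twist 0 = 0"
  by (simp add: twist_def)

text \<open>The tensor square is itself a differential graded ring under \<open>bar\<close>. The
  Koszul sign of the Leibniz rule is that of the whole of \<open>x\<close>, hence
  \<open>twist x\<close>.\<close>

lemma tbd_bar: "tbd (bar x y) = bar (tbd x) y + bar (twist x) (tbd y)"
proof -
  have 0: "tbd (bar (frag_of (a, b)) (frag_of (a', b'))) =
      bar (tbd (frag_of (a, b))) (frag_of (a', b')) + bar (twist (frag_of (a, b))) (tbd (frag_of (a', b')))"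
    for a b a' b'
  proof -
    have b: "even (deg c + (deg b + 1))" if "c \<in> Poly_Mapping.keys (bdc b)" for c
      using bdc_degree[OF that] by presburger
    have a': "even (deg c + (deg a' + 1))" if "c \<in> Poly_Mapping.keys (bdc a')" for c
      using bdc_degree[OF that] by presburger
    have sg: "(-1::int) ^ k * (-1) ^ l = (-1) ^ (k + l)" for k l
      by (simp add: power_add)
    \<comment> \<open>Four terms arise, according to which of \<open>a\<close>, \<open>b\<close>,
      \<open>a'\<close>, \<open>b'\<close> is differentiated. The signs for \<open>a\<close> match
      by themselves; the other three need these parities, in the order \<open>b\<close>,
      \<open>a'\<close>, \<open>b'\<close>.\<close>
    have s1: "(-1::int) ^ (deg a' * deg b + (deg a + deg a')) = (-1) ^ (deg a + deg a' * (deg b + 1))"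
      by (rule minus_one_power_eqI, auto)
    have s2: "(-1::int) ^ (deg a + deg b + (deg a' + Suc 0) * deg b) = (-1) ^ (deg a' * deg b + deg a)"
      by (rule minus_one_power_eqI, auto)
    have s3: "(-1::int) ^ (deg a' + (deg a + deg b + deg a' * deg b)) =
        (-1) ^ (deg a' * deg b + (deg a + deg a' + deg b))"
      by (rule minus_one_power_eqI, auto)
    show ?thesis
      by (simp add: bar_product_frag_of tbd_cmul tbd_frag_of bdc_append bar_product_add_left
          bar_product_add_right bar_product_cmul_left bar_product_cmul_right tensor_add_left
          tensor_add_right tensor_cmul_left tensor_cmul_right frag_cmul_distrib2 deg_append
          bar_tensor_left1 bar_tensor_left2[OF b] bar_tensor_right1[OF a'] bar_tensor_right2 twist_def sg
          s1 s2 s3 del: add_Suc_right add_Suc mult_Suc mult_Suc_right)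
  qed
  have 1: "tbd (bar (frag_of p) y) = bar (tbd (frag_of p)) y + bar (twist (frag_of p)) (tbd y)" for p
    by (cases p, rule frag_additive_eqI[where c = y]) (auto simp: bar_product_diff_right tbd_diff 0)
  show ?thesis
    by (rule frag_additive_eqI[where c = x]) (auto simp: bar_product_diff_left tbd_diff twist_diff 1)
qed

end

text \<open>\<open>D\<close> is prescribed on letters and extended multiplicatively. The set
  \<open>V\<close> singles out the letters on which compatibility with the boundary is required; for
  permutahedra these are the finite non-empty blocks.\<close>

locale dg_words_coproduct = dg_words deg bdc for deg :: "'a list \<Rightarrow> nat" and bdc +
  fixes D :: "'a \<Rightarrow> (('a list \<times> 'a list) \<Rightarrow>\<^sub>0 int)" and V :: "'a set"
  assumes D_degree: "v \<in> V \<Longrightarrow> (a, b) \<in> Poly_Mapping.keys (D v) \<Longrightarrow> deg a + deg b = deg [v]"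
    and bdc_single_letters: "v \<in> V \<Longrightarrow> u \<in> Poly_Mapping.keys (bdc [v]) \<Longrightarrow> set u \<subseteq> V"
    and D_bdc: "v \<in> V \<Longrightarrow>
      frag_extend (\<lambda>u. foldr (\<lambda>U. bar (D U)) u (frag_of ([], []))) (bdc [v]) = tbd (D v)"
begin

definition copc :: "'a list \<Rightarrow> (('a list \<times> 'a list) \<Rightarrow>\<^sub>0 int)" where
  "copc u = foldr (\<lambda>U. bar (D U)) u (frag_of ([], []))"

abbreviation cop where "cop \<equiv> frag_extend copc"

lemma copc_Nil [simp]: "copc [] = frag_of ([], [])"
  by (simp add: copc_def)

lemma copc_Cons: "copc (v # u) = bar (D v) (copc u)"
  by (simp add: copc_def)

lemma copc_append: "copc (u @ v) = bar (copc u) (copc v)"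
  by (induction u) (simp_all add: copc_Cons bar_assoc)

lemma cop_concat_product: "cop (concat_product x y) = bar (cop x) (cop y)"
proof -
  have 1: "cop (concat_product (frag_of a) y) = bar (copc a) (cop y)" for a
    by (rule frag_additive_eqI[where c = y])
      (auto simp: concat_product_diff_right frag_extend_diff bar_product_diff_right copc_append)
  show ?thesis
    by (rule frag_additive_eqI[where c = x])
      (auto simp: concat_product_diff_left frag_extend_diff bar_product_diff_left 1)
qed

lemma copc_degree:
  assumes "set u \<subseteq> V"
  shows "Poly_Mapping.keys (copc u) \<subseteq> {(a, b). deg a + deg b = deg u}"
  using assms
proof (induction u)
  case (Cons v u)
  have "deg (v # u) = deg [v] + deg u"
    using deg_append[of "[v]" u] by simp
  then show ?case
    unfolding copc_Cons using Cons D_degree[of v]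
    by (intro keys_bar_product) (fastforce simp: deg_append)
qed (simp add: keys_frag_of)

text \<open>Both sides obey the same Leibniz rule along the multiplicative map \<open>copc\<close>,
  so the identity propagates from letters to words. Homogeneity of \<open>D v\<close> turns the
  twist of \<open>tbd_bar\<close> into the sign in the boundary of a word.\<close>

lemma copc_bdc:
  assumes "set u \<subseteq> V"
  shows "cop (bdc u) = tbd (copc u)"
  using assms
proof (induction u)
  case Nil
  then show ?case
    by (simp add: tbd_frag_of)
next
  case (Cons v u)
  have "bdc (v # u) = concat_product (bdc [v]) (frag_of u) +
        frag_cmul ((-1) ^ deg [v]) (concat_product (frag_of [v]) (bdc u))"
    using bdc_append[of "[v]" u] by simp
  moreover have "cop (bdc [v]) = tbd (D v)"
    using D_bdc[of v] Cons.prems by (simp add: copc_def[abs_def])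
  moreover have "copc [v] = D v"
    by (simp add: copc_Cons)
  moreover have "twist (D v) = frag_cmul ((-1) ^ deg [v]) (D v)"
    using D_degree[of v] Cons.prems by (intro twist_homogeneous) auto
  ultimately show ?case
    using Cons
    by (simp add: copc_Cons frag_extend_add frag_extend_cmul cop_concat_product tbd_bar
        bar_product_cmul_left)
qed

lemma dg_coalgebra_words:
  assumes letters: "\<And>u. u \<in> B \<Longrightarrow> set u \<subseteq> V"
    and bd_closed: "\<And>u. u \<in> B \<Longrightarrow> Poly_Mapping.keys (bdc u) \<subseteq> B"
    and cop_closed: "\<And>u. u \<in> B \<Longrightarrow> Poly_Mapping.keys (copc u) \<subseteq> B \<times> B"
  shows "dg_coalgebra B deg bd cop"
proof
  show "bd \<in> hom (free_Abelian_group B) (free_Abelian_group B)"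
    using bd_closed by (rule frag_extend_hom)
  show "cop \<in> hom (free_Abelian_group B) (free_Abelian_group (B \<times> B))"
    using cop_closed by (rule frag_extend_hom)
  show "bd (frag_of b) \<in> carrier (free_Abelian_group {a \<in> B. deg a + 1 = deg b})" if "b \<in> B" for b
    using bd_closed[OF that] bdc_degree[of _ b] by auto
  show "cop (frag_of b) \<in> carrier (free_Abelian_group {(x, y) \<in> B \<times> B. deg x + deg y = deg b})"
    if "b \<in> B" for b
    using cop_closed[OF that] copc_degree[OF letters[OF that]] by auto
  show "cop (bd c) = tbd (cop c)" if "c \<in> carrier (free_Abelian_group B)" for c
    by (rule frag_additive_eqI[where c = c])
      (use that letters in \<open>auto simp: frag_extend_diff tbd_diff copc_bdc subsetD\<close>)
qed (simp add: bd_bd)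

end

subsection \<open>Signs and inversions\<close>

primrec inversions :: "nat list \<Rightarrow> nat" where
  "inversions [] = 0"
| "inversions (x # xs) = card {y \<in> set xs. y < x} + inversions xs"

text \<open>The inversions between two blocks written one after the other. Signs of shuffles and of
  partitions become exponents that are additive in each block.\<close>

definition cross :: "nat set \<Rightarrow> nat set \<Rightarrow> nat" where
  "cross M N = card {(x, y). x \<in> M \<and> y \<in> N \<and> y < x}"

lemma finite_cross: "finite M \<Longrightarrow> finite N \<Longrightarrow> finite {(x, y). x \<in> M \<and> y \<in> N \<and> y < x}"
  by (rule finite_subset[of _ "M \<times> N"]) auto

lemma cross_empty [simp]: "cross {} N = 0" "cross M {} = 0"
  by (simp_all add: cross_def)

lemma cross_Un_left:
  assumes "finite M" "finite M'" "finite N" "M \<inter> M' = {}"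
  shows "cross (M \<union> M') N = cross M N + cross M' N"
  unfolding cross_def using assms
  by (subst card_Un_disjoint[symmetric]) (auto intro: finite_cross intro!: arg_cong[where f = card])

lemma cross_Un_right:
  assumes "finite M" "finite N" "finite N'" "N \<inter> N' = {}"
  shows "cross M (N \<union> N') = cross M N + cross M N'"
  unfolding cross_def using assms
  by (subst card_Un_disjoint[symmetric]) (auto intro: finite_cross intro!: arg_cong[where f = card])

lemma cross_less: "\<forall>x\<in>M. \<forall>y\<in>N. x < y \<Longrightarrow> cross M N = 0"
  unfolding cross_def by (metis (no_types, lifting) case_prodE card.empty empty_Collect_eq not_less_iff_gr_or_eq)

lemma cross_greater:
  assumes "\<forall>x\<in>M. \<forall>y\<in>N. y < x"
  shows "cross M N = card M * card N"
proof -
  have "{(x, y). x \<in> M \<and> y \<in> N \<and> y < x} = M \<times> N"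
    using assms by auto
  then show ?thesis
    by (simp add: cross_def card_cartesian_product)
qed

lemma cross_image:
  assumes "strict_mono_on S f" "M \<subseteq> S" "N \<subseteq> S"
  shows "cross (f ` M) (f ` N) = cross M N"
proof -
  have inj: "inj_on f S"
    using assms(1) by (rule strict_mono_on_imp_inj_on)
  have less: "f x < f y \<longleftrightarrow> x < y" if "x \<in> S" "y \<in> S" for x y
    using assms(1) that by (rule strict_mono_on_less)
  let ?A = "{(x, y). x \<in> M \<and> y \<in> N \<and> y < x}"
  have "?A \<subseteq> S \<times> S"
    using assms(2,3) by auto
  then have "inj_on (map_prod f f) ?A"
    using map_prod_inj_on[OF inj inj] inj_on_subset by blast
  moreover have "{(x, y). x \<in> f ` M \<and> y \<in> f ` N \<and> y < x} = map_prod f f ` ?A"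
  proof (intro equalityI subsetI)
    fix z assume "z \<in> {(x, y). x \<in> f ` M \<and> y \<in> f ` N \<and> y < x}"
    then obtain x y where z: "z = (f x, f y)" "x \<in> M" "y \<in> N" "f y < f x"
      by auto
    then have "y < x"
      using less subsetD[OF assms(2)] subsetD[OF assms(3)] by blast
    with z have "(x, y) \<in> ?A"
      by simp
    then show "z \<in> map_prod f f ` ?A"
      using z(1) imageI[of "(x, y)" ?A "map_prod f f"] by (simp only: map_prod_simp)
  next
    fix z assume "z \<in> map_prod f f ` ?A"
    then obtain x y where z: "z = (f x, f y)" "x \<in> M" "y \<in> N" "y < x"
      by auto
    then have "f y < f x"
      using less subsetD[OF assms(2)] subsetD[OF assms(3)] by blast
    with z show "z \<in> {(x, y). x \<in> f ` M \<and> y \<in> f ` N \<and> y < x}"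
      by simp
  qed
  ultimately show ?thesis
    by (simp add: cross_def card_image)
qed

lemma inversions_append:
  "distinct (xs @ ys) \<Longrightarrow> inversions (xs @ ys) = inversions xs + inversions ys + cross (set xs) (set ys)"
proof (induction xs)
  case (Cons x xs)
  have "{y \<in> set (xs @ ys). y < x} = {y \<in> set xs. y < x} \<union> {y \<in> set ys. y < x}"
    by auto
  moreover have "card ({y \<in> set xs. y < x} \<union> {y \<in> set ys. y < x}) =
      card {y \<in> set xs. y < x} + card {y \<in> set ys. y < x}"
    using Cons.prems by (intro card_Un_disjoint) auto
  moreover have "cross {x} (set ys) = card {y \<in> set ys. y < x}"
    unfolding cross_def by (rule bij_betw_same_card[of snd]) (force simp: bij_betw_def inj_on_def)
  moreover have "cross (set (x # xs)) (set ys) = cross {x} (set ys) + cross (set xs) (set ys)"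
    using Cons.prems by (subst cross_Un_left[symmetric]) auto
  ultimately show ?case
    using Cons by simp
qed simp

lemma inversions_sorted: "sorted xs \<Longrightarrow> inversions xs = 0"
proof (induction xs)
  case (Cons x xs)
  then have "{y \<in> set xs. y < x} = {}"
    by auto
  with Cons show ?case
    by (simp only: inversions.simps card.empty) simp
qed simp

lemma permutation_of_list_swap:
  assumes "distinct (xs @ x # y # ys)" "length zs = length (xs @ x # y # ys)" "distinct zs"
    "set zs = set (xs @ x # y # ys)"
  shows "permutation_of_list (zip zs (xs @ y # x # ys)) =
    transpose x y \<circ> permutation_of_list (zip zs (xs @ x # y # ys))"
proof
  fix a
  let ?n = "length xs"
  let ?us = "xs @ x # y # ys" and ?vs = "xs @ y # x # ys"
  have len: "length ?vs = length zs" "length ?us = length zs"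
    using assms by auto
  have P: "permutation_of_list (zip zs ws) (zs ! i) = ws ! i" if "i < length zs" "length ws = length zs" for i ws
    using assms(3) that by (intro permutation_of_list_unique') (auto simp: set_zip)
  show "permutation_of_list (zip zs ?vs) a = (transpose x y \<circ> permutation_of_list (zip zs ?us)) a"
  proof (cases "a \<in> set zs")
    case True
    then obtain i where i: "i < length zs" "a = zs ! i"
      by (auto simp: in_set_conv_nth)
    have *: "?vs ! i = transpose x y (?us ! i)"
    proof -
      consider "i < ?n" | "i = ?n" | "i = Suc ?n" | "i > Suc ?n"
        by linarith
      then show ?thesis
      proof cases
        case 1
        then have "xs ! i \<noteq> x" "xs ! i \<noteq> y"
          using assms(1) by auto
        with 1 show ?thesis
          by (simp add: nth_append)
      next
        case 4
        then obtain j where j: "i = ?n + Suc (Suc j)"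
          using less_iff_Suc_add by auto
        then have "ys ! j \<in> set ys"
          using i assms(2) by auto
        then have "ys ! j \<noteq> x" "ys ! j \<noteq> y"
          using assms(1) by auto
        then show ?thesis
          by (simp add: nth_append j)
      qed (auto simp: nth_append)
    qed
    show ?thesis
      by (simp only: comp_apply i(2) P[OF i(1) len(1)] P[OF i(1) len(2)] *)
  next
    case False
    then have "permutation_of_list (zip zs ws) a = a" for ws
      by (intro permutation_of_list_id) (auto dest: set_zip_leftD)
    moreover have "transpose x y a = a"
      using False assms(4) by (intro transpose_apply_other) auto
    ultimately show ?thesis
      by simp
  qed
qed

lemma list_sign_swap:
  assumes "distinct (xs @ x # y # ys)"
  shows "list_sign (xs @ y # x # ys) = - list_sign (xs @ x # y # ys)"
proof -
  let ?us = "xs @ x # y # ys"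
  have "sort (xs @ y # x # ys) = sort ?us"
    by (rule properties_for_sort) auto
  moreover have "permutation_of_list (zip (sort ?us) (xs @ y # x # ys)) =
      transpose x y \<circ> permutation_of_list (zip (sort ?us) ?us)"
    by (rule permutation_of_list_swap) (use assms in auto)
  moreover have "permutation_of_list (zip (sort ?us) ?us) permutes set ?us"
    by (rule permutation_of_list_permutes, rule list_permutesI) (use assms in auto)
  then have "permutation (permutation_of_list (zip (sort ?us) ?us))"
    by (rule permutes_imp_permutation[OF finite_set])
  ultimately show ?thesis
    using assms by (simp add: list_sign_def sign_compose permutation_swap_id sign_swap_id)
qed

lemma inversions_swap:
  assumes "distinct (xs @ x # y # ys)" "y < x"
  shows "inversions (xs @ x # y # ys) = Suc (inversions (xs @ y # x # ys))"
proof -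
  have "{z \<in> set (y # ys). z < x} = insert y {z \<in> set ys. z < x}"
    using assms by auto
  moreover have "{z \<in> set (x # ys). z < y} = {z \<in> set ys. z < y}"
    using assms by auto
  moreover have "card (insert y {z \<in> set ys. z < x}) = Suc (card {z \<in> set ys. z < x})"
    using assms by (intro card_insert_disjoint) auto
  ultimately have "inversions (x # y # ys) = Suc (inversions (y # x # ys))"
    by simp
  moreover have "set (x # y # ys) = set (y # x # ys)"
    by auto
  ultimately show ?thesis
    using assms inversions_append[of xs "x # y # ys"] inversions_append[of xs "y # x # ys"] by simp
qed

text \<open>Bubble sort: exchanging an adjacent descent changes the sign and lowers the number of
  inversions by one, until the list is sorted and the permutation is the identity. From here on
  signs are found by counting.\<close>

lemma list_sign_inversions: "distinct xs \<Longrightarrow> list_sign xs = (-1) ^ inversions xs"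
proof (induction "inversions xs" arbitrary: xs rule: less_induct)
  case less
  show ?case
  proof (cases "sorted xs")
    case True
    have "permutation_of_list (zip xs xs) = id"
    proof
      fix a
      show "permutation_of_list (zip xs xs) a = id a"
      proof (cases "a \<in> set xs")
        case True
        then have "(a, a) \<in> set (zip xs xs)"
          by (auto simp: set_zip in_set_conv_nth)
        moreover have "distinct (map fst (zip xs xs))"
          using less.prems by simp
        ultimately show ?thesis
          using permutation_of_list_unique' by fastforce
      next
        case False
        then show ?thesis
          by (simp add: permutation_of_list_id)
      qed
    qed
    with True show ?thesis
      by (simp add: list_sign_def inversions_sorted sorted_sort_id)
  next
    case False
    then obtain i where i: "Suc i < length xs" "\<not> xs ! i \<le> xs ! Suc i"
      by (auto simp: sorted_iff_nth_Suc)
    let ?us = "take i xs" and ?vs = "drop (Suc (Suc i)) xs"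
    let ?x = "xs ! i" and ?y = "xs ! Suc i"
    have xs: "xs = ?us @ ?x # ?y # ?vs"
      using i by (simp add: Cons_nth_drop_Suc)
    have d: "distinct (?us @ ?x # ?y # ?vs)"
      using less.prems xs by simp
    have inv: "inversions xs = Suc (inversions (?us @ ?y # ?x # ?vs))"
      using inversions_swap[OF d] i xs by simp
    moreover have "distinct (?us @ ?y # ?x # ?vs)"
      using d by auto
    ultimately have "list_sign (?us @ ?y # ?x # ?vs) = (-1) ^ inversions (?us @ ?y # ?x # ?vs)"
      using less.hyps by simp
    with list_sign_swap[OF d] xs inv show ?thesis
      by simp
  qed
qed

lemma shuff_cross:
  assumes "finite M" "finite N" "M \<inter> N = {}"
  shows "shuff M N = (-1) ^ cross M N"
  using assms by (simp add: shuff_def list_sign_inversions inversions_append inversions_sorted)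

text \<open>Both sides are the sign of the arrangement \<open>P\<close>, \<open>Q\<close>,
  \<open>N\<close>, cut first after \<open>Q\<close> or first after \<open>P\<close>. The
  cancellations between iterated splittings rest on this identity.\<close>

lemma shuff_assoc:
  assumes "finite P" "finite Q" "finite N" "P \<inter> Q = {}" "P \<inter> N = {}" "Q \<inter> N = {}"
  shows "shuff (P \<union> Q) N * shuff P Q = shuff P (Q \<union> N) * shuff Q N"
  using assms by (simp add: shuff_cross Int_Un_distrib Int_Un_distrib2 cross_Un_left cross_Un_right power_add)

lemma shuff_insert_right:
  assumes "finite M" "finite N" "M \<inter> N = {}" "\<forall>x\<in>M \<union> N. x < m"
  shows "shuff M (insert m N) = shuff M N"
proof -
  have "m \<notin> M" "m \<notin> N"
    using assms by auto
  moreover have "cross M {m} = 0"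
    by (rule cross_less) (use assms in auto)
  ultimately show ?thesis
    using assms(1-3) cross_Un_right[of M "{m}" N] by (simp add: shuff_cross)
qed

text \<open>Placed in the left half, the largest element has to pass every element of
  \<open>N\<close>; in the right half it is already in its place.\<close>

lemma shuff_insert_left:
  assumes "finite M" "finite N" "M \<inter> N = {}" "\<forall>x\<in>M \<union> N. x < m"
  shows "shuff (insert m M) N = (-1) ^ card N * shuff M N"
proof -
  have "m \<notin> M" "m \<notin> N"
    using assms by auto
  moreover have "cross {m} N = card N"
    using assms cross_greater[of "{m}" N] by simp
  ultimately show ?thesis
    using assms(1-3) cross_Un_left[of "{m}" M N] by (simp add: shuff_cross power_add)
qed

lemma shuff_empty [simp]: "finite M \<Longrightarrow> shuff {} M = 1" "finite M \<Longrightarrow> shuff M {} = 1"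
  by (simp_all add: shuff_cross)

section \<open>Sums over ordered splittings of a set\<close>

text \<open>Handing both halves to \<open>f\<close>, instead of a subset of a fixed set, keeps
  iterated sums symmetric in the order of cutting.\<close>

definition splits :: "'a set \<Rightarrow> ('a set \<Rightarrow> 'a set \<Rightarrow> 'b::comm_monoid_add) \<Rightarrow> 'b" where
  "splits U f = (\<Sum>M\<in>Pow U. f M (U - M))"

lemma splits_cong:
  assumes "U = U'" "\<And>M N. M \<union> N = U' \<Longrightarrow> M \<inter> N = {} \<Longrightarrow> f M N = g M N"
  shows "splits U f = splits U' g"
  unfolding splits_def
proof (rule sum.cong)
  fix M assume "M \<in> Pow U'"
  then show "f M (U - M) = g M (U' - M)"
    using assms(1) assms(2)[of M "U' - M"] by auto
qed (simp add: assms)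

lemma splits_empty [simp]: "splits {} f = f {} {}"
  by (simp add: splits_def)

lemma splits_add: "splits U (\<lambda>M N. f M N + g M N) = splits U f + splits U g"
  by (simp add: splits_def sum.distrib)

lemma splits_insert:
  assumes "finite U" "m \<notin> U"
  shows "splits (insert m U) f = splits U (\<lambda>M N. f M (insert m N)) + splits U (\<lambda>M N. f (insert m M) N)"
proof -
  have "Pow (insert m U) = Pow U \<union> insert m ` Pow U"
    by (rule Pow_insert)
  moreover have "Pow U \<inter> insert m ` Pow U = {}"
    using assms by auto
  moreover have "inj_on (insert m) (Pow U)"
    using assms by (auto simp: inj_on_def)
  ultimately have "splits (insert m U) f =
      (\<Sum>M\<in>Pow U. f M (insert m U - M)) + (\<Sum>M\<in>Pow U. f (insert m M) (insert m U - insert m M))"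
    using assms by (simp add: splits_def sum.union_disjoint sum.reindex)
  also have "(\<Sum>M\<in>Pow U. f M (insert m U - M)) = splits U (\<lambda>M N. f M (insert m N))"
    unfolding splits_def
    by (rule sum.cong) (use assms in \<open>auto intro!: arg_cong2[where f = f]\<close>)
  also have "(\<Sum>M\<in>Pow U. f (insert m M) (insert m U - insert m M)) = splits U (\<lambda>M N. f (insert m M) N)"
    unfolding splits_def
    by (rule sum.cong) (use assms in \<open>auto intro!: arg_cong2[where f = f]\<close>)
  finally show ?thesis .
qed

text \<open>Both sides run over the ordered splittings of \<open>U\<close> into three parts; the
  index pairs \<open>(M, P)\<close> and \<open>(P, Q)\<close> are related by
  \<open>Q = M - P\<close>.\<close>

lemma splits_assoc:
  assumes "finite U"
  shows "splits U (\<lambda>M N. splits M (\<lambda>P Q. f P Q N)) = splits U (\<lambda>P R. splits R (\<lambda>Q N. f P Q N))"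
proof -
  have fin: "finite (Pow U)" "\<forall>M\<in>Pow U. finite (Pow M)" "\<forall>P\<in>Pow U. finite (Pow (U - P))"
    using assms finite_subset[OF _ assms] by auto
  have "splits U (\<lambda>M N. splits M (\<lambda>P Q. f P Q N)) =
      (\<Sum>(M, P)\<in>Sigma (Pow U) Pow. f P (M - P) (U - M))"
    unfolding splits_def by (rule sum.Sigma[OF fin(1,2)])
  also have "\<dots> = (\<Sum>(P, Q)\<in>Sigma (Pow U) (\<lambda>P. Pow (U - P)). f P Q (U - P - Q))"
  proof (rule sum.reindex_bij_witness[where i = "\<lambda>(P, Q). (P \<union> Q, P)" and j = "\<lambda>(M, P). (P, M - P)"])
    fix x assume "x \<in> Sigma (Pow U) Pow"
    then obtain M P where x: "x = (M, P)" "M \<subseteq> U" "P \<subseteq> M"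
      by auto
    then have "U - P - (M - P) = U - M" "P \<union> (M - P) = M"
      by auto
    with x show "(case (case x of (M, P) \<Rightarrow> (P, M - P)) of (P, Q) \<Rightarrow> f P Q (U - P - Q)) =
        (case x of (M, P) \<Rightarrow> f P (M - P) (U - M))"
      "(case (case x of (M, P) \<Rightarrow> (P, M - P)) of (P, Q) \<Rightarrow> (P \<union> Q, P)) = x"
      "(case x of (M, P) \<Rightarrow> (P, M - P)) \<in> Sigma (Pow U) (\<lambda>P. Pow (U - P))"
      by auto
  next
    fix x assume "x \<in> Sigma (Pow U) (\<lambda>P. Pow (U - P))"
    then obtain P Q where x: "x = (P, Q)" "P \<subseteq> U" "Q \<subseteq> U - P"
      by auto
    then have "P \<union> Q - P = Q"
      by auto
    with x show "(case (case x of (P, Q) \<Rightarrow> (P \<union> Q, P)) of (M, P) \<Rightarrow> (P, M - P)) = x"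
      "(case x of (P, Q) \<Rightarrow> (P \<union> Q, P)) \<in> Sigma (Pow U) Pow"
      by auto
  qed
  also have "\<dots> = splits U (\<lambda>P R. splits R (\<lambda>Q N. f P Q N))"
    unfolding splits_def by (rule sum.Sigma[OF fin(1,3), symmetric])
  finally show ?thesis .
qed

section \<open>The boundary of the permutahedra as a derivation\<close>

lemma part_dim_simps [simp]:
  "part_dim [] = 0" "part_dim (U # u) = card U - 1 + part_dim u" "part_dim (u @ v) = part_dim u + part_dim v"
  by (simp_all add: part_dim_def)

text \<open>The boundary of a top cell: for a single block the sum of the preceding dimensions is
  empty and only the exponent \<open>card M\<close> remains.\<close>

definition block_boundary :: "nat set \<Rightarrow> (nat set list \<Rightarrow>\<^sub>0 int)" where
  "block_boundary U = (\<Sum>M | M \<noteq> {} \<and> M \<subset> U.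
     frag_cmul ((-1) ^ card M * shuff M (U - M)) (frag_of [M, U - M]))"

lemma perm_boundary_face_Nil [simp]: "perm_boundary_face [] = 0"
  by (simp add: perm_boundary_face_def)

lemma perm_boundary_face_Cons:
  "perm_boundary_face (U # u) = concat_product (block_boundary U) (frag_of u) +
     frag_cmul ((-1) ^ (card U - 1)) (concat_product (frag_of [U]) (perm_boundary_face u))"
proof -
  have "perm_boundary_face (U # u) =
      (\<Sum>M | M \<noteq> {} \<and> M \<subset> U. frag_cmul ((-1) ^ card M * shuff M (U - M)) (frag_of ([M, U - M] @ u))) +
      (\<Sum>k<length u. \<Sum>M | M \<noteq> {} \<and> M \<subset> u ! k.
        frag_cmul ((-1) ^ (card U - 1 + (\<Sum>i<k. card (u ! i) - 1) + card M) * shuff M (u ! k - M))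
          (frag_of (U # take k u @ [M, u ! k - M] @ drop (Suc k) u)))"
    by (simp add: perm_boundary_face_def sum.lessThan_Suc_shift del: sum.lessThan_Suc)
  moreover have "concat_product (block_boundary U) (frag_of u) =
      (\<Sum>M | M \<noteq> {} \<and> M \<subset> U. frag_cmul ((-1) ^ card M * shuff M (U - M)) (frag_of ([M, U - M] @ u)))"
    by (simp add: block_boundary_def concat_product_sum_left concat_product_cmul_left)
  moreover have "frag_cmul ((-1) ^ (card U - 1)) (concat_product (frag_of [U]) (perm_boundary_face u)) =
      (\<Sum>k<length u. \<Sum>M | M \<noteq> {} \<and> M \<subset> u ! k.
        frag_cmul ((-1) ^ (card U - 1 + (\<Sum>i<k. card (u ! i) - 1) + card M) * shuff M (u ! k - M))
          (frag_of (U # take k u @ [M, u ! k - M] @ drop (Suc k) u)))"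
    by (simp add: perm_boundary_face_def concat_product_sum_right concat_product_cmul_right
        frag_cmul_sum power_add mult.assoc)
  ultimately show ?thesis
    by simp
qed

lemma perm_boundary_face_single [simp]: "perm_boundary_face [U] = block_boundary U"
  by (simp add: perm_boundary_face_Cons)

lemma perm_boundary_face_append:
  "perm_boundary_face (u @ v) = concat_product (perm_boundary_face u) (frag_of v) +
     frag_cmul ((-1) ^ part_dim u) (concat_product (frag_of u) (perm_boundary_face v))"
proof (induction u)
  case (Cons U u)
  have "concat_product (frag_of [U]) (concat_product (frag_of u) x) = concat_product (frag_of (U # u)) x" for x
    by (simp flip: concat_product_assoc)
  with Cons show ?case
    by (simp add: perm_boundary_face_Cons concat_product_add_left concat_product_add_right
        concat_product_cmul_left concat_product_cmul_right concat_product_assoc frag_cmul_distrib2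
        power_add add.assoc)
qed simp

text \<open>An infinite block has infinitely many singletons as proper subsets, and a sum over an
  infinite index set is 0. With this value the differential graded ring of words exists over all
  sets of numbers.\<close>

lemma block_boundary_infinite: "infinite U \<Longrightarrow> block_boundary U = 0"
proof -
  assume "infinite U"
  have "inj_on (\<lambda>x. {x}) U"
    by simp
  then have "infinite ((\<lambda>x. {x}) ` U)"
    using \<open>infinite U\<close> finite_imageD by blast
  moreover have "(\<lambda>x. {x}) ` U \<subseteq> {M. M \<noteq> {} \<and> M \<subset> U}"
    using \<open>infinite U\<close> by (auto simp: psubset_eq)
  ultimately have "infinite {M. M \<noteq> {} \<and> M \<subset> U}"
    using finite_subset by blast
  then show ?thesis
    unfolding block_boundary_def by (rule sum.infinite)
qed

lemma block_boundary_splits: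
  assumes "finite U"
  shows "block_boundary U = splits U (\<lambda>M N. if M = {} \<or> N = {} then 0
    else frag_cmul ((-1) ^ card M * shuff M N) (frag_of [M, N]))"
  unfolding block_boundary_def splits_def
  by (rule sum.mono_neutral_cong_left) (use assms in auto)

lemma keys_block_boundary:
  "Poly_Mapping.keys (block_boundary U) \<subseteq>
    {[M, N] | M N. finite U \<and> M \<noteq> {} \<and> N \<noteq> {} \<and> M \<inter> N = {} \<and> M \<union> N = U}"
proof (cases "finite U")
  case True
  then show ?thesis
    unfolding block_boundary_def
    by (intro keys_sum_subset keys_frag_cmul_subset) (auto simp: keys_frag_of)
qed (simp add: block_boundary_infinite)

lemma perm_boundary_face_degree:
  "v \<in> Poly_Mapping.keys (perm_boundary_face u) \<Longrightarrow> part_dim v + 1 = part_dim u"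
proof -
  have "Poly_Mapping.keys (perm_boundary_face u) \<subseteq> {v. part_dim v + 1 = part_dim u}"
  proof (induction u)
    case (Cons U u)
    have cc: "card M - 1 + (card N - 1) + 1 = card U - 1"
      if "finite U" "M \<noteq> {}" "N \<noteq> {}" "M \<inter> N = {}" "M \<union> N = U" for M N
    proof -
      have "finite M" "finite N"
        using that by auto
      then have "card U = card M + card N" "card M > 0" "card N > 0"
        using that card_Un_disjoint by (auto simp: card_gt_0_iff)
      then show ?thesis
        by simp
    qed
    have bb: "Suc (part_dim a) = card U - 1" if a: "a \<in> Poly_Mapping.keys (block_boundary U)" for a
    proof -
      obtain M N where "a = [M, N]" "finite U" "M \<noteq> {}" "N \<noteq> {}" "M \<inter> N = {}" "M \<union> N = U"
        using subsetD[OF keys_block_boundary a] by blast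
      then show ?thesis
        using cc[of M N] by simp
    qed
    show ?case
      unfolding perm_boundary_face_Cons
      by (intro keys_add_subset keys_frag_cmul_subset keys_concat_product)
        (auto simp: keys_frag_of dest!: bb subsetD[OF Cons])
  qed simp
  then show "v \<in> Poly_Mapping.keys (perm_boundary_face u) \<Longrightarrow> part_dim v + 1 = part_dim u"
    by auto
qed

lemma frag_cmul_cancel: "frag_cmul k x + frag_cmul (- k) x = 0"
  by (simp flip: frag_cmul_distrib)

lemma frag_extend_if: "frag_extend f (if b then x else y) = (if b then frag_extend f x else frag_extend f y)"
  by simp

lemma splits_frag_extend: "frag_extend f (splits U g) = splits U (\<lambda>M N. frag_extend f (g M N))"
  by (simp add: splits_def frag_extend_sum')

lemma splits_frag_cmul: "frag_cmul k (splits U g) = splits U (\<lambda>M N. frag_cmul k (g M N))"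
  by (simp add: splits_def frag_cmul_sum)

text \<open>Splitting twice leads to \<open>[P, Q, N]\<close> in two ways, by splitting off
  \<open>N\<close> first or \<open>P\<close> first. By \<open>shuff_assoc\<close> the two
  occurrences have opposite signs.\<close>

lemma boundary_block_boundary: "frag_extend perm_boundary_face (block_boundary U) = 0"
proof (cases "finite U")
  case True
  \<comment> \<open>The common value of the two occurrences up to sign: the exponent
    \<open>card (P \<union> Q) + card P\<close> has the parity of \<open>card Q\<close>. Empty parts
    give 0, so that sums may range over all splittings.\<close>
  define c where "c P Q N = (if P = {} \<or> Q = {} \<or> N = {} then 0 else
      frag_cmul ((-1) ^ card Q * (shuff (P \<union> Q) N * shuff P Q)) (frag_of [P, Q, N]))" for P Q N :: "nat set"
  have "frag_extend perm_boundary_face (block_boundary U) = splits U (\<lambda>M N. if M = {} \<or> N = {} then 0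
      else frag_cmul ((-1) ^ card M * shuff M N) (concat_product (block_boundary M) (frag_of [N])) +
        frag_cmul ((-1) ^ card M * shuff M N * (-1) ^ (card M - 1)) (concat_product (frag_of [M]) (block_boundary N)))"
    using True by (simp add: block_boundary_splits splits_frag_extend frag_extend_if frag_extend_cmul
        perm_boundary_face_Cons frag_cmul_distrib2 cong: if_cong)
  also have "\<dots> = splits U (\<lambda>M N. splits M (\<lambda>P Q. c P Q N)) - splits U (\<lambda>P R. splits R (\<lambda>Q N. c P Q N))"
    unfolding splits_def sum_subtractf[symmetric]
  proof (rule sum.cong)
    fix M assume "M \<in> Pow U"
    define N where "N = U - M"
    have fin: "finite M" "finite N" "M \<inter> N = {}"
      using True \<open>M \<in> Pow U\<close> by (auto simp: N_def intro: finite_subset)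
    have 1: "frag_cmul ((-1) ^ card M * shuff M N) (concat_product (block_boundary M) (frag_of [N])) =
        splits M (\<lambda>P Q. c P Q N)" if "N \<noteq> {}"
      unfolding block_boundary_splits[OF fin(1)] splits_def concat_product_sum_left frag_cmul_sum
    proof (rule sum.cong)
      fix P assume P: "P \<in> Pow M"
      then have c: "card M = card P + card (M - P)" and PM: "P \<union> (M - P) = M"
        using fin by (auto simp: card_Diff_subset finite_subset card_mono)
      have "(-1) ^ card M * shuff M N * ((-1) ^ card P * shuff P (M - P)) =
          (-1) ^ card (M - P) * (shuff M N * shuff P (M - P))"
        unfolding c by (auto simp: minus_one_power_iff)
      then have F: "frag_cmul ((-1) ^ card M * shuff M N * ((-1) ^ card P * shuff P (M - P))) z =
          frag_cmul ((-1) ^ card (M - P) * (shuff M N * shuff P (M - P))) z" for z :: "nat set list \<Rightarrow>\<^sub>0 int"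
        by (simp only:)
      from PM show "frag_cmul ((-1) ^ card M * shuff M N) (concat_product (if P = {} \<or> M - P = {} then 0
          else frag_cmul ((-1) ^ card P * shuff P (M - P)) (frag_of [P, M - P])) (frag_of [N])) = c P (M - P) N"
        using that by (auto simp: c_def concat_product_cmul_left F)
    qed simp
    have 2: "frag_cmul ((-1) ^ card M * shuff M N * (-1) ^ (card M - 1)) (concat_product (frag_of [M]) (block_boundary N)) =
        - splits N (\<lambda>Q R. c M Q R)" if "M \<noteq> {}"
      unfolding block_boundary_splits[OF fin(2)] splits_def concat_product_sum_right frag_cmul_sum sum_negf[symmetric]
    proof (rule sum.cong)
      fix Q assume Q: "Q \<in> Pow N"
      have "M \<inter> Q = {}" "M \<inter> (N - Q) = {}" "finite Q" "Q \<union> (N - Q) = N"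
        using fin Q finite_subset[of Q N] by auto
      then have "shuff M N * shuff Q (N - Q) = shuff (M \<union> Q) (N - Q) * shuff M Q"
        using shuff_assoc[of M Q "N - Q"] fin by simp
      then have "(-1) ^ card M * shuff M N * (-1) ^ (card M - 1) * ((-1) ^ card Q * shuff Q (N - Q)) =
          - ((-1) ^ card Q * (shuff (M \<union> Q) (N - Q) * shuff M Q))"
        using fin that by (cases "card M") (auto simp: minus_one_power_iff)
      then have F: "frag_cmul ((-1) ^ card M * shuff M N * (-1) ^ (card M - 1) * ((-1) ^ card Q * shuff Q (N - Q))) z =
          frag_cmul (- ((-1) ^ card Q * (shuff (M \<union> Q) (N - Q) * shuff M Q))) z"
        for z :: "nat set list \<Rightarrow>\<^sub>0 int"
        by (simp only:)
      show "frag_cmul ((-1) ^ card M * shuff M N * (-1) ^ (card M - 1))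
          (concat_product (frag_of [M]) (if Q = {} \<or> N - Q = {} then 0
          else frag_cmul ((-1) ^ card Q * shuff Q (N - Q)) (frag_of [Q, N - Q]))) = - c M Q (N - Q)"
        using that by (auto simp: c_def concat_product_cmul_right F simp del: One_nat_def)
    qed simp
    have "splits M (\<lambda>P Q. c P Q N) = 0" if "N = {}"
      using that by (simp add: c_def splits_def)
    moreover have "splits N (\<lambda>Q R. c M Q R) = 0" if "M = {}"
      using that by (simp add: c_def splits_def)
    moreover have "splits M (\<lambda>P Q. c P Q N) = 0" if "M = {}"
      using that by (simp add: c_def splits_def)
    moreover have "splits N (\<lambda>Q R. c M Q R) = 0" if "N = {}"
      using that by (simp add: c_def splits_def)
    ultimately show "(if M = {} \<or> U - M = {} then 0
      else frag_cmul ((-1) ^ card M * shuff M (U - M)) (concat_product (block_boundary M) (frag_of [U - M])) +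
        frag_cmul ((-1) ^ card M * shuff M (U - M) * (-1) ^ (card M - 1)) (concat_product (frag_of [M]) (block_boundary (U - M)))) =
      (\<Sum>P\<in>Pow M. c P (M - P) (U - M)) - (\<Sum>Q\<in>Pow (U - M). c M Q (U - M - Q))"
      using 1 2 unfolding N_def[symmetric] splits_def by auto
  qed simp
  also have "\<dots> = 0"
    by (simp add: splits_assoc[OF True])
  finally show ?thesis .
qed (simp add: block_boundary_infinite)

lemma dg_words_perm: "dg_words part_dim perm_boundary_face"
proof
  show "perm_boundary_face (u @ v) = concat_product (perm_boundary_face u) (frag_of v) +
      frag_cmul ((-1) ^ part_dim u) (concat_product (frag_of u) (perm_boundary_face v))" for u v
    by (rule perm_boundary_face_append)
  show "part_dim x + 1 = part_dim u" if "x \<in> Poly_Mapping.keys (perm_boundary_face u)" for x u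
    using that by (rule perm_boundary_face_degree)
qed (simp_all add: boundary_block_boundary)

interpretation perm: dg_words part_dim perm_boundary_face
  by (rule dg_words_perm)

subsection \<open>Inserting a new maximum\<close>

text \<open>Insertion of \<open>m\<close> as an operator of degree one acting from the right: to
  reach a block it passes all later blocks, whence the exponent. The same sign comes out of
  \<open>sgn1\<close> in \<open>sgn1_ins\<close>.\<close>

primrec grow :: "nat \<Rightarrow> nat set list \<Rightarrow> (nat set list \<Rightarrow>\<^sub>0 int)" where
  "grow m [] = 0"
| "grow m (U # u) = frag_cmul ((-1) ^ part_dim u) (frag_of (insert m U # u)) +
     concat_product (frag_of [U]) (grow m u)"

definition below :: "nat \<Rightarrow> nat set \<Rightarrow> bool" where
  "below m U \<longleftrightarrow> finite U \<and> U \<noteq> {} \<and> (\<forall>x\<in>U. x < m)"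

lemma grow_append:
  "grow m (u @ v) = frag_cmul ((-1) ^ part_dim v) (concat_product (grow m u) (frag_of v)) +
     concat_product (frag_of u) (grow m v)"
proof (induction u)
  case (Cons U u)
  have "concat_product (frag_of [U]) (concat_product (frag_of u) x) = concat_product (frag_of (U # u)) x" for x
    by (simp flip: concat_product_assoc)
  with Cons show ?case
    by (simp add: concat_product_add_left concat_product_add_right concat_product_assoc
        concat_product_cmul_left concat_product_cmul_right frag_cmul_distrib2 power_add mult.commute add.assoc)
qed simp

lemma grow_degree:
  assumes "\<forall>U\<in>set u. below m U"
  shows "Poly_Mapping.keys (grow m u) \<subseteq> {v. part_dim v = part_dim u + 1}"
  using assms
proof (induction u)
  case (Cons U u)
  have "card (insert m U) = Suc (card U)" "card U > 0"
    using Cons.prems by (auto simp: below_def card_gt_0_iff)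
  moreover have "Poly_Mapping.keys (grow m u) \<subseteq> {v. part_dim v = part_dim u + 1}"
    using Cons by simp
  ultimately show ?case
    unfolding grow.simps
    by (intro keys_add_subset keys_frag_cmul_subset keys_concat_product) (auto simp: keys_frag_of)
qed simp

text \<open>In a splitting of \<open>insert m U\<close> the element \<open>m\<close> belongs to one
  half. If this half has other elements, the term is an insertion into a splitting of
  \<open>U\<close>; if not, the half is \<open>{m}\<close>, and this gives the two extra
  terms.\<close>

lemma grow_block_boundary:
  assumes "below m U"
  shows "block_boundary (insert m U) = frag_extend (grow m) (block_boundary U) +
     frag_cmul ((-1) ^ card U) (frag_of [U, {m}] - frag_of [{m}, U])"
proof -
  let ?f = "\<lambda>M N. if M = {} \<or> N = {} then 0 else frag_cmul ((-1) ^ card M * shuff M N) (frag_of [M, N])"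
  let ?g = "\<lambda>M N. if N = {} then frag_cmul ((-1) ^ card M) (frag_of [M, {m}]) else 0"
  let ?h = "\<lambda>M N. if M = {} then frag_cmul ((-1) ^ Suc (card N)) (frag_of [{m}, N]) else 0"
  have U: "finite U" "m \<notin> U" "U \<noteq> {}"
    using assms by (auto simp: below_def)
  have "block_boundary (insert m U) = splits U (\<lambda>M N. ?f M (insert m N) + ?f (insert m M) N)"
    using U by (simp add: block_boundary_splits splits_insert splits_add)
  also have "\<dots> = splits U (\<lambda>M N. frag_extend (grow m) (?f M N) + (?g M N + ?h M N))"
  proof (rule splits_cong)
    fix M N assume MN: "M \<union> N = U" "M \<inter> N = {}"
    then have fin: "finite M" "finite N" "\<forall>x\<in>M \<union> N. x < m" "m \<notin> M"
      using assms by (auto simp: below_def)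
    have s: "shuff M (insert m N) = shuff M N" "shuff (insert m M) N = (-1) ^ card N * shuff M N"
      using shuff_insert_right[of M N m] shuff_insert_left[of M N m] MN fin by auto
    have s1: "shuff M {m} = 1" if "N = {}"
      using s(1) that fin by simp
    have s2: "shuff {m} N = (-1) ^ card N" if "M = {}"
      using s(2) that fin by simp
    have k: "(-1::int) ^ card N = - ((-1) ^ (card N - 1))" if "N \<noteq> {}"
      using that fin by (cases "card N") auto
    show "?f M (insert m N) + ?f (insert m M) N = frag_extend (grow m) (?f M N) + (?g M N + ?h M N)"
      using MN U fin s s1 s2 k by (auto simp: frag_extend_cmul frag_cmul_distrib2 algebra_simps)
  qed simp
  also have "\<dots> = frag_extend (grow m) (block_boundary U) + (splits U ?g + splits U ?h)"
    by (simp add: splits_add block_boundary_splits U splits_frag_extend)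
  also have "splits U ?g = frag_cmul ((-1) ^ card U) (frag_of [U, {m}])"
    unfolding splits_def using U
    by (subst sum.mono_neutral_right[of _ "{U}"]) auto
  also have "splits U ?h = frag_cmul ((-1) ^ Suc (card U)) (frag_of [{m}, U])"
    unfolding splits_def using U
    by (subst sum.mono_neutral_right[of _ "{{}}"]) auto
  finally show ?thesis
    by (simp add: frag_cmul_diff_distrib2 flip: minus_frag_cmul)
qed

text \<open>Each block contributes a term with \<open>{m}\<close> just before it and one with
  \<open>{m}\<close> just after it. Between neighbours these cancel in pairs, and \<open>{m}\<close>
  survives only at the two ends of the word.\<close>

lemma boundary_grow:
  assumes "\<forall>U\<in>set u. below m U"
  shows "perm.bd (grow m u) = frag_extend (grow m) (perm_boundary_face u) +
     frag_cmul ((-1) ^ Suc (part_dim u)) (frag_of (u @ [{m}]) - frag_of ({m} # u))"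
  using assms
proof (induction u)
  case Nil
  then show ?case
    by simp
next
  case (Cons U u)
  have U: "below m U" "card (insert m U) = Suc (card U)" "card U > 0"
    using Cons.prems by (auto simp: below_def card_gt_0_iff)
  have grow_cat_U: "frag_extend (grow m) (concat_product x (frag_of u)) =
      frag_cmul ((-1) ^ part_dim u) (concat_product (frag_extend (grow m) x) (frag_of u)) +
      concat_product x (grow m u)" for x
    by (rule frag_additive_eqI[where c = x])
      (simp_all add: concat_product_diff_left frag_extend_diff frag_cmul_diff_distrib2 grow_append)
  \<comment> \<open>The insertion into \<open>U\<close> sees the dimension of the word behind it,
    which the boundary has lowered by one; this is the extra sign.\<close>
  have grow_cat_u: "frag_extend (grow m) (concat_product (frag_of [U]) (perm_boundary_face u)) =
      frag_cmul ((-1) ^ Suc (part_dim u)) (concat_product (frag_of [insert m U]) (perm_boundary_face u)) +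
      concat_product (frag_of [U]) (frag_extend (grow m) (perm_boundary_face u))"
  proof (rule frag_additive_eqI[where c = "perm_boundary_face u"])
    fix v assume "v \<in> Poly_Mapping.keys (perm_boundary_face u)"
    then have "part_dim u = Suc (part_dim v)"
      using perm_boundary_face_degree by force
    then show "frag_extend (grow m) (concat_product (frag_of [U]) (frag_of v)) =
      frag_cmul ((-1) ^ Suc (part_dim u)) (concat_product (frag_of [insert m U]) (frag_of v)) +
      concat_product (frag_of [U]) (frag_extend (grow m) (frag_of v))"
      by simp
  qed (simp_all add: concat_product_diff_right frag_extend_diff frag_cmul_diff_distrib2)
  have IH: "perm.bd (grow m u) = frag_extend (grow m) (perm_boundary_face u) +
     frag_cmul ((-1) ^ Suc (part_dim u)) (frag_of (u @ [{m}]) - frag_of ({m} # u))"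
    using Cons by simp
  have A: "perm.bd (concat_product (frag_of [U]) (grow m u)) =
      concat_product (block_boundary U) (grow m u) +
      frag_cmul ((-1) ^ (card U - 1)) (concat_product (frag_of [U]) (perm.bd (grow m u)))"
    by (subst perm.bd_concat_product[where d = "card U - 1"]) auto
  obtain k where k: "card U = Suc k"
    using U(3) by (cases "card U") auto
  show ?case
    by (simp add: A IH k U(2) frag_extend_add frag_extend_cmul perm_boundary_face_Cons grow_block_boundary[OF U(1)]
        grow_cat_U grow_cat_u concat_product_add_left concat_product_add_right concat_product_diff_right
        concat_product_diff_left concat_product_cmul_left concat_product_cmul_right frag_cmul_distrib2
        frag_cmul_diff_distrib2 power_add)
      (simp add: algebra_simps frag_cmul_cancel)
qed

subsection \<open>The recursion for the diagonal\<close>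

abbreviation bar where "bar \<equiv> bar_product part_dim"

text \<open>An operator acting from the right passes \<open>b\<close> before it reaches
  \<open>a\<close>; this explains the sign here and its absence in
  \<open>grow_right\<close>.\<close>

definition grow_left :: "nat \<Rightarrow> ((nat set list \<times> nat set list) \<Rightarrow>\<^sub>0 int) \<Rightarrow> ((nat set list \<times> nat set list) \<Rightarrow>\<^sub>0 int)" where
  "grow_left m = frag_extend (\<lambda>(a, b). frag_cmul ((-1) ^ part_dim b) (tensor (grow m a) (frag_of b)))"

definition grow_right :: "nat \<Rightarrow> ((nat set list \<times> nat set list) \<Rightarrow>\<^sub>0 int) \<Rightarrow> ((nat set list \<times> nat set list) \<Rightarrow>\<^sub>0 int)" where
  "grow_right m = frag_extend (\<lambda>(a, b). tensor (frag_of a) (grow m b))"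

lemma grow_left_diff: "grow_left m (x - y) = grow_left m x - grow_left m y"
  by (simp add: grow_left_def frag_extend_diff)

lemma grow_right_diff: "grow_right m (x - y) = grow_right m x - grow_right m y"
  by (simp add: grow_right_def frag_extend_diff)

lemma grow_zero [simp]: "grow_left m 0 = 0" "grow_right m 0 = 0"
  by (simp_all add: grow_left_def grow_right_def)

lemma grow_left_of: "grow_left m (frag_of (a, b)) = frag_cmul ((-1) ^ part_dim b) (tensor (grow m a) (frag_of b))"
  by (simp add: grow_left_def)

lemma grow_right_of: "grow_right m (frag_of (a, b)) = tensor (frag_of a) (grow m b)"
  by (simp add: grow_right_def)

abbreviation words_below :: "nat \<Rightarrow> (nat set list \<times> nat set list) set" where
  "words_below m \<equiv> {a. \<forall>U\<in>set a. below m U} \<times> {b. \<forall>U\<in>set b. below m U}"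

lemma grow_right_add: "grow_right m (x + y) = grow_right m x + grow_right m y"
  by (simp add: grow_right_def frag_extend_add)

lemma grow_left_add: "grow_left m (x + y) = grow_left m x + grow_left m y"
  by (simp add: grow_left_def frag_extend_add)

lemma grow_right_cmul: "grow_right m (frag_cmul k x) = frag_cmul k (grow_right m x)"
  by (simp add: grow_right_def frag_extend_cmul)

lemma grow_left_cmul: "grow_left m (frag_cmul k x) = frag_cmul k (grow_left m x)"
  by (simp add: grow_left_def frag_extend_cmul)

lemma twist_of: "perm.twist (frag_of (a, b)) = frag_cmul ((-1) ^ (part_dim a + part_dim b)) (frag_of (a, b))"
  by (simp add: perm.twist_def)

lemma grow_parity:
  assumes "\<forall>U\<in>set u. below m U" "v \<in> Poly_Mapping.keys (grow m u)"
  shows "even (part_dim v + Suc (part_dim u))"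
  using grow_degree[OF assms(1)] assms(2) by auto

lemma boundary_parity:
  assumes "v \<in> Poly_Mapping.keys (perm_boundary_face u)"
  shows "even (part_dim v + Suc (part_dim u))"
  using perm_boundary_face_degree[OF assms] by presburger

text \<open>A derivation acting from the right: reaching \<open>x\<close> costs the sign of
  \<open>y\<close>, which for inhomogeneous chains is \<open>twist y\<close>.\<close>

lemma grow_right_bar:
  assumes "Poly_Mapping.keys x \<subseteq> words_below m" "Poly_Mapping.keys y \<subseteq> words_below m"
  shows "grow_right m (bar x y) = bar x (grow_right m y) + bar (grow_right m x) (perm.twist y)"
proof -
  have 0: "grow_right m (bar (frag_of (a, b)) (frag_of (a', b'))) =
     bar (frag_of (a, b)) (grow_right m (frag_of (a', b'))) +
     bar (grow_right m (frag_of (a, b))) (perm.twist (frag_of (a', b')))"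
    if "\<forall>U\<in>set b. below m U" for a b a' b'
  proof -
    have s: "(-1::int) ^ (part_dim a' + part_dim b') * (-1) ^ (part_dim a' * Suc (part_dim b)) =
        (-1) ^ (part_dim a' * part_dim b) * (-1) ^ part_dim b'"
      by (auto simp: minus_one_power_iff)
    show ?thesis
      by (simp only: bar_product_frag_of grow_right_cmul grow_right_of grow_append tensor_add_right
          tensor_cmul_right frag_cmul_distrib2 twist_of bar_product_cmul_right perm.bar_tensor_right2
          perm.bar_tensor_left2[OF grow_parity[OF that]] frag_cmul_cmul s add.commute)
  qed
  have 1: "grow_right m (bar (frag_of p) y) = bar (frag_of p) (grow_right m y) +
      bar (grow_right m (frag_of p)) (perm.twist y)" if p: "p \<in> words_below m" for p
  proof (rule frag_additive_eqI[where c = y])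
    fix q assume "q \<in> Poly_Mapping.keys y"
    obtain a b a' b' where "p = (a, b)" "q = (a', b')"
      by fastforce
    then show "grow_right m (bar (frag_of p) (frag_of q)) = bar (frag_of p) (grow_right m (frag_of q)) +
      bar (grow_right m (frag_of p)) (perm.twist (frag_of q))"
      using 0 p by auto
  qed (simp_all add: bar_product_diff_right grow_right_diff perm.twist_diff)
  show ?thesis
  proof (rule frag_additive_eqI[where c = x])
    fix p assume "p \<in> Poly_Mapping.keys x"
    then show "grow_right m (bar (frag_of p) y) = bar (frag_of p) (grow_right m y) +
      bar (grow_right m (frag_of p)) (perm.twist y)"
      using assms(1) by (intro 1) auto
  qed (simp_all add: bar_product_diff_left grow_right_diff)
qed

lemma grow_left_bar:
  assumes "Poly_Mapping.keys x \<subseteq> words_below m" "Poly_Mapping.keys y \<subseteq> words_below m"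
  shows "grow_left m (bar x y) = bar x (grow_left m y) + bar (grow_left m x) (perm.twist y)"
proof -
  have 0: "grow_left m (bar (frag_of (a, b)) (frag_of (a', b'))) =
     bar (frag_of (a, b)) (grow_left m (frag_of (a', b'))) +
     bar (grow_left m (frag_of (a, b))) (perm.twist (frag_of (a', b')))"
    if "\<forall>U\<in>set a'. below m U" for a b a' b'
  proof -
    have s1: "(-1::int) ^ part_dim b' * (-1) ^ (Suc (part_dim a') * part_dim b) =
        (-1) ^ (part_dim a' * part_dim b) * (-1) ^ (part_dim b + part_dim b')"
      by (auto simp: minus_one_power_iff)
    have s2: "(-1::int) ^ part_dim b * ((-1) ^ (part_dim a' + part_dim b') * (-1) ^ (part_dim a' * part_dim b)) =
        (-1) ^ (part_dim a' * part_dim b) * (-1) ^ (part_dim b + part_dim b') * (-1) ^ part_dim a'"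
      by (auto simp: minus_one_power_iff)
    have s3: "(-1::int) ^ (part_dim a' + part_dim b') * ((-1) ^ part_dim b * (-1) ^ (part_dim a' * part_dim b)) =
        (-1) ^ (part_dim a' * part_dim b) * (-1) ^ (part_dim b + part_dim b') * (-1) ^ part_dim a'"
      by (auto simp: minus_one_power_iff)
    show ?thesis
      by (simp only: bar_product_frag_of grow_left_cmul grow_left_of grow_append tensor_add_left
          tensor_cmul_left frag_cmul_distrib2 twist_of bar_product_cmul_right bar_product_cmul_left
          perm.bar_tensor_left1 perm.bar_tensor_right1[OF grow_parity[OF that]] frag_cmul_cmul part_dim_simps
          s1 s2 s3 mult.assoc[symmetric] add.commute)
        (simp only: mult.assoc s1 s2 s3 add.commute)
  qed
  have 1: "grow_left m (bar (frag_of p) y) = bar (frag_of p) (grow_left m y) +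
      bar (grow_left m (frag_of p)) (perm.twist y)" for p
  proof (rule frag_additive_eqI[where c = y])
    fix q assume q: "q \<in> Poly_Mapping.keys y"
    obtain a b a' b' where "p = (a, b)" "q = (a', b')"
      by fastforce
    then show "grow_left m (bar (frag_of p) (frag_of q)) = bar (frag_of p) (grow_left m (frag_of q)) +
      bar (grow_left m (frag_of p)) (perm.twist (frag_of q))"
      using 0 q assms(2) by auto
  qed (simp_all add: bar_product_diff_right grow_left_diff perm.twist_diff)
  show ?thesis
    by (rule frag_additive_eqI[where c = x]) (simp_all add: bar_product_diff_left grow_left_diff 1)
qed

lemma tbd_tensor_right:
  "perm.tbd (tensor (frag_of a) y) = tensor (perm_boundary_face a) y +
     frag_cmul ((-1) ^ part_dim a) (tensor (frag_of a) (perm.bd y))"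
  by (rule frag_additive_eqI[where c = y])
    (simp_all add: tensor_diff_right perm.tbd_diff frag_cmul_diff_distrib2 frag_extend_diff perm.tbd_frag_of)

lemma tbd_tensor_left:
  assumes "\<And>v. v \<in> Poly_Mapping.keys x \<Longrightarrow> even (part_dim v + d)"
  shows "perm.tbd (tensor x (frag_of b)) = tensor (perm.bd x) (frag_of b) +
     frag_cmul ((-1) ^ d) (tensor x (perm_boundary_face b))"
proof (rule frag_additive_eqI[where c = x])
  fix v assume "v \<in> Poly_Mapping.keys x"
  from minus_one_power_eqI[OF assms[OF this]]
  show "perm.tbd (tensor (frag_of v) (frag_of b)) = tensor (perm.bd (frag_of v)) (frag_of b) +
     frag_cmul ((-1) ^ d) (tensor (frag_of v) (perm_boundary_face b))"
    by (simp add: perm.tbd_frag_of)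
qed (simp_all add: tensor_diff_left perm.tbd_diff frag_cmul_diff_distrib2 frag_extend_diff)

lemma grow_right_tensor: "grow_right m (tensor (frag_of a) y) = tensor (frag_of a) (frag_extend (grow m) y)"
  by (rule frag_additive_eqI[where c = y])
    (simp_all add: tensor_diff_right grow_right_diff frag_extend_diff grow_right_of)

lemma grow_right_tensor': "grow_right m (tensor x (frag_of b)) = tensor x (grow m b)"
  by (rule frag_additive_eqI[where c = x])
    (simp_all add: tensor_diff_left grow_right_diff frag_extend_diff grow_right_of)

lemma grow_left_tensor:
  "grow_left m (tensor x (frag_of b)) = frag_cmul ((-1) ^ part_dim b) (tensor (frag_extend (grow m) x) (frag_of b))"
  by (rule frag_additive_eqI[where c = x])
    (simp_all add: tensor_diff_left grow_left_diff frag_extend_diff frag_cmul_diff_distrib2 grow_left_of)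

lemma grow_left_tensor':
  assumes "\<And>v. v \<in> Poly_Mapping.keys y \<Longrightarrow> even (part_dim v + d)"
  shows "grow_left m (tensor (frag_of a) y) = frag_cmul ((-1) ^ d) (tensor (grow m a) y)"
proof (rule frag_additive_eqI[where c = y])
  fix v assume "v \<in> Poly_Mapping.keys y"
  from minus_one_power_eqI[OF assms[OF this]]
  show "grow_left m (tensor (frag_of a) (frag_of v)) = frag_cmul ((-1) ^ d) (tensor (grow m a) (frag_of v))"
    by (simp add: grow_left_of)
qed (simp_all add: tensor_diff_right grow_left_diff frag_cmul_diff_distrib2)

text \<open>The image of \<open>boundary_grow\<close> in the tensor square. The end terms are
  written as products with a single cell, so that they can join a sum over splittings in
  \<open>tbd_hat\<close>.\<close>

lemma tbd_grow_right:
  assumes "Poly_Mapping.keys x \<subseteq> words_below m"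
  shows "perm.tbd (grow_right m x) = grow_right m (perm.tbd x) +
    (bar (frag_of ([], [{m}])) (perm.twist x) - bar (perm.twist x) (frag_of ([], [{m}])))"
proof (rule frag_additive_eqI[where c = x])
  fix p assume "p \<in> Poly_Mapping.keys x"
  then obtain a b where p: "p = (a, b)" and b: "\<forall>U\<in>set b. below m U"
    using assms by (cases p) auto
  show "perm.tbd (grow_right m (frag_of p)) = grow_right m (perm.tbd (frag_of p)) +
    (bar (frag_of ([], [{m}])) (perm.twist (frag_of p)) - bar (perm.twist (frag_of p)) (frag_of ([], [{m}])))"
    by (simp add: p grow_right_of tbd_tensor_right boundary_grow[OF b] perm.tbd_frag_of grow_right_add
        grow_right_cmul grow_right_tensor grow_right_tensor' twist_of bar_product_cmul_left
        bar_product_cmul_right bar_product_frag_of tensor_add_right tensor_cmul_right tensor_diff_right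
        frag_cmul_distrib2 frag_cmul_diff_distrib2 power_add)
      (simp add: algebra_simps frag_cmul_cancel)
qed (simp_all add: grow_right_diff perm.tbd_diff perm.twist_diff bar_product_diff_left bar_product_diff_right)

lemma tbd_grow_left:
  assumes "Poly_Mapping.keys x \<subseteq> words_below m"
  shows "perm.tbd (grow_left m x) = grow_left m (perm.tbd x) +
    (bar (frag_of ([{m}], [])) (perm.twist x) - bar (perm.twist x) (frag_of ([{m}], [])))"
proof (rule frag_additive_eqI[where c = x])
  fix p assume "p \<in> Poly_Mapping.keys x"
  then obtain a b where p: "p = (a, b)" and a: "\<forall>U\<in>set a. below m U"
    using assms by (cases p) auto
  show "perm.tbd (grow_left m (frag_of p)) = grow_left m (perm.tbd (frag_of p)) +
    (bar (frag_of ([{m}], [])) (perm.twist (frag_of p)) - bar (perm.twist (frag_of p)) (frag_of ([{m}], [])))"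
    by (simp add: p grow_left_of perm.tbd_cmul tbd_tensor_left[OF grow_parity[OF a]] boundary_grow[OF a]
        perm.tbd_frag_of grow_left_add
        grow_left_cmul grow_left_tensor grow_left_tensor'[OF boundary_parity] twist_of bar_product_cmul_left
        bar_product_cmul_right bar_product_frag_of tensor_add_left tensor_cmul_left tensor_diff_left
        frag_cmul_distrib2 frag_cmul_diff_distrib2 power_add)
      (simp add: algebra_simps frag_cmul_cancel)
qed (simp_all add: grow_left_diff perm.tbd_diff perm.twist_diff bar_product_diff_left bar_product_diff_right)

lemma keys_grow: "Poly_Mapping.keys (grow m u) \<subseteq> {xs @ insert m U # ys | xs U ys. u = xs @ U # ys}"
proof (induction u)
  case (Cons V u)
  show ?case
    unfolding grow.simps
  proof (intro keys_add_subset keys_frag_cmul_subset keys_concat_product)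
    show "Poly_Mapping.keys (frag_of (insert m V # u)) \<subseteq> {xs @ insert m U # ys | xs U ys. V # u = xs @ U # ys}"
      by (force simp: keys_frag_of)
    fix a b assume "a \<in> Poly_Mapping.keys (frag_of [V])" "b \<in> Poly_Mapping.keys (grow m u)"
    then obtain xs U ys where "a = [V]" "b = xs @ insert m U # ys" "u = xs @ U # ys"
      using Cons by (auto simp: keys_frag_of)
    then have "a @ b = (V # xs) @ insert m U # ys" "V # u = (V # xs) @ U # ys"
      by auto
    then show "a @ b \<in> {xs @ insert m U # ys | xs U ys. V # u = xs @ U # ys}"
      by blast
  qed
qed simp

section \<open>Ordered partitions under concatenation and insertion\<close>

lemma ordered_partitions_iff:
  "u \<in> ordered_partitions S \<longleftrightarrow> distinct u \<and> \<Union>(set u) = S \<and> {} \<notin> set u \<and>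
     (\<forall>U\<in>set u. \<forall>V\<in>set u. U \<noteq> V \<longrightarrow> U \<inter> V = {})"
  by (auto simp: ordered_partitions_def partition_on_def disjoint_def)

lemma ordered_partitions_append:
  assumes "u \<in> ordered_partitions B" "v \<in> ordered_partitions A" "A \<inter> B = {}"
  shows "u @ v \<in> ordered_partitions (B \<union> A)"
proof -
  have *: "U \<inter> V = {}" "U \<noteq> V" if "U \<in> set u" "V \<in> set v" for U V
  proof -
    show "U \<inter> V = {}"
      using assms that by (force simp: ordered_partitions_iff)
    moreover have "U \<noteq> {}"
      using assms(1) that by (auto simp: ordered_partitions_iff)
    ultimately show "U \<noteq> V"
      by auto
  qed
  then have "set u \<inter> set v = {}"
    by blast
  moreover have "\<forall>U\<in>set (u @ v). \<forall>V\<in>set (u @ v). U \<noteq> V \<longrightarrow> U \<inter> V = {}"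
  proof (intro ballI impI)
    fix U V assume "U \<in> set (u @ v)" "V \<in> set (u @ v)" "U \<noteq> V"
    then consider "U \<in> set u" "V \<in> set u" | "U \<in> set v" "V \<in> set v"
      | "U \<in> set u" "V \<in> set v" | "U \<in> set v" "V \<in> set u"
      by auto
    then show "U \<inter> V = {}"
      using assms(1,2) \<open>U \<noteq> V\<close> *(1)[of U V] *(1)[of V U]
      by cases (simp_all add: ordered_partitions_iff Int_commute)
  qed
  ultimately show ?thesis
    using assms(1,2) by (simp add: ordered_partitions_iff)
qed

lemma ordered_partitions_insert:
  assumes "xs @ U # ys \<in> ordered_partitions B" "m \<notin> B"
  shows "xs @ insert m U # ys \<in> ordered_partitions (insert m B)"
proof -
  have m: "m \<notin> V" if "V \<in> set xs \<union> set ys" for V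
    using assms that by (auto simp: ordered_partitions_iff)
  then have "insert m U \<notin> set xs \<union> set ys"
    by blast
  moreover have "insert m U \<inter> V = {}" "V \<inter> insert m U = {}" if "V \<in> set xs \<union> set ys" for V
  proof -
    have "U \<noteq> V"
      using assms(1) that by (auto simp: ordered_partitions_iff)
    then have "U \<inter> V = {}"
      using assms(1) that by (simp add: ordered_partitions_iff)
    then show "insert m U \<inter> V = {}" "V \<inter> insert m U = {}"
      using m[OF that] by auto
  qed
  ultimately show ?thesis
    using assms(1) by (auto simp: ordered_partitions_iff)
qed

lemma ordered_partitions_empty [simp]: "ordered_partitions {} = {[]}"
proof -
  have "u = []" if "u \<in> ordered_partitions {}" for u
    using that by (cases u) (auto simp: ordered_partitions_iff)
  then show ?thesis
    by (auto simp: ordered_partitions_iff)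
qed

lemma ordered_partitions_Nil [simp]: "[] \<in> ordered_partitions S \<longleftrightarrow> S = {}"
  by (auto simp: ordered_partitions_iff)

lemma ordered_partitions_single [simp]: "S \<noteq> {} \<Longrightarrow> [S] \<in> ordered_partitions S"
  by (auto simp: ordered_partitions_iff)

lemma ordered_partitions_below:
  assumes "u \<in> ordered_partitions S" "finite S" "\<forall>x\<in>S. x < m"
  shows "\<forall>U\<in>set u. below m U"
  using assms by (auto simp: ordered_partitions_iff below_def intro: finite_subset)

section \<open>The chain map property from the recursion\<close>

text \<open>The diagonal of the empty set is the pair of empty words, on which insertion gives 0;
  the hat puts the cell \<open>e\<close> in its place. This value makes the end terms of
  \<open>tbd_grow_right\<close> and \<open>tbd_grow_left\<close> the summands with an empty
  half.\<close>

definition grow_hat :: "((nat set list \<times> nat set list \<Rightarrow>\<^sub>0 int) \<Rightarrow> (nat set list \<times> nat set list \<Rightarrow>\<^sub>0 int)) \<Rightarrow>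
    nat set list \<times> nat set list \<Rightarrow> (nat set \<Rightarrow> (nat set list \<times> nat set list \<Rightarrow>\<^sub>0 int)) \<Rightarrow> nat set \<Rightarrow>
    (nat set list \<times> nat set list \<Rightarrow>\<^sub>0 int)" where
  "grow_hat X e D B = (if B = {} then frag_of e else X (D B))"

abbreviation right_hat where "right_hat m \<equiv> grow_hat (grow_right m) ([], [{m}])"
abbreviation left_hat where "left_hat m \<equiv> grow_hat (grow_left m) ([{m}], [])"

lemma splits_bar_left: "bar (splits U f) x = splits U (\<lambda>M N. bar (f M N) x)"
  by (simp add: splits_def bar_product_sum_left)

lemma splits_bar_right: "bar x (splits U f) = splits U (\<lambda>M N. bar x (f M N))"
  by (simp add: splits_def bar_product_sum_right)

lemma splits_tbd: "perm.tbd (splits U f) = splits U (\<lambda>M N. perm.tbd (f M N))"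
  by (simp add: splits_def perm.tbd_sum)

lemma splits_delta_left: "finite U \<Longrightarrow> splits U (\<lambda>M N. if M = {} then f N else 0) = f U"
  unfolding splits_def by (subst sum.mono_neutral_right[of _ "{{}}"]) auto

lemma splits_delta_right: "finite U \<Longrightarrow> splits U (\<lambda>M N. if N = {} then f M else 0) = f U"
  unfolding splits_def by (subst sum.mono_neutral_right[of _ "{U}"]) auto

lemma insert_Max_cases:
  fixes S' :: "'a::linorder set"
  assumes "finite S'" "S' \<noteq> {}"
  obtains m S where "S' = insert m S" "finite S" "\<forall>x\<in>S. x < m" "m \<notin> S"
proof (rule that[of "Max S'" "S' - {Max S'}"])
  have "x \<le> Max S'" if "x \<in> S'" for x
    using assms that by simp
  then show "\<forall>x\<in>S' - {Max S'}. x < Max S'"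
    by (auto simp: order.strict_iff_order)
  have "Max S' \<in> S'"
    using assms by simp
  then show "S' = insert (Max S') (S' - {Max S'})"
    by blast
qed (use assms in auto)

text \<open>Removing the maximum determines \<open>D\<close> on all finite sets. Detached from its
  origin in matrices, the recursion alone yields the chain map property.\<close>

locale diagonal_recursion =
  fixes D :: "nat set \<Rightarrow> (nat set list \<times> nat set list \<Rightarrow>\<^sub>0 int)"
  assumes D_empty: "D {} = frag_of ([], [])"
    and D_insert: "finite S \<Longrightarrow> \<forall>x\<in>S. x < m \<Longrightarrow>
      D (insert m S) = splits S (\<lambda>B A. frag_cmul (shuff B A) (bar (right_hat m D B) (left_hat m D A)))"
begin

definition cells :: "nat set \<Rightarrow> nat \<Rightarrow> (nat set list \<times> nat set list) set" where
  "cells S d = {(a, b). a \<in> ordered_partitions S \<and> b \<in> ordered_partitions S \<and> part_dim a + part_dim b = d}"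

lemma right_hat_cells:
  assumes "finite S" "\<forall>x\<in>S. x < m" "S \<noteq> {} \<Longrightarrow> Poly_Mapping.keys (D S) \<subseteq> cells S (card S - 1)"
  shows "Poly_Mapping.keys (right_hat m D S) \<subseteq>
    {(a, b). a \<in> ordered_partitions S \<and> b \<in> ordered_partitions (insert m S) \<and> part_dim a + part_dim b = card S}"
proof (cases "S = {}")
  case False
  have "Poly_Mapping.keys (grow_right m (D S)) \<subseteq>
    {(a, b). a \<in> ordered_partitions S \<and> b \<in> ordered_partitions (insert m S) \<and> part_dim a + part_dim b = card S}"
    unfolding grow_right_def
  proof (rule keys_frag_extend_subset, clarsimp)
    fix a b p q
    assume "(a, b) \<in> Poly_Mapping.keys (D S)" and pq: "(p, q) \<in> Poly_Mapping.keys (tensor (frag_of a) (grow m b))"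
    then have ab: "a \<in> ordered_partitions S" "b \<in> ordered_partitions S" "part_dim a + part_dim b = card S - 1"
      using assms(3) False by (auto simp: cells_def)
    have "p = a" "q \<in> Poly_Mapping.keys (grow m b)"
      using pq keys_tensor[OF subset_refl subset_refl, of "frag_of a" "grow m b"] by (auto simp: keys_frag_of)
    moreover from this(2) have "part_dim q = part_dim b + 1"
      using grow_degree[OF ordered_partitions_below[OF ab(2) assms(1,2)]] by auto
    moreover have "q \<in> ordered_partitions (insert m S)"
      using \<open>q \<in> Poly_Mapping.keys (grow m b)\<close> keys_grow[of m b] ab(2) assms(2) ordered_partitions_insert by blast
    moreover have "card S > 0"
      using False assms(1) by (simp add: card_gt_0_iff)
    ultimately show "p \<in> ordered_partitions S \<and> q \<in> ordered_partitions (insert m S) \<and> part_dim p + part_dim q = card S"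
      using ab by simp
  qed
  with False show ?thesis
    by (simp add: grow_hat_def)
qed (simp add: grow_hat_def keys_frag_of)

lemma left_hat_cells:
  assumes "finite S" "\<forall>x\<in>S. x < m" "S \<noteq> {} \<Longrightarrow> Poly_Mapping.keys (D S) \<subseteq> cells S (card S - 1)"
  shows "Poly_Mapping.keys (left_hat m D S) \<subseteq>
    {(a, b). a \<in> ordered_partitions (insert m S) \<and> b \<in> ordered_partitions S \<and> part_dim a + part_dim b = card S}"
proof (cases "S = {}")
  case False
  have "Poly_Mapping.keys (grow_left m (D S)) \<subseteq>
    {(a, b). a \<in> ordered_partitions (insert m S) \<and> b \<in> ordered_partitions S \<and> part_dim a + part_dim b = card S}"
    unfolding grow_left_def
  proof (rule keys_frag_extend_subset, clarsimp)
    fix a b p q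
    assume "(a, b) \<in> Poly_Mapping.keys (D S)" and pq: "(p, q) \<in> Poly_Mapping.keys (tensor (grow m a) (frag_of b))"
    then have ab: "a \<in> ordered_partitions S" "b \<in> ordered_partitions S" "part_dim a + part_dim b = card S - 1"
      using assms(3) False by (auto simp: cells_def)
    have "q = b" "p \<in> Poly_Mapping.keys (grow m a)"
      using pq keys_tensor[OF subset_refl subset_refl, of "grow m a" "frag_of b"] by (auto simp: keys_frag_of)
    moreover from this(2) have "part_dim p = part_dim a + 1"
      using grow_degree[OF ordered_partitions_below[OF ab(1) assms(1,2)]] by auto
    moreover have "p \<in> ordered_partitions (insert m S)"
      using \<open>p \<in> Poly_Mapping.keys (grow m a)\<close> keys_grow[of m a] ab(1) assms(2) ordered_partitions_insert by blast
    moreover have "card S > 0"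
      using False assms(1) by (simp add: card_gt_0_iff)
    ultimately show "p \<in> ordered_partitions (insert m S) \<and> q \<in> ordered_partitions S \<and> part_dim p + part_dim q = card S"
      using ab by simp
  qed
  with False show ?thesis
    by (simp add: grow_hat_def)
qed (simp add: grow_hat_def keys_frag_of)

text \<open>The two hatted halves have total dimensions \<open>card B\<close> and
  \<open>card (S - B)\<close>, which add up to the dimension of the top cell on
  \<open>insert m S\<close>.\<close>

lemma D_cells: "finite S \<Longrightarrow> S \<noteq> {} \<Longrightarrow> Poly_Mapping.keys (D S) \<subseteq> cells S (card S - 1)"
proof (induction S rule: finite_psubset_induct)
  case (psubset S')
  obtain m S where S: "S' = insert m S" "finite S" "\<forall>x\<in>S. x < m" "m \<notin> S"
    using insert_Max_cases[OF psubset.hyps(1) psubset.prems] .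
  show ?case
    unfolding S(1) D_insert[OF S(2,3)] splits_def
  proof (intro keys_sum_subset keys_frag_cmul_subset keys_bar_product)
    fix B a b a' b'
    assume B: "B \<in> Pow S" and 1: "(a, b) \<in> Poly_Mapping.keys (right_hat m D B)"
      and 2: "(a', b') \<in> Poly_Mapping.keys (left_hat m D (S - B))"
    have fin: "finite B" "finite (S - B)" "\<forall>x\<in>B. x < m" "\<forall>x\<in>S - B. x < m" "B \<subset> S'" "S - B \<subset> S'"
      using S B finite_subset[of B S] by auto
    have *: "a \<in> ordered_partitions B" "b \<in> ordered_partitions (insert m B)" "part_dim a + part_dim b = card B"
      "a' \<in> ordered_partitions (insert m (S - B))" "b' \<in> ordered_partitions (S - B)"
      "part_dim a' + part_dim b' = card (S - B)"
      using subsetD[OF right_hat_cells[OF fin(1,3) psubset.IH[OF fin(5)]] 1]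
        subsetD[OF left_hat_cells[OF fin(2,4) psubset.IH[OF fin(6)]] 2] by auto
    have "insert m (S - B) \<inter> B = {}" "(S - B) \<inter> insert m B = {}"
      using S(4) B by auto
    moreover have "B \<union> insert m (S - B) = insert m S" "insert m B \<union> (S - B) = insert m S"
      using B by auto
    moreover have "card B + card (S - B) = card S"
      using B S(2) card_mono[of S B] by (simp add: card_Diff_subset[OF fin(1)])
    ultimately show "(a @ a', b @ b') \<in> cells (insert m S) (card (insert m S) - 1)"
      using *(3,6) S(2,4) ordered_partitions_append[OF *(1,4)] ordered_partitions_append[OF *(2,5)]
      by (simp add: cells_def)
  qed
qed

lemma D_words_below:
  assumes "finite S" "\<forall>x\<in>S. x < m"
  shows "Poly_Mapping.keys (D S) \<subseteq> words_below m"
proof (cases "S = {}")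
  case False
  show ?thesis
  proof
    fix p assume "p \<in> Poly_Mapping.keys (D S)"
    then obtain a b where "p = (a, b)" "a \<in> ordered_partitions S" "b \<in> ordered_partitions S"
      using D_cells[OF assms(1) False] by (auto simp: cells_def)
    then show "p \<in> words_below m"
      using ordered_partitions_below[OF _ assms] by auto
  qed
qed (simp add: D_empty keys_frag_of)

lemma twist_D: "finite S \<Longrightarrow> S \<noteq> {} \<Longrightarrow> perm.twist (D S) = frag_cmul ((-1) ^ (card S - 1)) (D S)"
  by (rule perm.twist_homogeneous) (use D_cells in \<open>auto simp: cells_def\<close>)

text \<open>One computation for both factors, with \<open>X\<close> standing for
  \<open>grow_right\<close> or \<open>grow_left\<close>. The derivation property turns each product
  in the boundary of \<open>D S\<close> into two terms, and the commutator of \<open>X\<close> with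
  the boundary supplies the terms with an empty half.\<close>

lemma tbd_hat:
  assumes S: "finite S" "\<forall>x\<in>S. x < m"
    and X: "X = frag_extend g"
    and deriv: "\<And>x y. Poly_Mapping.keys x \<subseteq> words_below m \<Longrightarrow> Poly_Mapping.keys y \<subseteq> words_below m \<Longrightarrow>
       X (bar x y) = bar x (X y) + bar (X x) (perm.twist y)"
    and comm: "\<And>x. Poly_Mapping.keys x \<subseteq> words_below m \<Longrightarrow>
       perm.tbd (X x) = X (perm.tbd x) + (bar (frag_of e) (perm.twist x) - bar (perm.twist x) (frag_of e))"
    and e: "perm.tbd (frag_of e) = 0"
    and IH: "perm.tbd (D S) = splits S (\<lambda>M N. if M = {} \<or> N = {} then 0
       else frag_cmul ((-1) ^ card M * shuff M N) (bar (D M) (D N)))"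
  shows "perm.tbd (grow_hat X e D S) = splits S (\<lambda>P Q.
     (if P = {} then 0 else frag_cmul ((-1) ^ card P * shuff P Q) (bar (D P) (grow_hat X e D Q))) +
     (if Q = {} then 0 else frag_cmul ((-1) ^ Suc (card P + card Q) * shuff P Q) (bar (grow_hat X e D P) (D Q))))"
proof (cases "S = {}")
  case True
  then show ?thesis
    by (simp add: grow_hat_def e)
next
  case False
  let ?t = "\<lambda>M N. if M = {} \<or> N = {} then 0 else frag_cmul ((-1) ^ card M * shuff M N) (bar (D M) (D N))"
  have k: "card S = Suc (card S - 1)"
    using False S(1) by (simp add: card_gt_0_iff)
  have "perm.tbd (grow_hat X e D S) = X (splits S ?t) +
      (frag_cmul ((-1) ^ (card S - 1)) (bar (frag_of e) (D S)) - frag_cmul ((-1) ^ (card S - 1)) (bar (D S) (frag_of e)))"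
    using False D_words_below[OF S]
    by (simp add: grow_hat_def comm IH twist_D S(1) bar_product_cmul_left bar_product_cmul_right)
  \<comment> \<open>The end terms are rewritten as sums over splittings concentrated at
    \<open>Q = {}\<close> and at \<open>P = {}\<close>.\<close>
  also have "\<dots> = splits S (\<lambda>M N. X (?t M N)) +
      splits S (\<lambda>P Q. if Q = {} then frag_cmul ((-1) ^ card P) (bar (D P) (frag_of e)) else 0) +
      splits S (\<lambda>P Q. if P = {} then frag_cmul ((-1) ^ Suc (card Q)) (bar (frag_of e) (D Q)) else 0)"
    using S(1) unfolding X splits_frag_extend
    by (subst splits_delta_left, simp, subst splits_delta_right, simp, subst (3 4) k) simp
  also have "\<dots> = splits S (\<lambda>P Q. X (?t P Q) +
      (if Q = {} then frag_cmul ((-1) ^ card P) (bar (D P) (frag_of e)) else 0) +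
      (if P = {} then frag_cmul ((-1) ^ Suc (card Q)) (bar (frag_of e) (D Q)) else 0))"
    by (simp only: splits_add)
  also have "\<dots> = splits S (\<lambda>P Q.
     (if P = {} then 0 else frag_cmul ((-1) ^ card P * shuff P Q) (bar (D P) (grow_hat X e D Q))) +
     (if Q = {} then 0 else frag_cmul ((-1) ^ Suc (card P + card Q) * shuff P Q) (bar (grow_hat X e D P) (D Q))))"
  proof (rule splits_cong)
    fix P Q assume PQ: "P \<union> Q = S" "P \<inter> Q = {}"
    have fin: "finite P" "finite Q" "\<forall>x\<in>P. x < m" "\<forall>x\<in>Q. x < m"
      using PQ S by auto
    consider "P = {}" "Q \<noteq> {}" | "P \<noteq> {}" "Q = {}" | "P \<noteq> {}" "Q \<noteq> {}"
      using PQ False by auto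
    then show "X (?t P Q) +
      (if Q = {} then frag_cmul ((-1) ^ card P) (bar (D P) (frag_of e)) else 0) +
      (if P = {} then frag_cmul ((-1) ^ Suc (card Q)) (bar (frag_of e) (D Q)) else 0) =
     (if P = {} then 0 else frag_cmul ((-1) ^ card P * shuff P Q) (bar (D P) (grow_hat X e D Q))) +
     (if Q = {} then 0 else frag_cmul ((-1) ^ Suc (card P + card Q) * shuff P Q) (bar (grow_hat X e D P) (D Q)))"
    proof cases
      case 1
      then show ?thesis
        using fin by (simp add: X grow_hat_def)
    next
      case 2
      then show ?thesis
        using fin by (simp add: X grow_hat_def)
    next
      case 3
      have "(-1) ^ Suc (card P + card Q) * shuff P Q = (-1) ^ card P * shuff P Q * (-1) ^ (card Q - 1)"
        using 3 fin by (cases "card Q") (auto simp: power_add)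
      then have "frag_cmul ((-1) ^ Suc (card P + card Q) * shuff P Q) z =
          frag_cmul ((-1) ^ card P * shuff P Q * (-1) ^ (card Q - 1)) z" for z :: "nat set list \<times> nat set list \<Rightarrow>\<^sub>0 int"
        by (simp only:)
      moreover have "X (bar (D P) (D Q)) = bar (D P) (X (D Q)) + frag_cmul ((-1) ^ (card Q - 1)) (bar (X (D P)) (D Q))"
        using 3 fin by (simp add: deriv D_words_below twist_D bar_product_cmul_right)
      moreover have "X (frag_cmul c z) = frag_cmul c (X z)" for c z
        by (simp add: X frag_extend_cmul)
      ultimately show ?thesis
        using 3 by (simp add: grow_hat_def frag_cmul_distrib2 del: power_Suc)
    qed
  qed simp
  finally show ?thesis .
qed

lemma tbd_right_hat:
  assumes "finite S" "\<forall>x\<in>S. x < m"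
    and "perm.tbd (D S) = splits S (\<lambda>M N. if M = {} \<or> N = {} then 0
       else frag_cmul ((-1) ^ card M * shuff M N) (bar (D M) (D N)))"
  shows "perm.tbd (right_hat m D S) = splits S (\<lambda>P Q.
     (if P = {} then 0 else frag_cmul ((-1) ^ card P * shuff P Q) (bar (D P) (right_hat m D Q))) +
     (if Q = {} then 0 else frag_cmul ((-1) ^ Suc (card P + card Q) * shuff P Q) (bar (right_hat m D P) (D Q))))"
proof (rule tbd_hat[OF assms(1,2) _ _ _ _ assms(3)])
  show "grow_right m = frag_extend (\<lambda>(a, b). tensor (frag_of a) (grow m b))"
    by (rule ext) (simp add: grow_right_def)
  show "perm.tbd (frag_of ([], [{m}])) = 0"
    by (simp add: perm.tbd_frag_of block_boundary_splits splits_insert[of "{}"])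
qed (simp_all only: grow_right_bar tbd_grow_right)

lemma tbd_left_hat:
  assumes "finite S" "\<forall>x\<in>S. x < m"
    and "perm.tbd (D S) = splits S (\<lambda>M N. if M = {} \<or> N = {} then 0
       else frag_cmul ((-1) ^ card M * shuff M N) (bar (D M) (D N)))"
  shows "perm.tbd (left_hat m D S) = splits S (\<lambda>P Q.
     (if P = {} then 0 else frag_cmul ((-1) ^ card P * shuff P Q) (bar (D P) (left_hat m D Q))) +
     (if Q = {} then 0 else frag_cmul ((-1) ^ Suc (card P + card Q) * shuff P Q) (bar (left_hat m D P) (D Q))))"
proof (rule tbd_hat[OF assms(1,2) _ _ _ _ assms(3)])
  show "grow_left m = frag_extend (\<lambda>(a, b). frag_cmul ((-1) ^ part_dim b) (tensor (grow m a) (frag_of b)))"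
    by (rule ext) (simp add: grow_left_def)
  show "perm.tbd (frag_of ([{m}], [])) = 0"
    by (simp add: perm.tbd_frag_of block_boundary_splits splits_insert[of "{}"])
qed (simp_all only: grow_left_bar tbd_grow_left)

text \<open>The right-hand side is the multiplicative diagonal of the boundary of the cell
  \<open>S\<close>. Expanding the boundary of the recursion gives four families, according to the
  half that is split and the side on which the new factor appears.\<close>

theorem tbd_D:
  "finite S \<Longrightarrow> perm.tbd (D S) = splits S (\<lambda>M N. if M = {} \<or> N = {} then 0
     else frag_cmul ((-1) ^ card M * shuff M N) (bar (D M) (D N)))"
proof (induction S rule: finite_psubset_induct)
  case (psubset S')
  show ?case
  proof (cases "S' = {}")
    case True
    then show ?thesis
      by (simp add: D_empty perm.tbd_frag_of)
  next
    case False
    obtain m S where S: "S' = insert m S" "finite S" "\<forall>x\<in>S. x < m" "m \<notin> S"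
      using insert_Max_cases[OF psubset.hyps(1) False] .
    let ?R = "right_hat m D" and ?L = "left_hat m D"
    \<comment> \<open>In \<open>T1\<close> the new factor stands before both hatted factors, in
      \<open>T2\<close> between them and in \<open>T4\<close> after them. The remaining family, also
      with the factor in between but coming from the other half, is \<open>T2\<close> with the
      opposite sign.\<close>
    define T1 where "T1 P Q A = (if P = {} then 0 else
      frag_cmul (shuff (P \<union> Q) A * ((-1) ^ card P * shuff P Q)) (bar (D P) (bar (?R Q) (?L A))))" for P Q A
    define T2 where "T2 P Q A = (if Q = {} then 0 else
      frag_cmul (shuff (P \<union> Q) A * ((-1) ^ Suc (card P + card Q) * shuff P Q)) (bar (?R P) (bar (D Q) (?L A))))" for P Q A
    define T4 where "T4 B P Q = (if Q = {} then 0 else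
      frag_cmul (shuff B (P \<union> Q) * ((-1) ^ Suc (card P + card Q) * shuff P Q * (-1) ^ card B))
        (bar (?R B) (bar (?L P) (D Q))))" for B P Q
    have tw: "perm.twist (?R B) = frag_cmul ((-1) ^ card B) (?R B)" if "B \<subseteq> S" for B
    proof (rule perm.twist_homogeneous)
      fix a b assume "(a, b) \<in> Poly_Mapping.keys (?R B)"
      moreover have "finite B" "\<forall>x\<in>B. x < m"
        using that S finite_subset by auto
      ultimately show "part_dim a + part_dim b = card B"
        using right_hat_cells[of B m] D_cells[of B] by auto
    qed
    have "perm.tbd (D S') = splits S (\<lambda>B A. frag_cmul (shuff B A) (bar (perm.tbd (?R B)) (?L A)) +
        frag_cmul (shuff B A) (bar (perm.twist (?R B)) (perm.tbd (?L A))))"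
      unfolding S(1) D_insert[OF S(2,3)] splits_tbd
      by (simp add: perm.tbd_cmul perm.tbd_bar frag_cmul_distrib2)
    also have "\<dots> = splits S (\<lambda>B A. splits B (\<lambda>P Q. T1 P Q A) + splits B (\<lambda>P Q. T2 P Q A) +
        (splits A (\<lambda>P Q. - T2 B P Q) + splits A (\<lambda>P Q. T4 B P Q)))"
    proof (rule splits_cong)
      fix B A assume BA: "B \<union> A = S" "B \<inter> A = {}"
      have fin: "finite B" "finite A" "\<forall>x\<in>B. x < m" "\<forall>x\<in>A. x < m" "B \<subset> S'" "A \<subset> S'" "B \<subseteq> S"
        using S BA by auto
      have 1: "frag_cmul (shuff B A) (bar (perm.tbd (?R B)) (?L A)) =
          splits B (\<lambda>P Q. T1 P Q A + T2 P Q A)"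
        unfolding tbd_right_hat[OF fin(1,3) psubset.IH[OF fin(5)]] splits_bar_left splits_frag_cmul
        by (rule splits_cong)
          (auto simp: T1_def T2_def bar_product_add_left bar_product_cmul_left frag_cmul_distrib2 perm.bar_assoc)
      have 2: "frag_cmul (shuff B A) (bar (perm.twist (?R B)) (perm.tbd (?L A))) =
          splits A (\<lambda>P Q. - T2 B P Q + T4 B P Q)"
        unfolding tbd_left_hat[OF fin(2,4) psubset.IH[OF fin(6)]] tw[OF fin(7)] splits_bar_right splits_frag_cmul
      proof (rule splits_cong)
        fix P Q assume PQ: "P \<union> Q = A" "P \<inter> Q = {}"
        \<comment> \<open>Moving the cut across \<open>P\<close> does not change the product of
          shuffle signs; the exponents of the two families differ by one, and hence they
          cancel.\<close>
        have "shuff (B \<union> P) Q * shuff B P = shuff B A * shuff P Q"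
          using shuff_assoc[of B P Q] PQ BA fin by auto
        then have "shuff B A * ((-1) ^ card P * shuff P Q * (-1) ^ card B) =
            - (shuff (B \<union> P) Q * ((-1) ^ Suc (card B + card P) * shuff B P))"
          by (auto simp: power_add algebra_simps)
        then have s: "frag_cmul (shuff B A * ((-1) ^ card P * shuff P Q * (-1) ^ card B)) z =
            frag_cmul (- (shuff (B \<union> P) Q * ((-1) ^ Suc (card B + card P) * shuff B P))) z"
          for z :: "nat set list \<times> nat set list \<Rightarrow>\<^sub>0 int"
          by (simp only:)
        show "frag_cmul (shuff B A) (bar (frag_cmul ((-1) ^ card B) (?R B))
           ((if P = {} then 0 else frag_cmul ((-1) ^ card P * shuff P Q) (bar (D P) (?L Q))) +
            (if Q = {} then 0 else frag_cmul ((-1) ^ Suc (card P + card Q) * shuff P Q) (bar (?L P) (D Q))))) =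
           - T2 B P Q + T4 B P Q"
          using PQ(1) s
          by (cases "P = {}"; cases "Q = {}")
            (simp_all add: T2_def T4_def bar_product_add_right bar_product_cmul_left bar_product_cmul_right
              frag_cmul_distrib2 del: power_Suc)
      qed simp
      show "frag_cmul (shuff B A) (bar (perm.tbd (?R B)) (?L A)) +
        frag_cmul (shuff B A) (bar (perm.twist (?R B)) (perm.tbd (?L A))) =
        splits B (\<lambda>P Q. T1 P Q A) + splits B (\<lambda>P Q. T2 P Q A) +
        (splits A (\<lambda>P Q. - T2 B P Q) + splits A (\<lambda>P Q. T4 B P Q))"
        unfolding 1 2 splits_add ..
    qed simp
    also have "\<dots> = splits S (\<lambda>B A. splits B (\<lambda>P Q. T1 P Q A)) + splits S (\<lambda>B A. splits A (\<lambda>P Q. T4 B P Q))"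
    proof -
      have "splits S (\<lambda>B A. splits A (\<lambda>P Q. - T2 B P Q)) = - splits S (\<lambda>B A. splits B (\<lambda>P Q. T2 P Q A))"
        unfolding splits_assoc[OF S(2)] by (simp add: splits_def sum_negf)
      then show ?thesis
        by (simp add: splits_add)
    qed
    also have "\<dots> = splits S (\<lambda>M N. splits N (\<lambda>Q A. T1 M Q A)) + splits S (\<lambda>M N. splits M (\<lambda>B P. T4 B P N))"
      using splits_assoc[OF S(2), of T1] splits_assoc[OF S(2), of T4] by simp
    also have "\<dots> = splits S' (\<lambda>M N. if M = {} \<or> N = {} then 0
     else frag_cmul ((-1) ^ card M * shuff M N) (bar (D M) (D N)))"
      \<comment> \<open>In a splitting of \<open>S'\<close> the element \<open>m\<close> is in the
        second half, which is matched with \<open>T1\<close>, or in the first, which is matched with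
        \<open>T4\<close>. In both cases the recursion for the half containing \<open>m\<close> is
        read backwards.\<close>
      unfolding S(1) splits_insert[OF S(2,4)]
    proof (intro arg_cong2[where f = "(+)"] splits_cong refl)
      fix M N assume MN: "M \<union> N = S" "M \<inter> N = {}"
      have fin: "finite M" "finite N" "\<forall>x\<in>M. x < m" "\<forall>x\<in>N. x < m" "m \<notin> M"
        using S MN by auto
      have shN: "shuff M (insert m N) = shuff M N" and shM: "shuff (insert m M) N = (-1) ^ card N * shuff M N"
        using shuff_insert_right[of M N m] shuff_insert_left[of M N m] MN fin by auto
      show "splits N (\<lambda>Q A. T1 M Q A) = (if M = {} \<or> insert m N = {} then 0
          else frag_cmul ((-1) ^ card M * shuff M (insert m N)) (bar (D M) (D (insert m N))))"
      proof (cases "M = {}")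
        case False
        have "splits N (\<lambda>Q A. T1 M Q A) = splits N (\<lambda>Q A.
           frag_cmul ((-1) ^ card M * shuff M N) (bar (D M) (frag_cmul (shuff Q A) (bar (?R Q) (?L A)))))"
        proof (rule splits_cong)
          fix Q A assume QA: "Q \<union> A = N" "Q \<inter> A = {}"
          have "shuff (M \<union> Q) A * shuff M Q = shuff M N * shuff Q A"
            using shuff_assoc[of M Q A] QA MN fin by auto
          then have "shuff (M \<union> Q) A * ((-1) ^ card M * shuff M Q) = (-1) ^ card M * shuff M N * shuff Q A"
            by (simp add: algebra_simps)
          then have "frag_cmul (shuff (M \<union> Q) A * ((-1) ^ card M * shuff M Q)) z =
              frag_cmul ((-1) ^ card M * shuff M N * shuff Q A) z" for z :: "nat set list \<times> nat set list \<Rightarrow>\<^sub>0 int"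
            by (simp only:)
          then show "T1 M Q A =
              frag_cmul ((-1) ^ card M * shuff M N) (bar (D M) (frag_cmul (shuff Q A) (bar (?R Q) (?L A))))"
            using False by (simp add: T1_def bar_product_cmul_right)
        qed simp
        then show ?thesis
          using False by (simp add: shN D_insert[OF fin(2,4)] splits_bar_right splits_frag_cmul)
      qed (simp add: T1_def splits_def)
      show "splits M (\<lambda>B P. T4 B P N) = (if insert m M = {} \<or> N = {} then 0
          else frag_cmul ((-1) ^ card (insert m M) * shuff (insert m M) N) (bar (D (insert m M)) (D N)))"
      proof (cases "N = {}")
        case False
        have "splits M (\<lambda>B P. T4 B P N) = splits M (\<lambda>B P.
           frag_cmul ((-1) ^ card (insert m M) * shuff (insert m M) N) (bar (frag_cmul (shuff B P) (bar (?R B) (?L P))) (D N)))"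
        proof (rule splits_cong)
          fix B P assume BP: "B \<union> P = M" "B \<inter> P = {}"
          have "shuff M N * shuff B P = shuff B (P \<union> N) * shuff P N"
            using shuff_assoc[of B P N] BP MN fin by auto
          moreover have "card M = card B + card P"
            using BP fin by (metis card_Un_disjoint finite_Un)
          ultimately have "shuff B (P \<union> N) * ((-1) ^ Suc (card P + card N) * shuff P N * (-1) ^ card B) =
              (-1) ^ card (insert m M) * shuff (insert m M) N * shuff B P"
            using fin by (simp add: shM power_add algebra_simps)
          then have "frag_cmul (shuff B (P \<union> N) * ((-1) ^ Suc (card P + card N) * shuff P N * (-1) ^ card B)) z =
              frag_cmul ((-1) ^ card (insert m M) * shuff (insert m M) N * shuff B P) z"
            for z :: "nat set list \<times> nat set list \<Rightarrow>\<^sub>0 int"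
            by (simp only:)
          then show "T4 B P N =
              frag_cmul ((-1) ^ card (insert m M) * shuff (insert m M) N) (bar (frag_cmul (shuff B P) (bar (?R B) (?L P))) (D N))"
            using False by (simp add: T4_def bar_product_cmul_left perm.bar_assoc del: power_Suc)
        qed simp
        then show ?thesis
          using False by (simp add: D_insert[OF fin(1,3)] splits_bar_left splits_frag_cmul)
      qed (simp add: T4_def splits_def)
    qed
    finally show ?thesis .
  qed
qed

end

subsection \<open>Runs of words and shifts\<close>

text \<open>Runs are recorded as sets because they become the column sets of a step matrix; those of
  the reversed word become its row sets.\<close>

fun druns :: "nat list \<Rightarrow> nat set list" where
  "druns [] = []"
| "druns [x] = [{x}]"
| "druns (x # y # w) = (if y < x then insert x (hd (druns (y # w))) # tl (druns (y # w))
     else {x} # druns (y # w))"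

lemma druns_eq_Nil [simp]: "druns w = [] \<longleftrightarrow> w = []"
  by (induction w rule: druns.induct) auto

lemma druns_append:
  "u \<noteq> [] \<Longrightarrow> v \<noteq> [] \<Longrightarrow> last u < hd v \<Longrightarrow> druns (u @ v) = druns u @ druns v"
proof (induction u rule: druns.induct)
  case (2 x)
  then show ?case
    by (cases v) auto
next
  case (3 x y w)
  then have "druns (y # w @ v) = druns (y # w) @ druns v"
    by (cases "y < x") auto
  moreover have "druns (y # w) \<noteq> []"
    by simp
  ultimately show ?case
    by (simp add: hd_append tl_append split: list.split)
qed simp

text \<open>On the empty list the block \<open>{m}\<close> is created, in accordance with the hat
  convention of the recursion. Positions thus range over \<open>max 1 (length u)\<close> in all
  cases.\<close>

definition ins :: "nat \<Rightarrow> nat \<Rightarrow> nat set list \<Rightarrow> nat set list" where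
  "ins m k u = (if u = [] then [{m}] else u[k := insert m (u ! k)])"

lemma length_ins: "length (ins m k u) = max 1 (length u)"
  by (auto simp: ins_def max_def not_less_eq_eq Suc_le_eq)

lemma druns_Cons_max:
  assumes "\<forall>x\<in>set w. x < m"
  shows "druns (m # w) = ins m 0 (druns w)"
proof (cases w)
  case (Cons y v)
  then have "druns w \<noteq> []"
    by simp
  with Cons assms show ?thesis
    by (cases "druns w") (auto simp: ins_def)
qed (simp add: ins_def)

text \<open>The maximum is preceded by an ascent and followed by a descent: it opens a run and joins
  the first run of \<open>v\<close>.\<close>

lemma druns_max:
  assumes "\<forall>x\<in>set (u @ v). x < m"
  shows "druns (u @ m # v) = druns u @ ins m 0 (druns v)"
proof (cases "u = []")
  case False
  then have "last u < m"
    using assms by simp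
  with False show ?thesis
    using druns_append[of u "m # v"] druns_Cons_max[of v m] assms by simp
qed (use assms in \<open>simp add: druns_Cons_max\<close>)

lemma Union_druns: "\<Union>(set (druns w)) = set w"
proof (induction w rule: druns.induct)
  case (3 x y w)
  obtain h t where D: "druns (y # w) = h # t"
    by (cases "druns (y # w)") (auto simp: druns_eq_Nil[of "y # w", simplified])
  then have "h \<union> \<Union>(set t) = insert y (set w)"
    using 3 by (cases "y < x") simp_all
  then show ?case
    by (cases "y < x") (simp_all add: D insert_commute)
qed auto

lemma druns_nonempty: "U \<in> set (druns w) \<Longrightarrow> U \<noteq> {} \<and> finite U"
proof (induction w arbitrary: U rule: druns.induct)
  case (3 x y w)
  have "druns (y # w) \<noteq> []"
    by simp
  then have "hd (druns (y # w)) \<in> set (druns (y # w))" "set (tl (druns (y # w))) \<subseteq> set (druns (y # w))"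
    by (rule hd_in_set) (auto dest: list.set_sel(2)[rotated])
  with 3 show ?case
    by (auto split: if_splits)
qed auto

text \<open>
  \<open>I\<close> is the set moved into the first block. Properness of the moved sets is automatic for
  descending runs, since the minimum of a run is smaller than the maximum of the next one.
\<close>

fun shifts :: "nat set \<Rightarrow> nat set list \<Rightarrow> nat set list set" where
  "shifts I [] = {[]}"
| "shifts I [A] = {[A \<union> I]}"
| "shifts I (A # B # As) = {(A \<union> I - M) # \<sigma> | M \<sigma>.
     M \<subseteq> A \<union> I \<and> (\<forall>x\<in>M. Max B < x) \<and> \<sigma> \<in> shifts M (B # As)}"

lemma length_shifts: "\<sigma> \<in> shifts I A \<Longrightarrow> length \<sigma> = length A"
  by (induction I A arbitrary: \<sigma> rule: shifts.induct) auto

lemma shifts_insert_front: "shifts I (insert m A # As) = shifts (insert m I) (A # As)"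
  by (cases As) auto

text \<open>The bounds never stop \<open>m\<close>, which exceeds every entry of the blocks, and the
  bounds for the other elements do not change. The one new datum is the block \<open>k\<close> at
  which \<open>m\<close> comes to rest.\<close>

lemma shifts_insert:
  assumes "A \<noteq> []" "\<forall>U\<in>set A. finite U \<and> U \<noteq> {} \<and> (\<forall>x\<in>U. x < m)" "m \<notin> I"
  shows "shifts (insert m I) A = {ins m k \<tau> | k \<tau>. \<tau> \<in> shifts I A \<and> k < length A}"
  using assms
proof (induction I A rule: shifts.induct)
  case (3 I A B As)
  have m: "m \<notin> A" "Max B < m"
    using 3(3) by auto
  have IH: "shifts (insert m M) (B # As) = {ins m k \<tau> | k \<tau>. \<tau> \<in> shifts M (B # As) \<and> k < length (B # As)}"
    if "m \<notin> M" for M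
    using 3(1)[of M] 3(3) that by auto
  show ?case
  proof (intro equalityI subsetI)
    fix \<sigma> assume "\<sigma> \<in> shifts (insert m I) (A # B # As)"
    then obtain M \<rho> where s: "\<sigma> = (A \<union> insert m I - M) # \<rho>" "M \<subseteq> A \<union> insert m I" "\<forall>x\<in>M. Max B < x"
      "\<rho> \<in> shifts M (B # As)"
      by auto
    show "\<sigma> \<in> {ins m k \<tau> | k \<tau>. \<tau> \<in> shifts I (A # B # As) \<and> k < length (A # B # As)}"
    proof (cases "m \<in> M")
      case True
      have M: "insert m (M - {m}) = M"
        using True by auto
      obtain k \<tau> where k: "\<rho> = ins m k \<tau>" "\<tau> \<in> shifts (M - {m}) (B # As)" "k < length (B # As)"
        using IH[of "M - {m}"] s(4) unfolding M by auto
      have "\<sigma> = ins m (Suc k) ((A \<union> I - (M - {m})) # \<tau>)"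
        using s(1) k length_shifts[OF k(2)] True 3(4) m(1) by (auto simp: ins_def)
      moreover have "(A \<union> I - (M - {m})) # \<tau> \<in> shifts I (A # B # As)"
        using s k by auto
      ultimately show ?thesis
        using k(3) by (intro CollectI exI[of _ "Suc k"] exI[of _ "(A \<union> I - (M - {m})) # \<tau>"]) auto
    next
      case False
      have "\<sigma> = ins m 0 ((A \<union> I - M) # \<rho>)"
        using s(1) False by (auto simp: ins_def)
      moreover have "(A \<union> I - M) # \<rho> \<in> shifts I (A # B # As)"
        using s False by auto
      ultimately show ?thesis
        by (intro CollectI exI[of _ 0] exI[of _ "(A \<union> I - M) # \<rho>"]) auto
    qed
  next
    fix \<sigma> assume "\<sigma> \<in> {ins m k \<tau> | k \<tau>. \<tau> \<in> shifts I (A # B # As) \<and> k < length (A # B # As)}"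
    then obtain k M \<rho> where k: "\<sigma> = ins m k ((A \<union> I - M) # \<rho>)" "k < length (A # B # As)"
      "M \<subseteq> A \<union> I" "\<forall>x\<in>M. Max B < x" "\<rho> \<in> shifts M (B # As)"
      by auto
    have M: "m \<notin> M"
      using k(3) 3(4) m(1) by auto
    show "\<sigma> \<in> shifts (insert m I) (A # B # As)"
    proof (cases k)
      case 0
      then have "\<sigma> = (A \<union> insert m I - M) # \<rho>"
        using k(1) M by (auto simp: ins_def)
      then show ?thesis
        using k by auto
    next
      case (Suc j)
      have "\<rho> \<noteq> []"
        using length_shifts[OF k(5)] by auto
      then have "\<sigma> = (A \<union> I - M) # ins m j \<rho>"
        using k(1) Suc by (simp add: ins_def)
      also have "A \<union> I - M = A \<union> insert m I - insert m M"
        using 3(4) m(1) by auto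
      finally have "\<sigma> = (A \<union> insert m I - insert m M) # ins m j \<rho>" .
      moreover have "ins m j \<rho> \<in> shifts (insert m M) (B # As)"
        unfolding IH[OF M] using k(2,5) Suc by auto
      moreover have "insert m M \<subseteq> A \<union> insert m I" "\<forall>x\<in>insert m M. Max B < x"
        using k(3,4) m(2) by auto
      ultimately show ?thesis
        unfolding shifts.simps by blast
    qed
  qed
qed (auto simp: ins_def)

text \<open>No element to the left exceeds \<open>Max C\<close>, so nothing moves into
  \<open>C\<close>. The block is a barrier, and the two sides are shifted independently.\<close>

lemma shifts_append:
  assumes "As \<noteq> []" "\<forall>x\<in>I \<union> \<Union>(set As). x < Max C"
  shows "shifts I (As @ C # Cs) = {\<sigma> @ \<tau> | \<sigma> \<tau>. \<sigma> \<in> shifts I As \<and> \<tau> \<in> shifts {} (C # Cs)}"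
  using assms
proof (induction I As rule: shifts.induct)
  case (2 I A)
  have M: "M = {}" if "M \<subseteq> A \<union> I" "\<forall>x\<in>M. Max C < x" for M
  proof (rule ccontr)
    assume "M \<noteq> {}"
    then obtain x where "x \<in> M"
      by blast
    then have "Max C < x" "x < Max C"
      using 2(2) that by auto
    then show False
      by simp
  qed
  show ?case
  proof (intro equalityI subsetI)
    fix \<sigma> assume "\<sigma> \<in> shifts I ([A] @ C # Cs)"
    then obtain M \<tau> where *: "\<sigma> = (A \<union> I - M) # \<tau>" "M \<subseteq> A \<union> I" "\<forall>x\<in>M. Max C < x" "\<tau> \<in> shifts M (C # Cs)"
      by auto
    with M[OF *(2,3)] show "\<sigma> \<in> {\<sigma> @ \<tau> | \<sigma> \<tau>. \<sigma> \<in> shifts I [A] \<and> \<tau> \<in> shifts {} (C # Cs)}"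
      by simp
  next
    fix \<sigma> assume "\<sigma> \<in> {\<sigma> @ \<tau> | \<sigma> \<tau>. \<sigma> \<in> shifts I [A] \<and> \<tau> \<in> shifts {} (C # Cs)}"
    then obtain \<tau> where "\<sigma> = (A \<union> I - {}) # \<tau>" "\<tau> \<in> shifts {} (C # Cs)"
      by auto
    then show "\<sigma> \<in> shifts I ([A] @ C # Cs)"
      unfolding append.simps shifts.simps by blast
  qed
next
  case (3 I A B As)
  have IH: "shifts M (B # As @ C # Cs) = {\<sigma> @ \<tau> | \<sigma> \<tau>. \<sigma> \<in> shifts M (B # As) \<and> \<tau> \<in> shifts {} (C # Cs)}"
    if "M \<subseteq> A \<union> I" "\<forall>x\<in>M. Max B < x" for M
  proof -
    have "\<forall>x\<in>M \<union> \<Union>(set (B # As)). x < Max C"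
      using 3(3) that(1) by auto
    then show ?thesis
      using 3(1)[of M] by simp
  qed
  show ?case
  proof (intro equalityI subsetI)
    fix \<sigma> assume "\<sigma> \<in> shifts I ((A # B # As) @ C # Cs)"
    then obtain M \<rho> where s: "\<sigma> = (A \<union> I - M) # \<rho>" "M \<subseteq> A \<union> I" "\<forall>x\<in>M. Max B < x"
      "\<rho> \<in> shifts M (B # As @ C # Cs)"
      by auto
    then obtain \<rho>' \<tau> where "\<rho> = \<rho>' @ \<tau>" "\<rho>' \<in> shifts M (B # As)" "\<tau> \<in> shifts {} (C # Cs)"
      using IH[of M] by auto
    then have "\<sigma> = ((A \<union> I - M) # \<rho>') @ \<tau>" "(A \<union> I - M) # \<rho>' \<in> shifts I (A # B # As)" "\<tau> \<in> shifts {} (C # Cs)"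
      using s by auto
    then show "\<sigma> \<in> {\<sigma> @ \<tau> | \<sigma> \<tau>. \<sigma> \<in> shifts I (A # B # As) \<and> \<tau> \<in> shifts {} (C # Cs)}"
      by blast
  next
    fix \<sigma> assume "\<sigma> \<in> {\<sigma> @ \<tau> | \<sigma> \<tau>. \<sigma> \<in> shifts I (A # B # As) \<and> \<tau> \<in> shifts {} (C # Cs)}"
    then obtain M \<rho> \<tau> where s: "\<sigma> = ((A \<union> I - M) # \<rho>) @ \<tau>" "M \<subseteq> A \<union> I" "\<forall>x\<in>M. Max B < x"
      "\<rho> \<in> shifts M (B # As)" "\<tau> \<in> shifts {} (C # Cs)"
      by auto
    then have "\<rho> @ \<tau> \<in> shifts M (B # As @ C # Cs)"
      using IH[of M] by auto
    with s show "\<sigma> \<in> shifts I ((A # B # As) @ C # Cs)"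
      by auto
  qed
qed simp

section \<open>Shifted run partitions of a word\<close>

abbreviation Sh :: "nat list \<Rightarrow> nat set list set" where
  "Sh w \<equiv> shifts {} (druns w)"

lemma Sh_Nil [simp]: "Sh [] = {[]}"
  by simp

text \<open>The run opened by \<open>m\<close> has maximum \<open>m\<close> and is a barrier for the
  letters of \<open>u\<close>. Within the runs of \<open>v\<close> the element \<open>m\<close>
  starts in the first and may rest in any of them.\<close>

lemma Sh_max:
  assumes "\<forall>x\<in>set (u @ v). x < m"
  shows "Sh (u @ m # v) = {\<sigma> @ ins m k \<tau> | \<sigma> k \<tau>. \<sigma> \<in> Sh u \<and> \<tau> \<in> Sh v \<and> k < max 1 (length (druns v))}"
proof -
  have v: "shifts {} (ins m 0 (druns v)) = {ins m k \<tau> | k \<tau>. \<tau> \<in> Sh v \<and> k < max 1 (length (druns v))}"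
  proof (cases "druns v")
    case Nil
    then show ?thesis
      by (auto simp: ins_def)
  next
    case (Cons V vs)
    have "finite U \<and> U \<noteq> {} \<and> (\<forall>x\<in>U. x < m)" if "U \<in> set (V # vs)" for U
    proof -
      have U: "U \<in> set (druns v)"
        using that Cons by simp
      then have "U \<subseteq> set v"
        using Union_druns[of v] by blast
      then show ?thesis
        using druns_nonempty[OF U] assms by auto
    qed
    then have "shifts (insert m {}) (V # vs) = {ins m k \<tau> | k \<tau>. \<tau> \<in> shifts {} (V # vs) \<and> k < length (V # vs)}"
      by (intro shifts_insert) auto
    moreover have "max 1 (length (V # vs)) = length (V # vs)"
      by simp
    ultimately show ?thesis
      by (simp add: Cons ins_def shifts_insert_front)
  qed
  show ?thesis
  proof (cases "u = []")
    case True
    then show ?thesis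
      using assms by (simp add: druns_Cons_max v)
  next
    case False
    obtain C Cs where C: "ins m 0 (druns v) = C # Cs" "m \<in> C" "finite C" "\<forall>x\<in>C. x \<le> m"
    proof (cases "druns v")
      case Nil
      then show ?thesis
        using that by (simp add: ins_def)
    next
      case (Cons V vs)
      then have V: "finite V" "V \<subseteq> set v"
        using druns_nonempty[of V v] Union_druns[of v] by auto
      show ?thesis
      proof (rule that[of "insert m V" vs])
        show "ins m 0 (druns v) = insert m V # vs"
          by (simp add: ins_def Cons)
        have "x < m" if "x \<in> V" for x
          using V(2) assms that by auto
        then show "\<forall>x\<in>insert m V. x \<le> m"
          by (auto intro: less_imp_le)
      qed (use V in auto)
    qed
    then have "Max C = m"
      by (intro Max_eqI) auto
    then have "shifts {} (druns u @ C # Cs) = {\<sigma> @ \<tau> | \<sigma> \<tau>. \<sigma> \<in> Sh u \<and> \<tau> \<in> shifts {} (C # Cs)}"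
      using assms False by (intro shifts_append) (auto simp: Union_druns)
    then show ?thesis
      using v by (auto simp: druns_max[OF assms] C(1))
  qed
qed

text \<open>Cutting a word at its maximum is the word version of the recursion; the main facts about
  shifted runs are proved along it.\<close>

lemma word_max_induct [consumes 1, case_names Nil max]:
  fixes w :: "nat list"
  assumes "distinct w"
    and "P []"
    and "\<And>u m v. \<forall>x\<in>set (u @ v). x < m \<Longrightarrow> distinct (u @ v) \<Longrightarrow> P u \<Longrightarrow> P v \<Longrightarrow> P (u @ m # v)"
  shows "P w"
  using assms(1)
proof (induction w rule: length_induct)
  case (1 w)
  show ?case
  proof (cases "w = []")
    case False
    then have "Max (set w) \<in> set w"
      by simp
    then obtain u v where w: "w = u @ Max (set w) # v"
      by (meson split_list)
    define m where "m = Max (set w)"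
    have w': "w = u @ m # v"
      using w m_def by simp
    have "x < m" if "x \<in> set (u @ v)" for x
    proof -
      have "x \<le> m"
        unfolding m_def using that w' by (intro Max_ge) auto
      moreover have "x \<noteq> m"
        using 1(2) that w' by auto
      ultimately show ?thesis
        by simp
    qed
    then show ?thesis
      unfolding w' using 1 w' by (intro assms(3)) auto
  qed (use assms(2) in simp)
qed

lemma ins_ordered_partitions:
  assumes "u \<in> ordered_partitions S" "m \<notin> S" "k < max 1 (length u)"
  shows "ins m k u \<in> ordered_partitions (insert m S)"
proof (cases "u = []")
  case False
  then have k: "k < length u"
    using assms(3) by (cases u) auto
  then have "u = take k u @ u ! k # drop (Suc k) u"
    by (simp add: Cons_nth_drop_Suc)
  then show ?thesis
    using ordered_partitions_insert[of "take k u" "u ! k" "drop (Suc k) u" S m] assms k False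
    by (simp add: ins_def upd_conv_take_nth_drop)
qed (use assms in \<open>auto simp: ins_def\<close>)

lemma Sh_ordered_partitions: "distinct w \<Longrightarrow> Sh w \<subseteq> ordered_partitions (set w)"
proof (induction w rule: word_max_induct)
  case (max u m v)
  show ?case
    unfolding Sh_max[OF max(1)]
  proof safe
    fix \<sigma> k \<tau> assume *: "\<sigma> \<in> Sh u" "\<tau> \<in> Sh v" "k < max 1 (length (druns v))"
    have "ins m k \<tau> \<in> ordered_partitions (insert m (set v))"
      using max * length_shifts[OF *(2)] by (intro ins_ordered_partitions) auto
    moreover have "\<sigma> \<in> ordered_partitions (set u)"
      using max * by auto
    moreover have "insert m (set v) \<inter> set u = {}"
      using max(1,2) by auto
    ultimately show "\<sigma> @ ins m k \<tau> \<in> ordered_partitions (set (u @ m # v))"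
      using ordered_partitions_append[of \<sigma> "set u" "ins m k \<tau>" "insert m (set v)"] by (simp add: Un_insert_right)
  qed
qed simp

lemma finite_Sh: "distinct w \<Longrightarrow> finite (Sh w)"
proof (induction w rule: word_max_induct)
  case (max u m v)
  have "Sh (u @ m # v) \<subseteq> (\<lambda>(\<sigma>, k, \<tau>). \<sigma> @ ins m k \<tau>) ` (Sh u \<times> {..<max 1 (length (druns v))} \<times> Sh v)"
    unfolding Sh_max[OF max(1)] by force
  then show ?case
    using max by (meson finite_SigmaI finite_imageI finite_lessThan finite_subset)
qed simp

text \<open>Descending runs are separated by ascents and ascending runs by descents, and every pair
  of adjacent letters is one or the other. For step matrices this is the relation between
  \<open>p + q\<close> and the number of entries.\<close>

lemma length_druns_rev:
  "distinct w \<Longrightarrow> w \<noteq> [] \<Longrightarrow> length (druns w) + length (druns (rev w)) = length w + 1"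
proof (induction w rule: word_max_induct)
  case (max u m v)
  have "druns (rev (u @ m # v)) = druns (rev v) @ ins m 0 (druns (rev u))"
    using druns_max[of "rev v" "rev u" m] max(1) by auto
  moreover have "length (ins m 0 (druns x)) = (if x = [] then 1 else length (druns x))" for x
    by (cases "druns x") (auto simp: length_ins simp flip: druns_eq_Nil)
  ultimately show ?case
    using max druns_max[of u v m] by auto
qed simp

lemma ins_inject:
  assumes "ins m k u = ins m l v" "m \<notin> \<Union>(set u)" "m \<notin> \<Union>(set v)"
    "k < max 1 (length u)" "l < max 1 (length v)" "length u = length v"
  shows "u = v \<and> k = l"
proof (cases "u = []")
  case False
  have m: "m \<notin> u ! i" "m \<notin> v ! i" if "i < length u" for i
    using assms(2,3,6) that nth_mem[of i u] nth_mem[of i v] by auto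
  have eq: "u[k := insert m (u ! k)] = v[l := insert m (v ! l)]" and kl: "k < length u" "l < length u"
    using assms False by (auto simp: ins_def max_def split: if_splits)
  have "k = l"
  proof (rule ccontr)
    assume "k \<noteq> l"
    have "u[k := insert m (u ! k)] ! k = insert m (u ! k)"
      using kl by simp
    moreover have "v[l := insert m (v ! l)] ! k = v ! k"
      using \<open>k \<noteq> l\<close> by simp
    ultimately show False
      using eq m[OF kl(1)] by auto
  qed
  moreover have "u ! i = v ! i" if "i < length u" for i
  proof -
    have "u[k := insert m (u ! k)] ! i - {m} = v[l := insert m (v ! l)] ! i - {m}"
      using eq by simp
    then show ?thesis
      using m[OF that] that \<open>k = l\<close> assms(6) by (cases "i = k") auto
  qed
  ultimately show ?thesis
    using assms(6) by (simp add: list_eq_iff_nth_eq)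
qed (use assms in auto)

text \<open>The number of blocks of \<open>\<sigma>\<close> is fixed by \<open>u\<close>, so the
  concatenation can be cut again, and \<open>m\<close> marks the block \<open>k\<close>. Hence the
  parametrization in \<open>Sh_max\<close> is injective.\<close>

lemma sum_Sh_max:
  assumes m: "\<forall>x\<in>set (u @ v). x < m" and d: "distinct (u @ v)"
  shows "(\<Sum>\<sigma>\<in>Sh (u @ m # v). f \<sigma>) =
    (\<Sum>\<sigma>\<in>Sh u. \<Sum>\<tau>\<in>Sh v. \<Sum>k<max 1 (length \<tau>). f (\<sigma> @ ins m k \<tau>) :: 'a::comm_monoid_add)"
proof -
  let ?K = "{..<max 1 (length (druns v))}"
  have inj: "inj_on (\<lambda>(\<sigma>, \<tau>, k). \<sigma> @ ins m k \<tau>) (Sh u \<times> Sh v \<times> ?K)"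
  proof (rule inj_onI)
    fix x y
    assume "x \<in> Sh u \<times> Sh v \<times> ?K" "y \<in> Sh u \<times> Sh v \<times> ?K"
      and "(\<lambda>(\<sigma>, \<tau>, k). \<sigma> @ ins m k \<tau>) x = (\<lambda>(\<sigma>, \<tau>, k). \<sigma> @ ins m k \<tau>) y"
    then obtain \<sigma> \<tau> k \<sigma>' \<tau>' k' where xy: "x = (\<sigma>, \<tau>, k)" "y = (\<sigma>', \<tau>', k')"
      and *: "\<sigma> \<in> Sh u" "\<tau> \<in> Sh v" "k < max 1 (length (druns v))" "\<sigma>' \<in> Sh u" "\<tau>' \<in> Sh v"
      "k' < max 1 (length (druns v))" and eq: "\<sigma> @ ins m k \<tau> = \<sigma>' @ ins m k' \<tau>'"
      by auto
    have len: "length \<sigma> = length \<sigma>'" "length \<tau> = length (druns v)" "length \<tau>' = length (druns v)"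
      using * length_shifts by auto
    have "\<Union>(set \<tau>) = set v" "\<Union>(set \<tau>') = set v"
      using subsetD[OF Sh_ordered_partitions[of v]] *(2,5) d by (simp_all add: ordered_partitions_iff)
    moreover have "m \<notin> set v"
      using m by auto
    ultimately have mm: "m \<notin> \<Union>(set \<tau>)" "m \<notin> \<Union>(set \<tau>')"
      by simp_all
    have k: "k < max 1 (length \<tau>)" "k' < max 1 (length \<tau>')"
      unfolding len using *(3,6) .
    have "\<sigma> = \<sigma>'" and e: "ins m k \<tau> = ins m k' \<tau>'"
      using eq len(1) by simp_all
    then show "x = y"
      using ins_inject[OF e mm k] len xy by simp
  qed
  have "Sh (u @ m # v) = (\<lambda>(\<sigma>, \<tau>, k). \<sigma> @ ins m k \<tau>) ` (Sh u \<times> Sh v \<times> ?K)"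
    unfolding Sh_max[OF m] by force
  then have "(\<Sum>\<sigma>\<in>Sh (u @ m # v). f \<sigma>) = (\<Sum>(\<sigma>, \<tau>, k)\<in>Sh u \<times> Sh v \<times> ?K. f (\<sigma> @ ins m k \<tau>))"
    using sum.reindex[OF inj, of f] by (simp add: case_prod_unfold)
  also have "\<dots> = (\<Sum>\<sigma>\<in>Sh u. \<Sum>\<tau>\<in>Sh v. \<Sum>k\<in>?K. f (\<sigma> @ ins m k \<tau>))"
    by (simp add: sum.cartesian_product)
  also have "\<dots> = (\<Sum>\<sigma>\<in>Sh u. \<Sum>\<tau>\<in>Sh v. \<Sum>k<max 1 (length \<tau>). f (\<sigma> @ ins m k \<tau>))"
    by (intro sum.cong refl) (simp add: length_shifts)
  finally show ?thesis .
qed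

subsection \<open>The sign recursion\<close>

lemma ordered_partitions_Cons:
  "U # u \<in> ordered_partitions S \<longleftrightarrow> U \<noteq> {} \<and> U \<subseteq> S \<and> u \<in> ordered_partitions (S - U)"
proof
  assume a: "U # u \<in> ordered_partitions S"
  then have "U \<inter> V = {}" if "V \<in> set u" for V
    using that by (auto simp: ordered_partitions_iff)
  then have 1: "\<Union>(set u) = S - U"
    using a by (auto simp: ordered_partitions_iff)
  have 2: "U \<subseteq> S"
    using a unfolding ordered_partitions_iff by (metis Union_upper list.set_intros(1))
  have 3: "U \<noteq> {}"
    using a by (auto simp: ordered_partitions_iff)
  have "u \<in> ordered_partitions (S - U)"
    using a 1 by (simp add: ordered_partitions_iff)
  with 2 3 show "U \<noteq> {} \<and> U \<subseteq> S \<and> u \<in> ordered_partitions (S - U)"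
    by (intro conjI)
next
  assume a: "U \<noteq> {} \<and> U \<subseteq> S \<and> u \<in> ordered_partitions (S - U)"
  then have "[U] @ u \<in> ordered_partitions (U \<union> (S - U))"
    by (intro ordered_partitions_append) auto
  moreover have "U \<subseteq> S"
    using a by simp
  ultimately show "U # u \<in> ordered_partitions S"
    by (simp add: Un_absorb1)
qed

lemma ordered_partitions_appendD:
  "u @ v \<in> ordered_partitions S \<Longrightarrow>
    u \<in> ordered_partitions (\<Union>(set u)) \<and> v \<in> ordered_partitions (S - \<Union>(set u)) \<and> \<Union>(set u) \<subseteq> S"
proof (induction u arbitrary: S)
  case (Cons U u)
  then have U: "U \<noteq> {}" "U \<subseteq> S" "u @ v \<in> ordered_partitions (S - U)"
    by (auto simp: ordered_partitions_Cons)
  then have IH: "u \<in> ordered_partitions (\<Union>(set u))" "v \<in> ordered_partitions (S - U - \<Union>(set u))" "\<Union>(set u) \<subseteq> S - U"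
    using Cons.IH by auto
  have "\<Union>(set (U # u)) - U = \<Union>(set u)"
    using IH(3) by auto
  moreover have "S - \<Union>(set (U # u)) = S - U - \<Union>(set u)"
    by auto
  ultimately show ?case
    using U IH by (auto simp: ordered_partitions_Cons)
qed simp

definition block_word :: "nat set list \<Rightarrow> nat list" where
  "block_word u = concat (map sorted_list_of_set u)"

lemma block_word:
  "u \<in> ordered_partitions S \<Longrightarrow> finite S \<Longrightarrow> distinct (block_word u) \<and> set (block_word u) = S"
proof (induction u arbitrary: S)
  case (Cons U u)
  then have "U \<subseteq> S" "u \<in> ordered_partitions (S - U)"
    by (auto simp: ordered_partitions_Cons)
  then have "distinct (block_word u)" "set (block_word u) = S - U" "finite U" "U \<subseteq> S"
    using Cons finite_subset by auto
  then show ?case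
    by (auto simp: block_word_def)
qed (simp add: block_word_def)

lemma psgn_append:
  assumes "u \<in> ordered_partitions B" "v \<in> ordered_partitions A" "finite A" "finite B" "A \<inter> B = {}"
  shows "psgn (u @ v) = (-1) ^ cross B A * psgn u * psgn v"
proof -
  have *: "psgn x = (-1) ^ inversions (block_word x)" if "x \<in> ordered_partitions S" "finite S" for x S
    using block_word[OF that] by (simp add: psgn_def block_word_def list_sign_inversions)
  have "u @ v \<in> ordered_partitions (B \<union> A)"
    using assms by (intro ordered_partitions_append) auto
  moreover have "block_word (u @ v) = block_word u @ block_word v"
    by (simp add: block_word_def)
  moreover have "inversions (block_word u @ block_word v) =
      inversions (block_word u) + inversions (block_word v) + cross B A"
    using block_word[of u B] block_word[of v A] assms by (subst inversions_append) auto
  ultimately show ?thesis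
    using *[of "u @ v" "B \<union> A"] *[of u B] *[of v A] assms by (simp add: power_add)
qed

lemma psgn_single: "finite U \<Longrightarrow> psgn [U] = 1"
  by (simp add: psgn_def list_sign_inversions inversions_sorted)

lemma psgn_Nil: "psgn [] = 1"
  by (simp add: psgn_def list_sign_inversions)

abbreviation total :: "nat set list \<Rightarrow> nat" where
  "total u \<equiv> \<Sum>U\<leftarrow>u. card U"

lemma total_ordered_partitions: "u \<in> ordered_partitions S \<Longrightarrow> finite S \<Longrightarrow> total u = card S"
proof (induction u arbitrary: S)
  case (Cons U u)
  then have "U \<subseteq> S" "u \<in> ordered_partitions (S - U)"
    by (auto simp: ordered_partitions_Cons)
  then show ?case
    using Cons finite_subset[of U S] card_mono[of S U] by (simp add: card_Diff_subset)
qed simp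

lemma part_dim_ordered_partitions:
  "u \<in> ordered_partitions S \<Longrightarrow> finite S \<Longrightarrow> part_dim u + length u = card S"
proof (induction u arbitrary: S)
  case (Cons U u)
  then have "U \<subseteq> S" "u \<in> ordered_partitions (S - U)" "U \<noteq> {}"
    by (auto simp: ordered_partitions_Cons)
  moreover have "card U > 0" "card U \<le> card S"
    using calculation Cons.prems by (auto simp: card_gt_0_iff finite_subset card_mono)
  moreover have "part_dim u + length u = card (S - U)"
    using Cons calculation by auto
  ultimately show ?case
    using Cons.prems finite_subset[of U S] by (simp add: card_Diff_subset)
qed simp

text \<open>The exponent of \<open>sgn1\<close> in recursive form: the size of a block counts once
  for every later block. Under concatenation this is additive up to one product.\<close>

primrec weight :: "nat set list \<Rightarrow> nat" where
  "weight [] = 0"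
| "weight (U # u) = weight u + length u * card U"

lemma weight_eq: "(\<Sum>i = 1..<length u. i * card (u ! (length u - i - 1))) = weight u"
proof (induction u)
  case (Cons U u)
  show ?case
  proof (cases "u = []")
    case False
    have "(\<Sum>i = 1..<length (U # u). i * card ((U # u) ! (length (U # u) - i - 1))) =
       (\<Sum>i = 1..<length u. i * card ((U # u) ! (length u - i))) + length u * card U"
      using False by (simp add: Suc_le_eq)
    also have "(\<Sum>i = 1..<length u. i * card ((U # u) ! (length u - i))) =
        (\<Sum>i = 1..<length u. i * card (u ! (length u - i - 1)))"
      by (intro sum.cong refl) (auto simp: nth_Cons')
    finally show ?thesis
      using Cons by simp
  qed simp
qed simp

lemma sgn1_weight: "sgn1 u = (-1) ^ weight u * psgn u"
  unfolding sgn1_def weight_eq ..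

lemma weight_append: "weight (u @ v) = weight u + weight v + length v * total u"
  by (induction u) (simp_all add: algebra_simps)

lemma sgn1_append:
  assumes "u \<in> ordered_partitions B" "v \<in> ordered_partitions A" "finite A" "finite B" "A \<inter> B = {}"
  shows "sgn1 (u @ v) = (-1) ^ (length v * card B + cross B A) * sgn1 u * sgn1 v"
  using assms by (simp add: sgn1_weight weight_append psgn_append total_ordered_partitions power_add)

text \<open>Enlarging block \<open>k\<close> by the maximum raises the weight by the number of later
  blocks and the inversions by the number of later elements. The difference of these numbers is the
  dimension of the later blocks, the exponent in \<open>grow\<close>.\<close>

lemma sgn1_ins:
  assumes "u \<in> ordered_partitions S" "finite S" "\<forall>x\<in>S. x < m" "k < max 1 (length u)"
  shows "sgn1 (ins m k u) = (-1) ^ part_dim (drop (Suc k) u) * sgn1 u"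
proof (cases "u = []")
  case True
  then show ?thesis
    by (simp add: ins_def sgn1_weight psgn_single psgn_Nil)
next
  case False
  then have k: "k < length u"
    using assms(4) by (cases u) auto
  define x U y where "x = take k u" and "U = u ! k" and "y = drop (Suc k) u"
  have u: "u = x @ U # y"
    using k by (simp add: x_def U_def y_def Cons_nth_drop_Suc)
  have i: "ins m k u = x @ insert m U # y"
    using k False by (simp add: ins_def x_def U_def y_def upd_conv_take_nth_drop)
  define X Y where "X = \<Union>(set x)" and "Y = S - X - U"
  have x: "x \<in> ordered_partitions X" "X \<subseteq> S" and Uy: "U # y \<in> ordered_partitions (S - X)"
    using ordered_partitions_appendD[of x "U # y" S] assms(1) by (auto simp: u X_def)
  have U: "U \<noteq> {}" "U \<subseteq> S - X" "y \<in> ordered_partitions Y"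
    using Uy by (auto simp: ordered_partitions_Cons Y_def)
  have fin: "finite X" "finite U" "finite Y"
    using x(2) U(2) assms(2) by (auto simp: Y_def intro: finite_subset)
  have m: "m \<notin> X" "m \<notin> U" "m \<notin> Y"
    using x(2) U(2) assms(3) by (auto simp: Y_def)
  have dis: "Y \<inter> U = {}" "U \<union> Y = S - X" "(S - X) \<inter> X = {}"
    using U(2) by (auto simp: Y_def)
  have 1: "sgn1 (U # y) = (-1) ^ (length y * card U + cross U Y) * sgn1 [U] * sgn1 y"
    using sgn1_append[of "[U]" U y Y] U fin dis by simp
  have 2: "sgn1 (insert m U # y) = (-1) ^ (length y * card (insert m U) + cross (insert m U) Y) * sgn1 [insert m U] * sgn1 y"
    using sgn1_append[of "[insert m U]" "insert m U" y Y] U fin dis m by simp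
  have 3: "sgn1 u = (-1) ^ (length (U # y) * card X + cross X (S - X)) * sgn1 x * sgn1 (U # y)"
    unfolding u using sgn1_append[of x X "U # y" "S - X"] x Uy fin assms(2) dis by simp
  have "[insert m U] @ y \<in> ordered_partitions (insert m U \<union> Y)"
    using U dis m by (intro ordered_partitions_append) auto
  also have "insert m U \<union> Y = insert m (S - X)"
    using dis by auto
  finally have 4: "sgn1 (ins m k u) = (-1) ^ (length (insert m U # y) * card X + cross X (insert m (S - X))) * sgn1 x * sgn1 (insert m U # y)"
    unfolding i using sgn1_append[of x X "insert m U # y" "insert m (S - X)"] x fin assms(2) dis m by simp
  have "cross X (insert m (S - X)) = cross X (S - X) + cross X {m}"
    using cross_Un_right[of X "S - X" "{m}"] fin assms(2) m x(2) assms(3) by auto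
  moreover have "cross X {m} = 0"
    using x(2) assms(3) by (intro cross_less) auto
  moreover have "cross (insert m U) Y = cross {m} Y + cross U Y"
    using cross_Un_left[of "{m}" U Y] fin m by auto
  moreover have "cross {m} Y = card Y"
    using cross_greater[of "{m}" Y] assms(3) by (auto simp: Y_def)
  moreover have "card (insert m U) = Suc (card U)"
    using m fin by simp
  moreover have "sgn1 [V] = 1" if "finite V" for V
    using that by (simp add: sgn1_weight psgn_single)
  moreover have "part_dim y + length y = card Y"
    using part_dim_ordered_partitions[OF U(3) fin(3)] .
  then have "card Y = part_dim y + length y"
    by simp
  then have "(-1::int) ^ card Y * (-1) ^ length y = (-1) ^ part_dim y"
    by (simp add: power_add)
  ultimately show ?thesis
    unfolding 3 4 1 2 y_def[symmetric] using fin
    by (simp add: power_add algebra_simps)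
qed

lemma rsgn_append: "rsgn (u @ v) = rsgn u * rsgn v"
  by (simp add: rsgn_def)

text \<open>The exponent \<open>c * (c - 1) div 2\<close> of a block of size \<open>c\<close> grows
  by \<open>c\<close> when an element is added. The size of the first block is written as a
  difference of totals, which covers the empty list.\<close>

lemma rsgn_ins:
  assumes "\<forall>U\<in>set u. finite U \<and> m \<notin> U"
  shows "rsgn (ins m 0 u) = rsgn u * (-1) ^ (total u - total (tl u))"
proof (cases u)
  case (Cons U v)
  have "Suc c * c div 2 = c * (c - 1) div 2 + c" for c :: nat
  proof (cases c)
    case (Suc d)
    have "Suc c * c = c * (c - 1) + c * 2"
      using Suc by (simp add: algebra_simps)
    then show ?thesis
      by (simp only: div_mult_self3)
  qed simp
  then show ?thesis
    using assms Cons by (simp add: ins_def rsgn_def power_add)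
qed (simp add: ins_def rsgn_def)

text \<open>The sign \<open>csgn\<close> in terms of the word. The column partitions of
  \<open>E\<close> and \<open>F\<close> have equally many blocks, so the binomial factors of the two
  \<open>sgn2\<close> cancel and \<open>sgn1\<close> is left.\<close>

definition wsgn :: "nat list \<Rightarrow> nat set list \<Rightarrow> nat set list \<Rightarrow> int" where
  "wsgn w \<sigma> r = (-1) ^ (length r choose 2) * rsgn (druns w) * sgn1 r * (sgn1 (druns w) * sgn1 \<sigma>)"

lemma choose_two_add: "(a + b) choose 2 = (a choose 2) + (b choose 2) + a * b"
  by (induction b) (simp_all add: numeral_2_eq_2 algebra_simps)

lemma druns_ordered_partitions: "distinct w \<Longrightarrow> druns w \<in> ordered_partitions (set w)"
proof (induction w rule: word_max_induct)
  case (max u m v)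
  have "ins m 0 (druns v) \<in> ordered_partitions (insert m (set v))"
    using max by (intro ins_ordered_partitions) auto
  then have "druns u @ ins m 0 (druns v) \<in> ordered_partitions (set u \<union> insert m (set v))"
    using max by (intro ordered_partitions_append) auto
  then show ?case
    using druns_max[OF max(1)] by simp
qed simp

text \<open>The joint factors of \<open>u\<close> and \<open>v\<close> in \<open>sgn1\<close> are
  the same for the shifted columns and for the runs of the word, so they cancel. The row partition
  leaves \<open>shuff\<close>, and the rest is the signs of the two insertions and the Koszul sign
  of \<open>bar\<close>.\<close>

lemma wsgn_max:
  assumes m: "\<forall>x\<in>set (u @ v). x < m" and d: "distinct (u @ v)"
    and \<sigma>: "\<sigma> \<in> ordered_partitions (set u)" "length \<sigma> = length (druns u)"
    and \<theta>: "\<theta> \<in> ordered_partitions (set u)" "length \<theta> = length (druns (rev u))"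
    and \<tau>: "\<tau> \<in> ordered_partitions (set v)" "length \<tau> = length (druns v)"
    and \<eta>: "\<eta> \<in> ordered_partitions (set v)" "length \<eta> = length (druns (rev v))"
    and k: "k < max 1 (length \<tau>)" and i: "i < max 1 (length \<theta>)"
  shows "wsgn (u @ m # v) (\<sigma> @ ins m k \<tau>) (ins m i \<theta> @ \<eta>) =
    shuff (set u) (set v) * wsgn u \<sigma> \<theta> * wsgn v \<tau> \<eta> *
    (-1) ^ (part_dim (drop (Suc k) \<tau>) + part_dim (drop (Suc i) \<theta>) + part_dim \<eta> +
      part_dim (ins m k \<tau>) * part_dim (ins m i \<theta>))"
proof -
  let ?B = "set u" and ?A = "set v"
  have mB: "m \<notin> ?B" "\<forall>x\<in>?B. x < m" and mA: "m \<notin> ?A" "\<forall>x\<in>?A. x < m" and BA: "?A \<inter> ?B = {}"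
    using m d by auto
  have ins1: "ins m k \<tau> \<in> ordered_partitions (insert m ?A)" "ins m i \<theta> \<in> ordered_partitions (insert m ?B)"
    "ins m 0 (druns v) \<in> ordered_partitions (insert m ?A)"
    using ins_ordered_partitions \<tau> \<theta> mA mB k i d druns_ordered_partitions[of v] by auto
  have cBA: "cross ?B (insert m ?A) = cross ?B ?A"
  proof -
    have "cross ?B {m} = 0"
      using mB by (intro cross_less) auto
    then show ?thesis
      using cross_Un_right[of ?B ?A "{m}"] mA by auto
  qed
  have cAB: "cross (insert m ?B) ?A = cross ?B ?A + card ?A"
  proof -
    have "cross {m} ?A = card ?A"
      using cross_greater[of "{m}" ?A] mA by auto
    then show ?thesis
      using cross_Un_left[of "{m}" ?B ?A] mB by auto
  qed
  define pv qu a b s where "pv = length (ins m k \<tau>)" and "qu = length (ins m i \<theta>)"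
    and "a = card ?A" and "b = card ?B" and "s = cross ?B ?A"
  have pv': "length (ins m 0 (druns v)) = pv"
    using \<tau>(2) by (simp add: pv_def length_ins)
  have s1: "sgn1 (\<sigma> @ ins m k \<tau>) = (-1) ^ (pv * b + s) * sgn1 \<sigma> * ((-1) ^ part_dim (drop (Suc k) \<tau>) * sgn1 \<tau>)"
    using sgn1_append[OF \<sigma>(1) ins1(1)] sgn1_ins[OF \<tau>(1) _ mA(2) k] mB BA
    by (simp add: cBA pv_def b_def s_def)
  have s2: "sgn1 (ins m i \<theta> @ \<eta>) = (-1) ^ (length \<eta> * Suc b + (s + a)) * ((-1) ^ part_dim (drop (Suc i) \<theta>) * sgn1 \<theta>) * sgn1 \<eta>"
    using sgn1_append[OF ins1(2) \<eta>(1)] sgn1_ins[OF \<theta>(1) _ mB(2) i] mA mB BA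
    by (simp add: cAB b_def s_def a_def)
  have s3: "sgn1 (druns (u @ m # v)) = (-1) ^ (pv * b + s) * sgn1 (druns u) * ((-1) ^ part_dim (drop 1 (druns v)) * sgn1 (druns v))"
    using sgn1_append[OF druns_ordered_partitions[of u] ins1(3)] sgn1_ins[OF druns_ordered_partitions[of v] _ mA(2), of 0] mB BA d
    by (simp add: cBA pv' b_def s_def druns_max[OF m])
  have vf: "\<forall>U\<in>set (druns v). finite U \<and> m \<notin> U"
    using druns_nonempty[of _ v] Union_druns[of v] mA(1) by blast
  have s4: "rsgn (druns (u @ m # v)) = rsgn (druns u) * (rsgn (druns v) * (-1) ^ (total (druns v) - total (tl (druns v))))"
    using rsgn_ins[OF vf] by (simp add: druns_max[OF m] rsgn_append)
  \<comment> \<open>The correction from \<open>rsgn\<close> is the size of the first run of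
    \<open>v\<close>, that from \<open>sgn1\<close> the dimension of its later runs; together they
    have the parity of \<open>a + pv + 1\<close>.\<close>
  have tl: "even (part_dim (drop 1 (druns v)) + (total (druns v) - total (tl (druns v))) + (a + pv + 1))"
  proof (cases "druns v")
    case Nil
    then show ?thesis
      using \<tau>(2) by (simp add: a_def pv_def length_ins)
  next
    case (Cons V vs)
    have "V # vs \<in> ordered_partitions ?A"
      using druns_ordered_partitions[of v] d Cons by simp
    then have V: "V \<subseteq> ?A" "vs \<in> ordered_partitions (?A - V)"
      by (auto simp: ordered_partitions_Cons)
    then have "part_dim vs + length vs = card (?A - V)"
      using part_dim_ordered_partitions by auto
    moreover have "card (?A - V) + card V = a"
      using V(1) card_mono[of ?A V] by (simp add: card_Diff_subset finite_subset a_def)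
    moreover have "pv = Suc (length vs)"
      using \<tau>(2) Cons by (simp add: pv_def length_ins)
    ultimately have E: "part_dim (drop 1 (druns v)) + (total (druns v) - total (tl (druns v))) + (a + pv + 1) = 2 * (a + 1)"
      using Cons by simp
    show ?thesis
      unfolding E by simp
  qed
  \<comment> \<open>The relation between columns and rows of the step matrix on \<open>v\<close>;
    for empty \<open>v\<close> the value \<open>pv = 1\<close> keeps it true.\<close>
  have pvq: "pv + length \<eta> = a + 1"
  proof (cases "v = []")
    case False
    then show ?thesis
      using length_druns_rev[of v] d \<tau>(2) \<eta>(2)
      by (cases "druns v") (simp_all add: pv_def length_ins a_def distinct_card)
  qed (use \<tau> \<eta> in \<open>simp add: pv_def length_ins a_def\<close>)
  have d1: "part_dim (ins m k \<tau>) + pv = Suc a"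
    using part_dim_ordered_partitions[OF ins1(1)] mA by (simp add: pv_def a_def)
  have d2: "part_dim (ins m i \<theta>) + qu = Suc b"
    using part_dim_ordered_partitions[OF ins1(2)] mB by (simp add: qu_def b_def)
  have d3: "part_dim \<eta> + length \<eta> = a"
    using part_dim_ordered_partitions[OF \<eta>(1)] by (simp add: a_def)
  have ch: "(qu + length \<eta>) choose 2 = (length \<theta> choose 2) + (length \<eta> choose 2) + qu * length \<eta>"
  proof -
    have "qu choose 2 = length \<theta> choose 2"
      by (cases \<theta>) (simp_all add: qu_def length_ins numeral_2_eq_2)
    then show ?thesis
      by (simp add: choose_two_add)
  qed
  define t where "t = part_dim (drop 1 (druns v)) + (total (druns v) - total (tl (druns v)))"
  \<comment> \<open>By \<open>d1\<close> and \<open>pvq\<close> the dimension of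
    \<open>ins m k \<tau>\<close> equals \<open>length \<eta>\<close>. So the Koszul exponent, a
    product of dimensions, can be compared with \<open>qu * length \<eta>\<close>, which comes from
    the binomial coefficient.\<close>
  have key: "(-1::int) ^ (qu * length \<eta> + t + (length \<eta> * Suc b + (s + a))) =
      (-1) ^ s * (-1) ^ (part_dim \<eta> + part_dim (ins m k \<tau>) * part_dim (ins m i \<theta>))"
  proof -
    obtain x where x: "part_dim (ins m k \<tau>) = length \<eta>"
      using d1 pvq by simp
    have "even (qu * length \<eta> + t + (length \<eta> * Suc b + (s + a)) + (s + (part_dim \<eta> + length \<eta> * part_dim (ins m i \<theta>))))"
    proof -
      have "qu * length \<eta> + length \<eta> * part_dim (ins m i \<theta>) = length \<eta> * Suc b"
        using d2 by (metis add.commute add_mult_distrib2 mult.commute)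
      moreover have "even (t + (a + pv + 1))"
        using tl by (simp add: t_def)
      ultimately show ?thesis
        using pvq d3 by presburger
    qed
    from minus_one_power_eqI[OF this] show ?thesis
      by (simp add: power_add x)
  qed
  have sq: "(-1::int) ^ x * ((-1) ^ y * ((-1) ^ x * (-1) ^ y)) = 1" for x y
    by (simp add: minus_one_power_iff)
  have "wsgn (u @ m # v) (\<sigma> @ ins m k \<tau>) (ins m i \<theta> @ \<eta>) =
     (-1) ^ (qu * length \<eta> + t + (length \<eta> * Suc b + (s + a))) *
     ((-1) ^ (length \<theta> choose 2) * (-1) ^ (length \<eta> choose 2) *
      rsgn (druns u) * rsgn (druns v) * sgn1 \<theta> * sgn1 \<eta> * sgn1 \<sigma> * sgn1 \<tau> *
      sgn1 (druns u) * sgn1 (druns v) *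
      (-1) ^ part_dim (drop (Suc k) \<tau>) * (-1) ^ part_dim (drop (Suc i) \<theta>))"
    unfolding wsgn_def s1 s2 s3 s4 length_append qu_def[symmetric] ch t_def
    by (simp add: power_add sq del: power_Suc add_Suc_right drop_0 mult_Suc_right One_nat_def)
  also have "\<dots> = shuff (set u) (set v) * wsgn u \<sigma> \<theta> * wsgn v \<tau> \<eta> *
    (-1) ^ (part_dim (drop (Suc k) \<tau>) + part_dim (drop (Suc i) \<theta>) + part_dim \<eta> +
      part_dim (ins m k \<tau>) * part_dim (ins m i \<theta>))"
    unfolding key using BA
    by (simp add: wsgn_def shuff_cross s_def Int_commute power_add)
  finally show ?thesis .
qed

section \<open>Summing the recursion over all words\<close>

lemma tensor_sum_left: "tensor (\<Sum>i\<in>I. f i) y = (\<Sum>i\<in>I. tensor (f i) y)"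
  by (simp add: tensor_def frag_extend_sum')

lemma tensor_sum_right: "tensor x (\<Sum>i\<in>I. f i) = (\<Sum>i\<in>I. tensor x (f i))"
  by (simp add: tensor_def frag_extend_sum' frag_extend_fun_sum)

text \<open>Insertion with the empty word included: on \<open>[]\<close> it has the value that
  \<open>grow_hat\<close> prescribes, elsewhere it is \<open>grow\<close>.\<close>

definition grow_full :: "nat \<Rightarrow> nat set list \<Rightarrow> (nat set list \<Rightarrow>\<^sub>0 int)" where
  "grow_full m u = (\<Sum>k<max 1 (length u). frag_cmul ((-1) ^ part_dim (drop (Suc k) u)) (frag_of (ins m k u)))"

lemma grow_sum:
  "grow m u = (\<Sum>k<length u. frag_cmul ((-1) ^ part_dim (drop (Suc k) u)) (frag_of (u[k := insert m (u ! k)])))"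
proof (induction u)
  case (Cons U u)
  then show ?case
    by (simp add: sum.lessThan_Suc_shift concat_product_sum_right concat_product_cmul_right del: sum.lessThan_Suc)
qed simp

lemma grow_full_Nil: "grow_full m [] = frag_of [{m}]"
  by (simp add: grow_full_def ins_def)

lemma grow_full_grow:
  assumes "u \<noteq> []"
  shows "grow_full m u = grow m u"
proof -
  have "max 1 (length u) = length u"
    using assms by (cases u) auto
  then show ?thesis
    using assms unfolding grow_full_def grow_sum by (simp add: ins_def)
qed

text \<open>The part of the diagonal that comes from one step matrix. The list \<open>\<rho>\<close>
  runs through the rows from the top, whereas the row partition lists them from the bottom; hence
  \<open>rev \<rho>\<close>.\<close>

definition word_diag :: "nat list \<Rightarrow> (nat set list \<times> nat set list \<Rightarrow>\<^sub>0 int)" where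
  "word_diag w = (\<Sum>\<sigma>\<in>Sh w. \<Sum>\<rho>\<in>Sh (rev w). frag_cmul (wsgn w \<sigma> (rev \<rho>)) (frag_of (\<sigma>, rev \<rho>)))"

definition right_full :: "nat \<Rightarrow> (nat set list \<times> nat set list \<Rightarrow>\<^sub>0 int) \<Rightarrow> (nat set list \<times> nat set list \<Rightarrow>\<^sub>0 int)" where
  "right_full m = frag_extend (\<lambda>(a, b). tensor (frag_of a) (grow_full m b))"

definition left_full :: "nat \<Rightarrow> (nat set list \<times> nat set list \<Rightarrow>\<^sub>0 int) \<Rightarrow> (nat set list \<times> nat set list \<Rightarrow>\<^sub>0 int)" where
  "left_full m = frag_extend (\<lambda>(a, b). frag_cmul ((-1) ^ part_dim b) (tensor (grow_full m a) (frag_of b)))"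

lemma rev_ordered_partitions [simp]: "rev u \<in> ordered_partitions S \<longleftrightarrow> u \<in> ordered_partitions S"
  by (simp add: ordered_partitions_iff)

lemma rev_ins: "k < max 1 (length u) \<Longrightarrow> rev (ins m k u) = ins m (max 1 (length u) - Suc k) (rev u)"
proof (cases "u = []")
  case False
  assume "k < max 1 (length u)"
  with False have "k < length u" "max 1 (length u) = length u"
    by (cases u; auto)+
  with False show ?thesis
    by (simp add: ins_def rev_update rev_nth)
qed (simp add: ins_def)

text \<open>Brings the two sums that belong to \<open>u\<close> in front of the three that belong to
  \<open>v\<close>.\<close>

lemma sum_swap5:
  "(\<Sum>a\<in>A. \<Sum>b\<in>B. \<Sum>c\<in>C. \<Sum>d\<in>D. \<Sum>e\<in>E. f a b c d e) =
   (\<Sum>d\<in>D. \<Sum>e\<in>E. \<Sum>a\<in>A. \<Sum>c\<in>C. \<Sum>b\<in>B. f a b c d e)"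
proof -
  have "(\<Sum>b\<in>B. \<Sum>c\<in>C. \<Sum>d\<in>D. \<Sum>e\<in>E. f a b c d e) = (\<Sum>d\<in>D. \<Sum>e\<in>E. \<Sum>c\<in>C. \<Sum>b\<in>B. f a b c d e)" for a
  proof -
    have "(\<Sum>c\<in>C. \<Sum>d\<in>D. \<Sum>e\<in>E. f a b c d e) = (\<Sum>d\<in>D. \<Sum>e\<in>E. \<Sum>c\<in>C. f a b c d e)" for b
      by (subst sum.swap) (intro sum.cong refl sum.swap)
    then have "(\<Sum>b\<in>B. \<Sum>c\<in>C. \<Sum>d\<in>D. \<Sum>e\<in>E. f a b c d e) = (\<Sum>b\<in>B. \<Sum>d\<in>D. \<Sum>e\<in>E. \<Sum>c\<in>C. f a b c d e)"
      by simp
    also have "\<dots> = (\<Sum>d\<in>D. \<Sum>b\<in>B. \<Sum>e\<in>E. \<Sum>c\<in>C. f a b c d e)"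
      by (rule sum.swap)
    also have "\<dots> = (\<Sum>d\<in>D. \<Sum>e\<in>E. \<Sum>b\<in>B. \<Sum>c\<in>C. f a b c d e)"
      by (rule sum.cong[OF refl], rule sum.swap)
    also have "\<dots> = (\<Sum>d\<in>D. \<Sum>e\<in>E. \<Sum>c\<in>C. \<Sum>b\<in>B. f a b c d e)"
      by (rule sum.cong[OF refl], rule sum.cong[OF refl], rule sum.swap)
    finally show ?thesis .
  qed
  then have "(\<Sum>a\<in>A. \<Sum>b\<in>B. \<Sum>c\<in>C. \<Sum>d\<in>D. \<Sum>e\<in>E. f a b c d e) =
      (\<Sum>a\<in>A. \<Sum>d\<in>D. \<Sum>e\<in>E. \<Sum>c\<in>C. \<Sum>b\<in>B. f a b c d e)"
    by simp
  also have "\<dots> = (\<Sum>d\<in>D. \<Sum>a\<in>A. \<Sum>e\<in>E. \<Sum>c\<in>C. \<Sum>b\<in>B. f a b c d e)"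
    by (rule sum.swap)
  also have "\<dots> = (\<Sum>d\<in>D. \<Sum>e\<in>E. \<Sum>a\<in>A. \<Sum>c\<in>C. \<Sum>b\<in>B. f a b c d e)"
    by (rule sum.cong[OF refl], rule sum.swap)
  finally show ?thesis .
qed

text \<open>Columns are those of \<open>u\<close>, then those of \<open>v\<close> with
  \<open>m\<close>; rows from the bottom are those of \<open>u\<close> with \<open>m\<close>, then
  those of \<open>v\<close>. Thus \<open>m\<close> enters the second factor of the part of
  \<open>u\<close> and the first factor of the part of \<open>v\<close>.\<close>

lemma word_diag_max:
  assumes m: "\<forall>x\<in>set (u @ v). x < m" and d: "distinct (u @ v)"
  shows "word_diag (u @ m # v) = frag_cmul (shuff (set u) (set v))
    (bar (right_full m (word_diag u)) (left_full m (word_diag v)))"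
proof -
  define nu nv where "nu = max 1 (length (druns (rev u)))" and "nv = max 1 (length (druns v))"
  define c where "c \<sigma> \<theta> i \<tau> \<eta> k = frag_cmul (shuff (set u) (set v) * wsgn u \<sigma> \<theta> * wsgn v \<tau> \<eta> *
    (-1) ^ (part_dim (drop (Suc k) \<tau>) + part_dim (drop (Suc i) \<theta>) + part_dim \<eta> +
      part_dim (ins m k \<tau>) * part_dim (ins m i \<theta>)))
    (frag_of (\<sigma> @ ins m k \<tau>, ins m i \<theta> @ \<eta>))" for \<sigma> \<theta> i \<tau> \<eta> k
  have rv: "\<forall>x\<in>set (rev v @ rev u). x < m" "distinct (rev v @ rev u)" "rev (u @ m # v) = rev v @ m # rev u"
    using m d by auto
  have inner: "(\<Sum>i<max 1 (length \<rho>'). frag_cmul (wsgn (u @ m # v) (\<sigma> @ ins m k \<tau>) (rev (\<rho>'' @ ins m i \<rho>')))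
        (frag_of (\<sigma> @ ins m k \<tau>, rev (\<rho>'' @ ins m i \<rho>')))) = (\<Sum>i<nu. c \<sigma> (rev \<rho>') i \<tau> (rev \<rho>'') k)"
    if "\<sigma> \<in> Sh u" "\<tau> \<in> Sh v" "k < nv" "\<rho>' \<in> Sh (rev u)" "\<rho>'' \<in> Sh (rev v)" for \<sigma> \<tau> k \<rho>' \<rho>''
  proof -
    have len: "length \<sigma> = length (druns u)" "length \<tau> = length (druns v)"
      "length \<rho>' = length (druns (rev u))" "length \<rho>'' = length (druns (rev v))"
      using that length_shifts by auto
    have op: "\<sigma> \<in> ordered_partitions (set u)" "\<tau> \<in> ordered_partitions (set v)"
      "rev \<rho>' \<in> ordered_partitions (set u)" "rev \<rho>'' \<in> ordered_partitions (set v)"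
      using that d Sh_ordered_partitions[of u] Sh_ordered_partitions[of v]
        Sh_ordered_partitions[of "rev u"] Sh_ordered_partitions[of "rev v"] by auto
    have nu: "max 1 (length \<rho>') = nu"
      using len by (simp add: nu_def)
    have "(\<Sum>i<nu. frag_cmul (wsgn (u @ m # v) (\<sigma> @ ins m k \<tau>) (rev (\<rho>'' @ ins m i \<rho>')))
        (frag_of (\<sigma> @ ins m k \<tau>, rev (\<rho>'' @ ins m i \<rho>')))) = (\<Sum>i<nu. c \<sigma> (rev \<rho>') (nu - Suc i) \<tau> (rev \<rho>'') k)"
    proof (rule sum.cong[OF refl])
      fix i assume "i \<in> {..<nu}"
      then have i: "i < max 1 (length \<rho>')" "nu - Suc i < max 1 (length (rev \<rho>'))"
        using nu by auto
      have "rev (\<rho>'' @ ins m i \<rho>') = ins m (nu - Suc i) (rev \<rho>') @ rev \<rho>''"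
        using rev_ins[OF i(1), of m] nu by simp
      moreover have "k < max 1 (length \<tau>)"
        using that(3) len(2) by (simp add: nv_def)
      ultimately show "frag_cmul (wsgn (u @ m # v) (\<sigma> @ ins m k \<tau>) (rev (\<rho>'' @ ins m i \<rho>')))
        (frag_of (\<sigma> @ ins m k \<tau>, rev (\<rho>'' @ ins m i \<rho>'))) = c \<sigma> (rev \<rho>') (nu - Suc i) \<tau> (rev \<rho>'') k"
        using wsgn_max[OF m d op(1) len(1) op(3) _ op(2) len(2) op(4) _ _ i(2)] len
        by (simp add: c_def)
    qed
    \<comment> \<open>Reversing the list of rows reverses the position at which \<open>m\<close> is
      inserted, which does not affect the sum over all positions.\<close>
    also have "\<dots> = (\<Sum>i<nu. c \<sigma> (rev \<rho>') i \<tau> (rev \<rho>'') k)"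
      by (rule sum.nat_diff_reindex)
    finally show ?thesis
      unfolding nu .
  qed
  have "word_diag (u @ m # v) = (\<Sum>\<sigma>\<in>Sh u. \<Sum>\<tau>\<in>Sh v. \<Sum>k<nv. \<Sum>\<rho>''\<in>Sh (rev v). \<Sum>\<rho>'\<in>Sh (rev u).
      \<Sum>i<nu. c \<sigma> (rev \<rho>') i \<tau> (rev \<rho>'') k)"
    unfolding word_diag_def sum_Sh_max[OF m d] rv(3) sum_Sh_max[OF rv(1,2)]
    by (rule sum.cong[OF refl], rule sum.cong[OF refl], rule sum.cong, simp add: length_shifts nv_def,
        rule sum.cong[OF refl], rule sum.cong[OF refl], rule inner) auto
  also have "\<dots> = (\<Sum>\<sigma>\<in>Sh u. \<Sum>\<rho>'\<in>Sh (rev u). \<Sum>i<nu. \<Sum>\<tau>\<in>Sh v. \<Sum>\<rho>''\<in>Sh (rev v). \<Sum>k<nv.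
      c \<sigma> (rev \<rho>') i \<tau> (rev \<rho>'') k)"
    by (rule sum.cong[OF refl], rule sum_swap5)
  also have "\<dots> = frag_cmul (shuff (set u) (set v)) (bar (right_full m (word_diag u)) (left_full m (word_diag v)))"
  proof -
    have r: "right_full m (word_diag u) = (\<Sum>\<sigma>\<in>Sh u. \<Sum>\<rho>'\<in>Sh (rev u). \<Sum>i<nu.
        frag_cmul (wsgn u \<sigma> (rev \<rho>') * (-1) ^ part_dim (drop (Suc i) (rev \<rho>')))
          (frag_of (\<sigma>, ins m i (rev \<rho>'))))"
      unfolding word_diag_def right_full_def frag_extend_sum' frag_extend_cmul
    proof (intro sum.cong refl)
      fix \<sigma> \<rho>' assume "\<rho>' \<in> Sh (rev u)"
      then have "max 1 (length (rev \<rho>')) = nu"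
        using length_shifts by (simp add: nu_def)
      then show "frag_cmul (wsgn u \<sigma> (rev \<rho>')) (frag_extend (\<lambda>(a, b). tensor (frag_of a) (grow_full m b)) (frag_of (\<sigma>, rev \<rho>'))) =
        (\<Sum>i<nu. frag_cmul (wsgn u \<sigma> (rev \<rho>') * (-1) ^ part_dim (drop (Suc i) (rev \<rho>'))) (frag_of (\<sigma>, ins m i (rev \<rho>'))))"
        by (simp only: frag_extend_of prod.case grow_full_def tensor_sum_right tensor_cmul_right tensor_frag_of
            frag_cmul_sum frag_cmul_cmul)
    qed
    have l: "left_full m (word_diag v) = (\<Sum>\<tau>\<in>Sh v. \<Sum>\<rho>''\<in>Sh (rev v). \<Sum>k<nv.
        frag_cmul (wsgn v \<tau> (rev \<rho>'') * ((-1) ^ part_dim (rev \<rho>'') * (-1) ^ part_dim (drop (Suc k) \<tau>)))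
          (frag_of (ins m k \<tau>, rev \<rho>'')))"
      unfolding word_diag_def left_full_def frag_extend_sum' frag_extend_cmul
    proof (intro sum.cong refl)
      fix \<tau> \<rho>'' assume "\<tau> \<in> Sh v"
      then have "max 1 (length \<tau>) = nv"
        using length_shifts by (simp add: nv_def)
      then show "frag_cmul (wsgn v \<tau> (rev \<rho>''))
          (frag_extend (\<lambda>(a, b). frag_cmul ((-1) ^ part_dim b) (tensor (grow_full m a) (frag_of b))) (frag_of (\<tau>, rev \<rho>''))) =
        (\<Sum>k<nv. frag_cmul (wsgn v \<tau> (rev \<rho>'') * ((-1) ^ part_dim (rev \<rho>'') * (-1) ^ part_dim (drop (Suc k) \<tau>)))
          (frag_of (ins m k \<tau>, rev \<rho>'')))"
        by (simp only: frag_extend_of prod.case grow_full_def tensor_sum_left tensor_cmul_left tensor_frag_of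
            frag_cmul_sum frag_cmul_cmul)
    qed
    show ?thesis
      unfolding r bar_product_sum_left frag_cmul_sum
      unfolding l bar_product_sum_right frag_cmul_sum
      by (intro sum.cong refl)
        (simp add: c_def bar_product_cmul_left bar_product_cmul_right bar_product_frag_of power_add algebra_simps)
  qed
  finally show ?thesis .
qed

definition set_diag :: "nat set \<Rightarrow> (nat set list \<times> nat set list \<Rightarrow>\<^sub>0 int)" where
  "set_diag S = (\<Sum>w\<in>permutations_of_set S. word_diag w)"

lemma word_diag_Nil: "word_diag [] = frag_of ([], [])"
  by (simp add: word_diag_def wsgn_def rsgn_def sgn1_weight psgn_Nil numeral_2_eq_2)

text \<open>A word on \<open>insert m S\<close> is cut by \<open>m\<close> into a word before it and
  a word after it, and their letter sets form the splitting.\<close>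

lemma sum_permutations_insert:
  assumes "finite S" "m \<notin> S"
  shows "(\<Sum>w\<in>permutations_of_set (insert m S). f w) =
    splits S (\<lambda>B A. \<Sum>u\<in>permutations_of_set B. \<Sum>v\<in>permutations_of_set A. f (u @ m # v) :: 'b::comm_monoid_add)"
proof -
  let ?X = "Sigma (Pow S) (\<lambda>B. permutations_of_set B \<times> permutations_of_set (S - B))"
  let ?j = "\<lambda>(B, u, v). u @ m # v"
  have inj: "inj_on ?j ?X"
  proof (rule inj_onI)
    fix x y assume xy: "x \<in> ?X" "y \<in> ?X" "?j x = ?j y"
    obtain B u v B' u' v' where x: "x = (B, u, v)" and y: "y = (B', u', v')"
      by (metis prod_cases3)
    have s: "set u = B" "set v = S - B" "set u' = B'" "set v' = S - B'" "B \<subseteq> S" "B' \<subseteq> S"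
      using xy by (auto simp: x y permutations_of_set_def)
    then have "m \<notin> set u" "m \<notin> set v" "m \<notin> set u'" "m \<notin> set v'"
      using assms(2) by auto
    then have "u = u' \<and> v = v'"
      using xy(3) append_Cons_eq_iff[of m u v u' v'] by (simp add: x y)
    then show "x = y"
      using s by (simp add: x y)
  qed
  have "permutations_of_set (insert m S) = ?j ` ?X"
  proof (intro equalityI subsetI)
    fix w assume "w \<in> permutations_of_set (insert m S)"
    then have w: "set w = insert m S" "distinct w"
      by (auto simp: permutations_of_set_def)
    then obtain u v where uv: "w = u @ m # v"
      by (metis insertI1 split_list)
    have "set u \<subseteq> S" "set v = S - set u"
      using w assms(2) by (auto simp: uv)
    then have "(set u, u, v) \<in> ?X"
      using w(2) by (auto simp: uv permutations_of_set_def)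
    from imageI[OF this, of ?j] show "w \<in> ?j ` ?X"
      unfolding uv by (simp only: prod.case)
  next
    fix w assume "w \<in> ?j ` ?X"
    then obtain B u v where "w = u @ m # v" "B \<subseteq> S" "u \<in> permutations_of_set B" "v \<in> permutations_of_set (S - B)"
      by auto
    then show "w \<in> permutations_of_set (insert m S)"
      using assms(2) by (auto simp: permutations_of_set_def)
  qed
  then have "(\<Sum>w\<in>permutations_of_set (insert m S). f w) = (\<Sum>x\<in>?X. f (?j x))"
    using sum.reindex[OF inj, of f] by simp
  also have "\<dots> = (\<Sum>B\<in>Pow S. \<Sum>(u, v)\<in>permutations_of_set B \<times> permutations_of_set (S - B). f (u @ m # v))"
    using assms(1) by (subst sum.Sigma) (simp_all add: case_prod_unfold)
  also have "\<dots> = splits S (\<lambda>B A. \<Sum>u\<in>permutations_of_set B. \<Sum>v\<in>permutations_of_set A. f (u @ m # v))"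
    unfolding splits_def by (simp add: sum.cartesian_product)
  finally show ?thesis .
qed

lemma right_hat_words: "finite B \<Longrightarrow> right_hat m set_diag B = (\<Sum>u\<in>permutations_of_set B. right_full m (word_diag u))"
proof (cases "B = {}")
  case True
  then show ?thesis
    by (simp add: grow_hat_def right_full_def word_diag_Nil grow_full_Nil)
next
  case False
  have "grow_right m (word_diag u) = right_full m (word_diag u)" if "u \<in> permutations_of_set B" for u
  proof -
    have "rev \<rho> \<noteq> []" if "\<rho> \<in> Sh (rev u)" for \<rho>
      using length_shifts[OF that] False \<open>u \<in> permutations_of_set B\<close> by (auto simp: permutations_of_set_def)
    then show ?thesis
      unfolding grow_right_def right_full_def word_diag_def frag_extend_sum' frag_extend_cmul
      by (intro sum.cong refl) (simp add: grow_full_grow)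
  qed
  with False show ?thesis
    by (simp add: grow_hat_def set_diag_def) (simp add: grow_right_def frag_extend_sum')
qed

lemma left_hat_words: "finite B \<Longrightarrow> left_hat m set_diag B = (\<Sum>u\<in>permutations_of_set B. left_full m (word_diag u))"
proof (cases "B = {}")
  case True
  then show ?thesis
    by (simp add: grow_hat_def left_full_def word_diag_Nil grow_full_Nil)
next
  case False
  have "grow_left m (word_diag u) = left_full m (word_diag u)" if "u \<in> permutations_of_set B" for u
  proof -
    have "\<sigma> \<noteq> []" if "\<sigma> \<in> Sh u" for \<sigma>
      using length_shifts[OF that] False \<open>u \<in> permutations_of_set B\<close> by (auto simp: permutations_of_set_def)
    then show ?thesis
      unfolding grow_left_def left_full_def word_diag_def frag_extend_sum' frag_extend_cmul
      by (intro sum.cong refl) (simp add: grow_full_grow)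
  qed
  with False show ?thesis
    by (simp add: grow_hat_def set_diag_def) (simp add: grow_left_def frag_extend_sum')
qed

text \<open>Sum \<open>word_diag_max\<close> over all words: the parts before and after
  \<open>m\<close> vary independently, and the hats account for the words that begin or end with
  \<open>m\<close>.\<close>

lemma set_diag_recursion: "diagonal_recursion set_diag"
proof
  show "set_diag {} = frag_of ([], [])"
    by (simp add: set_diag_def word_diag_Nil)
next
  fix S :: "nat set" and m assume S: "finite S" "\<forall>x\<in>S. x < m"
  then have "m \<notin> S"
    by auto
  have "set_diag (insert m S) = splits S (\<lambda>B A. \<Sum>u\<in>permutations_of_set B. \<Sum>v\<in>permutations_of_set A. word_diag (u @ m # v))"
    unfolding set_diag_def by (rule sum_permutations_insert[OF S(1) \<open>m \<notin> S\<close>])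
  also have "\<dots> = splits S (\<lambda>B A. frag_cmul (shuff B A) (bar (right_hat m set_diag B) (left_hat m set_diag A)))"
  proof (rule splits_cong)
    fix B A assume BA: "B \<union> A = S" "B \<inter> A = {}"
    then have fin: "finite B" "finite A"
      using S by auto
    have "word_diag (u @ m # v) = frag_cmul (shuff B A) (bar (right_full m (word_diag u)) (left_full m (word_diag v)))"
      if "u \<in> permutations_of_set B" "v \<in> permutations_of_set A" for u v
      using word_diag_max[of u v m] that S BA by (auto simp: permutations_of_set_def)
    then show "(\<Sum>u\<in>permutations_of_set B. \<Sum>v\<in>permutations_of_set A. word_diag (u @ m # v)) =
        frag_cmul (shuff B A) (bar (right_hat m set_diag B) (left_hat m set_diag A))"
      unfolding right_hat_words[OF fin(1)] left_hat_words[OF fin(2)]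
      by (simp only: bar_product_sum_left, simp only: bar_product_sum_right frag_cmul_sum, intro sum.cong refl, simp)
  qed simp
  finally show "set_diag (insert m S) = splits S (\<lambda>B A. frag_cmul (shuff B A) (bar (right_hat m set_diag B) (left_hat m set_diag A)))" .
qed

subsection \<open>Configurations determine their word\<close>

lemma Sh_pair_max:
  assumes "\<forall>x\<in>set (u @ v). x < m" "distinct (u @ v)" "\<sigma> \<in> Sh (u @ m # v)" "\<rho> \<in> Sh (rev (u @ m # v))"
  obtains \<sigma>' \<tau> k \<rho>' \<rho>'' i where "\<sigma> = \<sigma>' @ ins m k \<tau>" "\<rho> = \<rho>'' @ ins m i \<rho>'"
    "\<sigma>' \<in> Sh u" "\<tau> \<in> Sh v" "\<rho>' \<in> Sh (rev u)" "\<rho>'' \<in> Sh (rev v)"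
    "k < max 1 (length \<tau>)" "i < max 1 (length \<rho>')"
    "\<sigma>' \<in> ordered_partitions (set u)" "\<rho>' \<in> ordered_partitions (set u)"
    "\<tau> \<in> ordered_partitions (set v)" "\<rho>'' \<in> ordered_partitions (set v)"
proof -
  obtain \<sigma>' \<tau> k where 1: "\<sigma> = \<sigma>' @ ins m k \<tau>" "\<sigma>' \<in> Sh u" "\<tau> \<in> Sh v" "k < max 1 (length (druns v))"
    using assms(3) Sh_max[OF assms(1)] by auto
  have "\<forall>x\<in>set (rev v @ rev u). x < m"
    using assms(1) by auto
  then obtain \<rho>'' \<rho>' i where 2: "\<rho> = \<rho>'' @ ins m i \<rho>'" "\<rho>'' \<in> Sh (rev v)" "\<rho>' \<in> Sh (rev u)"
    "i < max 1 (length (druns (rev u)))"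
    using assms(4) Sh_max[of "rev v" "rev u" m] by auto
  have "k < max 1 (length \<tau>)" "i < max 1 (length \<rho>')"
    using 1 2 length_shifts by auto
  moreover have "\<sigma>' \<in> ordered_partitions (set u)" "\<rho>' \<in> ordered_partitions (set u)"
    "\<tau> \<in> ordered_partitions (set v)" "\<rho>'' \<in> ordered_partitions (set v)"
    using subsetD[OF Sh_ordered_partitions 1(2)] subsetD[OF Sh_ordered_partitions 1(3)]
      subsetD[OF Sh_ordered_partitions 2(3)] subsetD[OF Sh_ordered_partitions 2(2)] assms(2) by auto
  ultimately show thesis
    using that 1 2 by blast
qed

lemma set_ins:
  assumes "k < max 1 (length u)" "u \<noteq> []"
  shows "insert m (u ! k) \<in> set (ins m k u)" "u ! k \<in> set u"
    "\<And>U. U \<in> set u \<Longrightarrow> U \<in> set (ins m k u) \<or> insert m U \<in> set (ins m k u)"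
    "\<And>U. U \<in> set (ins m k u) \<Longrightarrow> U \<in> set u \<or> (\<exists>V\<in>set u. U = insert m V)"
proof -
  have k: "k < length u"
    using assms by (cases u) auto
  show "insert m (u ! k) \<in> set (ins m k u)"
    using k assms(2) by (simp add: ins_def set_update_memI)
  show "u ! k \<in> set u"
    using k by simp
  show "U \<in> set (ins m k u) \<or> insert m U \<in> set (ins m k u)" if U: "U \<in> set u" for U
  proof -
    obtain l where l: "l < length u" "u ! l = U"
      using U by (auto simp: in_set_conv_nth)
    then have "u[k := insert m (u ! k)] ! l \<in> set (ins m k u)"
      using assms(2) nth_mem[of l "u[k := insert m (u ! k)]"] by (simp add: ins_def)
    then show ?thesis
      using k l by (cases "l = k") auto
  qed
  show "U \<in> set u \<or> (\<exists>V\<in>set u. U = insert m V)" if U: "U \<in> set (ins m k u)" for U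
  proof -
    have "set (ins m k u) \<subseteq> insert (insert m (u ! k)) (set u)"
      using set_update_subset_insert[of u k "insert m (u ! k)"] assms(2) by (simp only: ins_def if_False)
    then have "U = insert m (u ! k) \<or> U \<in> set u"
      using U by blast
    then show ?thesis
      using nth_mem[OF k] by metis
  qed
qed

text \<open>
  The incidence graph between the blocks of \<open>\<sigma>\<close> and those of \<open>\<rho>\<close> is connected.
\<close>

lemma Sh_pair_connected:
  assumes "distinct w" "\<sigma> \<in> Sh w" "\<rho> \<in> Sh (rev w)" "C \<subseteq> set w"
    and "\<forall>U\<in>set \<sigma> \<union> set \<rho>. U \<subseteq> C \<or> U \<inter> C = {}"
  shows "C = {} \<or> C = set w"
  using assms
proof (induction w arbitrary: \<sigma> \<rho> C rule: word_max_induct)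
  case (max u m v)
  obtain \<sigma>' \<tau> k \<rho>' \<rho>'' i where *: "\<sigma> = \<sigma>' @ ins m k \<tau>" "\<rho> = \<rho>'' @ ins m i \<rho>'"
    "\<sigma>' \<in> Sh u" "\<tau> \<in> Sh v" "\<rho>' \<in> Sh (rev u)" "\<rho>'' \<in> Sh (rev v)"
    "k < max 1 (length \<tau>)" "i < max 1 (length \<rho>')"
    and op: "\<sigma>' \<in> ordered_partitions (set u)" "\<rho>' \<in> ordered_partitions (set u)"
    "\<tau> \<in> ordered_partitions (set v)" "\<rho>'' \<in> ordered_partitions (set v)"
    by (rule Sh_pair_max[OF max(1,2,5,6)])
  have closed: "U \<subseteq> C \<or> U \<inter> C = {}" if "U \<in> set \<sigma>' \<union> set (ins m k \<tau>) \<union> set \<rho>'' \<union> set (ins m i \<rho>')" for U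
    using max.prems(4) that by (auto simp: *(1,2))
  have Eu: "U \<subseteq> set u" if "U \<in> set \<sigma>' \<union> set \<rho>'" for U
    using that op by (auto simp: ordered_partitions_iff)
  have Ev: "U \<subseteq> set v" if "U \<in> set \<tau> \<union> set \<rho>''" for U
    using that op by (auto simp: ordered_partitions_iff)
  have clu: "U \<subseteq> C \<inter> set u \<or> U \<inter> (C \<inter> set u) = {}" if U: "U \<in> set \<sigma>' \<union> set \<rho>'" for U
  proof (cases "U \<in> set \<sigma>'")
    case True
    then show ?thesis
      using closed[of U] Eu[OF U] by auto
  next
    case False
    then have "U \<in> set \<rho>'"
      using U by simp
    then have "U \<in> set (ins m i \<rho>') \<or> insert m U \<in> set (ins m i \<rho>')"
      using set_ins(3)[OF *(8)] by (cases "\<rho>' = []") auto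
    then show ?thesis
      using closed[of U] closed[of "insert m U"] Eu[OF U] by auto
  qed
  have clv: "U \<subseteq> C \<inter> set v \<or> U \<inter> (C \<inter> set v) = {}" if U: "U \<in> set \<tau> \<union> set \<rho>''" for U
  proof (cases "U \<in> set \<rho>''")
    case True
    then show ?thesis
      using closed[of U] Ev[OF U] by auto
  next
    case False
    then have "U \<in> set \<tau>"
      using U by simp
    then have "U \<in> set (ins m k \<tau>) \<or> insert m U \<in> set (ins m k \<tau>)"
      using set_ins(3)[OF *(7)] by (cases "\<tau> = []") auto
    then show ?thesis
      using closed[of U] closed[of "insert m U"] Ev[OF U] by auto
  qed
  have u: "C \<inter> set u = {} \<or> C \<inter> set u = set u"
    using max.IH(1)[OF *(3,5), of "C \<inter> set u"] clu by auto
  have v: "C \<inter> set v = {} \<or> C \<inter> set v = set v"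
    using max.IH(2)[OF *(4,6), of "C \<inter> set v"] clv by auto
  \<comment> \<open>The element \<open>m\<close> shares a block of \<open>\<rho>\<close> with
    letters of \<open>u\<close> and, in \<open>mv\<close>, a block of \<open>\<sigma>\<close> with
    letters of \<open>v\<close>. It ties the connected pieces of \<open>u\<close> and
    \<open>v\<close> together.\<close>
  have mu: "m \<in> C \<longleftrightarrow> C \<inter> set u = set u" if "u \<noteq> []"
  proof -
    have "\<rho>' \<noteq> []"
      using op(2) that by auto
    from set_ins(1,2)[OF *(8) this] have "insert m (\<rho>' ! i) \<subseteq> C \<or> insert m (\<rho>' ! i) \<inter> C = {}" "\<rho>' ! i \<in> set \<rho>'"
      using closed by auto
    moreover have "\<rho>' ! i \<noteq> {}" "\<rho>' ! i \<subseteq> set u"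
      using \<open>\<rho>' ! i \<in> set \<rho>'\<close> op(2) by (auto simp: ordered_partitions_iff)
    ultimately show ?thesis
      using u by blast
  qed
  have mv: "m \<in> C \<longleftrightarrow> C \<inter> set v = set v" if "v \<noteq> []"
  proof -
    have "\<tau> \<noteq> []"
      using op(3) that by auto
    from set_ins(1,2)[OF *(7) this] have "insert m (\<tau> ! k) \<subseteq> C \<or> insert m (\<tau> ! k) \<inter> C = {}" "\<tau> ! k \<in> set \<tau>"
      using closed by auto
    moreover have "\<tau> ! k \<noteq> {}" "\<tau> ! k \<subseteq> set v"
      using \<open>\<tau> ! k \<in> set \<tau>\<close> op(3) by (auto simp: ordered_partitions_iff)
    ultimately show ?thesis
      using v by blast
  qed
  have "C \<subseteq> insert m (set u \<union> set v)"
    using max.prems(3) by auto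
  then show ?case
    using u v mu mv by (cases "m \<in> C"; cases "u = []"; cases "v = []") auto
qed simp

lemma ordered_partitions_disjoint:
  "\<sigma> \<in> ordered_partitions S \<Longrightarrow> U \<in> set \<sigma> \<Longrightarrow> V \<in> set \<sigma> \<Longrightarrow> U \<noteq> V \<Longrightarrow> U \<inter> V = {}"
  by (simp add: ordered_partitions_iff)

lemma ordered_partitions_same_prefix:
  assumes "x @ y = x' @ y'" "x @ y \<in> ordered_partitions S" "\<Union>(set x) = \<Union>(set x')"
  shows "x = x' \<and> y = y'"
proof -
  have *: "z = []" if "x2 = x1 @ z" "x2 @ y2 \<in> ordered_partitions S" "\<Union>(set x2) = \<Union>(set x1)" for x1 x2 z y2
  proof (cases z)
    case (Cons Z zs)
    then have "Z \<noteq> {}" "Z \<in> set x2" "\<forall>U\<in>set x1. U \<inter> Z = {}"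
      using that by (auto simp: ordered_partitions_iff)
    moreover have "Z \<subseteq> \<Union>(set x1)"
      using \<open>Z \<in> set x2\<close> that(3) by blast
    ultimately show ?thesis
      by blast
  qed
  from assms(1) consider z where "x = x' @ z" "z @ y = y'" | z where "x @ z = x'" "y = z @ y'"
    by (auto simp: append_eq_append_conv2)
  then show ?thesis
  proof cases
    case (1 z)
    then show ?thesis
      using *[OF 1(1) assms(2,3)] by simp
  next
    case (2 z)
    then show ?thesis
      using *[OF 2(1)[symmetric] assms(2)[unfolded assms(1)] assms(3)[symmetric]] by simp
  qed
qed

lemma ins_inject':
  assumes "ins m k u = ins m l v" "u \<in> ordered_partitions S" "v \<in> ordered_partitions S" "m \<notin> S"
    "k < max 1 (length u)" "l < max 1 (length v)"
  shows "u = v"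
proof (cases "S = {}")
  case False
  have "u \<noteq> []" "v \<noteq> []"
    using assms(2,3) False by auto
  then have "length u = length v"
    using assms(1) length_ins[of m k u] length_ins[of m l v] by (cases u; cases v) auto
  moreover have "m \<notin> \<Union>(set u)" "m \<notin> \<Union>(set v)"
    using assms(2-4) by (auto simp: ordered_partitions_iff)
  ultimately show ?thesis
    using ins_inject[OF assms(1)] assms(5,6) by blast
qed (use assms in auto)

text \<open>It suffices to recover the letters before \<open>m\<close>. Two candidates are unions of
  initial blocks of \<open>\<sigma>\<close> and hence nested, and connectivity makes them equal;
  then the halves of the configuration agree and the induction hypothesis applies to each.\<close>

lemma Sh_pair_unique:
  assumes "distinct w" "\<sigma> \<in> Sh w" "\<rho> \<in> Sh (rev w)"
    and "distinct w'" "\<sigma> \<in> Sh w'" "\<rho> \<in> Sh (rev w')"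
  shows "w = w'"
  using assms
proof (induction w arbitrary: w' \<sigma> \<rho> rule: word_max_induct)
  case Nil
  then have "length (druns w') = 0"
    using length_shifts[of \<sigma> "{}" "druns w'"] by simp
  then show ?case
    by simp
next
  case (max u m v)
  have "\<sigma> \<in> ordered_partitions (set (u @ m # v))" "\<sigma> \<in> ordered_partitions (set w')"
    using subsetD[OF Sh_ordered_partitions max.prems(1)] subsetD[OF Sh_ordered_partitions max.prems(4)] max by auto
  then have S: "set w' = set (u @ m # v)" and \<sigma>op: "\<sigma> \<in> ordered_partitions (set (u @ m # v))"
    by (auto simp: ordered_partitions_iff)
  have "m \<in> set w'"
    using S by simp
  then obtain u' v' where w': "w' = u' @ m # v'"
    by (meson split_list)
  have d': "distinct (u' @ v')" "m \<notin> set (u' @ v')"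
    using max.prems(3) w' by auto
  have m': "\<forall>x\<in>set (u' @ v'). x < m"
  proof
    fix x assume "x \<in> set (u' @ v')"
    then have "x \<in> set (u @ m # v)" "x \<noteq> m"
      using S w' d'(2) by auto
    then show "x < m"
      using max(1) by auto
  qed
  obtain \<sigma>' \<tau> k \<rho>' \<rho>'' i where *: "\<sigma> = \<sigma>' @ ins m k \<tau>" "\<rho> = \<rho>'' @ ins m i \<rho>'"
    "\<sigma>' \<in> Sh u" "\<tau> \<in> Sh v" "\<rho>' \<in> Sh (rev u)" "\<rho>'' \<in> Sh (rev v)"
    "k < max 1 (length \<tau>)" "i < max 1 (length \<rho>')"
    and op: "\<sigma>' \<in> ordered_partitions (set u)" "\<rho>' \<in> ordered_partitions (set u)"
    "\<tau> \<in> ordered_partitions (set v)" "\<rho>'' \<in> ordered_partitions (set v)"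
    by (rule Sh_pair_max[OF max(1,2) max.prems(1,2)])
  obtain \<sigma>1 \<tau>1 k1 \<rho>1 \<rho>2 i1 where s1: "\<sigma> = \<sigma>1 @ ins m k1 \<tau>1" "\<rho> = \<rho>2 @ ins m i1 \<rho>1"
    "\<sigma>1 \<in> Sh u'" "\<tau>1 \<in> Sh v'" "\<rho>1 \<in> Sh (rev u')" "\<rho>2 \<in> Sh (rev v')"
    "k1 < max 1 (length \<tau>1)" "i1 < max 1 (length \<rho>1)"
    and op1: "\<sigma>1 \<in> ordered_partitions (set u')" "\<rho>1 \<in> ordered_partitions (set u')"
    "\<tau>1 \<in> ordered_partitions (set v')" "\<rho>2 \<in> ordered_partitions (set v')"
    by (rule Sh_pair_max[OF m' d'(1) max.prems(4,5)[unfolded w']])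
  have \<rho>op: "\<rho> \<in> ordered_partitions (set (u @ m # v))"
  proof -
    have "distinct (rev (u @ m # v))"
      using max(1,2) by auto
    from subsetD[OF Sh_ordered_partitions[OF this] max.prems(2)] show ?thesis
      by (simp only: set_rev)
  qed
  text \<open>Of two nested cuts of the same configuration, the difference would be a closed set.\<close>
  have cut: "set ub = set ua"
    if ab: "set ua \<subseteq> set ub" "distinct (ua @ va)" "m \<notin> set (ua @ va)" "m \<notin> set (ub @ vb)"
      "set (ua @ m # va) = set (ub @ m # vb)"
      and a: "\<sigma> = \<sigma>a @ ins m ka \<tau>a" "\<rho> = \<rho>b @ ins m ia \<rho>a" "\<tau>a \<in> Sh va" "\<rho>b \<in> Sh (rev va)"
      "ka < max 1 (length \<tau>a)" "\<tau>a \<in> ordered_partitions (set va)" "\<rho>b \<in> ordered_partitions (set va)"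
      and b: "\<sigma> = \<sigma>c @ ins m kc \<tau>c" "\<rho> = \<rho>d @ ins m ic \<rho>c"
      "\<sigma>c \<in> ordered_partitions (set ub)" "\<rho>d \<in> ordered_partitions (set vb)" "distinct (ub @ vb)"
    for ua va ub vb \<sigma>a \<tau>a ka \<rho>b \<rho>a ia \<sigma>c \<tau>c kc \<rho>c \<rho>d ic
  proof -
    let ?C = "set ub - set ua"
    have sub: "?C \<subseteq> set va"
      using ab by auto
    have \<sigma>cl: "U \<subseteq> set ub \<or> U \<inter> set ub = {}" if "U \<in> set \<sigma>" for U
    proof (cases "U \<in> set \<sigma>c")
      case True
      then show ?thesis
        using b(3) by (auto simp: ordered_partitions_iff)
    next
      case False
      have "U \<inter> V = {}" if "V \<in> set \<sigma>c" for V
      proof (rule ordered_partitions_disjoint[OF \<sigma>op \<open>U \<in> set \<sigma>\<close>])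
        show "V \<in> set \<sigma>"
          using that by (simp add: b(1))
        show "U \<noteq> V"
          using that False by blast
      qed
      moreover have "set ub = \<Union>(set \<sigma>c)"
        using b(3) by (simp add: ordered_partitions_iff)
      ultimately show ?thesis
        by auto
    qed
    have \<rho>cl: "U \<subseteq> set vb \<or> U \<inter> set vb = {}" if "U \<in> set \<rho>" for U
    proof (cases "U \<in> set \<rho>d")
      case True
      then show ?thesis
        using b(4) by (auto simp: ordered_partitions_iff)
    next
      case False
      have "U \<inter> V = {}" if "V \<in> set \<rho>d" for V
      proof (rule ordered_partitions_disjoint[OF \<rho>op \<open>U \<in> set \<rho>\<close>])
        show "V \<in> set \<rho>"
          using that by (simp add: b(2))
        show "U \<noteq> V"
          using that False by blast
      qed
      moreover have "set vb = \<Union>(set \<rho>d)"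
        using b(4) by (simp add: ordered_partitions_iff)
      ultimately show ?thesis
        by auto
    qed
    have "U \<subseteq> ?C \<or> U \<inter> ?C = {}" if U: "U \<in> set \<tau>a \<union> set \<rho>b" for U
    proof -
      have Uv: "U \<subseteq> set va"
        using U a(6,7) by (auto simp: ordered_partitions_iff)
      have dis: "set va \<inter> set ua = {}" "set ub \<inter> set vb = {}" "m \<notin> set ub" "m \<notin> set va"
        using ab b(5) by auto
      show ?thesis
      proof (cases "U \<in> set \<rho>b")
        case True
        then have "U \<subseteq> set vb \<or> U \<inter> set vb = {}"
          using \<rho>cl[of U] a(2) by auto
        moreover have "U \<subseteq> set ub \<union> set vb"
          using Uv ab(5) dis(4) by auto
        ultimately show ?thesis
          using Uv dis by blast
      next
        case False
        then have "U \<in> set \<tau>a"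
          using U by simp
        then have "U \<in> set \<sigma> \<or> insert m U \<in> set \<sigma>"
          using set_ins(3)[OF a(5)] a(1) by (cases "\<tau>a = []") auto
        then have "U \<subseteq> set ub \<or> U \<inter> set ub = {}"
          using \<sigma>cl[of U] \<sigma>cl[of "insert m U"] by auto
        then show ?thesis
          using Uv dis by blast
      qed
    qed
    then have "?C = {} \<or> ?C = set va"
      using Sh_pair_connected[of va \<tau>a \<rho>b ?C] a(3,4) ab(2) sub by auto
    \<comment> \<open>The block of \<open>\<sigma>\<close> with \<open>m\<close> also contains
      letters of \<open>va\<close>. If these were all in \<open>ub\<close>, the block would meet
      \<open>ub\<close> without being contained in it.\<close>
    moreover have "va = []" if "?C = set va"
    proof (rule ccontr)
      assume "va \<noteq> []"
      then have ne: "\<tau>a \<noteq> []"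
        using a(6) by auto
      have "insert m (\<tau>a ! ka) \<in> set \<sigma>" "\<tau>a ! ka \<in> set \<tau>a"
        using set_ins(1,2)[OF a(5) ne] a(1) by auto
      moreover have "\<tau>a ! ka \<noteq> {}" "\<tau>a ! ka \<subseteq> set va"
        using calculation(2) a(6) by (auto simp: ordered_partitions_iff)
      ultimately show False
        using \<sigma>cl[of "insert m (\<tau>a ! ka)"] that ab(4) by auto
    qed
    ultimately show ?thesis
      using ab(1) by auto
  qed
  have m0: "m \<notin> set (u @ v)"
    using max(1) by auto
  have SS: "set (u @ m # v) = set (u' @ m # v')"
    using S w' by simp
  have nested: "set u \<subseteq> set u' \<or> set u' \<subseteq> set u"
  proof -
    have "set u = \<Union>(set \<sigma>')" "set u' = \<Union>(set \<sigma>1)"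
      using op(1) op1(1) by (simp_all add: ordered_partitions_iff)
    moreover have "\<sigma>' @ ins m k \<tau> = \<sigma>1 @ ins m k1 \<tau>1"
      using *(1) s1(1) by simp
    ultimately show ?thesis
      by (auto simp: append_eq_append_conv2)
  qed
  have uu: "set u = set u'"
  proof (cases "set u \<subseteq> set u'")
    case True
    show ?thesis
      using cut[OF True max(2) m0 d'(2) SS *(1,2,4,6,7) op(3,4) s1(1,2) op1(1,4) d'(1)] by simp
  next
    case False
    then have "set u' \<subseteq> set u"
      using nested by simp
    then show ?thesis
      using cut[OF _ d'(1) d'(2) m0 SS[symmetric] s1(1,2,4,6,7) op1(3,4) *(1,2) op(1,4) max(2)] by simp
  qed
  then have vv: "set v = set v'"
    using SS m0 d' max(2) by auto
  have un: "\<Union>(set x) = T" if "x \<in> ordered_partitions T" for x and T :: "nat set"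
    using that by (simp add: ordered_partitions_iff)
  have mu: "m \<notin> set u" "m \<notin> set v"
    using m0 by simp_all
  have 1: "\<sigma>' = \<sigma>1 \<and> ins m k \<tau> = ins m k1 \<tau>1"
  proof (rule ordered_partitions_same_prefix)
    show "\<sigma>' @ ins m k \<tau> = \<sigma>1 @ ins m k1 \<tau>1"
      by (rule trans[OF *(1)[symmetric] s1(1)])
    show "\<sigma>' @ ins m k \<tau> \<in> ordered_partitions (set (u @ m # v))"
      by (rule \<sigma>op[unfolded *(1)])
    show "\<Union>(set \<sigma>') = \<Union>(set \<sigma>1)"
      unfolding un[OF op(1)] un[OF op1(1)] by (rule uu)
  qed
  have 2: "\<tau> = \<tau>1"
    by (rule ins_inject'[OF conjunct2[OF 1] op(3) op1(3)[folded vv] mu(2) *(7) s1(7)])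
  have 3: "\<rho>'' = \<rho>2 \<and> ins m i \<rho>' = ins m i1 \<rho>1"
  proof (rule ordered_partitions_same_prefix)
    show "\<rho>'' @ ins m i \<rho>' = \<rho>2 @ ins m i1 \<rho>1"
      by (rule trans[OF *(2)[symmetric] s1(2)])
    show "\<rho>'' @ ins m i \<rho>' \<in> ordered_partitions (set (u @ m # v))"
      by (rule \<rho>op[unfolded *(2)])
    show "\<Union>(set \<rho>'') = \<Union>(set \<rho>2)"
      unfolding un[OF op(4)] un[OF op1(4)] by (rule vv)
  qed
  have 4: "\<rho>' = \<rho>1"
    by (rule ins_inject'[OF conjunct2[OF 3] op(2) op1(2)[folded uu] mu(1) *(8) s1(8)])
  have d2: "distinct u'" "distinct v'"
    using d'(1) by simp_all
  have "u = u'"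
    by (rule max.IH(1)[OF *(3,5) d2(1)]) (use 1 4 s1(3,5) in simp_all)
  moreover have "v = v'"
    by (rule max.IH(2)[OF *(4,6) d2(2)]) (use 2 3 s1(4,6) in simp_all)
  ultimately have "u = u'" "v = v'"
    by simp_all
  then show ?case
    using w' by simp
qed

text \<open>This makes a configuration a matrix, with at most one entry in each cell. Apart from
  \<open>m\<close>, blocks that meet belong to the same side of \<open>m\<close> in the word, where
  induction applies; if both contain \<open>m\<close>, the other letters of the column are in
  \<open>v\<close> and those of the row in \<open>u\<close>.\<close>

lemma Sh_pair_meet:
  assumes "distinct w" "\<sigma> \<in> Sh w" "\<rho> \<in> Sh (rev w)" "U \<in> set \<sigma>" "V \<in> set \<rho>" "x \<in> U \<inter> V" "y \<in> U \<inter> V"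
  shows "x = y"
  using assms
proof (induction w arbitrary: \<sigma> \<rho> U V rule: word_max_induct)
  case (max u m v)
  obtain \<sigma>' \<tau> k \<rho>' \<rho>'' i where *: "\<sigma> = \<sigma>' @ ins m k \<tau>" "\<rho> = \<rho>'' @ ins m i \<rho>'"
    "\<sigma>' \<in> Sh u" "\<tau> \<in> Sh v" "\<rho>' \<in> Sh (rev u)" "\<rho>'' \<in> Sh (rev v)"
    "k < max 1 (length \<tau>)" "i < max 1 (length \<rho>')"
    and op: "\<sigma>' \<in> ordered_partitions (set u)" "\<rho>' \<in> ordered_partitions (set u)"
    "\<tau> \<in> ordered_partitions (set v)" "\<rho>'' \<in> ordered_partitions (set v)"
    by (rule Sh_pair_max[OF max(1,2) max.prems(1,2)])
  have dis: "set u \<inter> set v = {}" "m \<notin> set u" "m \<notin> set v"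
    using max(1,2) by auto
  have U: "U \<in> set \<sigma>' \<or> U \<in> set \<tau> \<or> U = {m} \<or> (\<exists>T\<in>set \<tau>. U = insert m T)"
    using max.prems(3) set_ins(4)[OF *(7)] unfolding *(1) by (cases "\<tau> = []") (auto simp: ins_def)
  have V: "V \<in> set \<rho>'' \<or> V \<in> set \<rho>' \<or> V = {m} \<or> (\<exists>T\<in>set \<rho>'. V = insert m T)"
    using max.prems(4) set_ins(4)[OF *(8)] unfolding *(2) by (cases "\<rho>' = []") (auto simp: ins_def)
  have sub: "T \<subseteq> set u" if "T \<in> set \<sigma>' \<union> set \<rho>'" for T
    using that op by (auto simp: ordered_partitions_iff)
  have sub': "T \<subseteq> set v" if "T \<in> set \<tau> \<union> set \<rho>''" for T
    using that op by (auto simp: ordered_partitions_iff)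
  define U0 V0 where "U0 = U - {m}" and "V0 = V - {m}"
  have noU: "T - {m} = T" "insert m T - {m} = T" if "T \<subseteq> set u \<or> T \<subseteq> set v" for T
    using that dis by auto
  have U0: "U \<in> set \<sigma>' \<and> U0 = U \<or> U0 \<in> set \<tau> \<or> U0 = {}"
  proof -
    consider "U \<in> set \<sigma>'" | "U \<in> set \<tau>" | "U = {m}" | T where "T \<in> set \<tau>" "U = insert m T"
      using U by blast
    then show ?thesis
      by cases (simp_all add: U0_def noU sub sub')
  qed
  have V0: "V \<in> set \<rho>'' \<and> V0 = V \<or> V0 \<in> set \<rho>' \<or> V0 = {}"
  proof -
    consider "V \<in> set \<rho>''" | "V \<in> set \<rho>'" | "V = {m}" | T where "T \<in> set \<rho>'" "V = insert m T"
      using V by blast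
    then show ?thesis
      by cases (simp_all add: V0_def noU sub sub')
  qed
  show ?case
  proof (cases "m \<in> U \<and> m \<in> V")
    case True
    then have "U \<notin> set \<sigma>'" "V \<notin> set \<rho>''"
      using sub[of U] sub'[of V] dis by auto
    then have "U0 \<subseteq> set v" "V0 \<subseteq> set u"
      using U0 V0 sub sub' by auto
    then have "U \<inter> V \<subseteq> {m}"
      using dis by (auto simp: U0_def V0_def)
    then show ?thesis
      using max.prems(5,6) by auto
  next
    case False
    then have xy: "x \<in> U0 \<inter> V0" "y \<in> U0 \<inter> V0"
      using max.prems(5,6) by (auto simp: U0_def V0_def)
    have "U0 \<noteq> {}" "V0 \<noteq> {}"
      using xy by auto
    then have "U0 \<in> set \<sigma>' \<or> U0 \<in> set \<tau>" "V0 \<in> set \<rho>'' \<or> V0 \<in> set \<rho>'"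
      using U0 V0 by metis+
    then consider (1) "U0 \<in> set \<sigma>'" "V0 \<in> set \<rho>''" | (2) "U0 \<in> set \<sigma>'" "V0 \<in> set \<rho>'"
      | (3) "U0 \<in> set \<tau>" "V0 \<in> set \<rho>''" | (4) "U0 \<in> set \<tau>" "V0 \<in> set \<rho>'"
      by blast
    then show ?thesis
    proof cases
      case 1
      then have "U0 \<subseteq> set u" "V0 \<subseteq> set v"
        using sub[of U0] sub'[of V0] by simp_all
      then show ?thesis
        using xy(1) dis(1) by blast
    next
      case 2
      then show ?thesis
        by (rule max.IH(1)[OF *(3,5) _ _ xy])
    next
      case 3
      then show ?thesis
        by (rule max.IH(2)[OF *(4,6) _ _ xy])
    next
      case 4
      then have "U0 \<subseteq> set v" "V0 \<subseteq> set u"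
        using sub'[of U0] sub[of V0] by simp_all
      then show ?thesis
        using xy(1) dis(1) by blast
    qed
  qed
qed simp

subsection \<open>Configuration matrices\<close>

text \<open>It is applied to intersections with at most one element, which \<open>Min\<close>
  extracts. The value 0 marks an empty cell, so \<open>compatible\<close> keeps 0 out of
  \<open>S\<close>.\<close>

definition cell :: "nat set \<Rightarrow> nat" where
  "cell X = (if X = {} then 0 else Min X)"

definition block_mat :: "nat set list \<Rightarrow> nat set list \<Rightarrow> nat mat" where
  "block_mat \<sigma> \<rho> = mat (length \<rho>) (length \<sigma>) (\<lambda>(i, j). cell (\<rho> ! i \<inter> \<sigma> ! j))"

definition compatible :: "nat set \<Rightarrow> nat set list \<Rightarrow> nat set list \<Rightarrow> bool" where
  "compatible S \<sigma> \<rho> \<longleftrightarrow> finite S \<and> 0 \<notin> S \<and> \<sigma> \<in> ordered_partitions S \<and> \<rho> \<in> ordered_partitions S \<and>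
     (\<forall>U\<in>set \<sigma>. \<forall>V\<in>set \<rho>. \<forall>x\<in>U \<inter> V. \<forall>y\<in>U \<inter> V. x = y)"

lemma compatible_sym: "compatible S \<sigma> \<rho> \<Longrightarrow> compatible S \<rho> \<sigma>"
  unfolding compatible_def by (metis IntD1 IntD2 IntI)

lemma dim_block_mat [simp]: "dim_row (block_mat \<sigma> \<rho>) = length \<rho>" "dim_col (block_mat \<sigma> \<rho>) = length \<sigma>"
  by (simp_all add: block_mat_def)

lemma transpose_block_mat: "transpose_mat (block_mat \<sigma> \<rho>) = block_mat \<rho> \<sigma>"
  by (rule eq_matI) (simp_all add: block_mat_def Int_commute)

lemma block_mat_index: "i < length \<rho> \<Longrightarrow> j < length \<sigma> \<Longrightarrow> block_mat \<sigma> \<rho> $$ (i, j) = cell (\<rho> ! i \<inter> \<sigma> ! j)"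
  by (simp add: block_mat_def)

lemma ordered_partitions_nth_unique:
  assumes "\<sigma> \<in> ordered_partitions S" "i < length \<sigma>" "j < length \<sigma>" "x \<in> \<sigma> ! i" "x \<in> \<sigma> ! j"
  shows "i = j"
proof (rule ccontr)
  assume "i \<noteq> j"
  then have "\<sigma> ! i \<noteq> \<sigma> ! j"
    using assms by (simp add: ordered_partitions_iff nth_eq_iff_index_eq)
  then have "\<sigma> ! i \<inter> \<sigma> ! j = {}"
    using assms by (simp add: ordered_partitions_iff)
  with assms(4,5) show False
    by auto
qed

lemma ordered_partitions_nthE:
  assumes "\<sigma> \<in> ordered_partitions S" "x \<in> S"
  obtains j where "j < length \<sigma>" "x \<in> \<sigma> ! j"
proof -
  have "x \<in> \<Union>(set \<sigma>)"
    using assms by (simp add: ordered_partitions_iff)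
  then show thesis
    using that by (auto simp: in_set_conv_nth)
qed

lemma ordered_partitions_nthD: "\<sigma> \<in> ordered_partitions S \<Longrightarrow> j < length \<sigma> \<Longrightarrow> \<sigma> ! j \<subseteq> S \<and> \<sigma> ! j \<noteq> {}"
  unfolding ordered_partitions_iff by (metis Union_upper nth_mem)

context
  fixes S \<sigma> \<rho>
  assumes c: "compatible S \<sigma> \<rho>"
begin

lemma block_mat_eqI:
  assumes "i < length \<rho>" "j < length \<sigma>" "x \<in> \<rho> ! i" "x \<in> \<sigma> ! j"
  shows "block_mat \<sigma> \<rho> $$ (i, j) = x"
proof -
  have "\<rho> ! i \<in> set \<rho>" "\<sigma> ! j \<in> set \<sigma>"
    using assms by simp_all
  then have "\<rho> ! i \<inter> \<sigma> ! j = {x}"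
    using c assms(3,4) unfolding compatible_def by blast
  then show ?thesis
    using assms by (simp add: block_mat_index cell_def)
qed

lemma block_mat_nonzero:
  assumes "i < length \<rho>" "j < length \<sigma>" "block_mat \<sigma> \<rho> $$ (i, j) \<noteq> 0"
  shows "block_mat \<sigma> \<rho> $$ (i, j) \<in> \<rho> ! i \<and> block_mat \<sigma> \<rho> $$ (i, j) \<in> \<sigma> ! j"
proof -
  obtain x where "x \<in> \<rho> ! i \<inter> \<sigma> ! j"
    using assms by (auto simp: block_mat_index cell_def split: if_splits)
  then show ?thesis
    using block_mat_eqI[OF assms(1,2)] by auto
qed

lemma support_block_mat:
  "(i, j) \<in> support (block_mat \<sigma> \<rho>) \<longleftrightarrow> i < length \<rho> \<and> j < length \<sigma> \<and> \<rho> ! i \<inter> \<sigma> ! j \<noteq> {}"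
proof -
  have "x \<noteq> 0" if "x \<in> \<rho> ! i" "i < length \<rho>" for x
    using that ordered_partitions_nthD[of \<rho> S i] c unfolding compatible_def by (metis subsetD)
  then show ?thesis
    using block_mat_eqI[of i j] block_mat_nonzero[of i j] by (auto simp: support_def)
qed

lemma col_set_block_mat:
  assumes "j < length \<sigma>"
  shows "col_set (block_mat \<sigma> \<rho>) j = \<sigma> ! j"
proof (intro equalityI subsetI)
  fix x assume "x \<in> col_set (block_mat \<sigma> \<rho>) j"
  then obtain i where i: "(i, j) \<in> support (block_mat \<sigma> \<rho>)" "x = block_mat \<sigma> \<rho> $$ (i, j)"
    by (auto simp: col_set_def)
  then have "block_mat \<sigma> \<rho> $$ (i, j) \<noteq> 0" "i < length \<rho>"
    by (auto simp: support_def)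
  then show "x \<in> \<sigma> ! j"
    using block_mat_nonzero[OF _ assms] i(2) by simp
next
  fix x assume x: "x \<in> \<sigma> ! j"
  then have "x \<in> S"
    using ordered_partitions_nthD[OF _ assms] c unfolding compatible_def by blast
  then obtain i where i: "i < length \<rho>" "x \<in> \<rho> ! i"
    using ordered_partitions_nthE[of \<rho> S x] c unfolding compatible_def by blast
  then have "(i, j) \<in> support (block_mat \<sigma> \<rho>)" "x = block_mat \<sigma> \<rho> $$ (i, j)"
    using assms x block_mat_eqI[of i j x] by (auto simp: support_block_mat)
  then show "x \<in> col_set (block_mat \<sigma> \<rho>) j"
    unfolding col_set_def by blast
qed

lemma bij_betw_block_mat: "bij_betw (\<lambda>ij. block_mat \<sigma> \<rho> $$ ij) (support (block_mat \<sigma> \<rho>)) S"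
  unfolding bij_betw_def
proof (intro conjI inj_onI)
  fix a b assume ab: "a \<in> support (block_mat \<sigma> \<rho>)" "b \<in> support (block_mat \<sigma> \<rho>)"
    "block_mat \<sigma> \<rho> $$ a = block_mat \<sigma> \<rho> $$ b"
  obtain i j k l where e: "a = (i, j)" "b = (k, l)"
    by fastforce
  let ?x = "block_mat \<sigma> \<rho> $$ (i, j)"
  have "?x \<in> \<rho> ! i" "?x \<in> \<sigma> ! j" "?x \<in> \<rho> ! k" "?x \<in> \<sigma> ! l" "i < length \<rho>" "k < length \<rho>" "j < length \<sigma>" "l < length \<sigma>"
    using ab block_mat_nonzero[of i j] block_mat_nonzero[of k l] unfolding e by (auto simp: support_def)
  then show "a = b"
    using ordered_partitions_nth_unique[of \<rho> S i k ?x] ordered_partitions_nth_unique[of \<sigma> S j l ?x] c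
    unfolding e compatible_def by blast
next
  show "(\<lambda>ij. block_mat \<sigma> \<rho> $$ ij) ` support (block_mat \<sigma> \<rho>) = S"
  proof (intro equalityI subsetI)
    fix x assume "x \<in> (\<lambda>ij. block_mat \<sigma> \<rho> $$ ij) ` support (block_mat \<sigma> \<rho>)"
    then obtain i j where "(i, j) \<in> support (block_mat \<sigma> \<rho>)" "x = block_mat \<sigma> \<rho> $$ (i, j)"
      by auto
    then have "x \<in> \<rho> ! i" "i < length \<rho>"
      using block_mat_nonzero[of i j] by (auto simp: support_def)
    then show "x \<in> S"
      using ordered_partitions_nthD[of \<rho> S i] c unfolding compatible_def by blast
  next
    fix x assume "x \<in> S"
    then obtain i j where ij: "i < length \<rho>" "x \<in> \<rho> ! i" "j < length \<sigma>" "x \<in> \<sigma> ! j"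
      using ordered_partitions_nthE[of \<rho> S x] ordered_partitions_nthE[of \<sigma> S x] c
      unfolding compatible_def by metis
    then have "(i, j) \<in> support (block_mat \<sigma> \<rho>)" "block_mat \<sigma> \<rho> $$ (i, j) = x"
      using block_mat_eqI[of i j x] by (auto simp: support_block_mat)
    then show "x \<in> (\<lambda>ij. block_mat \<sigma> \<rho> $$ ij) ` support (block_mat \<sigma> \<rho>)"
      by (metis imageI)
  qed
qed

end

lemma support_transpose: "(i, j) \<in> support (transpose_mat F) \<longleftrightarrow> (j, i) \<in> support F"
  by (auto simp: support_def)

lemma col_set_transpose: "col_set (transpose_mat F) i = row_set F i"
proof -
  have "transpose_mat F $$ (k, i) = F $$ (i, k)" if "(i, k) \<in> support F" for k
    using that by (simp add: support_def)
  then show ?thesis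
    unfolding col_set_def row_set_def support_transpose by metis
qed

lemma row_set_block_mat:
  assumes "compatible S \<sigma> \<rho>" "i < length \<rho>"
  shows "row_set (block_mat \<sigma> \<rho>) i = \<rho> ! i"
  using col_set_block_mat[OF compatible_sym[OF assms(1)] assms(2)]
  by (simp add: col_set_transpose flip: transpose_block_mat[of \<sigma> \<rho>])

lemma col_sets_block_mat:
  assumes "compatible S \<sigma> \<rho>"
  shows "map (col_set (block_mat \<sigma> \<rho>)) [0..<length \<sigma>] = \<sigma>"
  by (rule nth_equalityI) (simp_all add: col_set_block_mat[OF assms])

lemma row_sets_block_mat:
  assumes "compatible S \<sigma> \<rho>"
  shows "map (row_set (block_mat \<sigma> \<rho>)) [0..<length \<rho>] = \<rho>"
  by (rule nth_equalityI) (simp_all add: row_set_block_mat[OF assms])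

lemma col_part_block_mat: "compatible S \<sigma> \<rho> \<Longrightarrow> col_part (block_mat \<sigma> \<rho>) = \<sigma>"
  by (simp add: col_part_def col_sets_block_mat)

lemma row_part_block_mat: "compatible S \<sigma> \<rho> \<Longrightarrow> row_part (block_mat \<sigma> \<rho>) = rev \<rho>"
  by (simp add: row_part_def row_sets_block_mat)

section \<open>Moves of matrix entries as moves of blocks\<close>

text \<open>Entries keep their rows, and row \<open>i\<close> has an entry to move exactly when it
  meets \<open>M\<close>. Compatibility of the result guarantees that the entry arrives in a free
  cell.\<close>

lemma shift_right_block_mat:
  assumes c: "compatible S \<sigma> \<rho>" and j: "Suc j < length \<sigma>" and M: "M \<subseteq> \<sigma> ! j"
    and \<sigma>': "\<sigma>' = \<sigma>[j := \<sigma> ! j - M, Suc j := \<sigma> ! Suc j \<union> M]" and c': "compatible S \<sigma>' \<rho>"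
  shows "shift_right M (block_mat \<sigma> \<rho>) = block_mat \<sigma>' \<rho>"
proof (rule eq_matI)
  fix i k assume "i < dim_row (block_mat \<sigma>' \<rho>)" "k < dim_col (block_mat \<sigma>' \<rho>)"
  then have ik: "i < length \<rho>" "k < length \<sigma>"
    by (simp_all add: \<sigma>')
  have M0: "0 \<notin> M"
    using ordered_partitions_nthD[of \<sigma> S j] M j c unfolding compatible_def by auto
  \<comment> \<open>Values are distinct and \<open>M\<close> lies in column \<open>j\<close>, so the
    test by value in \<open>shift_right\<close> can succeed in column \<open>j\<close> only.\<close>
  have e: "block_mat \<sigma> \<rho> $$ (i, l) \<in> M \<longleftrightarrow> l = j \<and> \<rho> ! i \<inter> M \<noteq> {}" if "l < length \<sigma>" for l
  proof
    assume x: "block_mat \<sigma> \<rho> $$ (i, l) \<in> M"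
    then have "block_mat \<sigma> \<rho> $$ (i, l) \<noteq> 0"
      using M0 by metis
    then have "block_mat \<sigma> \<rho> $$ (i, l) \<in> \<rho> ! i" "block_mat \<sigma> \<rho> $$ (i, l) \<in> \<sigma> ! l"
      using block_mat_nonzero[OF c ik(1) that] by auto
    moreover have "block_mat \<sigma> \<rho> $$ (i, l) \<in> \<sigma> ! j"
      using x M by auto
    ultimately show "l = j \<and> \<rho> ! i \<inter> M \<noteq> {}"
      using ordered_partitions_nth_unique[of \<sigma> S l j] that j x c unfolding compatible_def by auto
  next
    assume l: "l = j \<and> \<rho> ! i \<inter> M \<noteq> {}"
    then obtain x where "x \<in> \<rho> ! i" "x \<in> M" "x \<in> \<sigma> ! j"
      using M by blast
    then show "block_mat \<sigma> \<rho> $$ (i, l) \<in> M"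
      using block_mat_eqI[OF c ik(1), of j x] l j by auto
  qed
  have sr: "shift_right M (block_mat \<sigma> \<rho>) $$ (i, k) =
     (if 0 < k \<and> block_mat \<sigma> \<rho> $$ (i, k - 1) \<in> M then block_mat \<sigma> \<rho> $$ (i, k - 1)
      else if block_mat \<sigma> \<rho> $$ (i, k) \<in> M then 0 else block_mat \<sigma> \<rho> $$ (i, k))"
    using ik by (simp add: shift_right_def)
  have k': "k < length \<sigma>'"
    using ik by (simp add: \<sigma>')
  consider "k = Suc j" | "k = j" | "k \<noteq> j" "k \<noteq> Suc j"
    by auto
  then show "shift_right M (block_mat \<sigma> \<rho>) $$ (i, k) = block_mat \<sigma>' \<rho> $$ (i, k)"
  proof cases
    case 1
    have s: "\<sigma>' ! k = \<sigma> ! Suc j \<union> M"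
      using 1 j by (simp add: \<sigma>')
    show ?thesis
    proof (cases "\<rho> ! i \<inter> M = {}")
      case True
      then have "\<rho> ! i \<inter> \<sigma>' ! k = \<rho> ! i \<inter> \<sigma> ! k"
        unfolding s using 1 by blast
      then show ?thesis
        using True e[of j] e[of k] ik j k' 1 unfolding sr by (simp add: block_mat_index)
    next
      case False
      then obtain x where x: "x \<in> \<rho> ! i" "x \<in> M"
        by blast
      then have "block_mat \<sigma> \<rho> $$ (i, j) = x"
        using block_mat_eqI[OF c ik(1), of j x] M j by auto
      moreover have "block_mat \<sigma>' \<rho> $$ (i, k) = x"
        using block_mat_eqI[OF c' ik(1) k', of x] x s by auto
      ultimately show ?thesis
        using x 1 unfolding sr by simp
    qed
  next
    case 2
    have s: "\<sigma>' ! k = \<sigma> ! j - M"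
      using 2 j by (simp add: \<sigma>')
    have n: "\<not> (0 < k \<and> block_mat \<sigma> \<rho> $$ (i, k - 1) \<in> M)"
      using e[of "k - 1"] ik 2 by auto
    show ?thesis
    proof (cases "\<rho> ! i \<inter> M = {}")
      case True
      moreover have "\<sigma>' ! k = \<sigma> ! k - M"
        using s 2 by simp
      ultimately have "\<rho> ! i \<inter> \<sigma>' ! k = \<rho> ! i \<inter> \<sigma> ! k"
        by auto
      then show ?thesis
        unfolding sr if_not_P[OF n] using True e[of k] ik k' by (simp add: block_mat_index)
    next
      case False
      then obtain x where x: "x \<in> \<rho> ! i" "x \<in> M" "x \<in> \<sigma> ! j"
        using M by blast
      have "\<rho> ! i \<in> set \<rho>" "\<sigma> ! j \<in> set \<sigma>"
        using ik j by auto
      then have "\<rho> ! i \<inter> \<sigma> ! j = {x}"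
        using c x unfolding compatible_def by blast
      then have "\<rho> ! i \<inter> \<sigma>' ! k = {}"
        using s x(2) by auto
      then show ?thesis
        unfolding sr if_not_P[OF n] using e[of k] False 2 ik k' by (simp add: block_mat_index cell_def)
    qed
  next
    case 3
    have "\<sigma>' ! k = \<sigma> ! k"
      using 3 by (simp add: \<sigma>')
    moreover have n: "\<not> (0 < k \<and> block_mat \<sigma> \<rho> $$ (i, k - 1) \<in> M)"
      using e[of "k - 1"] ik 3 by auto
    ultimately show ?thesis
      unfolding sr if_not_P[OF n] using e[of k] ik k' 3 by (simp add: block_mat_index)
  qed
qed (simp_all add: shift_right_def \<sigma>')

text \<open>Downward moves are rightward moves of the transpose, which reduces rows to
  columns.\<close>

lemma shift_down_transpose: "shift_down M F = transpose_mat (shift_right M (transpose_mat F))"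
  by (rule eq_matI) (auto simp: shift_down_def shift_right_def)

lemma fold_shift_down_transpose:
  "fold (\<lambda>i. shift_down (N i)) xs F = transpose_mat (fold (\<lambda>i. shift_right (N i)) xs (transpose_mat F))"
  by (induction xs arbitrary: F) (simp_all add: shift_down_transpose)

text \<open>The state after the first \<open>k\<close> moves: blocks before position
  \<open>k\<close> are final, block \<open>k\<close> has received \<open>M k\<close> and not yet
  given anything away.\<close>

definition moved :: "nat set list \<Rightarrow> (nat \<Rightarrow> nat set) \<Rightarrow> nat \<Rightarrow> nat set list" where
  "moved A M k = map (\<lambda>i. if i < k then A ! i \<union> M i - M (Suc i) else if i = k then A ! i \<union> M i else A ! i)
     [0..<length A]"

text \<open>Unlike in \<open>admissible\<close>, the set \<open>M 0\<close> is left free. It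
  corresponds to the incoming set of \<open>shifts\<close>, and the predicate passes to the tail of
  the list.\<close>

definition moves :: "nat set list \<Rightarrow> (nat \<Rightarrow> nat set) \<Rightarrow> bool" where
  "moves A M \<longleftrightarrow> (\<forall>j\<in>{1..<length A}. M j \<subseteq> A ! (j - 1) \<union> M (j - 1) \<and> (\<forall>x\<in>M j. Max (A ! j) < x))"

lemma length_moved [simp]: "length (moved A M k) = length A"
  by (simp add: moved_def)

lemma moved_Cons: "moved (A # As) M (Suc k) = (A \<union> M 0 - M 1) # moved As (\<lambda>i. M (Suc i)) k"
  by (simp add: moved_def map_upt_Suc del: upt_Suc)

lemma moves_Cons_Cons: "moves (A # B # As) M \<longleftrightarrow>
    M 1 \<subseteq> A \<union> M 0 \<and> (\<forall>x\<in>M 1. Max B < x) \<and> moves (B # As) (\<lambda>i. M (Suc i))"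
proof -
  have eq: "{1..<length (A # B # As)} = insert 1 (Suc ` {1..<length (B # As)})"
    by (auto simp: image_Suc_atLeastLessThan)
  have "(M (Suc j) \<subseteq> (A # B # As) ! (Suc j - 1) \<union> M (Suc j - 1) \<and> (\<forall>x\<in>M (Suc j). Max ((A # B # As) ! Suc j) < x)) \<longleftrightarrow>
      (M (Suc j) \<subseteq> (B # As) ! (j - 1) \<union> M (Suc (j - 1)) \<and> (\<forall>x\<in>M (Suc j). Max ((B # As) ! j) < x))"
    if "j \<in> {1..<length (B # As)}" for j
    using that by (cases j) simp_all
  note P = ball_cong[OF refl this]
  show ?thesis
    unfolding moves_def eq ball_simps P by simp
qed

lemma shifts_moved: "A \<noteq> [] \<Longrightarrow> \<sigma> \<in> shifts I A \<longleftrightarrow> (\<exists>M. M 0 = I \<and> moves A M \<and> \<sigma> = moved A M (length A - 1))"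
proof (induction I A arbitrary: \<sigma> rule: shifts.induct)
  case (2 I A)
  show ?case
    by (auto simp: moves_def moved_def intro: exI[of _ "\<lambda>_. I"])
next
  case (3 I A B As)
  have IH: "\<rho> \<in> shifts N (B # As) \<longleftrightarrow> (\<exists>M. M 0 = N \<and> moves (B # As) M \<and> \<rho> = moved (B # As) M (length (B # As) - 1))"
    for \<rho> N
    using 3(1) by simp
  show ?case
  proof
    assume "\<sigma> \<in> shifts I (A # B # As)"
    then obtain M1 \<rho> where *: "\<sigma> = (A \<union> I - M1) # \<rho>" "M1 \<subseteq> A \<union> I" "\<forall>x\<in>M1. Max B < x" "\<rho> \<in> shifts M1 (B # As)"
      by auto
    obtain M where M: "M 0 = M1" "moves (B # As) M" "\<rho> = moved (B # As) M (length (B # As) - 1)"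
      using *(4)[unfolded IH] by (elim exE conjE)
    define M' where "M' = case_nat I M"
    have "M' 0 = I" "moves (A # B # As) M'" "\<sigma> = moved (A # B # As) M' (length (A # B # As) - 1)"
      using * M by (simp_all add: M'_def moves_Cons_Cons moved_Cons)
    then show "\<exists>M. M 0 = I \<and> moves (A # B # As) M \<and> \<sigma> = moved (A # B # As) M (length (A # B # As) - 1)"
      by blast
  next
    assume "\<exists>M. M 0 = I \<and> moves (A # B # As) M \<and> \<sigma> = moved (A # B # As) M (length (A # B # As) - 1)"
    then obtain M where M: "M 0 = I" "moves (A # B # As) M" "\<sigma> = moved (A # B # As) M (length (A # B # As) - 1)"
      by blast
    have "moved (B # As) (\<lambda>i. M (Suc i)) (length (B # As) - 1) \<in> shifts (M 1) (B # As)"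
      unfolding IH using M(2) by (intro exI[of _ "\<lambda>i. M (Suc i)"]) (simp add: moves_Cons_Cons)
    then show "\<sigma> \<in> shifts I (A # B # As)"
      using M by (auto simp: moves_Cons_Cons moved_Cons)
  qed
qed simp

text \<open>Stopping after \<open>k\<close> moves amounts to making only empty moves afterwards.
  Hence every intermediate partition is a shifted partition too, and its blocks still meet those of
  the other direction at most once.\<close>

lemma moved_in_shifts:
  assumes "moves A M" "k < length A"
  shows "moved A M k \<in> shifts (M 0) A"
proof -
  define M' where "M' i = (if i \<le> k then M i else {})" for i
  have "moves A M'"
    unfolding moves_def
  proof
    fix j assume "j \<in> {1..<length A}"
    from bspec[OF assms(1)[unfolded moves_def] this]
    show "M' j \<subseteq> A ! (j - 1) \<union> M' (j - 1) \<and> (\<forall>x\<in>M' j. Max (A ! j) < x)"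
    proof (cases "j \<le> k")
      case True
      then have "M' j = M j" "M' (j - 1) = M (j - 1)"
        by (auto simp: M'_def)
      then show ?thesis
        using \<open>M j \<subseteq> A ! (j - 1) \<union> M (j - 1) \<and> (\<forall>x\<in>M j. Max (A ! j) < x)\<close> by simp
    next
      case False
      then have "M' j = {}"
        by (simp add: M'_def)
      then show ?thesis
        by simp
    qed
  qed
  moreover have "moved A M k = moved A M' (length A - 1)"
    by (rule nth_equalityI) (use assms(2) in \<open>auto simp: moved_def M'_def\<close>)
  moreover have "M' 0 = M 0"
    by (simp add: M'_def)
  moreover have "A \<noteq> []"
    using assms(2) by auto
  ultimately show ?thesis
    by (intro iffD2[OF shifts_moved] exI[of _ M'] conjI)
qed

lemma fold_shift_right:
  assumes "M 0 = {}" "moves A M" "\<forall>k<length A. compatible S (moved A M k) \<rho>" "k < length A"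
  shows "fold (\<lambda>j. shift_right (M j)) [1..<Suc k] (block_mat A \<rho>) = block_mat (moved A M k) \<rho>"
  using assms(4)
proof (induction k)
  case 0
  have "moved A M 0 = A"
    by (rule nth_equalityI) (auto simp: moved_def assms(1))
  then show ?case
    by simp
next
  case (Suc k)
  have "moved A M (Suc k) = (moved A M k)[k := moved A M k ! k - M (Suc k), Suc k := moved A M k ! Suc k \<union> M (Suc k)]"
    using Suc.prems by (intro nth_equalityI) (auto simp: moved_def nth_list_update)
  moreover have "M (Suc k) \<subseteq> moved A M k ! k"
    using bspec[OF assms(2)[unfolded moves_def], of "Suc k"] Suc.prems by (simp add: moved_def)
  ultimately have "shift_right (M (Suc k)) (block_mat (moved A M k) \<rho>) = block_mat (moved A M (Suc k)) \<rho>"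
    using Suc.prems assms(3) by (intro shift_right_block_mat[of S _ _ k]) auto
  then show ?case
    using Suc by simp
qed

text \<open>The witness is the last letter of the run: no descent follows it, so it is at most the
  first letter of the next run.\<close>

lemma druns_consecutive:
  "Suc j < length (druns w) \<Longrightarrow> \<exists>x\<in>druns w ! j. x \<le> Max (druns w ! Suc j)"
proof (induction w arbitrary: j rule: druns.induct)
  case (3 x y w)
  obtain h t where D: "druns (y # w) = h # t"
    by (cases "druns (y # w)") (auto simp: druns_eq_Nil[of "y # w", simplified])
  have y: "y \<in> h" "finite h"
  proof -
    show "y \<in> h"
      using D by (cases w) (auto split: if_splits)
    show "finite h"
      using druns_nonempty[of h "y # w"] D by simp
  qed
  show ?case
  proof (cases "y < x")
    case True
    then have len: "Suc j < length (druns (y # w))"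
      using 3(4) D by simp
    obtain z where "z \<in> druns (y # w) ! j" "z \<le> Max (druns (y # w) ! Suc j)"
      using 3(1)[OF True len] by blast
    then show ?thesis
      using True D by (cases j) auto
  next
    case False
    show ?thesis
    proof (cases j)
      case 0
      have "y \<le> Max h"
        using y by simp
      then have "x \<le> Max h"
        using False by linarith
      then show ?thesis
        using False D 0 by simp
    next
      case (Suc i)
      then have "Suc i < length (druns (y # w))"
        using 3(4) False by simp
      then show ?thesis
        using 3(3)[OF False] False Suc by simp
    qed
  qed
qed auto

lemma admissible_druns: "admissible (druns w) M \<longleftrightarrow> M 0 = {} \<and> moves (druns w) M"
proof -
  have "M j \<subset> druns w ! (j - 1) \<union> M (j - 1)"
    if j: "j \<in> {1..<length (druns w)}" and sub: "M j \<subseteq> druns w ! (j - 1) \<union> M (j - 1)"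
      and gt: "\<forall>x\<in>M j. Max (druns w ! j) < x" for j
  proof -
    obtain i where i: "j = Suc i"
      using j by (cases j) auto
    then obtain x where x: "x \<in> druns w ! i" "x \<le> Max (druns w ! j)"
      using druns_consecutive[of i w] j by auto
    then have "x \<notin> M j"
      using gt by (meson leD)
    moreover have "x \<in> druns w ! (j - 1)"
      using x(1) i by simp
    ultimately show ?thesis
      using sub by blast
  qed
  then have "(M j \<subset> druns w ! (j - 1) \<union> M (j - 1) \<and> (\<forall>x\<in>M j. Max (druns w ! j) < x)) \<longleftrightarrow>
      (M j \<subseteq> druns w ! (j - 1) \<union> M (j - 1) \<and> (\<forall>x\<in>M j. Max (druns w ! j) < x))"
    if "j \<in> {1..<length (druns w)}" for j
    using that by (metis psubset_imp_subset)
  note eq = ball_cong[OF refl this]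
  show ?thesis
    unfolding admissible_def moves_def by (rule conj_cong[OF refl eq])
qed

lemma Sh_compatible:
  assumes "distinct w" "0 \<notin> set w" "\<sigma> \<in> Sh w" "\<rho> \<in> Sh (rev w)"
  shows "compatible (set w) \<sigma> \<rho>"
proof -
  have "distinct (rev w)"
    using assms(1) by simp
  from subsetD[OF Sh_ordered_partitions[OF this] assms(4)] have "\<rho> \<in> ordered_partitions (set w)"
    by (simp only: set_rev)
  moreover have "\<forall>U\<in>set \<sigma>. \<forall>V\<in>set \<rho>. \<forall>x\<in>U \<inter> V. \<forall>y\<in>U \<inter> V. x = y"
  proof (intro ballI)
    fix U V x y assume "U \<in> set \<sigma>" "V \<in> set \<rho>" "x \<in> U \<inter> V" "y \<in> U \<inter> V"
    then show "x = y"
      by (rule Sh_pair_meet[OF assms(1,3,4)])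
  qed
  ultimately show ?thesis
    unfolding compatible_def using subsetD[OF Sh_ordered_partitions[OF assms(1)] assms(3)] assms(2)
    by simp
qed

lemma druns_in_Sh: "druns w \<in> Sh w"
proof (cases "w = []")
  case False
  then have 0: "0 < length (druns w)"
    by simp
  have "moves (druns w) (\<lambda>_. {})"
    by (simp add: moves_def)
  moreover have "moved (druns w) (\<lambda>_. {}) 0 = druns w"
    by (rule nth_equalityI) (auto simp: moved_def)
  ultimately show ?thesis
    using moved_in_shifts[OF _ 0, of "\<lambda>_. {}"] by simp
qed simp

text \<open>The word starts at the bottom left, so its ascending runs are met from the bottom row
  upwards; the runs of the reversed word list the rows from the top.\<close>

definition word_mat :: "nat list \<Rightarrow> nat mat" where
  "word_mat w = block_mat (druns w) (druns (rev w))"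

text \<open>Right shifts keep the row sets and down shifts keep the column sets, so the result is
  built from two independent shifted partitions. At every intermediate stage columns and rows stay
  compatible, which keeps matrices and block lists in correspondence.\<close>

lemma derived_from_word_mat:
  assumes w: "distinct w" "0 \<notin> set w" "w \<noteq> []"
  shows "derived_from (word_mat w) F \<longleftrightarrow> (\<exists>\<sigma>\<in>Sh w. \<exists>\<rho>\<in>Sh (rev w). F = block_mat \<sigma> \<rho>)"
proof -
  let ?A = "druns w" and ?B = "druns (rev w)"
  have AB: "compatible (set w) ?A ?B"
    by (rule Sh_compatible[OF w(1,2) druns_in_Sh druns_in_Sh])
  have ne: "?A \<noteq> []" "?B \<noteq> []"
    using w(3) by simp_all
  have A1: "[1..<length ?A] = [1..<Suc (length ?A - 1)]" and B1: "[1..<length ?B] = [1..<Suc (length ?B - 1)]"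
    using ne by (cases ?A; simp)+
  have right: "fold (\<lambda>j. shift_right (M j)) [1..<length ?A] (word_mat w) = block_mat (moved ?A M (length ?A - 1)) ?B"
    if "M 0 = {}" "moves ?A M" for M
    unfolding A1 word_mat_def
  proof (rule fold_shift_right[OF that, of "set w"])
    show "\<forall>k<length ?A. compatible (set w) (moved ?A M k) ?B"
    proof (intro allI impI)
      fix k assume "k < length ?A"
      from moved_in_shifts[OF that(2) this] have "moved ?A M k \<in> Sh w"
        unfolding that(1) .
      then show "compatible (set w) (moved ?A M k) ?B"
        by (rule Sh_compatible[OF w(1,2) _ druns_in_Sh])
    qed
    show "length ?A - 1 < length ?A"
      using ne by simp
  qed
  have down: "fold (\<lambda>i. shift_down (N i)) [1..<length ?B] (block_mat \<sigma> ?B) = block_mat \<sigma> (moved ?B N (length ?B - 1))"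
    if "N 0 = {}" "moves ?B N" "\<sigma> \<in> Sh w" for N \<sigma>
  proof -
    have "fold (\<lambda>i. shift_right (N i)) [1..<Suc (length ?B - 1)] (block_mat ?B \<sigma>) = block_mat (moved ?B N (length ?B - 1)) \<sigma>"
    proof (rule fold_shift_right[OF that(1,2), of "set w"])
      show "\<forall>k<length ?B. compatible (set w) (moved ?B N k) \<sigma>"
      proof (intro allI impI)
        fix k assume "k < length ?B"
        from moved_in_shifts[OF that(2) this] have "moved ?B N k \<in> Sh (rev w)"
          unfolding that(1) .
        then show "compatible (set w) (moved ?B N k) \<sigma>"
          by (rule compatible_sym[OF Sh_compatible[OF w(1,2) that(3)]])
      qed
      show "length ?B - 1 < length ?B"
        using ne by simp
    qed
    then show ?thesis
      unfolding fold_shift_down_transpose B1 transpose_block_mat by (simp add: transpose_block_mat del: upt_Suc)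
  qed
  have "derived_from (word_mat w) F \<longleftrightarrow> (\<exists>M N. M 0 = {} \<and> moves ?A M \<and> N 0 = {} \<and> moves ?B N \<and>
      F = fold (\<lambda>i. shift_down (N i)) [1..<length ?B] (fold (\<lambda>j. shift_right (M j)) [1..<length ?A] (word_mat w)))"
    using col_sets_block_mat[OF AB] row_sets_block_mat[OF AB]
    unfolding derived_from_def by (simp add: word_mat_def admissible_druns)
  also have "\<dots> \<longleftrightarrow> (\<exists>M N. M 0 = {} \<and> moves ?A M \<and> N 0 = {} \<and> moves ?B N \<and>
      F = block_mat (moved ?A M (length ?A - 1)) (moved ?B N (length ?B - 1)))"
  proof -
    have "fold (\<lambda>i. shift_down (N i)) [1..<length ?B] (fold (\<lambda>j. shift_right (M j)) [1..<length ?A] (word_mat w)) =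
        block_mat (moved ?A M (length ?A - 1)) (moved ?B N (length ?B - 1))"
      if "M 0 = {}" "moves ?A M" "N 0 = {}" "moves ?B N" for M N
    proof -
      have "moved ?A M (length ?A - 1) \<in> Sh w"
        using shifts_moved[OF ne(1), of _ "{}"] that(1,2) by blast
      then show ?thesis
        unfolding right[OF that(1,2)] by (rule down[OF that(3,4)])
    qed
    then show ?thesis
      by (simp cong: conj_cong)
  qed
  also have "\<dots> \<longleftrightarrow> (\<exists>\<sigma>\<in>Sh w. \<exists>\<rho>\<in>Sh (rev w). F = block_mat \<sigma> \<rho>)"
  proof -
    have B: "(\<exists>M. M 0 = {} \<and> moves ?A M \<and> P (moved ?A M (length ?A - 1))) \<longleftrightarrow> (\<exists>\<sigma>\<in>Sh w. P \<sigma>)" for P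
      unfolding Bex_def shifts_moved[OF ne(1)] by blast
    have A: "(\<exists>N. N 0 = {} \<and> moves ?B N \<and> P (moved ?B N (length ?B - 1))) \<longleftrightarrow> (\<exists>\<rho>\<in>Sh (rev w). P \<rho>)" for P
      unfolding Bex_def shifts_moved[OF ne(2)] by blast
    show ?thesis
      unfolding B[symmetric] A[symmetric] by blast
  qed
  finally show ?thesis .
qed

subsection \<open>Step matrices are words\<close>

text \<open>
  Reading a step matrix along its staircase from the bottom left to the top right gives a word;
  \<open>asc w k\<close> and \<open>dsc w k\<close> are the column and the row of its \<open>k\<close>-th letter.
\<close>

definition asc :: "nat list \<Rightarrow> nat \<Rightarrow> nat" where
  "asc w k = card {t. t < k \<and> \<not> w ! Suc t < w ! t}"

definition dsc :: "nat list \<Rightarrow> nat \<Rightarrow> nat" where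
  "dsc w k = card {t. k \<le> t \<and> Suc t < length w \<and> w ! Suc t < w ! t}"

lemma asc_0 [simp]: "asc w 0 = 0"
  by (simp add: asc_def)

lemma asc_Suc: "asc w (Suc k) = asc w k + (if w ! Suc k < w ! k then 0 else 1)"
proof -
  have "{t. t < Suc k \<and> \<not> w ! Suc t < w ! t} =
      (if w ! Suc k < w ! k then {} else {k}) \<union> {t. t < k \<and> \<not> w ! Suc t < w ! t}"
    by (auto simp: less_Suc_eq)
  then show ?thesis
    by (simp add: asc_def)
qed

lemma dsc_Suc: "Suc k < length w \<Longrightarrow> dsc w k = dsc w (Suc k) + (if w ! Suc k < w ! k then 1 else 0)"
proof -
  assume k: "Suc k < length w"
  have "{t. k \<le> t \<and> Suc t < length w \<and> w ! Suc t < w ! t} =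
      (if w ! Suc k < w ! k then {k} else {}) \<union> {t. Suc k \<le> t \<and> Suc t < length w \<and> w ! Suc t < w ! t}"
    using k by (auto simp: Suc_le_eq order.strict_iff_order)
  moreover have "finite {t. Suc k \<le> t \<and> Suc t < length w \<and> w ! Suc t < w ! t}"
    by (rule finite_subset[of _ "{..<length w}"]) auto
  ultimately show ?thesis
    by (simp add: dsc_def)
qed

text \<open>Each step along the staircase goes one column right or one row up, so the column index
  minus the row index grows by one: the \<open>k\<close>-th letter lies on the \<open>k\<close>-th
  diagonal from the bottom left.\<close>

lemma asc_dsc: "k < length w \<Longrightarrow> asc w k + dsc w 0 = k + dsc w k"
  by (induction k) (auto simp: asc_Suc dsc_Suc split: if_splits)

lemma asc_Cons: "w \<noteq> [] \<Longrightarrow> asc (x # w) (Suc k) = (if w ! 0 < x then 0 else 1) + asc w k"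
  by (induction k) (simp_all add: asc_Suc)

lemma druns_asc:
  "w \<noteq> [] \<Longrightarrow> length (druns w) = Suc (asc w (length w - 1)) \<and>
    (\<forall>j<length (druns w). druns w ! j = {w ! k | k. k < length w \<and> asc w k = j})"
proof (induction w rule: druns.induct)
  case (3 x y w)
  let ?v = "y # w"
  obtain h t where D: "druns ?v = h # t"
    by (cases "druns ?v") (auto simp: druns_eq_Nil[of "y # w", simplified])
  have IH: "length (druns ?v) = Suc (asc ?v (length ?v - 1))"
    "\<And>j. j < length (druns ?v) \<Longrightarrow> druns ?v ! j = {?v ! k | k. k < length ?v \<and> asc ?v k = j}"
    using 3 by (cases "y < x"; simp)+
  have A: "asc (x # ?v) (Suc k) = (if y < x then 0 else 1) + asc ?v k" for k
    using asc_Cons[of ?v x k] by simp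
  have L: "length (x # ?v) - 1 = Suc (length ?v - 1)"
    by simp
  have set_Cons: "{(x # ?v) ! k | k. k < length (x # ?v) \<and> asc (x # ?v) k = j} =
      (if j = 0 then {x} else {}) \<union> {?v ! k | k. k < length ?v \<and> (if y < x then 0 else 1) + asc ?v k = j}" for j
  proof (intro equalityI subsetI)
    fix z assume "z \<in> {(x # ?v) ! k | k. k < length (x # ?v) \<and> asc (x # ?v) k = j}"
    then obtain k where k: "z = (x # ?v) ! k" "k < length (x # ?v)" "asc (x # ?v) k = j"
      by blast
    then show "z \<in> (if j = 0 then {x} else {}) \<union> {?v ! k | k. k < length ?v \<and> (if y < x then 0 else 1) + asc ?v k = j}"
    proof (cases k)
      case (Suc l)
      then have "z = ?v ! l" "l < length ?v" "(if y < x then 0 else 1) + asc ?v l = j"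
        using k A[of l] by simp_all
      then show ?thesis
        by blast
    qed simp
  next
    fix z assume z: "z \<in> (if j = 0 then {x} else {}) \<union> {?v ! k | k. k < length ?v \<and> (if y < x then 0 else 1) + asc ?v k = j}"
    show "z \<in> {(x # ?v) ! k | k. k < length (x # ?v) \<and> asc (x # ?v) k = j}"
    proof (cases "j = 0 \<and> z = x")
      case True
      then have "z = (x # ?v) ! 0" "0 < length (x # ?v)" "asc (x # ?v) 0 = j"
        by simp_all
      then show ?thesis
        by blast
    next
      case False
      then obtain l where "z = ?v ! l" "l < length ?v" "(if y < x then 0 else 1) + asc ?v l = j"
        using z by (auto split: if_splits)
      then have "z = (x # ?v) ! Suc l" "Suc l < length (x # ?v)" "asc (x # ?v) (Suc l) = j"
        using A[of l] by simp_all
      then show ?thesis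
        by blast
    qed
  qed
  show ?case
  proof (cases "y < x")
    case True
    have R: "druns (x # ?v) = insert x h # t"
      using True D by simp
    have "length (druns (x # ?v)) = Suc (asc (x # ?v) (length (x # ?v) - 1))"
      unfolding L A R using IH(1) True D by simp
    moreover have "druns (x # ?v) ! j = {(x # ?v) ! k | k. k < length (x # ?v) \<and> asc (x # ?v) k = j}"
      if "j < length (druns (x # ?v))" for j
    proof -
      have "druns (x # ?v) ! j = (if j = 0 then {x} else {}) \<union> druns ?v ! j"
        unfolding R D by (cases j) auto
      also have "druns ?v ! j = {?v ! k | k. k < length ?v \<and> asc ?v k = j}"
        using IH(2)[of j] that R D by simp
      finally show ?thesis
        unfolding set_Cons using True by simp
    qed
    ultimately show ?thesis
      by blast
  next
    case False
    have R: "druns (x # ?v) = {x} # druns ?v"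
      using False by simp
    have "length (druns (x # ?v)) = Suc (asc (x # ?v) (length (x # ?v) - 1))"
      unfolding L A R using IH(1) False by simp
    moreover have "druns (x # ?v) ! j = {(x # ?v) ! k | k. k < length (x # ?v) \<and> asc (x # ?v) k = j}"
      if "j < length (druns (x # ?v))" for j
    proof (cases j)
      case 0
      then show ?thesis
        unfolding set_Cons R using False by simp
    next
      case (Suc i)
      then have "druns (x # ?v) ! j = {?v ! k | k. k < length ?v \<and> asc ?v k = i}"
        using IH(2)[of i] that unfolding R by simp
      then show ?thesis
        unfolding set_Cons using False Suc by simp
    qed
    ultimately show ?thesis
      by blast
  qed
qed auto

text \<open>Reversal exchanges ascents and descents; distinctness excludes equal neighbours, which
  \<open>asc\<close> would count as ascents.\<close>

lemma asc_rev:
  assumes "distinct w" "k < length w"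
  shows "asc (rev w) (length w - Suc k) = dsc w k"
proof -
  let ?f = "\<lambda>t. length w - Suc (Suc t)"
  have "{t. t < length w - Suc k \<and> \<not> rev w ! Suc t < rev w ! t} =
      ?f ` {t. k \<le> t \<and> Suc t < length w \<and> w ! Suc t < w ! t}"
  proof (intro equalityI subsetI)
    fix t assume "t \<in> {t. t < length w - Suc k \<and> \<not> rev w ! Suc t < rev w ! t}"
    then have t: "t < length w - Suc k" "\<not> rev w ! Suc t < rev w ! t"
      by auto
    define s where "s = length w - Suc (Suc t)"
    have s: "k \<le> s" "Suc s < length w" "t = ?f s" "Suc s = length w - Suc t"
      using t(1) by (auto simp: s_def)
    have "rev w ! Suc t = w ! s"
      unfolding s_def using t(1) by (simp add: rev_nth)
    moreover have "rev w ! t = w ! Suc s"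
      unfolding s(4) using t(1) by (simp add: rev_nth)
    moreover have "w ! s \<noteq> w ! Suc s"
      using assms(1) s(2) by (simp add: nth_eq_iff_index_eq)
    ultimately have "w ! Suc s < w ! s"
      using t(2) by simp
    with s(1,2) show "t \<in> ?f ` {t. k \<le> t \<and> Suc t < length w \<and> w ! Suc t < w ! t}"
      by (intro image_eqI[of _ _ s] CollectI conjI) (rule s(3))
  next
    fix t assume "t \<in> ?f ` {t. k \<le> t \<and> Suc t < length w \<and> w ! Suc t < w ! t}"
    then obtain s where s: "t = ?f s" "k \<le> s" "Suc s < length w" "w ! Suc s < w ! s"
      by auto
    have e: "length w - Suc (Suc t) = s" "length w - Suc t = Suc s" "Suc t < length w" "t < length w - Suc k"
      unfolding s(1) using s(2,3) by auto
    have "rev w ! Suc t = w ! s" "rev w ! t = w ! Suc s"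
      using rev_nth[of "Suc t" w] rev_nth[of t w] e by simp_all
    then show "t \<in> {t. t < length w - Suc k \<and> \<not> rev w ! Suc t < rev w ! t}"
      using s(4) e(4) by simp
  qed
  moreover have "inj_on ?f {t. k \<le> t \<and> Suc t < length w \<and> w ! Suc t < w ! t}"
    by (auto simp: inj_on_def)
  ultimately show ?thesis
    by (simp add: asc_def dsc_def card_image)
qed

lemma druns_rev_dsc:
  assumes "distinct w" "w \<noteq> []" "i < length (druns (rev w))"
  shows "druns (rev w) ! i = {w ! k | k. k < length w \<and> dsc w k = i}"
proof -
  have "druns (rev w) ! i = {rev w ! k | k. k < length (rev w) \<and> asc (rev w) k = i}"
    using druns_asc[of "rev w"] assms by simp
  also have "\<dots> = {w ! k | k. k < length w \<and> dsc w k = i}"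
  proof (intro equalityI subsetI)
    fix x assume "x \<in> {rev w ! k | k. k < length (rev w) \<and> asc (rev w) k = i}"
    then obtain k where k: "x = rev w ! k" "k < length w" "asc (rev w) k = i"
      by auto
    define l where "l = length w - Suc k"
    have l: "l < length w" "length w - Suc l = k"
      using k(2) by (auto simp: l_def)
    have "x = w ! l"
      unfolding k(1) l_def using k(2) by (rule rev_nth)
    moreover have "dsc w l = i"
      using asc_rev[OF assms(1) l(1)] unfolding l(2) k(3) by simp
    ultimately show "x \<in> {w ! k | k. k < length w \<and> dsc w k = i}"
      using l(1) by blast
  next
    fix x assume "x \<in> {w ! k | k. k < length w \<and> dsc w k = i}"
    then obtain k where k: "x = w ! k" "k < length w" "dsc w k = i"
      by auto
    have l: "length w - Suc k < length w" "length w - Suc (length w - Suc k) = k"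
      using k(2) by auto
    have "x = rev w ! (length w - Suc k)"
      unfolding rev_nth[OF l(1)] l(2) by (rule k(1))
    moreover have "asc (rev w) (length w - Suc k) = i"
      unfolding asc_rev[OF assms(1) k(2)] by (rule k(3))
    moreover have "length w - Suc k < length (rev w)"
      using l(1) by simp
    ultimately show "x \<in> {rev w ! k | k. k < length (rev w) \<and> asc (rev w) k = i}"
      by blast
  qed
  finally show ?thesis .
qed

lemma asc_mono: "k \<le> l \<Longrightarrow> asc w k \<le> asc w l"
  by (induction l rule: dec_induct) (simp_all add: asc_Suc)

lemma dsc_antimono: "k \<le> l \<Longrightarrow> l < length w \<Longrightarrow> dsc w l \<le> dsc w k"
  by (induction l rule: dec_induct) (auto simp: dsc_Suc split: if_splits)

text \<open>If \<open>dsc\<close> takes the same value at \<open>k\<close> and \<open>l\<close>,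
  there is no descent between them; each step then leads to a larger letter in the next
  column.\<close>

lemma same_row:
  assumes "distinct w" "k \<le> l" "l < length w" "dsc w k = dsc w l"
  shows "(k < l \<longrightarrow> w ! k < w ! l) \<and> asc w l = asc w k + (l - k)"
  using assms(2-)
proof (induction l rule: dec_induct)
  case (step l)
  have "dsc w (Suc l) \<le> dsc w l" "dsc w l \<le> dsc w k"
    using dsc_antimono[of l "Suc l" w] dsc_antimono[of k l w] step.hyps(1) step.prems(1) by simp_all
  then have d: "dsc w k = dsc w l" "dsc w (Suc l) = dsc w l"
    using step.prems(2) by linarith+
  have nd: "\<not> w ! Suc l < w ! l"
    using dsc_Suc[OF step.prems(1)] d(2) by (metis add_cancel_right_right zero_neq_one)
  moreover have "w ! l \<noteq> w ! Suc l"
    using assms(1) step.prems(1) by (simp add: nth_eq_iff_index_eq)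
  ultimately have lt: "w ! l < w ! Suc l"
    by simp
  have IH: "(k < l \<longrightarrow> w ! k < w ! l) \<and> asc w l = asc w k + (l - k)"
    using step.IH step.prems(1) d(1) by simp
  have "asc w (Suc l) = asc w k + (Suc l - k)"
    using IH nd step.hyps by (simp add: asc_Suc)
  moreover have "w ! k < w ! Suc l"
    using IH lt step.hyps(1) by (cases "k = l") auto
  ultimately show ?case
    by blast
qed simp

lemma same_col:
  assumes "k \<le> l" "l < length w" "asc w k = asc w l"
  shows "(k < l \<longrightarrow> w ! l < w ! k) \<and> dsc w k = dsc w l + (l - k)"
  using assms
proof (induction l rule: dec_induct)
  case (step l)
  have "asc w l \<le> asc w (Suc l)" "asc w k \<le> asc w l"
    using asc_mono[of l "Suc l" w] asc_mono[of k l w] step.hyps(1) by simp_all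
  then have d: "asc w k = asc w l" "asc w (Suc l) = asc w l"
    using step.prems(2) by linarith+
  have nd: "w ! Suc l < w ! l"
    using asc_Suc[of w l] d(2) by (metis add_cancel_right_right zero_neq_one)
  have IH: "(k < l \<longrightarrow> w ! l < w ! k) \<and> dsc w k = dsc w l + (l - k)"
    using step.IH step.prems(1) d(1) by simp
  have "dsc w k = dsc w (Suc l) + (Suc l - k)"
    using IH nd step.hyps dsc_Suc[OF step.prems(1)] by simp
  moreover have "w ! Suc l < w ! k"
    using IH nd step.hyps(1) by (cases "k = l") auto
  ultimately show ?case
    by blast
qed simp

context
  fixes w :: "nat list"
  assumes w: "distinct w" "0 \<notin> set w" "w \<noteq> []"
begin

lemma word_mat_compatible: "compatible (set w) (druns w) (druns (rev w))"
  by (rule Sh_compatible[OF w(1,2) druns_in_Sh druns_in_Sh])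

lemma asc_less: "k < length w \<Longrightarrow> asc w k < length (druns w)"
proof -
  assume "k < length w"
  then have "k \<le> length w - 1"
    by simp
  then show ?thesis
    using druns_asc[OF w(3)] asc_mono[of k "length w - 1" w] by (simp add: less_Suc_eq_le)
qed

lemma length_druns_rev_dsc: "length (druns (rev w)) = Suc (dsc w 0)"
  using druns_asc[of "rev w"] asc_rev[OF w(1), of 0] w(3) by simp

lemma dsc_less: "k < length w \<Longrightarrow> dsc w k < length (druns (rev w))"
  using length_druns_rev_dsc dsc_antimono[of 0 k w] by simp

lemma in_druns:
  assumes k: "k < length w"
  shows "w ! k \<in> druns w ! asc w k" "w ! k \<in> druns (rev w) ! dsc w k"
proof -
  have "druns w ! asc w k = {w ! l | l. l < length w \<and> asc w l = asc w k}"
    using druns_asc[OF w(3)] asc_less[OF k] by blast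
  then show "w ! k \<in> druns w ! asc w k"
    using k by blast
  show "w ! k \<in> druns (rev w) ! dsc w k"
    unfolding druns_rev_dsc[OF w(1,3) dsc_less[OF k]] using k by blast
qed

lemma word_mat_entry:
  assumes k: "k < length w"
  shows "word_mat w $$ (dsc w k, asc w k) = w ! k"
  unfolding word_mat_def
  by (rule block_mat_eqI[OF word_mat_compatible dsc_less[OF k] asc_less[OF k] in_druns(2,1)[OF k]])

lemma support_word_mat: "(i, j) \<in> support (word_mat w) \<longleftrightarrow> (\<exists>k<length w. i = dsc w k \<and> j = asc w k)"
proof
  assume "(i, j) \<in> support (word_mat w)"
  then have ij: "i < length (druns (rev w))" "j < length (druns w)" and ne: "druns (rev w) ! i \<inter> druns w ! j \<noteq> {}"
    unfolding word_mat_def support_block_mat[OF word_mat_compatible] by auto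
  from ne obtain x where "x \<in> druns (rev w) ! i" "x \<in> druns w ! j"
    by blast
  moreover have "druns w ! j = {w ! l | l. l < length w \<and> asc w l = j}"
    using druns_asc[OF w(3)] ij(2) by blast
  ultimately obtain k l where kl: "x = w ! k" "k < length w" "dsc w k = i" "x = w ! l" "l < length w" "asc w l = j"
    unfolding druns_rev_dsc[OF w(1,3) ij(1)] by blast
  then have "k = l"
    using w(1) nth_eq_iff_index_eq by metis
  with kl show "\<exists>k<length w. i = dsc w k \<and> j = asc w k"
    by blast
next
  assume "\<exists>k<length w. i = dsc w k \<and> j = asc w k"
  then obtain k where k: "k < length w" "i = dsc w k" "j = asc w k"
    by blast
  then show "(i, j) \<in> support (word_mat w)"
    unfolding word_mat_def support_block_mat[OF word_mat_compatible]
    using in_druns[OF k(1)] asc_less[OF k(1)] dsc_less[OF k(1)] unfolding k(2,3) by blast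
qed

lemma word_mat_row:
  assumes "(i, j) \<in> support (word_mat w)" "(i, l) \<in> support (word_mat w)" "j < l"
  obtains k k' where "k < k'" "k' < length w" "dsc w k = i" "dsc w k' = i" "asc w k = j" "asc w k' = l"
proof -
  obtain k k' where k: "k < length w" "i = dsc w k" "j = asc w k" "k' < length w" "i = dsc w k'" "l = asc w k'"
    using assms by (auto simp: support_word_mat)
  moreover have "k < k'"
    using k assms(3) asc_mono[of k' k w] by (meson leD leI)
  ultimately show thesis
    using that by simp
qed

lemma word_mat_col:
  assumes "(i, j) \<in> support (word_mat w)" "(l, j) \<in> support (word_mat w)" "i < l"
  obtains k k' where "k < k'" "k' < length w" "dsc w k = l" "dsc w k' = i" "asc w k = j" "asc w k' = j"
proof -
  obtain k k' where k: "k < length w" "l = dsc w k" "j = asc w k" "k' < length w" "i = dsc w k'" "j = asc w k'"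
    using assms by (auto simp: support_word_mat)
  moreover have "k < k'"
    using k assms(3) dsc_antimono[of k' k w] by (meson leD leI)
  ultimately show thesis
    using that by simp
qed

lemma ordered_word_mat:
  assumes S: "set w = {1..length w}"
  shows "ordered_matrix (length (druns (rev w))) (length (druns w)) (word_mat w)"
  unfolding ordered_matrix_def
proof (intro conjI allI impI)
  have len: "length (druns w) + length (druns (rev w)) - 1 = length w"
    using length_druns_rev[OF w(1,3)] by simp
  show "bij_betw (\<lambda>ij. word_mat w $$ ij) (support (word_mat w)) {1..length (druns w) + length (druns (rev w)) - 1}"
    unfolding len S[symmetric] word_mat_def by (rule bij_betw_block_mat[OF word_mat_compatible])
  show "row_set (word_mat w) i \<noteq> {}" if "i < length (druns (rev w))" for i
    unfolding word_mat_def row_set_block_mat[OF word_mat_compatible that]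
    using druns_nonempty[of "druns (rev w) ! i" "rev w"] that by simp
  show "col_set (word_mat w) i \<noteq> {}" if "i < length (druns w)" for i
    unfolding word_mat_def col_set_block_mat[OF word_mat_compatible that]
    using druns_nonempty[of "druns w ! i" w] that by simp
  show "word_mat w $$ (i, j) < word_mat w $$ (i, k)"
    if ijk: "(i, j) \<in> support (word_mat w) \<and> (i, k) \<in> support (word_mat w) \<and> j < k" for i j k
  proof -
    obtain a b where ab: "a < b" "b < length w" "dsc w a = i" "dsc w b = i" "asc w a = j" "asc w b = k"
      using word_mat_row[of i j k] ijk by blast
    then show ?thesis
      using word_mat_entry[of a] word_mat_entry[of b] same_row[OF w(1), of a b] by simp
  qed
  show "word_mat w $$ (i, j) < word_mat w $$ (k, j)"
    if ijk: "(i, j) \<in> support (word_mat w) \<and> (k, j) \<in> support (word_mat w) \<and> i < k" for i k j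
  proof -
    obtain a b where ab: "a < b" "b < length w" "dsc w a = k" "dsc w b = i" "asc w a = j" "asc w b = j"
      using word_mat_col[of i j k] ijk by blast
    then show ?thesis
      using word_mat_entry[of a] word_mat_entry[of b] same_col[of a b w] by simp
  qed
  show "word_mat w \<in> carrier_mat (length (druns (rev w))) (length (druns w))"
    by (simp add: word_mat_def block_mat_def)
  show "1 \<le> length (druns (rev w))" "1 \<le> length (druns w)"
    using length_druns_rev_dsc druns_asc[OF w(3)] by simp_all
qed

text \<open>The letters between two letters of one row run through all columns in between, and
  dually for columns. By \<open>asc_dsc\<close> a diagonal holds the letter of exactly one
  position.\<close>

lemma step_word_mat:
  assumes S: "set w = {1..length w}"
  shows "step_matrix (length (druns (rev w))) (length (druns w)) (word_mat w)"
  unfolding step_matrix_def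
proof (intro conjI allI impI ballI)
  show "(i, k) \<in> support (word_mat w)"
    if ijkl: "(i, j) \<in> support (word_mat w) \<and> (i, l) \<in> support (word_mat w) \<and> j < k \<and> k < l" for i j k l
  proof -
    obtain a b where ab: "a < b" "b < length w" "dsc w a = i" "dsc w b = i" "asc w a = j" "asc w b = l"
      by (rule word_mat_row[OF conjunct1[OF ijkl] conjunct1[OF conjunct2[OF ijkl]]]) (use ijkl in auto)
    have "asc w b = asc w a + (b - a)"
      using same_row[OF w(1), of a b] ab by simp
    define t where "t = a + (k - j)"
    have t: "a \<le> t" "t \<le> b" "t < length w"
      using ab ijkl \<open>asc w b = asc w a + (b - a)\<close> by (auto simp: t_def)
    have "dsc w t = i"
      using dsc_antimono[of a t w] dsc_antimono[of t b w] t ab by simp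
    moreover from this have "asc w t = k"
      using same_row[OF w(1), of a t] t ab ijkl by (simp add: t_def)
    ultimately show ?thesis
      using t(3) by (auto simp: support_word_mat)
  qed
  show "(k, j) \<in> support (word_mat w)"
    if ijkl: "(i, j) \<in> support (word_mat w) \<and> (l, j) \<in> support (word_mat w) \<and> i < k \<and> k < l" for j i k l
  proof -
    obtain a b where ab: "a < b" "b < length w" "dsc w a = l" "dsc w b = i" "asc w a = j" "asc w b = j"
      by (rule word_mat_col[OF conjunct1[OF ijkl] conjunct1[OF conjunct2[OF ijkl]]]) (use ijkl in auto)
    have d: "dsc w a = dsc w b + (b - a)"
      using same_col[of a b w] ab by simp
    define t where "t = a + (l - k)"
    have t: "a \<le> t" "t \<le> b" "t < length w"
      using ab ijkl d by (auto simp: t_def)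
    have "asc w t = j"
      using asc_mono[of a t w] asc_mono[of t b w] t ab by simp
    moreover have "dsc w t = k"
    proof -
      have "dsc w a = dsc w t + (t - a)"
        using same_col[OF t(1,3)] ab(5) calculation by simp
      moreover have "t - a = l - k"
        by (simp add: t_def)
      ultimately show ?thesis
        using ab(3) ijkl by linarith
    qed
    ultimately show ?thesis
      using t(3) by (auto simp: support_word_mat)
  qed
  fix d assume d: "d \<in> {1 - int (length (druns (rev w)))..int (length (druns w)) - 1}"
  have len: "length (druns w) + length (druns (rev w)) = length w + 1"
    using length_druns_rev[OF w(1,3)] .
  have diag: "int (asc w k) - int (dsc w k) = int k - int (dsc w 0)" if "k < length w" for k
    using asc_dsc[OF that] by simp
  \<comment> \<open>By \<open>asc_dsc\<close> the letter on diagonal \<open>d\<close> can only be at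
    this position; \<open>dsc w 0\<close> is the index of the bottom row, where the word
    starts.\<close>
  define k where "k = nat (d + int (dsc w 0))"
  have k: "k < length w" "int k - int (dsc w 0) = d"
    using d len length_druns_rev_dsc by (auto simp: k_def)
  show "\<exists>!ij. ij \<in> support (word_mat w) \<and> int (snd ij) - int (fst ij) = d"
  proof (rule ex1I[of _ "(dsc w k, asc w k)"])
    show "(dsc w k, asc w k) \<in> support (word_mat w) \<and> int (snd (dsc w k, asc w k)) - int (fst (dsc w k, asc w k)) = d"
      using k diag by (auto simp: support_word_mat)
    fix ij assume ij: "ij \<in> support (word_mat w) \<and> int (snd ij) - int (fst ij) = d"
    then obtain l where l: "l < length w" "ij = (dsc w l, asc w l)"
      by (cases ij) (auto simp: support_word_mat)
    then have "l = k"
      using ij diag[OF l(1)] k by simp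
    then show "ij = (dsc w k, asc w k)"
      using l by simp
  qed
qed (rule ordered_word_mat[OF S])

end

text \<open>Since entries are distinct, row \<open>i\<close> and column \<open>j\<close> can share a
  value only in their common cell.\<close>

lemma ordered_matrix_block_mat:
  assumes "ordered_matrix q p E"
  shows "E = block_mat (map (col_set E) [0..<p]) (map (row_set E) [0..<q])"
proof (rule eq_matI)
  have dim: "dim_row E = q" "dim_col E = p" and inj: "inj_on (\<lambda>ij. E $$ ij) (support E)"
    using assms by (auto simp: ordered_matrix_def bij_betw_def)
  fix i j assume "i < dim_row (block_mat (map (col_set E) [0..<p]) (map (row_set E) [0..<q]))"
    "j < dim_col (block_mat (map (col_set E) [0..<p]) (map (row_set E) [0..<q]))"
  then have ij: "i < q" "j < p"
    by simp_all
  have "row_set E i \<inter> col_set E j = (if (i, j) \<in> support E then {E $$ (i, j)} else {})"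
  proof -
    have "(i, j) \<in> support E \<and> x = E $$ (i, j)" if r: "x \<in> row_set E i" and c: "x \<in> col_set E j" for x
    proof -
      obtain k l where kl: "(i, k) \<in> support E" "x = E $$ (i, k)" "(l, j) \<in> support E" "x = E $$ (l, j)"
        using r c unfolding row_set_def col_set_def by blast
      have "(i, k) = (l, j)"
        by (rule inj_onD[OF inj _ kl(1,3)]) (simp flip: kl(2,4))
      then show ?thesis
        using kl by simp
    qed
    moreover have "E $$ (i, j) \<in> row_set E i" "E $$ (i, j) \<in> col_set E j" if "(i, j) \<in> support E"
      using that by (auto simp: row_set_def col_set_def)
    ultimately show ?thesis
      by auto
  qed
  then show "E $$ (i, j) = block_mat (map (col_set E) [0..<p]) (map (row_set E) [0..<q]) $$ (i, j)"
    using ij dim by (auto simp: block_mat_index cell_def support_def)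
qed (use assms in \<open>auto simp: ordered_matrix_def\<close>)

text \<open>The word is read off diagonal by diagonal. The point is that entries on consecutive
  diagonals are neighbours in the matrix, which follows from consecutiveness in rows and columns
  together with uniqueness on each diagonal.\<close>

lemma step_matrix_word:
  assumes "step_matrix q p E"
  obtains w where "distinct w" "set w = {1..p + q - 1}" "length (druns w) = p" "length (druns (rev w)) = q"
    "E = word_mat w"
proof -
  define L where "L = p + q - 1"
  have om: "ordered_matrix q p E"
    and rowc: "\<And>i j k l. (i, j) \<in> support E \<Longrightarrow> (i, l) \<in> support E \<Longrightarrow> j < k \<Longrightarrow> k < l \<Longrightarrow> (i, k) \<in> support E"
    and colc: "\<And>i j k l. (i, j) \<in> support E \<Longrightarrow> (l, j) \<in> support E \<Longrightarrow> i < k \<Longrightarrow> k < l \<Longrightarrow> (k, j) \<in> support E"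
    and diag: "\<And>d. d \<in> {1 - int q..int p - 1} \<Longrightarrow> \<exists>!ij. ij \<in> support E \<and> int (snd ij) - int (fst ij) = d"
    using assms unfolding step_matrix_def by blast+
  have qp: "1 \<le> q" "1 \<le> p" and dim: "dim_row E = q" "dim_col E = p"
    and bij: "bij_betw (\<lambda>ij. E $$ ij) (support E) {1..L}"
    and rowi: "\<And>i j k. (i, j) \<in> support E \<Longrightarrow> (i, k) \<in> support E \<Longrightarrow> j < k \<Longrightarrow> E $$ (i, j) < E $$ (i, k)"
    and coli: "\<And>i j k. (i, j) \<in> support E \<Longrightarrow> (k, j) \<in> support E \<Longrightarrow> i < k \<Longrightarrow> E $$ (i, j) < E $$ (k, j)"
    using om unfolding ordered_matrix_def L_def by auto
  have bnd: "i < q \<and> j < p" if "(i, j) \<in> support E" for i j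
    using that dim by (simp add: support_def)
  \<comment> \<open>Diagonals are numbered from the bottom left corner, which lies on diagonal
    \<open>1 - q\<close>; hence the offset \<open>q - 1\<close>.\<close>
  define c where "c k = (THE ij. ij \<in> support E \<and> int (snd ij) - int (fst ij) = int k - (int q - 1))" for k
  define r s where "r k = fst (c k)" and "s k = snd (c k)" for k
  have ex1: "\<exists>!ij. ij \<in> support E \<and> int (snd ij) - int (fst ij) = int k - (int q - 1)" if "k < L" for k
    using that qp by (intro diag) (auto simp: L_def)
  have c: "c k \<in> support E \<and> int (snd (c k)) - int (fst (c k)) = int k - (int q - 1)" if "k < L" for k
    unfolding c_def by (rule theI'[OF ex1[OF that]])
  have rs: "(r k, s k) \<in> support E" "s k + q = Suc k + r k" if "k < L" for k
    using c[OF that] by (auto simp: r_def s_def)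
  have uniq: "i = r k \<and> j = s k" if "(i, j) \<in> support E" "j + q = Suc k + i" "k < L" for i j k
  proof -
    have "int (snd (i, j)) - int (fst (i, j)) = int k - (int q - 1)"
      using that(2) by simp
    then have "(i, j) = c k"
      using ex1[OF that(3)] c[OF that(3)] that(1) by blast
    then show ?thesis
      by (simp add: r_def s_def flip: \<open>(i, j) = c k\<close>)
  qed
  \<comment> \<open>The invariant of the path: every row from \<open>r k\<close> down to the bottom
    and every column up to \<open>s k\<close> has been visited by step \<open>k\<close>. A jump
    would thus return to a row or column that already has an entry.\<close>
  define vis where "vis k \<longleftrightarrow> (\<forall>i. r k \<le> i \<and> i < q \<longrightarrow> (\<exists>k'\<le>k. r k' = i)) \<and> (\<forall>j\<le>s k. \<exists>k'\<le>k. s k' = j)" for k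
  have path: "(r (Suc k) = r k \<and> s (Suc k) = Suc (s k)) \<or> (Suc (r (Suc k)) = r k \<and> s (Suc k) = s k)"
    if k: "Suc k < L" and V: "vis k" for k
  proof -
    have e: "s (Suc k) + q = Suc (Suc k) + r (Suc k)" "s k + q = Suc k + r k"
      and m: "(r (Suc k), s (Suc k)) \<in> support E"
      using rs[of k] rs[of "Suc k"] k by simp_all
    \<comment> \<open>A step downwards reaches a row visited at some \<open>k' < k\<close>. Entries
      of a row are consecutive, so the place left of the new entry is occupied; it lies on diagonal
      \<open>k\<close>, whose only entry is in row \<open>r k\<close>.\<close>
    have "\<not> r k < r (Suc k)"
    proof
      assume gt: "r k < r (Suc k)"
      then obtain k' where k': "k' \<le> k" "r k' = r (Suc k)"
        using V bnd[OF m] unfolding vis_def by (metis less_imp_le)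
      then have "k' < k"
        using gt by (metis le_neq_implies_less less_irrefl)
      then have "(r (Suc k), s k') \<in> support E" "s k' + q = Suc k' + r (Suc k)"
        using rs[of k'] k k' by simp_all
      then have "(r (Suc k), s (Suc k) - 1) \<in> support E" "s (Suc k) - 1 + q = Suc k + r (Suc k)"
        using rowc[of "r (Suc k)" "s k'" "s (Suc k)" "s (Suc k) - 1"] m e(1) \<open>k' < k\<close>
        by (cases "s k' = s (Suc k) - 1"; simp)+
      then have "r (Suc k) = r k"
        using uniq[of "r (Suc k)" "s (Suc k) - 1" k] k by simp
      then show False
        using gt by simp
    qed
    \<comment> \<open>A step upwards by more than one row leads left to a visited column; now the
      place below the new entry is occupied and lies on diagonal \<open>k\<close>.\<close>
    moreover have "\<not> Suc (r (Suc k)) < r k"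
    proof
      assume lt: "Suc (r (Suc k)) < r k"
      then have "s (Suc k) < s k"
        using e by simp
      then obtain k' where k': "k' \<le> k" "s k' = s (Suc k)"
        using V unfolding vis_def by (metis less_imp_le)
      then have "k' < k"
        using \<open>s (Suc k) < s k\<close> by (metis le_neq_implies_less less_irrefl)
      then have "(r k', s (Suc k)) \<in> support E" "s (Suc k) + q = Suc k' + r k'"
        using rs[of k'] k k' by simp_all
      then have "(Suc (r (Suc k)), s (Suc k)) \<in> support E"
        using colc[of "r (Suc k)" "s (Suc k)" "r k'" "Suc (r (Suc k))"] m e(1) \<open>k' < k\<close>
        by (cases "r k' = Suc (r (Suc k))"; simp)
      then have "s (Suc k) = s k"
        using uniq[of "Suc (r (Suc k))" "s (Suc k)" k] k e(1) by simp
      then show False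
        using \<open>s (Suc k) < s k\<close> by simp
    qed
    ultimately have "r (Suc k) = r k \<or> Suc (r (Suc k)) = r k"
      by linarith
    then show ?thesis
      using e by auto
  qed
  have L: "0 < L"
    using qp by (simp add: L_def)
  \<comment> \<open>The first diagonal consists of the bottom left corner alone.\<close>
  have start: "r 0 = q - 1" "s 0 = 0"
    using rs[OF L] bnd[OF rs(1)[OF L]] by auto
  have V: "vis k" if "k < L" for k
    using that
  proof (induction k)
    case 0
    then show ?case
      using start by (auto simp: vis_def)
  next
    case (Suc k)
    then have V: "vis k"
      by simp
    have "\<exists>k'\<le>Suc k. r k' = i" if "r (Suc k) \<le> i" "i < q" for i
    proof (cases "i = r (Suc k)")
      case False
      then have "r k \<le> i"
        using path[OF Suc.prems V] that by auto
      then show ?thesis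
        using V that(2) unfolding vis_def by (meson le_SucI)
    qed blast
    moreover have "\<exists>k'\<le>Suc k. s k' = j" if "j \<le> s (Suc k)" for j
    proof (cases "j = s (Suc k)")
      case False
      then have "j \<le> s k"
        using path[OF Suc.prems V] that by auto
      then show ?thesis
        using V unfolding vis_def by (meson le_SucI)
    qed blast
    ultimately show ?case
      unfolding vis_def by blast
  qed
  define w where "w = map (\<lambda>k. E $$ (r k, s k)) [0..<L]"
  have len: "length w = L" and nth: "\<And>k. k < L \<Longrightarrow> w ! k = E $$ (r k, s k)"
    by (simp_all add: w_def)
  have s_asc: "s k = asc w k" if "k < L" for k
    using that
  proof (induction k)
    case (Suc k)
    then have k: "k < L" "s k = asc w k" and m: "(r k, s k) \<in> support E" "(r (Suc k), s (Suc k)) \<in> support E"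
      using rs(1)[of k] rs(1)[of "Suc k"] by simp_all
    from path[OF Suc.prems V[OF k(1)]] show ?case
    proof
      assume a: "r (Suc k) = r k \<and> s (Suc k) = Suc (s k)"
      then have "w ! k < w ! Suc k"
        using rowi[of "r k" "s k" "Suc (s k)"] m Suc.prems by (simp add: nth)
      then show ?thesis
        using a k by (simp add: asc_Suc)
    next
      assume a: "Suc (r (Suc k)) = r k \<and> s (Suc k) = s k"
      then have "w ! Suc k < w ! k"
        using coli[of "r (Suc k)" "s k" "r k"] m Suc.prems by (simp add: nth)
      then show ?thesis
        using a k by (simp add: asc_Suc)
    qed
  qed (simp add: start)
  have supp: "\<exists>k<L. i = r k \<and> j = s k" if "(i, j) \<in> support E" for i j
  proof -
    define k where "k = j + q - Suc i"
    have "k < L" "j + q = Suc k + i"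
      using bnd[OF that] by (auto simp: k_def L_def)
    then show ?thesis
      using uniq[OF that] by blast
  qed
  have "set w = (\<lambda>ij. E $$ ij) ` support E"
  proof (intro equalityI subsetI)
    fix x assume "x \<in> set w"
    then obtain k where "k < L" "x = E $$ (r k, s k)"
      by (auto simp: w_def)
    then show "x \<in> (\<lambda>ij. E $$ ij) ` support E"
      using rs(1)[of k] by blast
  next
    fix x assume "x \<in> (\<lambda>ij. E $$ ij) ` support E"
    then obtain i j where "(i, j) \<in> support E" "x = E $$ (i, j)"
      by auto
    then obtain k where "k < L" "x = E $$ (r k, s k)"
      using supp by blast
    then show "x \<in> set w"
      by (auto simp: w_def)
  qed
  then have set_w: "set w = {1..L}"
    using bij by (simp add: bij_betw_def)
  then have dist: "distinct w"
    by (intro card_distinct) (simp add: len)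
  have ne: "w \<noteq> []"
    using len L by auto
  \<comment> \<open>Likewise the last diagonal consists of the top right corner, so the number of
    ascents is \<open>p - 1\<close>.\<close>
  have last: "s (L - 1) + q = L + r (L - 1)" "s (L - 1) < p"
    using rs[of "L - 1"] bnd[OF rs(1), of "L - 1"] L by simp_all
  then have "asc w (L - 1) = p - 1"
    using s_asc[of "L - 1"] L by (simp add: L_def)
  then have p: "length (druns w) = p"
    using druns_asc[OF ne] qp by (simp add: len)
  then have q: "length (druns (rev w)) = q"
    using length_druns_rev[OF dist ne] qp by (simp add: len L_def)
  have "dsc w 0 = q - 1"
    using druns_asc[of "rev w"] asc_rev[OF dist, of 0] ne q by simp
  then have r_dsc: "r k = dsc w k" if "k < L" for k
    using asc_dsc[of k w] rs(2)[OF that] s_asc[OF that] that qp by (simp add: len)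
  have "map (col_set E) [0..<p] = druns w"
  proof (rule nth_equalityI)
    fix j assume "j < length (map (col_set E) [0..<p])"
    then have j: "j < p"
      by simp
    have "col_set E j = {w ! k | k. k < length w \<and> asc w k = j}"
    proof (intro equalityI subsetI)
      fix x assume "x \<in> col_set E j"
      then obtain i where i: "(i, j) \<in> support E" "x = E $$ (i, j)"
        by (auto simp: col_set_def)
      then obtain k where "k < L" "i = r k" "j = s k"
        using supp by blast
      then have "x = w ! k" "k < length w" "asc w k = j"
        using i s_asc by (simp_all add: nth len)
      then show "x \<in> {w ! k | k. k < length w \<and> asc w k = j}"
        by blast
    next
      fix x assume "x \<in> {w ! k | k. k < length w \<and> asc w k = j}"
      then obtain k where "x = w ! k" "k < L" "asc w k = j"
        by (auto simp: len)
      then have "x = E $$ (r k, j)" "(r k, j) \<in> support E"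
        using rs(1)[of k] s_asc[of k] by (simp_all add: nth)
      then show "x \<in> col_set E j"
        unfolding col_set_def by blast
    qed
    moreover have "druns w ! j = {w ! k | k. k < length w \<and> asc w k = j}"
      using druns_asc[OF ne] j unfolding p by blast
    moreover have "map (col_set E) [0..<p] ! j = col_set E j"
      using j by simp
    ultimately show "map (col_set E) [0..<p] ! j = druns w ! j"
      by simp
  qed (simp add: p)
  moreover have "map (row_set E) [0..<q] = druns (rev w)"
  proof (rule nth_equalityI)
    fix i assume "i < length (map (row_set E) [0..<q])"
    then have i: "i < q"
      by simp
    have "row_set E i = {w ! k | k. k < length w \<and> dsc w k = i}"
    proof (intro equalityI subsetI)
      fix x assume "x \<in> row_set E i"
      then obtain j where j: "(i, j) \<in> support E" "x = E $$ (i, j)"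
        by (auto simp: row_set_def)
      then obtain k where "k < L" "i = r k" "j = s k"
        using supp by blast
      then have "x = w ! k" "k < length w" "dsc w k = i"
        using j r_dsc by (simp_all add: nth len)
      then show "x \<in> {w ! k | k. k < length w \<and> dsc w k = i}"
        by blast
    next
      fix x assume "x \<in> {w ! k | k. k < length w \<and> dsc w k = i}"
      then obtain k where "x = w ! k" "k < L" "dsc w k = i"
        by (auto simp: len)
      then have "x = E $$ (i, s k)" "(i, s k) \<in> support E"
        using rs(1)[of k] r_dsc[of k] by (simp_all add: nth)
      then show "x \<in> row_set E i"
        unfolding row_set_def by blast
    qed
    moreover have "druns (rev w) ! i = {w ! k | k. k < length w \<and> dsc w k = i}"
      by (rule druns_rev_dsc[OF dist ne]) (simp only: q i)
    moreover have "map (row_set E) [0..<q] ! i = row_set E i"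
      using i by simp
    ultimately show "map (row_set E) [0..<q] ! i = druns (rev w) ! i"
      by simp
  qed (simp add: q)
  ultimately have "E = word_mat w"
    using ordered_matrix_block_mat[OF om] by (simp add: word_mat_def)
  then show thesis
    using that dist set_w p q by (simp add: L_def)
qed

section \<open>From configuration matrices to words\<close>

lemma config_matrices_words:
  assumes "1 \<le> q" "1 \<le> p"
  shows "F \<in> config_matrices q p \<longleftrightarrow> (\<exists>w \<sigma> \<rho>. distinct w \<and> set w = {1..p + q - 1} \<and> length (druns w) = p \<and>
    length (druns (rev w)) = q \<and> \<sigma> \<in> Sh w \<and> \<rho> \<in> Sh (rev w) \<and> F = block_mat \<sigma> \<rho>)"
proof
  assume "F \<in> config_matrices q p"
  then obtain E where E: "step_matrix q p E" "derived_from E F"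
    by (auto simp: config_matrices_def)
  obtain w where w: "distinct w" "set w = {1..p + q - 1}" "length (druns w) = p" "length (druns (rev w)) = q" "E = word_mat w"
    by (rule step_matrix_word[OF E(1)])
  have "w \<noteq> []" "0 \<notin> set w"
    using w(2,3) assms by auto
  then have "\<exists>\<sigma>\<in>Sh w. \<exists>\<rho>\<in>Sh (rev w). F = block_mat \<sigma> \<rho>"
    using derived_from_word_mat[OF w(1)] E(2) w(5) by simp
  then show "\<exists>w \<sigma> \<rho>. distinct w \<and> set w = {1..p + q - 1} \<and> length (druns w) = p \<and>
    length (druns (rev w)) = q \<and> \<sigma> \<in> Sh w \<and> \<rho> \<in> Sh (rev w) \<and> F = block_mat \<sigma> \<rho>"
    using w(1-4) by (elim bexE) (intro exI conjI)
next
  assume "\<exists>w \<sigma> \<rho>. distinct w \<and> set w = {1..p + q - 1} \<and> length (druns w) = p \<and>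
    length (druns (rev w)) = q \<and> \<sigma> \<in> Sh w \<and> \<rho> \<in> Sh (rev w) \<and> F = block_mat \<sigma> \<rho>"
  then obtain w \<sigma> \<rho> where w: "distinct w" "set w = {1..p + q - 1}" "length (druns w) = p"
    "length (druns (rev w)) = q" "\<sigma> \<in> Sh w" "\<rho> \<in> Sh (rev w)" "F = block_mat \<sigma> \<rho>"
    by (elim exE conjE)
  have ne: "w \<noteq> []" "0 \<notin> set w"
    using w(2,3) assms by auto
  have "length w = p + q - 1"
    using distinct_card[OF w(1)] w(2) by simp
  then have "step_matrix q p (word_mat w)"
    using step_word_mat[OF w(1) ne(2,1)] w by simp
  moreover have "derived_from (word_mat w) F"
    unfolding derived_from_word_mat[OF w(1) ne(2,1)] by (rule bexI[OF _ w(5)], rule bexI[OF _ w(6)], rule w(7))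
  ultimately show "F \<in> config_matrices q p"
    unfolding config_matrices_def by (intro CollectI exI conjI)
qed

text \<open>A matrix determines its column and row sets, and these determine the word by
  \<open>Sh_pair_unique\<close>. So the step matrix behind a configuration matrix is well
  defined.\<close>

lemma block_mat_inject:
  assumes "distinct w" "0 \<notin> set w" "\<sigma> \<in> Sh w" "\<rho> \<in> Sh (rev w)"
    and "distinct w'" "0 \<notin> set w'" "\<sigma>' \<in> Sh w'" "\<rho>' \<in> Sh (rev w')"
    and "block_mat \<sigma> \<rho> = block_mat \<sigma>' \<rho>'"
  shows "w = w' \<and> \<sigma> = \<sigma>' \<and> \<rho> = \<rho>'"
proof -
  have 1: "\<sigma> = \<sigma>'"
    using col_part_block_mat[OF Sh_compatible[OF assms(1-4)]] col_part_block_mat[OF Sh_compatible[OF assms(5-8)]]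
      assms(9) by simp
  have "rev \<rho> = rev \<rho>'"
    using row_part_block_mat[OF Sh_compatible[OF assms(1-4)]] row_part_block_mat[OF Sh_compatible[OF assms(5-8)]]
      assms(9) by simp
  then have 2: "\<rho> = \<rho>'"
    by simp
  have "w = w'"
    by (rule Sh_pair_unique[OF assms(1,3,4,5)]) (use assms(7,8) 1 2 in simp_all)
  with 1 2 show ?thesis
    by simp
qed

text \<open>Here the choice in \<open>source_step\<close> is evaluated: a step matrix from which the
  given matrix is derived comes from a word, and this word must be \<open>w\<close>.\<close>

lemma csgn_block_mat:
  assumes w: "distinct w" "set w = {1..length w}" "w \<noteq> []" and \<sigma>: "\<sigma> \<in> Sh w" and \<rho>: "\<rho> \<in> Sh (rev w)"
  shows "csgn (block_mat \<sigma> \<rho>) = wsgn w \<sigma> (rev \<rho>)"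
proof -
  let ?F = "block_mat \<sigma> \<rho>"
  have w0: "0 \<notin> set w"
    using w(2) by auto
  have len: "length \<sigma> = length (druns w)" "length \<rho> = length (druns (rev w))"
    using length_shifts[OF \<sigma>] length_shifts[OF \<rho>] .
  have "source_step ?F = word_mat w"
    unfolding source_step_def
  proof (rule some_equality)
    have "derived_from (word_mat w) ?F"
      unfolding derived_from_word_mat[OF w(1) w0 w(3)] by (rule bexI[OF bexI[OF refl \<rho>] \<sigma>])
    then show "step_matrix (dim_row ?F) (dim_col ?F) (word_mat w) \<and> derived_from (word_mat w) ?F"
      using step_word_mat[OF w(1) w0 w(3,2)] by (simp add: len)
  next
    fix E assume E: "step_matrix (dim_row ?F) (dim_col ?F) E \<and> derived_from E ?F"
    obtain w' where w': "distinct w'" "set w' = {1..dim_col ?F + dim_row ?F - 1}" "length (druns w') = dim_col ?F" "E = word_mat w'"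
      by (rule step_matrix_word[OF conjunct1[OF E]])
    have "dim_col ?F \<noteq> 0"
      using w(3) by (simp add: len)
    then have "w' \<noteq> []"
      using w'(3) by auto
    have w'0: "0 \<notin> set w'"
      using w'(2) by auto
    have "\<exists>\<sigma>'\<in>Sh w'. \<exists>\<rho>'\<in>Sh (rev w'). ?F = block_mat \<sigma>' \<rho>'"
      using E w'(4) derived_from_word_mat[OF w'(1) w'0 \<open>w' \<noteq> []\<close>] by simp
    then obtain \<sigma>' \<rho>' where "\<sigma>' \<in> Sh w'" "\<rho>' \<in> Sh (rev w')" "?F = block_mat \<sigma>' \<rho>'"
      by (elim bexE)
    then have "w = w'"
      using block_mat_inject[OF w(1) w0 \<sigma> \<rho> w'(1) w'0] by simp
    then show "E = word_mat w"
      using w'(4) by simp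
  qed
  moreover have "col_part (word_mat w) = druns w"
    unfolding word_mat_def by (rule col_part_block_mat[OF Sh_compatible[OF w(1) w0 druns_in_Sh druns_in_Sh]])
  moreover have "col_part ?F = \<sigma>" "row_part ?F = rev \<rho>"
    using col_part_block_mat row_part_block_mat Sh_compatible[OF w(1) w0 \<sigma> \<rho>] by blast+
  ultimately show ?thesis
    by (simp add: csgn_def wsgn_def sgn2_def len algebra_simps)
qed

text \<open>The double sum over \<open>q\<close> and matrices becomes one sum over triples
  \<open>(w, \<sigma>, \<rho>)\<close>; the number \<open>q\<close> of rows is the number of
  ascending runs of \<open>w\<close>.\<close>

theorem perm_diag_top_set_diag: "perm_diag_top n = set_diag {1..n + 1}"
proof -
  let ?P = "permutations_of_set {1..n + 1}"
  let ?X = "Sigma ?P (\<lambda>w. Sh w \<times> Sh (rev w))"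
  let ?J = "\<lambda>(w :: nat list, \<sigma>, \<rho>). block_mat \<sigma> \<rho>"
  let ?C = "\<lambda>q. config_matrices q (n + 2 - q)"
  let ?g = "\<lambda>F. frag_cmul (csgn F) (frag_of (col_part F, row_part F))"
  have P: "distinct w" "set w = {1..n + 1}" "0 \<notin> set w" "w \<noteq> []" "length w = n + 1" if "w \<in> ?P" for w
  proof -
    show *: "distinct w" "set w = {1..n + 1}"
      using that by (auto simp: permutations_of_set_def)
    then show "0 \<notin> set w" "w \<noteq> []" "length w = n + 1"
      using distinct_card[OF *(1)] by auto
  qed
  have inj: "inj_on ?J ?X"
  proof (rule inj_onI)
    fix x y assume xy: "x \<in> ?X" "y \<in> ?X" "?J x = ?J y"
    obtain w \<sigma> \<rho> w' \<sigma>' \<rho>' where e: "x = (w, \<sigma>, \<rho>)" "y = (w', \<sigma>', \<rho>')"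
      by (metis prod_cases3)
    then have m: "w \<in> ?P" "w' \<in> ?P" "\<sigma> \<in> Sh w" "\<rho> \<in> Sh (rev w)" "\<sigma>' \<in> Sh w'" "\<rho>' \<in> Sh (rev w')"
      using xy(1,2) by auto
    show "x = y"
      using block_mat_inject[OF P(1,3)[OF m(1)] m(3,4) P(1,3)[OF m(2)] m(5,6)] xy(3) e by simp
  qed
  have C: "F \<in> ?C q \<longleftrightarrow> (\<exists>x\<in>?X. F = ?J x \<and> length (druns (rev (fst x))) = q)" if q: "q \<in> {1..n + 1}" for F q
  proof -
    have q': "1 \<le> q" "1 \<le> n + 2 - q" "n + 2 - q + q - 1 = n + 1"
      using q by auto
    show ?thesis
      unfolding config_matrices_words[OF q'(1,2)] q'(3)
    proof
      assume "\<exists>w \<sigma> \<rho>. distinct w \<and> set w = {1..n + 1} \<and> length (druns w) = n + 2 - q \<and>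
        length (druns (rev w)) = q \<and> \<sigma> \<in> Sh w \<and> \<rho> \<in> Sh (rev w) \<and> F = block_mat \<sigma> \<rho>"
      then obtain w \<sigma> \<rho> where *: "distinct w" "set w = {1..n + 1}" "length (druns (rev w)) = q"
        "\<sigma> \<in> Sh w" "\<rho> \<in> Sh (rev w)" "F = block_mat \<sigma> \<rho>"
        by (elim exE conjE)
      then have "(w, \<sigma>, \<rho>) \<in> ?X"
        by (simp add: permutations_of_set_def)
      with * show "\<exists>x\<in>?X. F = ?J x \<and> length (druns (rev (fst x))) = q"
        by (intro bexI[of _ "(w, \<sigma>, \<rho>)"]) simp_all
    next
      assume "\<exists>x\<in>?X. F = ?J x \<and> length (druns (rev (fst x))) = q"
      then obtain w \<sigma> \<rho> where *: "w \<in> ?P" "\<sigma> \<in> Sh w" "\<rho> \<in> Sh (rev w)" "F = block_mat \<sigma> \<rho>" "length (druns (rev w)) = q"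
        by auto
      moreover have "length (druns w) = n + 2 - q"
        using length_druns_rev[OF P(1,4)[OF *(1)]] P(5)[OF *(1)] *(5) by simp
      ultimately show "\<exists>w \<sigma> \<rho>. distinct w \<and> set w = {1..n + 1} \<and> length (druns w) = n + 2 - q \<and>
        length (druns (rev w)) = q \<and> \<sigma> \<in> Sh w \<and> \<rho> \<in> Sh (rev w) \<and> F = block_mat \<sigma> \<rho>"
        using P(1,2)[OF *(1)] by (intro exI conjI)
    qed
  qed
  have finX: "finite ?X"
  proof (rule finite_SigmaI)
    show "finite (Sh w \<times> Sh (rev w))" if "w \<in> ?P" for w
      using finite_Sh[of w] finite_Sh[of "rev w"] P(1)[OF that] by simp
  qed simp
  have U: "(\<Union>q\<in>{1..n + 1}. ?C q) = ?J ` ?X"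
  proof (intro equalityI subsetI)
    fix F assume "F \<in> (\<Union>q\<in>{1..n + 1}. ?C q)"
    then show "F \<in> ?J ` ?X"
      using C by blast
  next
    fix F assume "F \<in> ?J ` ?X"
    then obtain x where x: "x \<in> ?X" "F = ?J x"
      by blast
    define w where "w = fst x"
    have w: "w \<in> ?P"
      using x(1) by (auto simp: w_def)
    define q where "q = length (druns (rev w))"
    have "druns w \<noteq> []" "druns (rev w) \<noteq> []"
      using P(4)[OF w] by simp_all
    then have "1 \<le> length (druns w)" "1 \<le> q"
      by (simp_all add: q_def Suc_le_eq del: druns_eq_Nil)
    then have q: "q \<in> {1..n + 1}"
      using length_druns_rev[OF P(1,4)[OF w]] P(5)[OF w] by (simp add: q_def)
    then have "F \<in> ?C q"
      unfolding C[OF q] using x by (intro bexI[of _ x]) (simp_all add: q_def w_def)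
    with q show "F \<in> (\<Union>q\<in>{1..n + 1}. ?C q)"
      by blast
  qed
  have "perm_diag_top n = (\<Sum>F\<in>(\<Union>q\<in>{1..n + 1}. ?C q). ?g F)"
    unfolding perm_diag_top_def
  proof (rule sum.UNION_disjoint[symmetric])
    show "\<forall>q\<in>{1..n + 1}. finite (?C q)"
    proof
      fix q assume "q \<in> {1..n + 1}"
      then have "?C q \<subseteq> ?J ` ?X"
        using U by blast
      then show "finite (?C q)"
        using finX finite_subset by blast
    qed
    show "\<forall>q\<in>{1..n + 1}. \<forall>q'\<in>{1..n + 1}. q \<noteq> q' \<longrightarrow> ?C q \<inter> ?C q' = {}"
    proof (intro ballI impI equals0I)
      fix q q' F assume q: "q \<in> {1..n + 1}" "q' \<in> {1..n + 1}" "q \<noteq> q'" and F: "F \<in> ?C q \<inter> ?C q'"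
      obtain x where x: "x \<in> ?X" "F = ?J x" "length (druns (rev (fst x))) = q"
        using iffD1[OF C[OF q(1)] IntD1[OF F]] by (elim bexE conjE)
      obtain y where y: "y \<in> ?X" "F = ?J y" "length (druns (rev (fst y))) = q'"
        using iffD1[OF C[OF q(2)] IntD2[OF F]] by (elim bexE conjE)
      have "x = y"
        by (rule inj_onD[OF inj _ x(1) y(1)]) (rule trans[OF x(2)[symmetric] y(2)])
      then show False
        using x(3) y(3) q(3) by simp
    qed
  qed simp
  also have "\<dots> = (\<Sum>x\<in>?X. ?g (?J x))"
    unfolding U by (rule sum.reindex[OF inj, unfolded comp_def])
  also have "\<dots> = (\<Sum>w\<in>?P. \<Sum>(\<sigma>, \<rho>)\<in>Sh w \<times> Sh (rev w). ?g (block_mat \<sigma> \<rho>))"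
    by (subst sum.Sigma) (auto simp: case_prod_unfold finite_Sh P(1))
  also have "\<dots> = set_diag {1..n + 1}"
    unfolding set_diag_def word_diag_def sum.cartesian_product
  proof (intro sum.cong refl)
    fix w x assume w: "w \<in> ?P" and x: "x \<in> Sh w \<times> Sh (rev w)"
    obtain \<sigma> \<rho> where x': "x = (\<sigma>, \<rho>)" "\<sigma> \<in> Sh w" "\<rho> \<in> Sh (rev w)"
      using x by auto
    have c: "compatible (set w) \<sigma> \<rho>"
      by (rule Sh_compatible[OF P(1,3)[OF w] x'(2,3)])
    have "csgn (block_mat \<sigma> \<rho>) = wsgn w \<sigma> (rev \<rho>)"
      by (rule csgn_block_mat[OF P(1)[OF w] _ P(4)[OF w] x'(2,3)]) (simp add: P(2,5)[OF w])
    then show "(case x of (\<sigma>, \<rho>) \<Rightarrow> ?g (block_mat \<sigma> \<rho>)) = (case x of (\<sigma>, \<rho>) \<Rightarrow> frag_cmul (wsgn w \<sigma> (rev \<rho>)) (frag_of (\<sigma>, rev \<rho>)))"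
      by (simp add: x'(1) col_part_block_mat[OF c] row_part_block_mat[OF c])
  qed
  finally show ?thesis .
qed

subsection \<open>The cube\<close>

lemma cube_dim_simps [simp]:
  "cube_dim [] = 0" "cube_dim (e # c) = interval_dim e + cube_dim c" "cube_dim (c @ d) = cube_dim c + cube_dim d"
  by (simp_all add: cube_dim_def)

definition interval_bd :: "interval_cell \<Rightarrow> (interval_cell list \<Rightarrow>\<^sub>0 int)" where
  "interval_bd e = frag_extend (\<lambda>e'. frag_of [e']) (interval_boundary e)"

lemma interval_bd_simps [simp]:
  "interval_bd End0 = 0" "interval_bd End1 = 0" "interval_bd Edge = frag_of [End1] - frag_of [End0]"
  by (simp_all add: interval_bd_def frag_extend_diff)

lemma cube_boundary_cell_Cons': "cube_boundary_cell (e # c) = concat_product (interval_bd e) (frag_of c) +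
    frag_cmul ((-1) ^ interval_dim e) (concat_product (frag_of [e]) (cube_boundary_cell c))"
  by (simp add: concat_product_def interval_bd_def frag_extend_extend)

lemma cube_boundary_cell_append: "cube_boundary_cell (c @ d) = concat_product (cube_boundary_cell c) (frag_of d) +
    frag_cmul ((-1) ^ cube_dim c) (concat_product (frag_of c) (cube_boundary_cell d))"
proof (induction c)
  case (Cons e c)
  have "concat_product (frag_of [e]) (concat_product (frag_of c) x) = concat_product (frag_of (e # c)) x" for x
    by (simp flip: concat_product_assoc)
  then show ?case
    by (simp add: cube_boundary_cell_Cons' Cons concat_product_add_left concat_product_add_right
        concat_product_cmul_left concat_product_cmul_right concat_product_assoc frag_cmul_distrib2
        power_add add.assoc del: cube_boundary_cell.simps(2))
qed simp

lemma cube_boundary_cell_keys: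
  "Poly_Mapping.keys (cube_boundary_cell c) \<subseteq> {d. length d = length c \<and> cube_dim d + 1 = cube_dim c}"
proof (induction c)
  case (Cons e c)
  have "Poly_Mapping.keys (interval_bd e) \<subseteq> {d. length d = 1 \<and> cube_dim d + 1 = interval_dim e}"
    by (cases e) (auto simp: keys_frag_of dest: subsetD[OF keys_diff])
  with Cons show ?case
    unfolding cube_boundary_cell_Cons'
    by (intro keys_add_subset keys_frag_cmul_subset keys_concat_product) (auto simp: keys_frag_of dest!: subsetD)
qed simp

lemma dg_words_cube: "dg_words cube_dim cube_boundary_cell"
proof
  show "cube_boundary_cell (u @ v) = concat_product (cube_boundary_cell u) (frag_of v) +
      frag_cmul ((-1) ^ cube_dim u) (concat_product (frag_of u) (cube_boundary_cell v))" for u v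
    by (rule cube_boundary_cell_append)
  show "cube_dim x + 1 = cube_dim u" if "x \<in> Poly_Mapping.keys (cube_boundary_cell u)" for x u
    using subsetD[OF cube_boundary_cell_keys that] by simp
  show "frag_extend cube_boundary_cell (cube_boundary_cell [e]) = 0" for e
    unfolding cube_boundary_cell_Cons'
    by (cases e) (simp_all add: frag_extend_diff cube_boundary_cell_Cons' del: cube_boundary_cell.simps(2))
qed simp

interpretation cube: dg_words cube_dim cube_boundary_cell
  by (rule dg_words_cube)

lemma cube_boundary_cell_single [simp]: "cube_boundary_cell [e] = interval_bd e"
  by (simp add: cube_boundary_cell_Cons' del: cube_boundary_cell.simps(2))

text \<open>In the boundary of the two terms of an edge, \<open>[End0]\<close> paired with
  \<open>[End1]\<close> occurs twice with opposite signs; the diagonals of the two endpoints are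
  left.\<close>

lemma dg_words_coproduct_cube: "dg_words_coproduct cube_dim cube_boundary_cell interval_diag UNIV"
proof
  show "cube_dim a + cube_dim b = cube_dim [v]" if "(a, b) \<in> Poly_Mapping.keys (interval_diag v)" for v a b
    using that by (cases v) (auto simp: keys_frag_of dest!: subsetD[OF Poly_Mapping.keys_add])
  show "frag_extend (\<lambda>u. foldr (\<lambda>U. bar_product cube_dim (interval_diag U)) u (frag_of ([], []))) (cube_boundary_cell [v]) =
      cube.tbd (interval_diag v)" for v
    by (cases v) (simp_all add: frag_extend_diff cube.tbd_add cube.tbd_frag_of tensor_diff_left tensor_diff_right
        del: cube_boundary_cell.simps(2))
qed simp

interpretation cube: dg_words_coproduct cube_dim cube_boundary_cell interval_diag UNIV
  by (rule dg_words_coproduct_cube)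

lemma cube_copc_keys: "Poly_Mapping.keys (cube.copc c) \<subseteq> cube_cells (length c) \<times> cube_cells (length c)"
proof (induction c)
  case (Cons e c)
  have "length a = 1 \<and> length b = 1" if "(a, b) \<in> Poly_Mapping.keys (interval_diag e)" for a b
    using that by (cases e) (auto simp: keys_frag_of dest!: subsetD[OF Poly_Mapping.keys_add])
  with Cons show ?case
    unfolding cube.copc_Cons by (intro keys_bar_product) (force simp: cube_cells_def)
qed (simp add: cube_cells_def keys_frag_of)

lemma cube_diag_eq: "cube_diag = cube.cop" "cube_boundary = cube.bd"
  by (simp_all add: fun_eq_iff cube_diag_def cube_boundary_def cube_diag_cell_def[abs_def] cube.copc_def[abs_def])

lemma dg_coalgebra_cube: "dg_coalgebra (cube_cells n) cube_dim cube_boundary cube_diag"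
  unfolding cube_diag_eq
proof (rule cube.dg_coalgebra_words)
  show "Poly_Mapping.keys (cube_boundary_cell u) \<subseteq> cube_cells n" if "u \<in> cube_cells n" for u
    using cube_boundary_cell_keys[of u] that by (auto simp: cube_cells_def)
  show "Poly_Mapping.keys (cube.copc u) \<subseteq> cube_cells n \<times> cube_cells n" if "u \<in> cube_cells n" for u
    using cube_copc_keys[of u] that by (auto simp: cube_cells_def)
qed simp

subsection \<open>The projection under removal of the largest element\<close>

text \<open>A recursive form of the order of blocks used in \<open>rho_cell\<close>, suited to
  concatenation of words.\<close>

primrec before :: "nat set list \<Rightarrow> nat \<Rightarrow> nat \<Rightarrow> bool" where
  "before [] i j \<longleftrightarrow> False"
| "before (A # u) i j \<longleftrightarrow> i \<in> A \<and> j \<in> \<Union>(set u) \<or> before u i j"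

lemma before_append: "before (u @ v) i j \<longleftrightarrow> before u i j \<or> (i \<in> \<Union>(set u) \<and> j \<in> \<Union>(set v)) \<or> before v i j"
  by (induction u) auto

lemma before_iff: "before u i i' \<longleftrightarrow> (\<exists>j k. j < k \<and> k < length u \<and> i \<in> u ! j \<and> i' \<in> u ! k)"
proof (induction u)
  case (Cons A u)
  have "(\<exists>j k. j < k \<and> k < length (A # u) \<and> i \<in> (A # u) ! j \<and> i' \<in> (A # u) ! k) \<longleftrightarrow>
      (\<exists>k<length u. i \<in> A \<and> i' \<in> u ! k) \<or> (\<exists>j k. j < k \<and> k < length u \<and> i \<in> u ! j \<and> i' \<in> u ! k)"
    (is "?L \<longleftrightarrow> ?R")
  proof
    assume ?L
    then obtain j k where jk: "j < k" "k < length (A # u)" "i \<in> (A # u) ! j" "i' \<in> (A # u) ! k"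
      by blast
    then obtain k' where k': "k = Suc k'"
      by (cases k) auto
    show ?R
      using jk k' by (cases j) auto
  next
    assume ?R
    then show ?L
    proof
      assume "\<exists>k<length u. i \<in> A \<and> i' \<in> u ! k"
      then obtain k where "k < length u" "i \<in> A" "i' \<in> u ! k"
        by blast
      then show ?L
        by (intro exI[of _ 0] exI[of _ "Suc k"]) simp
    next
      assume "\<exists>j k. j < k \<and> k < length u \<and> i \<in> u ! j \<and> i' \<in> u ! k"
      then obtain j k where "j < k" "k < length u" "i \<in> u ! j" "i' \<in> u ! k"
        by blast
      then show ?L
        by (intro exI[of _ "Suc j"] exI[of _ "Suc k"]) simp
    qed
  qed
  moreover have "(\<exists>k<length u. i \<in> A \<and> i' \<in> u ! k) \<longleftrightarrow> i \<in> A \<and> i' \<in> \<Union>(set u)"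
    by (auto simp: in_set_conv_nth) (metis nth_mem)
  ultimately show ?case
    using Cons by simp
qed simp

definition end_cell :: "nat set list \<Rightarrow> nat \<Rightarrow> interval_cell" where
  "end_cell u i = (if \<exists>A \<in> set u. i \<in> A \<and> Suc i \<in> A then Edge else if before u i (Suc i) then End0 else End1)"

lemma rho_cell_end_cell: "rho_cell n u = map (end_cell u) [1..<n + 1]"
  by (simp only: rho_cell_def end_cell_def[abs_def] before_iff Suc_eq_plus1)

definition intervals :: "nat set list \<Rightarrow> bool" where
  "intervals u \<longleftrightarrow> (\<forall>A\<in>set u. \<exists>a b. A = {a..b})"

definition rho_face :: "nat \<Rightarrow> nat set list \<Rightarrow> (interval_cell list \<Rightarrow>\<^sub>0 int)" where
  "rho_face n u = (if intervals u then frag_cmul (list_sign (edge_indices u)) (frag_of (rho_cell n u)) else 0)"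

lemma rho_chain_face: "rho_chain n = frag_extend (rho_face n)"
  by (simp add: rho_chain_def rho_face_def[abs_def] intervals_def)

definition edges :: "nat set \<Rightarrow> nat set" where
  "edges A = {i \<in> A. Suc i \<in> A}"

lemma edge_indices_append: "edge_indices (u @ v) = edge_indices u @ edge_indices v"
  by (simp add: edge_indices_def)

lemma edge_indices_Cons: "edge_indices (A # u) = sorted_list_of_set (edges A) @ edge_indices u"
  by (simp add: edge_indices_def edges_def)

lemma edge_indices_props:
  "u \<in> ordered_partitions S \<Longrightarrow> finite S \<Longrightarrow> distinct (edge_indices u) \<and> set (edge_indices u) \<subseteq> S \<and>
    (intervals u \<longrightarrow> length (edge_indices u) = part_dim u)"
proof (induction u arbitrary: S)
  case (Cons A u)
  then have A: "A \<noteq> {}" "A \<subseteq> S" "u \<in> ordered_partitions (S - A)"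
    by (simp_all add: ordered_partitions_Cons)
  have IH: "distinct (edge_indices u)" "set (edge_indices u) \<subseteq> S - A"
    "intervals u \<Longrightarrow> length (edge_indices u) = part_dim u"
    using Cons.IH[OF A(3)] Cons.prems(2) by simp_all
  have "finite A"
    using A(2) Cons.prems(2) by (rule finite_subset)
  have e: "edges A \<subseteq> A" "finite (edges A)"
    using \<open>finite A\<close> by (auto simp: edges_def)
  have "card (edges A) = card A - 1" if "A = {a..b}" for a b
  proof -
    have "edges A = {a..<b}"
      unfolding that edges_def by auto
    then show ?thesis
      using that A(1) by simp
  qed
  then have "card (edges A) = card A - 1" if "intervals (A # u)"
    using that by (auto simp: intervals_def)
  moreover have "intervals u" if "intervals (A # u)"
    using that by (simp add: intervals_def)
  ultimately show ?case
    using IH e A(2) by (auto simp: edge_indices_Cons)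
qed (simp add: edge_indices_def)

lemma edge_indices_Suc: "x \<in> set (edge_indices u) \<Longrightarrow> Suc x \<in> \<Union>(set u)"
proof (induction u)
  case (Cons A u)
  have "set (sorted_list_of_set (edges A)) \<subseteq> edges A"
    by (cases "finite (edges A)") simp_all
  then show ?case
    using Cons by (auto simp: edge_indices_Cons edges_def)
qed (simp add: edge_indices_def)

text \<open>Adds the last coordinate of the cube. The element \<open>N + 1\<close> enters only the
  restriction to \<open>{N, N + 1}\<close>, so removing it from a face removes this
  coordinate.\<close>

definition snoc :: "interval_cell \<Rightarrow> (interval_cell list \<Rightarrow>\<^sub>0 int) \<Rightarrow> (interval_cell list \<Rightarrow>\<^sub>0 int)" where
  "snoc e x = concat_product x (frag_of [e])"

lemma snoc_simps [simp]: "snoc e 0 = 0" "snoc e (x + y) = snoc e x + snoc e y" "snoc e (x - y) = snoc e x - snoc e y"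
  "snoc e (frag_cmul k x) = frag_cmul k (snoc e x)" "snoc e (frag_of c) = frag_of (c @ [e])"
  by (simp_all add: snoc_def concat_product_add_left concat_product_diff_left concat_product_cmul_left)

text \<open>Describes a face \<open>a @ w @ b\<close> on \<open>{1..N}\<close> around the place
  where \<open>N + 1\<close> is inserted. The three letter sets are recorded because the projection
  depends on which of them contains \<open>N\<close>.\<close>

definition three_parts :: "nat \<Rightarrow> nat set \<Rightarrow> nat set \<Rightarrow> nat set \<Rightarrow> bool" where
  "three_parts N P W Q \<longleftrightarrow> 1 \<le> N \<and> P \<union> W \<union> Q = {1..N} \<and> P \<inter> W = {} \<and> P \<inter> Q = {} \<and> W \<inter> Q = {}"

lemma three_partsD:
  assumes "three_parts N P W Q"
  shows "finite P" "finite W" "finite Q" "P \<subseteq> {1..N}" "W \<subseteq> {1..N}" "Q \<subseteq> {1..N}" "Suc N \<notin> P" "Suc N \<notin> W" "Suc N \<notin> Q"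
    "N \<in> P \<or> N \<in> W \<or> N \<in> Q" "1 \<le> N" "P \<inter> W = {}" "P \<inter> Q = {}" "W \<inter> Q = {}" "P \<union> W \<union> Q = {1..N}"
proof -
  have s: "P \<union> W \<union> Q = {1..N}" "1 \<le> N"
    using assms by (simp_all add: three_parts_def)
  then show sub: "P \<subseteq> {1..N}" "W \<subseteq> {1..N}" "Q \<subseteq> {1..N}"
    by blast+
  show "finite P" "finite W" "finite Q"
    using sub by (simp_all add: finite_subset)
  show "Suc N \<notin> P" "Suc N \<notin> W" "Suc N \<notin> Q"
    using sub by auto
  have "N \<in> P \<union> W \<union> Q"
    unfolding s(1) using s(2) by simp
  then show "N \<in> P \<or> N \<in> W \<or> N \<in> Q"
    by blast
qed (use assms in \<open>simp_all add: three_parts_def\<close>)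

lemma end_cell_skip:
  assumes "i \<noteq> m" "Suc i \<noteq> m"
  shows "end_cell (a @ insert m T # b) i = end_cell (a @ T # b) i"
proof -
  have "(\<exists>A\<in>set (a @ insert m T # b). i \<in> A \<and> Suc i \<in> A) \<longleftrightarrow> (\<exists>A\<in>set (a @ T # b). i \<in> A \<and> Suc i \<in> A)"
    using assms by auto
  moreover have "before (a @ insert m T # b) i (Suc i) \<longleftrightarrow> before (a @ T # b) i (Suc i)"
    using assms by (simp add: before_append)
  ultimately show ?thesis
    unfolding end_cell_def by (simp only:)
qed

lemma end_cell_empty: "end_cell (a @ {} # b) i = end_cell (a @ b) i"
proof -
  have "(\<exists>A\<in>set (a @ {} # b). i \<in> A \<and> Suc i \<in> A) \<longleftrightarrow> (\<exists>A\<in>set (a @ b). i \<in> A \<and> Suc i \<in> A)"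
    by auto
  moreover have "before (a @ {} # b) i (Suc i) \<longleftrightarrow> before (a @ b) i (Suc i)"
    by (simp add: before_append)
  ultimately show ?thesis
    unfolding end_cell_def by (simp only:)
qed

lemma rho_cell_insert:
  assumes "1 \<le> N"
  shows "rho_cell N (a @ insert (Suc N) T # b) =
    rho_cell (N - 1) (a @ T # b) @ [end_cell (a @ insert (Suc N) T # b) N]"
proof -
  have "[1..<N + 1] = [1..<N - 1 + 1] @ [N]"
    using assms by (cases N) simp_all
  moreover have "map (end_cell (a @ insert (Suc N) T # b)) [1..<N - 1 + 1] = map (end_cell (a @ T # b)) [1..<N - 1 + 1]"
    by (rule map_cong[OF refl], rule end_cell_skip) auto
  ultimately show ?thesis
    unfolding rho_cell_end_cell by (simp only: map_append list.map)
qed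

lemma rho_cell_empty: "rho_cell N (a @ {} # b) = rho_cell N (a @ b)"
  unfolding rho_cell_end_cell by (rule map_cong[OF refl end_cell_empty])

lemma op_notin: "u \<in> ordered_partitions S \<Longrightarrow> x \<notin> S \<Longrightarrow> A \<in> set u \<Longrightarrow> x \<notin> A"
  by (auto simp: ordered_partitions_iff)

lemma op_Union: "u \<in> ordered_partitions S \<Longrightarrow> \<Union>(set u) = S"
  by (simp add: ordered_partitions_iff)

lemma before_notin: "j \<notin> \<Union>(set u) \<Longrightarrow> \<not> before u i j"
  by (induction u) auto

text \<open>A block \<open>{N + 1}\<close> contains no edge index and leaves the sign alone. The new
  coordinate is a vertex, decided by whether \<open>N\<close> comes before it.\<close>

lemma rho_face_single:
  assumes t: "three_parts N P {} Q" and a: "a \<in> ordered_partitions P" and b: "b \<in> ordered_partitions Q"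
  shows "rho_face N (a @ {Suc N} # b) = snoc (if N \<in> P then End0 else End1) (rho_face (N - 1) (a @ b))"
proof -
  note D = three_partsD[OF t]
  have "intervals (a @ {Suc N} # b) \<longleftrightarrow> intervals (a @ b)"
    unfolding intervals_def by auto (metis atLeastAtMost_singleton)+
  moreover have "edge_indices (a @ {Suc N} # b) = edge_indices (a @ b)"
  proof -
    have "edges {Suc N} = {}"
      by (auto simp: edges_def)
    then show ?thesis
      by (simp add: edge_indices_append edge_indices_Cons)
  qed
  moreover have "end_cell (a @ {Suc N} # b) N = (if N \<in> P then End0 else End1)"
  proof -
    have "\<not> (\<exists>A\<in>set (a @ {Suc N} # b). N \<in> A \<and> Suc N \<in> A)"
      using op_notin[OF a D(7)] op_notin[OF b D(9)] by auto
    moreover have "before (a @ {Suc N} # b) N (Suc N) \<longleftrightarrow> N \<in> P"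
      using before_notin[of "Suc N" a N] before_notin[of "Suc N" b N] D(7,9)
      by (simp add: before_append op_Union[OF a] op_Union[OF b])
    ultimately show ?thesis
      unfolding end_cell_def by (simp only: if_False)
  qed
  moreover have "rho_cell N (a @ {Suc N} # b) = rho_cell (N - 1) (a @ b) @ [end_cell (a @ {Suc N} # b) N]"
    using rho_cell_insert[OF D(11), of a "{}" b] by (simp only: rho_cell_empty)
  ultimately show ?thesis
    by (simp add: rho_face_def)
qed

text \<open>A set that contains \<open>N + 1\<close> and a smaller element but misses
  \<open>N\<close> is not an interval, so the cell is collapsed.\<close>

lemma rho_face_insert_notin:
  assumes "T \<noteq> {}" "T \<subseteq> {1..N}" "N \<notin> T"
  shows "rho_face n (a @ insert (Suc N) T # b) = 0"
proof -
  have "insert (Suc N) T \<noteq> {c..d}" for c d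
  proof
    assume e: "insert (Suc N) T = {c..d}"
    obtain x where x: "x \<in> T"
      using assms(1) by blast
    then have "x \<in> {c..d}" "Suc N \<in> {c..d}" "x \<le> N"
      using e assms(2) by auto
    then have "N \<in> {c..d}"
      by auto
    then show False
      unfolding e[symmetric] using assms(3) by auto
  qed
  then show ?thesis
    by (simp add: rho_face_def intervals_def)
qed

text \<open>The new edge index \<open>N\<close> exceeds all others and is listed right after those
  of \<open>T\<close>. Sorting moves it past the edge indices of \<open>b\<close>, of which there
  are \<open>part_dim b\<close> when all blocks are intervals.\<close>

lemma rho_face_insert_in:
  assumes t: "three_parts N P T Q" and N: "N \<in> T"
    and a: "a \<in> ordered_partitions P" and b: "b \<in> ordered_partitions Q"
  shows "rho_face N (a @ insert (Suc N) T # b) =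
    frag_cmul ((-1) ^ part_dim b) (snoc Edge (rho_face (N - 1) (a @ T # b)))"
proof -
  note D = three_partsD[OF t]
  have int: "(\<exists>c d. insert (Suc N) T = {c..d}) \<longleftrightarrow> (\<exists>c d. T = {c..d})"
  proof
    assume "\<exists>c d. insert (Suc N) T = {c..d}"
    then obtain c d where cd: "insert (Suc N) T = {c..d}"
      by blast
    have S: "Suc N \<in> {c..d}"
      unfolding cd[symmetric] by simp
    have "x \<in> {c..N}" if x: "x \<in> T" for x
    proof -
      have "x \<in> {c..d}"
        unfolding cd[symmetric] using x by simp
      moreover have "x \<in> {1..N}"
        using D(5) x by blast
      ultimately show ?thesis
        by simp
    qed
    moreover have "x \<in> T" if x: "x \<in> {c..N}" for x
    proof -
      have "x \<in> insert (Suc N) T"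
        unfolding cd using x S by simp
      then show ?thesis
        using x by simp
    qed
    ultimately have "T = {c..N}"
      by blast
    then show "\<exists>c d. T = {c..d}"
      by blast
  next
    assume "\<exists>c d. T = {c..d}"
    then obtain c d where cd: "T = {c..d}"
      by blast
    then have "d = N" "c \<le> N"
      using N D(5) by auto
    then have "insert (Suc N) T = {c..Suc N}"
      using cd by auto
    then show "\<exists>c d. insert (Suc N) T = {c..d}"
      by blast
  qed
  have I: "intervals (a @ insert (Suc N) T # b) \<longleftrightarrow> intervals (a @ T # b)"
    unfolding intervals_def using int by (simp add: ball_Un)
  have "T \<noteq> {}"
    using N by blast
  have aTb: "a @ T # b \<in> ordered_partitions {1..N}"
    using ordered_partitions_append[OF a, of "T # b" "T \<union> Q"] D b \<open>T \<noteq> {}\<close>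
      ordered_partitions_append[of "[T]" T b Q] by (simp add: Int_Un_distrib Int_Un_distrib2 Int_commute Un_assoc)
  have eT: "sorted_list_of_set (edges (insert (Suc N) T)) = sorted_list_of_set (edges T) @ [N]"
  proof -
    have e: "edges (insert (Suc N) T) = insert N (edges T)"
      using N D(5,8) by (auto simp: edges_def)
    have "finite (edges T)" "\<forall>x\<in>edges T. x < N"
      using D(2,5,8) unfolding edges_def by (auto simp: nat_less_le)
    then have "sorted_list_of_set (set (sorted_list_of_set (edges T) @ [N])) = sorted_list_of_set (edges T) @ [N]"
      by (intro sorted_list_of_set.idem_if_sorted_distinct) (auto simp: sorted_append less_imp_le)
    then show ?thesis
      unfolding e using \<open>finite (edges T)\<close> by simp
  qed
  have s: "list_sign (edge_indices (a @ insert (Suc N) T # b)) =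
      (-1) ^ part_dim b * list_sign (edge_indices (a @ T # b))" if i: "intervals (a @ T # b)"
  proof -
    define l where "l = edge_indices a @ sorted_list_of_set (edges T)"
    have 1: "edge_indices (a @ T # b) = l @ edge_indices b"
      "edge_indices (a @ insert (Suc N) T # b) = l @ [N] @ edge_indices b"
      by (simp_all add: l_def edge_indices_append edge_indices_Cons eT)
    have p: "distinct (l @ edge_indices b)"
      using edge_indices_props[OF aTb] by (simp add: 1)
    have lt: "\<forall>x\<in>set (l @ edge_indices b). x < N"
    proof
      fix x assume x: "x \<in> set (l @ edge_indices b)"
      have "Suc x \<in> \<Union>(set (a @ T # b))"
        by (rule edge_indices_Suc) (simp only: 1(1) x)
      then have "Suc x \<in> {1..N}"
        using op_Union[OF aTb] by blast
      then show "x < N"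
        by simp
    qed
    have d: "distinct (l @ [N] @ edge_indices b)"
      using p lt by auto
    have "inversions (l @ [N] @ edge_indices b) = inversions (l @ edge_indices b) + length (edge_indices b)"
    proof -
      have "cross (set l) (set ([N] @ edge_indices b)) = cross (set l) {N} + cross (set l) (set (edge_indices b))"
        using d by (subst cross_Un_right[symmetric]) auto
      moreover have "cross (set l) {N} = 0"
        using lt by (intro cross_less) auto
      moreover have "cross {N} (set (edge_indices b)) = length (edge_indices b)"
        using lt p by (subst cross_greater) (auto simp: distinct_card)
      ultimately show ?thesis
        using inversions_append[OF d] inversions_append[OF p] inversions_append[of "[N]" "edge_indices b"] d
        by simp
    qed
    moreover have "length (edge_indices b) = part_dim b"
    proof -
      have "intervals b"
        using i by (simp add: intervals_def)
      then show ?thesis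
        using edge_indices_props[OF b D(3)] by simp
    qed
    ultimately show ?thesis
      unfolding 1 using p d by (simp add: list_sign_inversions power_add)
  qed
  have c: "end_cell (a @ insert (Suc N) T # b) N = Edge"
    using N by (simp add: end_cell_def)
  show ?thesis
    using s I rho_cell_insert[OF D(11), of a T b] c by (simp add: rho_face_def)
qed

interpretation set_diag: diagonal_recursion set_diag
  by (rule set_diag_recursion)

subsection \<open>Naturality of the diagonal\<close>

lemma part_dim_image:
  "inj_on f (\<Union>(set u)) \<Longrightarrow> part_dim (map ((`) f) u) = part_dim u"
proof (induction u)
  case (Cons U u)
  have "inj_on f U" "inj_on f (\<Union>(set u))"
    using Cons.prems by (auto intro: inj_on_subset)
  then show ?case
    using Cons.IH by (simp add: card_image)
qed simp

lemma concat_product_image: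
  "frag_extend (\<lambda>u. frag_of (map g u)) (concat_product x y) =
    concat_product (frag_extend (\<lambda>u. frag_of (map g u)) x) (frag_extend (\<lambda>u. frag_of (map g u)) y)"
proof -
  have *: "frag_extend (\<lambda>u. frag_of (map g u)) (concat_product (frag_of a) y) =
    concat_product (frag_of (map g a)) (frag_extend (\<lambda>u. frag_of (map g u)) y)" for a
    by (rule frag_additive_eqI[where c = y]) (simp_all add: concat_product_diff_right frag_extend_diff)
  show ?thesis
    by (rule frag_additive_eqI[where c = x]) (simp_all add: * concat_product_diff_left frag_extend_diff)
qed

lemma grow_image:
  "inj_on f (\<Union>(set u)) \<Longrightarrow>
    frag_extend (\<lambda>v. frag_of (map ((`) f) v)) (grow m u) = grow (f m) (map ((`) f) u)"
proof (induction u)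
  case (Cons U u)
  have "inj_on f (\<Union>(set u))"
    using Cons.prems by (auto intro: inj_on_subset)
  then show ?case
    using Cons.IH by (simp add: frag_extend_add frag_extend_cmul concat_product_image part_dim_image)
qed simp

definition image_pair :: "(nat \<Rightarrow> nat) \<Rightarrow> nat set list \<times> nat set list \<Rightarrow> (nat set list \<times> nat set list \<Rightarrow>\<^sub>0 int)" where
  "image_pair f = (\<lambda>(a, b). frag_of (map ((`) f) a, map ((`) f) b))"

lemma tensor_image_pair:
  "frag_extend (image_pair f) (tensor x y) =
    tensor (frag_extend (\<lambda>v. frag_of (map ((`) f) v)) x) (frag_extend (\<lambda>v. frag_of (map ((`) f) v)) y)"
proof -
  have *: "frag_extend (image_pair f) (tensor (frag_of a) y) =
    tensor (frag_of (map ((`) f) a)) (frag_extend (\<lambda>v. frag_of (map ((`) f) v)) y)" for a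
    by (rule frag_additive_eqI[where c = y])
      (simp_all add: tensor_diff_right frag_extend_diff image_pair_def)
  show ?thesis
    by (rule frag_additive_eqI[where c = x]) (simp_all add: * tensor_diff_left frag_extend_diff)
qed

abbreviation words_in :: "nat set \<Rightarrow> (nat set list \<times> nat set list) set" where
  "words_in S \<equiv> {a. \<Union>(set a) \<subseteq> S} \<times> {b. \<Union>(set b) \<subseteq> S}"

lemma bar_image_pair:
  assumes "inj_on f S" "Poly_Mapping.keys x \<subseteq> words_in S" "Poly_Mapping.keys y \<subseteq> words_in S"
  shows "frag_extend (image_pair f) (bar x y) = bar (frag_extend (image_pair f) x) (frag_extend (image_pair f) y)"
proof (rule frag_additive_eqI[where c = x])
  fix p assume p: "p \<in> Poly_Mapping.keys x"
  show "frag_extend (image_pair f) (bar (frag_of p) y) =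
      bar (frag_extend (image_pair f) (frag_of p)) (frag_extend (image_pair f) y)"
  proof (rule frag_additive_eqI[where c = y])
    fix q assume q: "q \<in> Poly_Mapping.keys y"
    obtain a b a' b' where pq: "p = (a, b)" "q = (a', b')"
      by fastforce
    have "inj_on f (\<Union>(set b))" "inj_on f (\<Union>(set a'))"
      using assms p q pq by (auto intro: inj_on_subset)
    then show "frag_extend (image_pair f) (bar (frag_of p) (frag_of q)) =
      bar (frag_extend (image_pair f) (frag_of p)) (frag_extend (image_pair f) (frag_of q))"
      by (simp add: pq bar_product_frag_of frag_extend_cmul image_pair_def part_dim_image)
  qed (simp_all add: bar_product_diff_right frag_extend_diff)
qed (simp_all add: bar_product_diff_left frag_extend_diff)

lemma grow_right_image_pair:
  assumes "inj_on f S" "Poly_Mapping.keys x \<subseteq> words_in S"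
  shows "frag_extend (image_pair f) (grow_right m x) = grow_right (f m) (frag_extend (image_pair f) x)"
proof (rule frag_additive_eqI[where c = x])
  fix p assume p: "p \<in> Poly_Mapping.keys x"
  obtain a b where ab: "p = (a, b)"
    by fastforce
  have "inj_on f (\<Union>(set b))"
    using assms p ab by (auto intro: inj_on_subset)
  then show "frag_extend (image_pair f) (grow_right m (frag_of p)) =
      grow_right (f m) (frag_extend (image_pair f) (frag_of p))"
    by (simp add: ab grow_right_of tensor_image_pair grow_image) (simp add: image_pair_def grow_right_of)
qed (simp_all add: grow_right_diff frag_extend_diff)

lemma grow_left_image_pair:
  assumes "inj_on f S" "Poly_Mapping.keys x \<subseteq> words_in S"
  shows "frag_extend (image_pair f) (grow_left m x) = grow_left (f m) (frag_extend (image_pair f) x)"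
proof (rule frag_additive_eqI[where c = x])
  fix p assume p: "p \<in> Poly_Mapping.keys x"
  obtain a b where ab: "p = (a, b)"
    by fastforce
  have "inj_on f (\<Union>(set a))" "inj_on f (\<Union>(set b))"
    using assms p ab by (auto intro: inj_on_subset)
  then show "frag_extend (image_pair f) (grow_left m (frag_of p)) =
      grow_left (f m) (frag_extend (image_pair f) (frag_of p))"
    by (simp add: ab grow_left_of frag_extend_cmul tensor_image_pair grow_image)
      (simp add: image_pair_def grow_left_of part_dim_image)
qed (simp_all add: grow_left_diff frag_extend_diff)

lemma splits_image:
  assumes "inj_on f S"
  shows "splits (f ` S) g = splits S (\<lambda>M N. g (f ` M) (f ` N))"
proof -
  have "splits (f ` S) g = (\<Sum>M\<in>(`) f ` Pow S. g M (f ` S - M))"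
    by (simp add: splits_def image_Pow_surj)
  also have "\<dots> = (\<Sum>M\<in>Pow S. g (f ` M) (f ` S - f ` M))"
    by (rule sum.reindex[unfolded o_def]) (rule inj_on_image_Pow[OF assms])
  also have "\<dots> = (\<Sum>M\<in>Pow S. g (f ` M) (f ` (S - M)))"
    by (rule sum.cong[OF refl]) (use inj_on_image_set_diff[OF assms] in auto)
  finally show ?thesis
    by (simp add: splits_def)
qed

lemma right_left_hat_words_in:
  assumes "finite S" "\<forall>x\<in>S. x < m"
  shows "Poly_Mapping.keys (right_hat m set_diag S) \<subseteq> words_in (insert m S)"
    "Poly_Mapping.keys (left_hat m set_diag S) \<subseteq> words_in (insert m S)"
proof -
  have c: "Poly_Mapping.keys (set_diag S) \<subseteq> set_diag.cells S (card S - 1)" if "S \<noteq> {}"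
    using assms(1) that by (rule set_diag.D_cells)
  have U: "\<Union>(set a) = T" if "a \<in> ordered_partitions T" for a T
    using that by (simp add: ordered_partitions_iff)
  show "Poly_Mapping.keys (right_hat m set_diag S) \<subseteq> words_in (insert m S)"
    using set_diag.right_hat_cells[OF assms c] U by blast
  show "Poly_Mapping.keys (left_hat m set_diag S) \<subseteq> words_in (insert m S)"
    using set_diag.left_hat_cells[OF assms c] U by blast
qed

lemma set_diag_words_in:
  assumes "finite S"
  shows "Poly_Mapping.keys (set_diag S) \<subseteq> words_in S"
proof (cases "S = {}")
  case False
  have "\<Union>(set a) = S" if "a \<in> ordered_partitions S" for a
    using that by (simp add: ordered_partitions_iff)
  then show ?thesis
    using set_diag.D_cells[OF assms False] unfolding set_diag.cells_def by blast
qed (simp add: set_diag.D_empty keys_frag_of)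

text \<open>A strictly increasing map preserves maxima, shuffle signs and dimensions, hence every
  ingredient of the recursion.\<close>

lemma set_diag_image:
  "finite S \<Longrightarrow> strict_mono_on S f \<Longrightarrow> frag_extend (image_pair f) (set_diag S) = set_diag (f ` S)"
proof (induction S rule: finite_psubset_induct)
  case (psubset S')
  show ?case
  proof (cases "S' = {}")
    case False
    obtain m S where S: "S' = insert m S" "finite S" "\<forall>x\<in>S. x < m" "m \<notin> S"
      using insert_Max_cases[OF psubset.hyps(1) False] .
    have mono: "strict_mono_on (insert m S) f"
      using psubset.prems S(1) by simp
    have inj: "inj_on f (insert m S)"
      using mono by (rule strict_mono_on_imp_inj_on)
    have fm: "\<forall>y\<in>f ` S. y < f m"
      using S(3) by (auto intro!: strict_mono_onD[OF mono])
    have IH: "frag_extend (image_pair f) (set_diag B) = set_diag (f ` B)" if "B \<subseteq> S" for B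
    proof (rule psubset.IH)
      show "B \<subset> S'"
        using that S(1,4) by blast
      show "strict_mono_on B f"
        using that by (intro monotone_on_subset[OF mono]) blast
    qed
    have injB: "inj_on f B" if "B \<subseteq> S" for B
      using that by (intro inj_on_subset[OF inj]) blast
    have fin: "finite B" if "B \<subseteq> S" for B
      using that S(2) by (rule finite_subset)
    have R: "frag_extend (image_pair f) (right_hat m set_diag B) = right_hat (f m) set_diag (f ` B)" if "B \<subseteq> S" for B
      using grow_right_image_pair[OF injB[OF that] set_diag_words_in[OF fin[OF that]]] IH[OF that]
      by (simp add: grow_hat_def image_pair_def)
    have L: "frag_extend (image_pair f) (left_hat m set_diag B) = left_hat (f m) set_diag (f ` B)" if "B \<subseteq> S" for B
      using grow_left_image_pair[OF injB[OF that] set_diag_words_in[OF fin[OF that]]] IH[OF that]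
      by (simp add: grow_hat_def image_pair_def)
    have "set_diag (f ` S') = splits (f ` S) (\<lambda>B A. frag_cmul (shuff B A)
        (bar (right_hat (f m) set_diag B) (left_hat (f m) set_diag A)))"
      unfolding S(1) image_insert using S(2) by (intro set_diag.D_insert[OF _ fm]) simp
    also have "\<dots> = splits S (\<lambda>B A. frag_cmul (shuff (f ` B) (f ` A))
        (bar (right_hat (f m) set_diag (f ` B)) (left_hat (f m) set_diag (f ` A))))"
      by (rule splits_image[OF injB]) simp
    also have "\<dots> = splits S (\<lambda>B A. frag_extend (image_pair f) (frag_cmul (shuff B A)
        (bar (right_hat m set_diag B) (left_hat m set_diag A))))"
    proof (rule splits_cong[OF refl])
      fix B A assume BA: "B \<union> A = S" "B \<inter> A = {}"
      then have sub: "B \<subseteq> S" "A \<subseteq> S"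
        by blast+
      have "f ` B \<inter> f ` A = {}"
        using inj_on_image_Int[OF injB[OF subset_refl] sub] BA(2) by simp
      then have "shuff (f ` B) (f ` A) = shuff B A"
        using fin[OF sub(1)] fin[OF sub(2)] BA(2) sub
        by (simp add: shuff_cross cross_image[OF mono, of B A] subset_insertI2)
      moreover have "Poly_Mapping.keys (right_hat m set_diag B) \<subseteq> words_in (insert m S)"
        using right_left_hat_words_in(1)[of B m] fin[OF sub(1)] S(3) sub(1) by blast
      moreover have "Poly_Mapping.keys (left_hat m set_diag A) \<subseteq> words_in (insert m S)"
        using right_left_hat_words_in(2)[of A m] fin[OF sub(2)] S(3) sub(2) by blast
      ultimately show "frag_cmul (shuff (f ` B) (f ` A))
          (bar (right_hat (f m) set_diag (f ` B)) (left_hat (f m) set_diag (f ` A))) =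
        frag_extend (image_pair f) (frag_cmul (shuff B A) (bar (right_hat m set_diag B) (left_hat m set_diag A)))"
        by (simp only: frag_extend_cmul bar_image_pair[OF inj] R[OF sub(1)] L[OF sub(2)])
    qed
    also have "\<dots> = frag_extend (image_pair f) (set_diag S')"
      unfolding S(1) set_diag.D_insert[OF S(2,3)] by (simp only: splits_frag_extend)
    finally show ?thesis
      by (rule sym)
  qed (simp add: set_diag.D_empty image_pair_def)
qed

text \<open>The prescribed diagonal of a block is transported from \<open>{1..card U}\<close>. By
  naturality it is the recursive diagonal of \<open>U\<close> itself, to which \<open>tbd_D\<close>
  applies.\<close>

lemma perm_diag_block_set_diag:
  assumes "finite U" "U \<noteq> {}"
  shows "perm_diag_block U = set_diag U"
proof -
  define f where "f k = sorted_list_of_set U ! (k - 1)" for k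
  have l: "length (sorted_list_of_set U) = card U"
    by simp
  have mono: "strict_mono_on {1..card U} f"
  proof (rule strict_mono_onI)
    fix i j assume "i \<in> {1..card U}" "j \<in> {1..card U}" "i < j"
    then show "f i < f j"
      unfolding f_def using assms(1)
      by (intro sorted_wrt_nth_less[OF strict_sorted_list_of_set]) auto
  qed
  have im: "f ` {1..card U} = U"
  proof -
    have "f ` {1..card U} = (!) (sorted_list_of_set U) ` ((\<lambda>k. k - 1) ` {1..card U})"
      by (simp add: image_image f_def)
    also have "(\<lambda>k. k - 1) ` {1..card U} = {..<card U}"
    proof -
      have "k \<in> (\<lambda>k. k - 1) ` {1..card U}" if "k < card U" for k
        using that by (intro image_eqI[of _ _ "Suc k"]) auto
      then show ?thesis
        by auto
    qed
    also have "(!) (sorted_list_of_set U) ` {..<card U} = set (sorted_list_of_set U)"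
      by (subst atLeast0LessThan[symmetric], subst nth_image) (simp_all add: l[symmetric] del: sorted_list_of_set.length_sorted_key_list_of_set)
    finally show ?thesis
      using assms(1) by simp
  qed
  have "card U > 0"
    using assms by (simp add: card_gt_0_iff)
  then have "perm_diag_block U = frag_extend (image_pair f) (set_diag {1..card U})"
    unfolding perm_diag_block_def perm_diag_top_set_diag image_pair_def relabel_def f_def[abs_def] by simp
  also have "\<dots> = set_diag U"
    using set_diag_image[OF _ mono] im by simp
  finally show ?thesis .
qed

lemma set_diag_singleton: "set_diag {m} = frag_of ([{m}], [{m}])"
proof -
  have "set_diag {m} = splits {} (\<lambda>B A. frag_cmul (shuff B A) (bar (right_hat m set_diag B) (left_hat m set_diag A)))"
    by (rule set_diag.D_insert) simp_all
  then show ?thesis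
    by (simp add: splits_def grow_hat_def bar_product_frag_of shuff_cross)
qed

subsection \<open>The permutahedra\<close>

lemma dg_words_coproduct_perm:
  "dg_words_coproduct part_dim perm_boundary_face perm_diag_block {U. finite U \<and> U \<noteq> {}}"
proof
  fix v :: "nat set"
  assume v: "v \<in> {U. finite U \<and> U \<noteq> {}}"
  then have v': "finite v" "v \<noteq> {}"
    by simp_all
  show "part_dim a + part_dim b = part_dim [v]" if "(a, b) \<in> Poly_Mapping.keys (perm_diag_block v)" for a b
    using that set_diag.D_cells[OF v'] by (auto simp: perm_diag_block_set_diag[OF v'] set_diag.cells_def)
  show "set u \<subseteq> {U. finite U \<and> U \<noteq> {}}" if u: "u \<in> Poly_Mapping.keys (perm_boundary_face [v])" for u
  proof -
    have "u \<in> {[M, N] |M N. finite v \<and> M \<noteq> {} \<and> N \<noteq> {} \<and> M \<inter> N = {} \<and> M \<union> N = v}"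
      using u keys_block_boundary[of v] by auto
    then show ?thesis
      by auto
  qed
  let ?c = "\<lambda>u. foldr (\<lambda>U. bar (perm_diag_block U)) u (frag_of ([], []))"
  have "frag_extend ?c (perm_boundary_face [v]) = splits v (\<lambda>M N. frag_extend ?c
      (if M = {} \<or> N = {} then 0 else frag_cmul ((-1) ^ card M * shuff M N) (frag_of [M, N])))"
    by (simp only: perm_boundary_face_single block_boundary_splits[OF v'(1)] splits_frag_extend)
  also have "\<dots> = splits v (\<lambda>M N. if M = {} \<or> N = {} then 0 else
      frag_cmul ((-1) ^ card M * shuff M N) (bar (set_diag M) (set_diag N)))"
  proof (rule splits_cong[OF refl])
    fix M N assume "M \<union> N = v"
    then have "finite M" "finite N"
      using v'(1) by auto
    then show "frag_extend ?c
      (if M = {} \<or> N = {} then 0 else frag_cmul ((-1) ^ card M * shuff M N) (frag_of [M, N])) =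
      (if M = {} \<or> N = {} then 0 else
      frag_cmul ((-1) ^ card M * shuff M N) (bar (set_diag M) (set_diag N)))"
      by (simp add: frag_extend_cmul perm_diag_block_set_diag)
  qed
  also have "\<dots> = perm.tbd (perm_diag_block v)"
    unfolding perm_diag_block_set_diag[OF v'] by (rule set_diag.tbd_D[OF v'(1), symmetric])
  finally show "frag_extend ?c (perm_boundary_face [v]) = perm.tbd (perm_diag_block v)" .
qed

interpretation perm: dg_words_coproduct part_dim perm_boundary_face perm_diag_block "{U. finite U \<and> U \<noteq> {}}"
  by (rule dg_words_coproduct_perm)

lemma perm_diag_eq: "perm_diag = perm.cop" "perm_boundary = perm.bd"
  by (simp_all add: fun_eq_iff perm_diag_def perm_boundary_def perm_diag_face_def[abs_def] perm.copc_def[abs_def])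

lemma ordered_partitions_letters:
  assumes "u \<in> ordered_partitions S" "finite S"
  shows "set u \<subseteq> {U. finite U \<and> U \<noteq> {}}"
proof -
  have "finite U \<and> U \<noteq> {}" if "U \<in> set u" for U
  proof -
    have "U \<subseteq> S" "{} \<notin> set u"
      using assms(1) that by (auto simp: ordered_partitions_iff)
    then show ?thesis
      using that assms(2) finite_subset by blast
  qed
  then show ?thesis
    by blast
qed

lemma keys_perm_boundary_face:
  "u \<in> ordered_partitions S \<Longrightarrow> finite S \<Longrightarrow> Poly_Mapping.keys (perm_boundary_face u) \<subseteq> ordered_partitions S"
proof (induction u arbitrary: S)
  case (Cons U u)
  then have U: "U \<noteq> {}" "U \<subseteq> S" "u \<in> ordered_partitions (S - U)"
    by (simp_all add: ordered_partitions_Cons)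
  have SU: "S = U \<union> (S - U)"
    using U(2) by blast
  have app: "a @ b \<in> ordered_partitions S" if "a \<in> ordered_partitions U" "b \<in> ordered_partitions (S - U)" for a b
    by (subst SU) (rule ordered_partitions_append[OF that], blast)
  have bU: "a \<in> ordered_partitions U" if a: "a \<in> Poly_Mapping.keys (block_boundary U)" for a
  proof -
    obtain M N where MN: "a = [M, N]" "M \<noteq> {}" "N \<noteq> {}" "M \<inter> N = {}" "M \<union> N = U"
      using subsetD[OF keys_block_boundary a] by (elim CollectE exE conjE) (rule that)
    have "[M] @ [N] \<in> ordered_partitions (M \<union> N)"
      using MN by (intro ordered_partitions_append) (simp_all add: Int_commute)
    then show ?thesis
      using MN by simp
  qed
  have "Poly_Mapping.keys (perm_boundary_face u) \<subseteq> ordered_partitions (S - U)"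
    using U(3) Cons.prems(2) by (intro Cons.IH) simp_all
  moreover have "U # b \<in> ordered_partitions S" if "b \<in> ordered_partitions (S - U)" for b
    using app[of "[U]" b] that U(1) by simp
  ultimately show ?case
    unfolding perm_boundary_face_Cons using app bU U(3)
    by (intro keys_add_subset keys_frag_cmul_subset keys_concat_product) (auto simp: keys_frag_of)
qed simp

lemma keys_perm_copc:
  "u \<in> ordered_partitions S \<Longrightarrow> finite S \<Longrightarrow>
    Poly_Mapping.keys (perm.copc u) \<subseteq> ordered_partitions S \<times> ordered_partitions S"
proof (induction u arbitrary: S)
  case (Cons U u)
  then have U: "U \<noteq> {}" "U \<subseteq> S" "u \<in> ordered_partitions (S - U)"
    by (simp_all add: ordered_partitions_Cons)
  have "finite U"
    using U(2) Cons.prems(2) by (rule finite_subset)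
  have SU: "S = U \<union> (S - U)"
    using U(2) by blast
  have app: "a @ b \<in> ordered_partitions S" if "a \<in> ordered_partitions U" "b \<in> ordered_partitions (S - U)" for a b
    by (subst SU) (rule ordered_partitions_append[OF that], blast)
  have 1: "Poly_Mapping.keys (perm_diag_block U) \<subseteq> ordered_partitions U \<times> ordered_partitions U"
    using set_diag.D_cells[OF \<open>finite U\<close> U(1)]
    by (auto simp: perm_diag_block_set_diag[OF \<open>finite U\<close> U(1)] set_diag.cells_def)
  have 2: "Poly_Mapping.keys (perm.copc u) \<subseteq> ordered_partitions (S - U) \<times> ordered_partitions (S - U)"
    using U(3) Cons.prems(2) by (intro Cons.IH) simp_all
  show ?case
    unfolding perm.copc_Cons
  proof (rule keys_bar_product)
    fix a b a' b' assume "(a, b) \<in> Poly_Mapping.keys (perm_diag_block U)" "(a', b') \<in> Poly_Mapping.keys (perm.copc u)"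
    then have "a \<in> ordered_partitions U" "b \<in> ordered_partitions U"
      "a' \<in> ordered_partitions (S - U)" "b' \<in> ordered_partitions (S - U)"
      using 1 2 by blast+
    then show "(a @ a', b @ b') \<in> ordered_partitions S \<times> ordered_partitions S"
      by (simp add: app)
  qed
qed (simp add: keys_frag_of)

lemma dg_coalgebra_perm: "dg_coalgebra (perm_faces m) part_dim perm_boundary perm_diag"
  unfolding perm_diag_eq perm_faces_def
proof (rule perm.dg_coalgebra_words)
  fix u assume u: "u \<in> ordered_partitions {1..m}"
  show "set u \<subseteq> {U. finite U \<and> U \<noteq> {}}"
    using u by (rule ordered_partitions_letters) simp
  show "Poly_Mapping.keys (perm_boundary_face u) \<subseteq> ordered_partitions {1..m}"
    using u by (rule keys_perm_boundary_face) simp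
  show "Poly_Mapping.keys (perm.copc u) \<subseteq> ordered_partitions {1..m} \<times> ordered_partitions {1..m}"
    using u by (rule keys_perm_copc) simp
qed

section \<open>Decomposing a face at its largest element\<close>

lemma three_parts_op:
  assumes "three_parts N P W Q" "a \<in> ordered_partitions P" "w \<in> ordered_partitions W" "b \<in> ordered_partitions Q"
  shows "a @ w @ b \<in> ordered_partitions {1..N}"
proof -
  note D = three_partsD[OF assms(1)]
  have wb: "w @ b \<in> ordered_partitions (W \<union> Q)"
    by (rule ordered_partitions_append[OF assms(3,4)]) (use D(14) in blast)
  have "a @ w @ b \<in> ordered_partitions (P \<union> (W \<union> Q))"
    by (rule ordered_partitions_append[OF assms(2) wb]) (use D(12,13) in blast)
  then show ?thesis
    by (simp only: D(15) flip: Un_assoc)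
qed

lemma three_parts_cases:
  assumes u: "u \<in> ordered_partitions {1..Suc N}" and N: "1 \<le> N"
  obtains xs U ys P Q where "u = xs @ insert (Suc N) U # ys" "three_parts N P U Q"
    "xs \<in> ordered_partitions P" "ys \<in> ordered_partitions Q"
proof -
  have "Suc N \<in> \<Union>(set u)"
    unfolding op_Union[OF u] by simp
  then obtain A where A: "A \<in> set u" "Suc N \<in> A"
    by blast
  then obtain xs ys where xy: "u = xs @ A # ys"
    by (meson split_list)
  have 1: "xs \<in> ordered_partitions (\<Union>(set xs))" "A # ys \<in> ordered_partitions ({1..Suc N} - \<Union>(set xs))"
    "\<Union>(set xs) \<subseteq> {1..Suc N}"
    using ordered_partitions_appendD u unfolding xy by blast+
  then have 2: "A \<subseteq> {1..Suc N} - \<Union>(set xs)" "ys \<in> ordered_partitions ({1..Suc N} - \<Union>(set xs) - A)"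
    by (simp_all only: ordered_partitions_Cons)
  have "three_parts N (\<Union>(set xs)) (A - {Suc N}) ({1..Suc N} - \<Union>(set xs) - A)"
    unfolding three_parts_def
  proof (intro conjI)
    have i: "{1..Suc N} - {Suc N} = {1..N}"
      by auto
    show "\<Union>(set xs) \<union> (A - {Suc N}) \<union> ({1..Suc N} - \<Union>(set xs) - A) = {1..N}"
      unfolding i[symmetric] using 1(3) 2(1) A(2) by blast
  qed (use N 2(1) in blast)+
  moreover have "u = xs @ insert (Suc N) (A - {Suc N}) # ys"
    using xy A(2) by (simp add: insert_absorb)
  ultimately show thesis
    using 1(1) 2(2) by (intro that)
qed

text \<open>Of all insertions into blocks of \<open>w\<close> only the one into the block with
  \<open>N\<close> survives the projection. Its sign in \<open>grow\<close> and the sign of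
  \<open>rho_face_insert_in\<close> share the later blocks of \<open>w\<close>, so the dimension of
  \<open>b\<close> is left.\<close>

lemma rho_grow:
  assumes "three_parts N P W Q" "a \<in> ordered_partitions P" "w \<in> ordered_partitions W" "b \<in> ordered_partitions Q"
  shows "frag_extend (rho_face N) (concat_product (concat_product (frag_of a) (grow (Suc N) w)) (frag_of b)) =
    (if N \<in> W then frag_cmul ((-1) ^ part_dim b) (snoc Edge (rho_face (N - 1) (a @ w @ b))) else 0)"
  using assms
proof (induction w arbitrary: a P W)
  case (Cons V w)
  note D = three_partsD[OF Cons.prems(1)]
  have V: "V \<noteq> {}" "V \<subseteq> W" "w \<in> ordered_partitions (W - V)"
    using Cons.prems(3) by (simp_all add: ordered_partitions_Cons)
  have t1: "three_parts N P V ((W - V) \<union> Q)"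
    unfolding three_parts_def D(15)[symmetric] using D(11,12,13,14) V(2) by blast
  have t2: "three_parts N (P \<union> V) (W - V) Q"
    unfolding three_parts_def D(15)[symmetric] using D(11,12,13,14) V(2) by blast
  have wb: "w @ b \<in> ordered_partitions ((W - V) \<union> Q)"
    by (rule ordered_partitions_append[OF V(3) Cons.prems(4)]) (use D(14) in blast)
  have aV: "a @ [V] \<in> ordered_partitions (P \<union> V)"
    by (rule ordered_partitions_append[OF Cons.prems(2) ordered_partitions_single[OF V(1)]]) (use V(2) D(12) in blast)
  have VN: "V \<subseteq> {1..N}"
    using V(2) D(5) by blast
  have IH: "frag_extend (rho_face N) (concat_product (concat_product (frag_of (a @ [V])) (grow (Suc N) w)) (frag_of b)) =
    (if N \<in> W - V then frag_cmul ((-1) ^ part_dim b) (snoc Edge (rho_face (N - 1) (a @ V # w @ b))) else 0)"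
    using Cons.IH[OF t2 aV V(3) Cons.prems(4)] by simp
  have first: "frag_cmul ((-1) ^ part_dim w) (rho_face N (a @ insert (Suc N) V # w @ b)) =
    (if N \<in> V then frag_cmul ((-1) ^ part_dim b) (snoc Edge (rho_face (N - 1) (a @ V # w @ b))) else 0)"
  proof (cases "N \<in> V")
    case True
    have "(-1::int) ^ part_dim w * (-1) ^ part_dim (w @ b) = (-1) ^ part_dim b"
      by (simp add: power_add flip: mult.assoc power_mult_distrib)
    then show ?thesis
      using True rho_face_insert_in[OF t1 True Cons.prems(2) wb] by (simp only: frag_cmul_cmul if_True)
  next
    case False
    then show ?thesis
      using rho_face_insert_notin[OF V(1) VN False, of N a "w @ b"] by simp
  qed
  have "concat_product (concat_product (frag_of a) (grow (Suc N) (V # w))) (frag_of b) =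
    frag_cmul ((-1) ^ part_dim w) (frag_of (a @ insert (Suc N) V # w @ b)) +
    concat_product (concat_product (frag_of (a @ [V])) (grow (Suc N) w)) (frag_of b)"
  proof -
    have "concat_product (frag_of a) (concat_product (frag_of [V]) x) = concat_product (frag_of (a @ [V])) x" for x
      by (simp flip: concat_product_assoc)
    then show ?thesis
      by (simp add: concat_product_add_left concat_product_add_right concat_product_cmul_left concat_product_cmul_right)
  qed
  then have e: "frag_extend (rho_face N) (concat_product (concat_product (frag_of a) (grow (Suc N) (V # w))) (frag_of b)) =
    frag_cmul ((-1) ^ part_dim w) (rho_face N (a @ insert (Suc N) V # w @ b)) +
    frag_extend (rho_face N) (concat_product (concat_product (frag_of (a @ [V])) (grow (Suc N) w)) (frag_of b))"
    by (simp only: frag_extend_add frag_extend_cmul frag_extend_of)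
  have "N \<in> W \<longleftrightarrow> N \<in> V \<or> N \<in> W - V"
    using V(2) by blast
  then show ?case
    unfolding e IH first by (cases "N \<in> V") simp_all
qed simp

lemma op_one: "u \<in> ordered_partitions {1..1} \<Longrightarrow> u = [{1}]"
proof (cases u)
  case (Cons A v)
  assume "u \<in> ordered_partitions {1..1}"
  then have A: "A \<noteq> {}" "A \<subseteq> {1}" "v \<in> ordered_partitions ({1} - A)"
    using Cons by (simp_all add: ordered_partitions_Cons)
  then have "A = {1}"
    by blast
  then show ?thesis
    using A(3) Cons by simp
qed simp

lemma rho_face_zero: "rho_face 0 [{1}] = frag_of []"
proof -
  have "edges {1} = {}"
    by (auto simp: edges_def)
  moreover have "intervals [{1}]"
    by (simp add: intervals_def) (metis atLeastAtMost_singleton)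
  moreover have "list_sign [] = 1"
    by (simp add: list_sign_inversions)
  ultimately show ?thesis
    by (simp add: rho_face_def edge_indices_Cons rho_cell_def) (simp add: edge_indices_def)
qed

lemma keys_snoc:
  assumes "Poly_Mapping.keys x \<subseteq> S" "\<And>c. c \<in> S \<Longrightarrow> c @ [e] \<in> T"
  shows "Poly_Mapping.keys (snoc e x) \<subseteq> T"
  unfolding snoc_def by (intro keys_concat_product) (use assms in \<open>auto simp: keys_frag_of\<close>)

text \<open>Faces on \<open>{1..N}\<close> go to the cube with \<open>N - 1\<close> coordinates, so
  the induction starts with a point at \<open>N = 1\<close>.\<close>

lemma rho_face_degree:
  "1 \<le> N \<Longrightarrow> u \<in> ordered_partitions {1..N} \<Longrightarrow>
    Poly_Mapping.keys (rho_face (N - 1) u) \<subseteq> {c. length c = N - 1 \<and> cube_dim c = part_dim u}"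
proof (induction N arbitrary: u rule: nat_induct_at_least)
  case base
  then have "u = [{1}]"
    by (rule op_one)
  then show ?case
    by (simp add: rho_face_zero[unfolded One_nat_def] keys_frag_of)
next
  case (Suc N)
  from Suc.prems Suc.hyps obtain xs U ys P Q where u: "u = xs @ insert (Suc N) U # ys"
    and t: "three_parts N P U Q" and xs: "xs \<in> ordered_partitions P" and ys: "ys \<in> ordered_partitions Q"
    by (rule three_parts_cases)
  note D = three_partsD[OF t]
  consider "U = {}" | "N \<in> U" | "U \<noteq> {}" "N \<notin> U"
    by blast
  then show ?case
  proof cases
    case 1
    have "xs @ ys \<in> ordered_partitions {1..N}"
      using three_parts_op[OF t[unfolded 1] xs, of "[]" ys] ys by simp
    then have "Poly_Mapping.keys (rho_face (N - 1) (xs @ ys)) \<subseteq> {c. length c = N - 1 \<and> cube_dim c = part_dim (xs @ ys)}"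
      by (rule Suc.IH)
    then show ?thesis
      unfolding u 1 diff_Suc_1 rho_face_single[OF t[unfolded 1] xs ys]
      by (rule keys_snoc) (use Suc.hyps in auto)
  next
    case 2
    then have "U \<noteq> {}"
      by blast
    then have "xs @ U # ys \<in> ordered_partitions {1..N}"
      using three_parts_op[OF t xs _ ys, of "[U]"] by simp
    then have "Poly_Mapping.keys (rho_face (N - 1) (xs @ U # ys)) \<subseteq> {c. length c = N - 1 \<and> cube_dim c = part_dim (xs @ U # ys)}"
      by (rule Suc.IH)
    then have "Poly_Mapping.keys (snoc Edge (rho_face (N - 1) (xs @ U # ys))) \<subseteq> {c. length c = N \<and> cube_dim c = part_dim u}"
    proof (rule keys_snoc)
      have "card U > 0"
        using \<open>U \<noteq> {}\<close> D(2) by (simp add: card_gt_0_iff)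
      then show "c @ [Edge] \<in> {c. length c = N \<and> cube_dim c = part_dim u}"
        if "c \<in> {c. length c = N - 1 \<and> cube_dim c = part_dim (xs @ U # ys)}" for c
        using that Suc.hyps D(2,8) by (simp add: u)
    qed
    moreover have "rho_face N u = frag_cmul ((-1) ^ part_dim ys) (snoc Edge (rho_face (N - 1) (xs @ U # ys)))"
      unfolding u by (rule rho_face_insert_in[OF t 2 xs ys])
    ultimately show ?thesis
      by (simp only: diff_Suc_1 keys_frag_cmul_subset)
  next
    case 3
    then show ?thesis
      unfolding u using rho_face_insert_notin[OF 3(1) D(5) 3(2), of N xs ys] by simp
  qed
qed

subsection \<open>Compatibility of the projection with the boundary\<close>

lemma perm_boundary_face_middle:
  "perm_boundary_face (xs @ A # ys) = concat_product (perm_boundary_face xs) (frag_of (A # ys)) +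
    frag_cmul ((-1) ^ part_dim xs) (concat_product (concat_product (frag_of xs) (block_boundary A)) (frag_of ys)) +
    frag_cmul ((-1) ^ (part_dim xs + (card A - 1))) (concat_product (frag_of (xs @ [A])) (perm_boundary_face ys))"
proof -
  have "concat_product (frag_of xs) (concat_product (frag_of [A]) x) = concat_product (frag_of (xs @ [A])) x" for x
    by (simp flip: concat_product_assoc)
  then show ?thesis
    by (simp add: perm_boundary_face_append[of xs] perm_boundary_face_Cons concat_product_add_right
        concat_product_cmul_right frag_cmul_distrib2 power_add concat_product_assoc add.assoc)
qed

lemma cube_bd_snoc:
  assumes "\<And>c. c \<in> Poly_Mapping.keys x \<Longrightarrow> cube_dim c = d"
  shows "cube.bd (snoc e x) = snoc e (cube.bd x) + frag_cmul ((-1) ^ d) (concat_product x (interval_bd e))"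
  unfolding snoc_def by (subst cube.bd_concat_product[OF assms]) (simp_all del: cube_boundary_cell.simps(2))

lemma snoc_frag_extend_left:
  assumes "\<And>a. a \<in> Poly_Mapping.keys x \<Longrightarrow> f (a @ v) = frag_cmul k (snoc e (g (a @ v')))"
  shows "frag_extend f (concat_product x (frag_of v)) = frag_cmul k (snoc e (frag_extend g (concat_product x (frag_of v'))))"
  by (rule frag_additive_eqI[where c = x])
    (use assms in \<open>simp_all add: concat_product_diff_left frag_extend_diff frag_cmul_diff_distrib2\<close>)

lemma snoc_frag_extend_right:
  assumes "\<And>a. a \<in> Poly_Mapping.keys x \<Longrightarrow> f (v @ a) = frag_cmul k (snoc e (g (v' @ a)))"
  shows "frag_extend f (concat_product (frag_of v) x) = frag_cmul k (snoc e (frag_extend g (concat_product (frag_of v') x)))"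
  by (rule frag_additive_eqI[where c = x])
    (use assms in \<open>simp_all add: concat_product_diff_right frag_extend_diff frag_cmul_diff_distrib2\<close>)

lemma block_boundary_singleton [simp]: "block_boundary {m} = 0"
proof -
  have "{M. M \<noteq> {} \<and> M \<subset> {m}} = {}"
    by blast
  then show ?thesis
    unfolding block_boundary_def by (simp only: sum.empty)
qed

text \<open>If the new element is alone in its block, the last coordinate is a vertex and has no
  boundary. Otherwise the insertion part of \<open>grow_block_boundary\<close> gives the boundary in
  the other coordinates, and its two end terms give the endpoints of the last one.\<close>

lemma rho_face_boundary:
  "1 \<le> N \<Longrightarrow> u \<in> ordered_partitions {1..N} \<Longrightarrow>
    frag_extend (rho_face (N - 1)) (perm_boundary_face u) = cube.bd (rho_face (N - 1) u)"
proof (induction N arbitrary: u rule: nat_induct_at_least)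
  case base
  then have "u = [{1}]"
    by (rule op_one)
  then show ?case
    by (simp add: rho_face_zero[unfolded One_nat_def])
next
  case (Suc N)
  from Suc.prems Suc.hyps obtain xs U ys P Q where u: "u = xs @ insert (Suc N) U # ys"
    and t: "three_parts N P U Q" and xs: "xs \<in> ordered_partitions P" and ys: "ys \<in> ordered_partitions Q"
    by (rule three_parts_cases)
  note D = three_partsD[OF t]
  let ?R = "frag_extend (rho_face N)" and ?R' = "frag_extend (rho_face (N - 1))"
  have bxs: "a \<in> ordered_partitions P" if "a \<in> Poly_Mapping.keys (perm_boundary_face xs)" for a
    using keys_perm_boundary_face[OF xs D(1)] that by blast
  have bys: "a \<in> ordered_partitions Q" if "a \<in> Poly_Mapping.keys (perm_boundary_face ys)" for a
    using keys_perm_boundary_face[OF ys D(3)] that by blast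
  show ?case
  proof (cases "U = {}")
    case True
    define e where "e = (if N \<in> P then End0 else End1)"
    have single: "rho_face N (a @ {Suc N} # b) = snoc e (rho_face (N - 1) (a @ b))"
      if "a \<in> ordered_partitions P" "b \<in> ordered_partitions Q" for a b
      unfolding e_def using t[unfolded True] that by (rule rho_face_single)
    have xy: "xs @ ys \<in> ordered_partitions {1..N}"
      using three_parts_op[OF t[unfolded True] xs, of "[]" ys] ys by simp
    have "?R (concat_product (perm_boundary_face xs) (frag_of ({Suc N} # ys))) =
        frag_cmul 1 (snoc e (?R' (concat_product (perm_boundary_face xs) (frag_of ys))))"
      by (rule snoc_frag_extend_left) (simp add: single bxs ys)
    moreover have "?R (concat_product (frag_of (xs @ [{Suc N}])) (perm_boundary_face ys)) =
        frag_cmul 1 (snoc e (?R' (concat_product (frag_of xs) (perm_boundary_face ys))))"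
      by (rule snoc_frag_extend_right) (simp add: single bys xs)
    ultimately have "?R (perm_boundary_face u) = snoc e (?R' (perm_boundary_face (xs @ ys)))"
      unfolding u True perm_boundary_face_middle[of xs "{Suc N}" ys] perm_boundary_face_append[of xs ys]
      by (simp add: frag_extend_add frag_extend_cmul)
    also have "\<dots> = snoc e (cube.bd (rho_face (N - 1) (xs @ ys)))"
      by (simp only: Suc.IH[OF xy])
    also have "\<dots> = cube.bd (snoc e (rho_face (N - 1) (xs @ ys)))"
      using rho_face_degree[OF Suc.hyps xy]
      by (subst cube_bd_snoc[where d = "part_dim (xs @ ys)"]) (auto simp: e_def)
    finally show ?thesis
      by (simp add: u True single xs ys)
  next
    case False
    define u0 where "u0 = xs @ U # ys"
    have u0: "u0 \<in> ordered_partitions {1..N}"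
      using three_parts_op[OF t xs _ ys, of "[U]"] False by (simp add: u0_def)
    have below: "below (Suc N) U"
      using D(2,5) False by (auto simp: below_def less_Suc_eq_le)
    have cU: "card U > 0" "card (insert (Suc N) U) = Suc (card U)"
      using False D(2,8) by (simp_all add: card_gt_0_iff)
    have t1: "three_parts N (P \<union> U) {} Q" "three_parts N P {} (U \<union> Q)"
      unfolding three_parts_def D(15)[symmetric] using D(11,12,13,14) by blast+
    have xsU: "xs @ [U] \<in> ordered_partitions (P \<union> U)"
      by (rule ordered_partitions_append[OF xs ordered_partitions_single[OF False]]) (use D(12) in blast)
    have Uys: "[U] @ ys \<in> ordered_partitions (U \<union> Q)"
      by (rule ordered_partitions_append[OF ordered_partitions_single[OF False] ys]) (use D(14) in blast)
    \<comment> \<open>The faces with \<open>U\<close>, \<open>{N + 1}\<close> and with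
      \<open>{N + 1}\<close>, \<open>U\<close> have the same image in the first coordinates; in the
      last one they differ precisely if \<open>N\<close> is in \<open>U\<close>.\<close>
    define E0 where "E0 = (if N \<in> P \<union> U then End0 else End1)"
    define E1 where "E1 = (if N \<in> P then End0 else End1)"
    have s0: "rho_face N (xs @ [U, {Suc N}] @ ys) = snoc E0 (rho_face (N - 1) u0)"
      using rho_face_single[OF t1(1) xsU ys] by (simp add: u0_def E0_def)
    have s1: "rho_face N (xs @ [{Suc N}, U] @ ys) = snoc E1 (rho_face (N - 1) u0)"
      using rho_face_single[OF t1(2) xs Uys] by (simp add: u0_def E1_def)
    define k :: int where "k = (if N \<in> U then (-1) ^ part_dim ys else 0)"
    have ins: "rho_face N (a @ insert (Suc N) U # b) =
        frag_cmul (if N \<in> U then (-1) ^ part_dim b else 0) (snoc Edge (rho_face (N - 1) (a @ U # b)))"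
      if "a \<in> ordered_partitions P" "b \<in> ordered_partitions Q" for a b
      using rho_face_insert_in[OF t _ that] rho_face_insert_notin[OF False D(5)] by simp
    have r1: "?R (concat_product (perm_boundary_face xs) (frag_of (insert (Suc N) U # ys))) =
        frag_cmul k (snoc Edge (?R' (concat_product (perm_boundary_face xs) (frag_of (U # ys)))))"
      by (rule snoc_frag_extend_left) (simp add: ins bxs ys k_def)
    \<comment> \<open>The boundary lowers the dimension behind the enlarged block by one, whence
      \<open>- k\<close>.\<close>
    have r3: "?R (concat_product (frag_of (xs @ [insert (Suc N) U])) (perm_boundary_face ys)) =
        frag_cmul (- k) (snoc Edge (?R' (concat_product (frag_of (xs @ [U])) (perm_boundary_face ys))))"
    proof (rule snoc_frag_extend_right)
      fix b assume b: "b \<in> Poly_Mapping.keys (perm_boundary_face ys)"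
      have "(-1::int) ^ part_dim ys = - ((-1) ^ part_dim b)"
        unfolding perm_boundary_face_degree[OF b, symmetric] by simp
      then have "(if N \<in> U then (-1) ^ part_dim b else 0) = - k"
        unfolding k_def by simp
      then show "rho_face N ((xs @ [insert (Suc N) U]) @ b) =
          frag_cmul (- k) (snoc Edge (rho_face (N - 1) ((xs @ [U]) @ b)))"
        using ins[OF xs bys[OF b]] by (simp only: append_assoc append_Cons append_Nil)
    qed
    have r2: "?R (concat_product (concat_product (frag_of xs) (frag_extend (grow (Suc N)) (block_boundary U))) (frag_of ys)) =
        frag_cmul k (snoc Edge (?R' (concat_product (concat_product (frag_of xs) (block_boundary U)) (frag_of ys))))"
    proof (rule frag_additive_eqI[where c = "block_boundary U"])
      fix w assume "w \<in> Poly_Mapping.keys (block_boundary U)"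
      then have "w \<in> ordered_partitions U"
        using keys_perm_boundary_face[of "[U]" U] False D(2) by auto
      then show "?R (concat_product (concat_product (frag_of xs) (frag_extend (grow (Suc N)) (frag_of w))) (frag_of ys)) =
        frag_cmul k (snoc Edge (?R' (concat_product (concat_product (frag_of xs) (frag_of w)) (frag_of ys))))"
        using rho_grow[OF t xs _ ys] by (simp add: k_def)
    qed (simp_all add: frag_extend_diff concat_product_diff_left concat_product_diff_right frag_cmul_diff_distrib2)
    have "?R (perm_boundary_face u) = frag_cmul k (snoc Edge (?R' (perm_boundary_face u0))) +
      frag_cmul ((-1) ^ (part_dim xs + card U)) (snoc E0 (rho_face (N - 1) u0) - snoc E1 (rho_face (N - 1) u0))"
    proof -
      have b: "?R (concat_product (concat_product (frag_of xs) (block_boundary (insert (Suc N) U))) (frag_of ys)) =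
        frag_cmul k (snoc Edge (?R' (concat_product (concat_product (frag_of xs) (block_boundary U)) (frag_of ys)))) +
        frag_cmul ((-1) ^ card U) (snoc E0 (rho_face (N - 1) u0) - snoc E1 (rho_face (N - 1) u0))"
        using s0 s1 by (simp add: grow_block_boundary[OF below] concat_product_add_left concat_product_add_right
            concat_product_cmul_left concat_product_cmul_right concat_product_diff_left concat_product_diff_right
            frag_extend_add frag_extend_cmul frag_extend_diff r2)
      have c: "(-1::int) ^ (part_dim xs + (card (insert (Suc N) U) - 1)) * - k = k * (-1) ^ (part_dim xs + (card U - 1))"
        using cU by (cases "card U") simp_all
      show ?thesis
        unfolding u perm_boundary_face_middle frag_extend_add frag_extend_cmul r1 r3 b u0_def[symmetric]
        by (simp only: frag_cmul_cmul c)
          (simp add: u0_def perm_boundary_face_middle frag_extend_add frag_extend_cmul frag_cmul_distrib2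
            frag_cmul_diff_distrib2 power_add mult.commute)
    qed
    also have "\<dots> = cube.bd (rho_face N u)"
    proof (cases "N \<in> U")
      case True
      have NP: "N \<notin> P"
        using True D(12) by blast
      have ru: "rho_face N u = frag_cmul k (snoc Edge (rho_face (N - 1) u0))"
        using ins[OF xs ys] True by (simp add: u u0_def k_def)
      have b: "cube.bd (snoc Edge (rho_face (N - 1) u0)) = snoc Edge (cube.bd (rho_face (N - 1) u0)) +
          frag_cmul ((-1) ^ part_dim u0) (snoc End1 (rho_face (N - 1) u0) - snoc End0 (rho_face (N - 1) u0))"
        using rho_face_degree[OF Suc.hyps u0]
        by (subst cube_bd_snoc[where d = "part_dim u0"]) (auto simp: snoc_def concat_product_diff_right)
      have sg: "(-1::int) ^ (part_dim xs + card U) = - (k * (-1) ^ part_dim u0)"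
        using cU(1) True by (cases "card U") (simp_all add: k_def u0_def power_add flip: power_mult_distrib)
      have m: "frag_cmul (- z) (x - y) = frag_cmul z (y - x)" for z :: int and x y :: "interval_cell list \<Rightarrow>\<^sub>0 int"
        by (rule poly_mapping_eqI) (simp add: lookup_minus algebra_simps)
      have E: "E0 = End0" "E1 = End1"
        using True NP by (simp_all add: E0_def E1_def)
      show ?thesis
        by (simp only: ru frag_extend_cmul b Suc.IH[OF u0] E sg m frag_cmul_distrib2 frag_cmul_cmul)
    next
      \<comment> \<open>Here the face itself is collapsed, and \<open>E0 = E1\<close> makes the two
        end terms cancel.\<close>
      case F: False
      then show ?thesis
        using ins[OF xs ys] by (simp add: u k_def E0_def E1_def)
    qed
    finally show ?thesis
      by simp
  qed
qed

subsection \<open>Compatibility of the projection with the diagonal\<close>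

definition rho_pair :: "nat \<Rightarrow> (nat set list \<times> nat set list \<Rightarrow>\<^sub>0 int) \<Rightarrow> (interval_cell list \<times> interval_cell list \<Rightarrow>\<^sub>0 int)" where
  "rho_pair n = frag_extend (\<lambda>(a, b). tensor (rho_face n a) (rho_face n b))"

lemma rho_pair_simps: "rho_pair n (frag_of (a, b)) = tensor (rho_face n a) (rho_face n b)"
  "rho_pair n (x - y) = rho_pair n x - rho_pair n y" "rho_pair n (frag_cmul k x) = frag_cmul k (rho_pair n x)"
  "rho_pair n 0 = 0"
  by (simp_all add: rho_pair_def frag_extend_diff frag_extend_cmul)

lemma rho_pair_tensor:
  "rho_pair n (tensor x y) = tensor (frag_extend (rho_face n) x) (frag_extend (rho_face n) y)"
proof -
  have *: "rho_pair n (tensor (frag_of a) y) = tensor (rho_face n a) (frag_extend (rho_face n) y)" for a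
    by (rule frag_additive_eqI[where c = y]) (simp_all add: tensor_diff_right frag_extend_diff rho_pair_simps)
  show ?thesis
    by (rule frag_additive_eqI[where c = x]) (simp_all add: * tensor_diff_left frag_extend_diff rho_pair_simps)
qed

lemma grow_parity_op:
  assumes "w \<in> ordered_partitions W" "finite W" "W \<subseteq> {1..N}" "c \<in> Poly_Mapping.keys (grow (Suc N) w)"
  shows "even (part_dim c + Suc (part_dim w))"
proof (rule grow_parity[OF _ assms(4)])
  show "\<forall>V\<in>set w. below (Suc N) V"
    by (rule ordered_partitions_below[OF assms(1,2)]) (use assms(3) in \<open>auto simp: less_Suc_eq_le\<close>)
qed

lemma keys_concat_product_parity:
  assumes "\<And>c. c \<in> Poly_Mapping.keys x \<Longrightarrow> even (part_dim c + d)" "c \<in> Poly_Mapping.keys (concat_product x (frag_of v))"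
  shows "even (part_dim c + (d + part_dim v))"
proof -
  have "Poly_Mapping.keys (concat_product x (frag_of v)) \<subseteq> {c. even (part_dim c + (d + part_dim v))}"
    by (rule keys_concat_product) (use assms(1) in \<open>auto simp: keys_frag_of\<close>)
  then show ?thesis
    using assms(2) by blast
qed

text \<open>The exponent collects the sign of \<open>grow_left\<close>, the Koszul signs of the two
  products and the sign of \<open>rho_grow\<close>; \<open>sign_left\<close> compares it with the
  sign on the cube.\<close>

lemma rho_pair_grow_left:
  assumes t: "three_parts N P C Q" and a: "a \<in> ordered_partitions P" and w: "w \<in> ordered_partitions C"
    and a': "a' \<in> ordered_partitions Q"
  shows "rho_pair N (bar (frag_of (a, b)) (bar (grow_left (Suc N) (frag_of (w, v))) (frag_of (a', b')))) =
    (if N \<in> C then frag_cmul ((-1) ^ (part_dim v + part_dim a' * part_dim v + (Suc (part_dim w) + part_dim a') * part_dim b + part_dim a'))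
      (tensor (snoc Edge (rho_face (N - 1) (a @ w @ a'))) (rho_face N (b @ v @ b'))) else 0)"
proof -
  note D = three_partsD[OF t]
  have "bar (frag_of (a, b)) (bar (grow_left (Suc N) (frag_of (w, v))) (frag_of (a', b'))) =
    frag_cmul ((-1) ^ part_dim v * ((-1) ^ (part_dim a' * part_dim v) * (-1) ^ ((Suc (part_dim w) + part_dim a') * part_dim b)))
      (tensor (concat_product (frag_of a) (concat_product (grow (Suc N) w) (frag_of a'))) (frag_of (b @ v @ b')))"
    by (simp only: grow_left_of bar_product_cmul_left bar_product_cmul_right perm.bar_tensor_left1
        perm.bar_tensor_right1[OF keys_concat_product_parity[OF grow_parity_op[OF w D(2,5)]]] frag_cmul_cmul mult.assoc)
  note e = this
  note g = rho_grow[OF t a w a', unfolded concat_product_assoc]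
  show ?thesis
  proof (cases "N \<in> C")
    case True
    show ?thesis
      by (simp only: e rho_pair_simps(3) rho_pair_tensor g True if_True frag_extend_of tensor_cmul_left
          frag_cmul_cmul power_add mult.assoc)
  next
    case False
    then show ?thesis
      by (simp only: e rho_pair_simps(3) rho_pair_tensor g if_False tensor_zero frag_cmul_zero2)
  qed
qed

lemma rho_pair_grow_right:
  assumes t: "three_parts N P B Q" and b: "b \<in> ordered_partitions P" and w: "w \<in> ordered_partitions B"
    and b': "b' \<in> ordered_partitions Q"
  shows "rho_pair N (bar (frag_of (a, b)) (bar (grow_right (Suc N) (frag_of (v, w))) (frag_of (a', b')))) =
    (if N \<in> B then frag_cmul ((-1) ^ (part_dim a' * Suc (part_dim w) + (part_dim v + part_dim a') * part_dim b + part_dim b'))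
      (tensor (rho_face N (a @ v @ a')) (snoc Edge (rho_face (N - 1) (b @ w @ b')))) else 0)"
proof -
  note D = three_partsD[OF t]
  have "bar (frag_of (a, b)) (bar (grow_right (Suc N) (frag_of (v, w))) (frag_of (a', b'))) =
    frag_cmul ((-1) ^ (part_dim a' * Suc (part_dim w)) * (-1) ^ ((part_dim v + part_dim a') * part_dim b))
      (tensor (frag_of (a @ v @ a')) (concat_product (frag_of b) (concat_product (grow (Suc N) w) (frag_of b'))))"
    by (simp only: grow_right_of bar_product_cmul_left bar_product_cmul_right
        perm.bar_tensor_left2[OF grow_parity_op[OF w D(2,5)]] perm.bar_tensor_right2 frag_cmul_cmul part_dim_simps)
  note e = this
  note g = rho_grow[OF t b w b', unfolded concat_product_assoc]
  show ?thesis
  proof (cases "N \<in> B")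
    case True
    show ?thesis
      by (simp only: e rho_pair_simps(3) rho_pair_tensor g True if_True frag_extend_of tensor_cmul_right
          frag_cmul_cmul power_add mult.assoc)
  next
    case False
    then show ?thesis
      by (simp only: e rho_pair_simps(3) rho_pair_tensor g if_False tensor_zero frag_cmul_zero2)
  qed
qed

lemmas pair_diffs = rho_pair_simps(2,4) bar_product_diff_left bar_product_diff_right grow_left_diff grow_right_diff
  frag_cmul_diff_distrib2

text \<open>In the second factor \<open>N + 1\<close> joins a block of \<open>B\<close>, in the
  first a block of \<open>C\<close>. Both factors can survive the projection only if
  \<open>N\<close> lies in \<open>B\<close> and in \<open>C\<close>, which are disjoint. This
  removes all splittings with two non-empty halves.\<close>

lemma rho_pair_mixed:
  assumes t: "three_parts N P (B \<union> C) Q" and BC: "B \<inter> C = {}"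
    and p: "a \<in> ordered_partitions P" "b \<in> ordered_partitions P"
    and q: "a' \<in> ordered_partitions Q" "b' \<in> ordered_partitions Q"
    and x: "Poly_Mapping.keys x \<subseteq> ordered_partitions B \<times> ordered_partitions B"
    and y: "Poly_Mapping.keys y \<subseteq> ordered_partitions C \<times> ordered_partitions C"
  shows "rho_pair N (bar (frag_of (a, b)) (bar (bar (grow_right (Suc N) x) (grow_left (Suc N) y)) (frag_of (a', b')))) = 0"
proof (rule frag_additive_eqI[where c = x])
  fix r assume r: "r \<in> Poly_Mapping.keys x"
  obtain a1 b1 where r1: "r = (a1, b1)"
    by fastforce
  have ab1: "a1 \<in> ordered_partitions B" "b1 \<in> ordered_partitions B"
    using r x unfolding r1 by blast+
  show "rho_pair N (bar (frag_of (a, b)) (bar (bar (grow_right (Suc N) (frag_of r)) (grow_left (Suc N) y)) (frag_of (a', b')))) = 0"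
  proof (rule frag_additive_eqI[where c = y])
    fix s assume s: "s \<in> Poly_Mapping.keys y"
    obtain a2 b2 where s2: "s = (a2, b2)"
      by fastforce
    have ab2: "a2 \<in> ordered_partitions C" "b2 \<in> ordered_partitions C"
      using s y unfolding s2 by blast+
    note D = three_partsD[OF t]
    show "rho_pair N (bar (frag_of (a, b)) (bar (bar (grow_right (Suc N) (frag_of r)) (grow_left (Suc N) (frag_of s))) (frag_of (a', b')))) = 0"
    proof (cases "N \<in> C")
      case False
      have t': "three_parts N (P \<union> B) C Q"
        unfolding three_parts_def D(15)[symmetric] using D(11,12,13,14) BC by blast
      have aa: "a @ a1 \<in> ordered_partitions (P \<union> B)"
        by (rule ordered_partitions_append[OF p(1) ab1(1)]) (use D(12) in blast)
      show ?thesis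
        unfolding r1 grow_right_of
      proof (rule frag_additive_eqI[where c = "grow (Suc N) b1"])
        fix z
        have "bar (frag_of (a, b)) (bar (bar (frag_of (a1, z)) (grow_left (Suc N) (frag_of s))) (frag_of (a', b'))) =
            bar (bar (frag_of (a, b)) (frag_of (a1, z))) (bar (grow_left (Suc N) (frag_of s)) (frag_of (a', b')))"
          by (simp only: perm.bar_assoc)
        then show "rho_pair N (bar (frag_of (a, b)) (bar (bar (tensor (frag_of a1) (frag_of z)) (grow_left (Suc N) (frag_of s))) (frag_of (a', b')))) = 0"
          using rho_pair_grow_left[OF t' aa ab2(1) q(1), of "b @ z" b2 b'] False
          by (simp add: s2 bar_product_frag_of bar_product_cmul_left rho_pair_simps)
      qed (simp_all add: pair_diffs tensor_diff_right)
    next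
      case True
      then have NB: "N \<notin> B"
        using BC by blast
      have t': "three_parts N P B (C \<union> Q)"
        unfolding three_parts_def D(15)[symmetric] using D(11,12,13,14) BC by blast
      have bb: "b2 @ b' \<in> ordered_partitions (C \<union> Q)"
        by (rule ordered_partitions_append[OF ab2(2) q(2)]) (use D(14) in blast)
      show ?thesis
        unfolding s2 grow_left_of
      proof (rule frag_additive_eqI[where c = "grow (Suc N) a2"])
        fix z
        have "bar (frag_of (a, b)) (bar (bar (grow_right (Suc N) (frag_of r)) (frag_of (z, b2))) (frag_of (a', b'))) =
            bar (frag_of (a, b)) (bar (grow_right (Suc N) (frag_of r)) (bar (frag_of (z, b2)) (frag_of (a', b'))))"
          by (simp only: perm.bar_assoc)
        then show "rho_pair N (bar (frag_of (a, b)) (bar (bar (grow_right (Suc N) (frag_of r)) (frag_cmul ((-1) ^ part_dim b2) (tensor (frag_of z) (frag_of b2)))) (frag_of (a', b')))) = 0"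
          using rho_pair_grow_right[OF t' p(2) ab1(2) bb, of a a1 "z @ a'"] NB
          by (simp add: r1 bar_product_frag_of bar_product_cmul_left bar_product_cmul_right rho_pair_simps)
      qed (simp_all add: pair_diffs tensor_diff_left)
    qed
  qed (simp_all add: pair_diffs rho_pair_simps)
qed (simp_all add: pair_diffs rho_pair_simps)

text \<open>The last coordinate of the first factor has to pass the second factor, of degree
  \<open>d\<close>.\<close>

lemma bar_snoc:
  assumes "\<And>c. c \<in> Poly_Mapping.keys y \<Longrightarrow> cube_dim c = d"
  shows "cube.bar (tensor x y) (frag_of ([e], [e'])) = frag_cmul ((-1) ^ (interval_dim e * d)) (tensor (snoc e x) (snoc e' y))"
proof (rule frag_additive_eqI[where c = x])
  fix a
  show "cube.bar (tensor (frag_of a) y) (frag_of ([e], [e'])) =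
      frag_cmul ((-1) ^ (interval_dim e * d)) (tensor (snoc e (frag_of a)) (snoc e' y))"
  proof (rule frag_additive_eqI[where c = y])
    fix b assume "b \<in> Poly_Mapping.keys y"
    from assms[OF this]
    show "cube.bar (tensor (frag_of a) (frag_of b)) (frag_of ([e], [e'])) =
      frag_cmul ((-1) ^ (interval_dim e * d)) (tensor (snoc e (frag_of a)) (snoc e' (frag_of b)))"
      by (simp add: bar_product_frag_of)
  qed (simp_all add: tensor_diff_right bar_product_diff_left frag_cmul_diff_distrib2)
qed (simp_all add: tensor_diff_left bar_product_diff_left frag_cmul_diff_distrib2)

lemma bar_three: "bar (frag_of (a, b)) (bar (frag_of (w, v)) (frag_of (a', b'))) =
    frag_cmul ((-1) ^ (part_dim a' * part_dim v + (part_dim w + part_dim a') * part_dim b)) (frag_of (a @ w @ a', b @ v @ b'))"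
  by (simp add: bar_product_frag_of bar_product_cmul_right power_add)

lemma rho_pair_single:
  assumes t: "three_parts N P {} Q" and p: "a \<in> ordered_partitions P" "b \<in> ordered_partitions P"
    and q: "a' \<in> ordered_partitions Q" "b' \<in> ordered_partitions Q"
  defines "e \<equiv> if N \<in> P then End0 else End1"
  shows "rho_pair N (bar (frag_of (a, b)) (bar (frag_of ([{Suc N}], [{Suc N}])) (frag_of (a', b')))) =
    cube.bar (rho_pair (N - 1) (bar (frag_of (a, b)) (frag_of (a', b')))) (frag_of ([e], [e]))"
proof -
  note D = three_partsD[OF t]
  have bb: "b @ b' \<in> ordered_partitions {1..N}"
    using three_parts_op[OF t p(2), of "[]" b'] q(2) by simp
  have "cube_dim c = part_dim (b @ b')" if "c \<in> Poly_Mapping.keys (rho_face (N - 1) (b @ b'))" for c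
    using rho_face_degree[OF D(11) bb] that by blast
  note bs = bar_snoc[OF this, where e = e and e' = e]
  have e0: "interval_dim e = 0"
    by (simp add: e_def)
  have "rho_face N (a @ {Suc N} # a') = snoc e (rho_face (N - 1) (a @ a'))"
    "rho_face N (b @ {Suc N} # b') = snoc e (rho_face (N - 1) (b @ b'))"
    unfolding e_def by (rule rho_face_single[OF t p(1) q(1)], rule rho_face_single[OF t p(2) q(2)])
  then show ?thesis
    by (simp add: bar_three) (simp add: bar_product_frag_of rho_pair_simps bar_product_cmul_left bs e0)
qed

lemma sign_left:
  fixes v w a b a' b' :: nat
  shows "(-1::int) ^ (v + a' * v + (Suc w + a') * b + a') =
    (-1) ^ (a' + b') * ((-1) ^ (a' * v + (w + a') * b) * (-1) ^ (b + (v + b')))"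
proof -
  have "v + a' * v + (Suc w + a') * b + a' + ((a' + b') + ((a' * v + (w + a') * b) + (b + (v + b')))) =
      2 * (v + a' * v + (w + a') * b + b + a' + b')"
    by (simp add: algebra_simps)
  then have "even (v + a' * v + (Suc w + a') * b + a' + ((a' + b') + ((a' * v + (w + a') * b) + (b + (v + b')))))"
    by (simp only: dvd_triv_left)
  then have "(-1::int) ^ (v + a' * v + (Suc w + a') * b + a') =
      (-1) ^ ((a' + b') + ((a' * v + (w + a') * b) + (b + (v + b'))))"
    by (rule minus_one_power_eqI)
  then show ?thesis
    by (simp only: power_add mult.assoc)
qed

lemma sign_right:
  fixes v w a b a' b' :: nat
  shows "(-1::int) ^ (a' * Suc w + (v + a') * b + b') = (-1) ^ (a' + b') * (-1) ^ (a' * w + (v + a') * b)"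
proof -
  have "a' * Suc w + (v + a') * b + b' + ((a' + b') + (a' * w + (v + a') * b)) =
      2 * (a' * w + (v + a') * b + a' + b')"
    by (simp add: algebra_simps)
  then have "even (a' * Suc w + (v + a') * b + b' + ((a' + b') + (a' * w + (v + a') * b)))"
    by (simp only: dvd_triv_left)
  then have "(-1::int) ^ (a' * Suc w + (v + a') * b + b') = (-1) ^ ((a' + b') + (a' * w + (v + a') * b))"
    by (rule minus_one_power_eqI)
  then show ?thesis
    by (simp only: power_add mult.assoc)
qed

text \<open>Only splittings with an empty half remain. For \<open>N\<close> in \<open>U\<close>, the
  one with \<open>B = {}\<close> puts the new block before the letters of \<open>U\<close> in the
  second factor and gives \<open>[Edge]\<close> with \<open>[End1]\<close>; the one with
  \<open>C = {}\<close> puts it after them in the first factor and gives \<open>[End0]\<close> with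
  \<open>[Edge]\<close>. These are the two terms of the Serre diagonal of the new edge.\<close>

lemma rho_pair_insert:
  assumes t: "three_parts N P U Q" and U: "U \<noteq> {}" and p: "a \<in> ordered_partitions P" "b \<in> ordered_partitions P"
    and q: "a' \<in> ordered_partitions Q" "b' \<in> ordered_partitions Q"
    and d: "part_dim a' + part_dim b' = d"
  shows "rho_pair N (bar (frag_of (a, b)) (bar (set_diag (insert (Suc N) U)) (frag_of (a', b')))) =
    (if N \<in> U then frag_cmul ((-1) ^ d)
      (cube.bar (rho_pair (N - 1) (bar (frag_of (a, b)) (bar (set_diag U) (frag_of (a', b'))))) (interval_diag Edge)) else 0)"
proof -
  note D = three_partsD[OF t]
  let ?m = "Suc N"
  let ?F = "\<lambda>z. rho_pair N (bar (frag_of (a, b)) (bar z (frag_of (a', b'))))"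
  let ?G = "\<lambda>z. rho_pair (N - 1) (bar (frag_of (a, b)) (bar z (frag_of (a', b'))))"
  have keys: "Poly_Mapping.keys (set_diag B) \<subseteq> ordered_partitions B \<times> ordered_partitions B" if "B \<subseteq> U" for B
  proof (cases "B = {}")
    case False
    then show ?thesis
      using set_diag.D_cells[OF finite_subset[OF that D(2)] False] unfolding set_diag.cells_def by blast
  qed (simp add: set_diag.D_empty keys_frag_of)
  have bwb: "b @ w @ b' \<in> ordered_partitions {1..N}" if "w \<in> ordered_partitions U" for w
    using three_parts_op[OF t p(2) that q(2)] .
  have deg: "cube_dim c = part_dim (b @ w @ b')"
    if "w \<in> ordered_partitions U" "c \<in> Poly_Mapping.keys (rho_face (N - 1) (b @ w @ b'))" for w c
    using rho_face_degree[OF D(11) bwb[OF that(1)]] that(2) by blast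
  have T1: "?F (bar (frag_of ([], [{?m}])) (grow_left ?m (set_diag U))) =
      (if N \<in> U then frag_cmul ((-1) ^ d) (cube.bar (?G (set_diag U)) (frag_of ([Edge], [End1]))) else 0)"
  proof (rule frag_additive_eqI[where c = "set_diag U"])
    fix r assume r: "r \<in> Poly_Mapping.keys (set_diag U)"
    obtain w v where wv: "r = (w, v)"
      by fastforce
    have op: "w \<in> ordered_partitions U" "v \<in> ordered_partitions U"
      using r keys[OF subset_refl] unfolding wv by blast+
    have t': "three_parts N P {} (U \<union> Q)"
      unfolding three_parts_def D(15)[symmetric] using D(11,12,13,14) by blast
    have vb: "v @ b' \<in> ordered_partitions (U \<union> Q)"
      by (rule ordered_partitions_append[OF op(2) q(2)]) (use D(14) in blast)
    have e: "bar (frag_of (a, b)) (frag_of ([], [{?m}])) = frag_of (a, b @ [{?m}])"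
      by (simp add: bar_product_frag_of)
    have "?F (bar (frag_of ([], [{?m}])) (grow_left ?m (frag_of (w, v)))) =
        rho_pair N (bar (frag_of (a, b @ [{?m}])) (bar (grow_left ?m (frag_of (w, v))) (frag_of (a', b'))))"
      unfolding e[symmetric] by (simp only: perm.bar_assoc)
    also have "\<dots> = (if N \<in> U then frag_cmul ((-1) ^ d) (cube.bar (?G (frag_of (w, v))) (frag_of ([Edge], [End1]))) else 0)"
    proof (cases "N \<in> U")
      case True
      then have "N \<notin> P"
        using D(12) by blast
      then have s: "rho_face N ((b @ [{?m}]) @ v @ b') = snoc End1 (rho_face (N - 1) (b @ v @ b'))"
        using rho_face_single[OF t' p(2) vb] by simp
      have sg: "(-1::int) ^ (part_dim v + part_dim a' * part_dim v + (Suc (part_dim w) + part_dim a') * part_dim b + part_dim a') =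
          (-1) ^ d * ((-1) ^ (part_dim a' * part_dim v + (part_dim w + part_dim a') * part_dim b) *
            (-1) ^ (interval_dim Edge * part_dim (b @ v @ b')))"
        unfolding d[symmetric] by (simp only: interval_dim.simps part_dim_simps mult_1_left sign_left)
      have pd: "part_dim (b @ [{?m}]) = part_dim b"
        by simp
      show ?thesis
        by (simp only: True if_True rho_pair_grow_left[OF t p(1) op(1) q(1)] s pd sg bar_three rho_pair_simps
            bar_product_cmul_left bar_snoc[OF deg[OF op(2)]] frag_cmul_cmul)
    next
      case False
      then show ?thesis
        by (simp only: rho_pair_grow_left[OF t p(1) op(1) q(1)] if_False)
    qed
    finally show "?F (bar (frag_of ([], [{?m}])) (grow_left ?m (frag_of r))) =
      (if N \<in> U then frag_cmul ((-1) ^ d) (cube.bar (?G (frag_of r)) (frag_of ([Edge], [End1]))) else 0)"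
      unfolding wv .
  qed (simp_all add: pair_diffs)
  have T2: "?F (bar (grow_right ?m (set_diag U)) (frag_of ([{?m}], []))) =
      (if N \<in> U then frag_cmul ((-1) ^ d) (cube.bar (?G (set_diag U)) (frag_of ([End0], [Edge]))) else 0)"
  proof (rule frag_additive_eqI[where c = "set_diag U"])
    fix r assume r: "r \<in> Poly_Mapping.keys (set_diag U)"
    obtain v w where wv: "r = (v, w)"
      by fastforce
    have op: "v \<in> ordered_partitions U" "w \<in> ordered_partitions U"
      using r keys[OF subset_refl] unfolding wv by blast+
    have t': "three_parts N (P \<union> U) {} Q"
      unfolding three_parts_def D(15)[symmetric] using D(11,12,13,14) by blast
    have av: "a @ v \<in> ordered_partitions (P \<union> U)"
      by (rule ordered_partitions_append[OF p(1) op(1)]) (use D(12) in blast)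
    have e: "bar (frag_of ([{?m}], [])) (frag_of (a', b')) = frag_of ({?m} # a', b')"
      by (simp add: bar_product_frag_of)
    have "?F (bar (grow_right ?m (frag_of (v, w))) (frag_of ([{?m}], []))) =
        rho_pair N (bar (frag_of (a, b)) (bar (grow_right ?m (frag_of (v, w))) (frag_of ({?m} # a', b'))))"
      unfolding e[symmetric] by (simp only: perm.bar_assoc)
    also have "\<dots> = (if N \<in> U then frag_cmul ((-1) ^ d) (cube.bar (?G (frag_of (v, w))) (frag_of ([End0], [Edge]))) else 0)"
    proof (cases "N \<in> U")
      case True
      then have s: "rho_face N (a @ v @ {?m} # a') = snoc End0 (rho_face (N - 1) (a @ v @ a'))"
        using rho_face_single[OF t' av q(1)] by simp
      have sg: "(-1::int) ^ (part_dim a' * Suc (part_dim w) + (part_dim v + part_dim a') * part_dim b + part_dim b') =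
          (-1) ^ d * ((-1) ^ (part_dim a' * part_dim w + (part_dim v + part_dim a') * part_dim b) *
            (-1) ^ (interval_dim End0 * part_dim (b @ w @ b')))"
        unfolding d[symmetric] by (simp only: interval_dim.simps mult_0 power_0 mult_1_right sign_right)
      have pd: "part_dim ({?m} # a') = part_dim a'"
        by simp
      show ?thesis
        by (simp only: True if_True rho_pair_grow_right[OF t p(2) op(2) q(2)] s pd sg bar_three rho_pair_simps
            bar_product_cmul_left bar_snoc[OF deg[OF op(2)]] frag_cmul_cmul)
    next
      case False
      then show ?thesis
        by (simp only: rho_pair_grow_right[OF t p(2) op(2) q(2)] if_False)
    qed
    finally show "?F (bar (grow_right ?m (frag_of r)) (frag_of ([{?m}], []))) =
      (if N \<in> U then frag_cmul ((-1) ^ d) (cube.bar (?G (frag_of r)) (frag_of ([End0], [Edge]))) else 0)"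
      unfolding wv .
  qed (simp_all add: pair_diffs)
  have F_splits: "?F (splits U f) = splits U (\<lambda>B C. ?F (f B C))" for f
    by (simp add: splits_bar_left splits_bar_right rho_pair_def splits_frag_extend)
  have below: "\<forall>x\<in>U. x < ?m"
    using D(5) by (auto simp: less_Suc_eq_le)
  have "?F (set_diag (insert ?m U)) = splits U (\<lambda>B C. frag_cmul (shuff B C)
      (?F (bar (right_hat ?m set_diag B) (left_hat ?m set_diag C))))"
    unfolding set_diag.D_insert[OF D(2) below] F_splits
    by (simp only: bar_product_cmul_left bar_product_cmul_right rho_pair_simps)
  also have "\<dots> = splits U (\<lambda>B C.
      (if B = {} then ?F (bar (frag_of ([], [{?m}])) (grow_left ?m (set_diag C))) else 0) +
      (if C = {} then ?F (bar (grow_right ?m (set_diag B)) (frag_of ([{?m}], []))) else 0))"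
  proof (rule splits_cong[OF refl])
    fix B C assume BC: "B \<union> C = U" "B \<inter> C = {}"
    then have sub: "B \<subseteq> U" "C \<subseteq> U"
      by blast+
    have fin: "finite B" "finite C"
      using sub D(2) finite_subset by blast+
    consider "B = {}" "C \<noteq> {}" | "B \<noteq> {}" "C = {}" | "B \<noteq> {}" "C \<noteq> {}"
      using BC(1) U by blast
    then show "frag_cmul (shuff B C) (?F (bar (right_hat ?m set_diag B) (left_hat ?m set_diag C))) =
      (if B = {} then ?F (bar (frag_of ([], [{?m}])) (grow_left ?m (set_diag C))) else 0) +
      (if C = {} then ?F (bar (grow_right ?m (set_diag B)) (frag_of ([{?m}], []))) else 0)"
    proof cases
      case 3
      then show ?thesis
        using rho_pair_mixed[OF t[folded BC(1)] BC(2) p q keys[OF sub(1)] keys[OF sub(2)]] by (simp add: grow_hat_def)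
    qed (use fin in \<open>simp_all add: grow_hat_def shuff_cross\<close>)
  qed
  also have "\<dots> = ?F (bar (frag_of ([], [{?m}])) (grow_left ?m (set_diag U))) +
      ?F (bar (grow_right ?m (set_diag U)) (frag_of ([{?m}], [])))"
    unfolding splits_add splits_delta_left[OF D(2)] splits_delta_right[OF D(2)] ..
  also have "\<dots> = (if N \<in> U then frag_cmul ((-1) ^ d) (cube.bar (?G (set_diag U)) (interval_diag Edge)) else 0)"
    unfolding T1 T2 by (simp add: bar_product_add_right frag_cmul_distrib2 add.commute)
  finally show ?thesis .
qed

lemma rho_pair_bilinear:
  assumes "\<And>p q. p \<in> Poly_Mapping.keys x \<Longrightarrow> q \<in> Poly_Mapping.keys y \<Longrightarrow>
    rho_pair N (bar (frag_of p) (bar z (frag_of q))) =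
    frag_cmul k (cube.bar (rho_pair N' (bar (frag_of p) (bar z' (frag_of q)))) w)"
  shows "rho_pair N (bar x (bar z y)) = frag_cmul k (cube.bar (rho_pair N' (bar x (bar z' y))) w)"
proof (rule frag_additive_eqI[where c = x])
  fix p assume p: "p \<in> Poly_Mapping.keys x"
  show "rho_pair N (bar (frag_of p) (bar z y)) = frag_cmul k (cube.bar (rho_pair N' (bar (frag_of p) (bar z' y))) w)"
    by (rule frag_additive_eqI[where c = y]) (use assms[OF p] in \<open>simp_all add: pair_diffs\<close>)
qed (simp_all add: pair_diffs)

text \<open>Removing the largest element changes one factor of the diagonal on the permutahedron and
  strips the last coordinate of the cube. What has to match is the diagonal of that coordinate: a
  vertex for a block by itself, an edge if \<open>N\<close> is in the same block, and 0 on both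
  sides otherwise.\<close>

lemma rho_face_diagonal:
  "1 \<le> N \<Longrightarrow> u \<in> ordered_partitions {1..N} \<Longrightarrow> rho_pair (N - 1) (perm.copc u) = cube.cop (rho_face (N - 1) u)"
proof (induction N arbitrary: u rule: nat_induct_at_least)
  case base
  then have "u = [{1}]"
    by (rule op_one)
  then show ?case
    by (simp add: rho_face_zero[unfolded One_nat_def] perm.copc_Cons perm_diag_block_set_diag set_diag_singleton
        rho_pair_simps)
next
  case (Suc N)
  from Suc.prems Suc.hyps obtain xs U ys P Q where u: "u = xs @ insert (Suc N) U # ys"
    and t: "three_parts N P U Q" and xs: "xs \<in> ordered_partitions P" and ys: "ys \<in> ordered_partitions Q"
    by (rule three_parts_cases)
  note D = three_partsD[OF t]
  have cu: "perm.copc u = bar (perm.copc xs) (bar (set_diag (insert (Suc N) U)) (perm.copc ys))"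
    using D(2) by (simp add: u perm.copc_append perm.copc_Cons perm_diag_block_set_diag)
  have kx: "fst p \<in> ordered_partitions P" "snd p \<in> ordered_partitions P" if "p \<in> Poly_Mapping.keys (perm.copc xs)" for p
    using keys_perm_copc[OF xs D(1)] that by auto
  have ky: "fst q \<in> ordered_partitions Q" "snd q \<in> ordered_partitions Q" "part_dim (fst q) + part_dim (snd q) = part_dim ys"
    if "q \<in> Poly_Mapping.keys (perm.copc ys)" for q
    using keys_perm_copc[OF ys D(3)] perm.copc_degree[OF ordered_partitions_letters[OF ys D(3)]] that by auto
  show ?case
  proof (cases "U = {}")
    case True
    define e where "e = (if N \<in> P then End0 else End1)"
    have xy: "xs @ ys \<in> ordered_partitions {1..N}"
      using three_parts_op[OF t[unfolded True] xs, of "[]" ys] ys by simp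
    have "rho_pair N (bar (perm.copc xs) (bar (frag_of ([{Suc N}], [{Suc N}])) (perm.copc ys))) =
        frag_cmul 1 (cube.bar (rho_pair (N - 1) (bar (perm.copc xs) (bar (frag_of ([], [])) (perm.copc ys)))) (frag_of ([e], [e])))"
    proof (rule rho_pair_bilinear)
      fix p q assume pq: "p \<in> Poly_Mapping.keys (perm.copc xs)" "q \<in> Poly_Mapping.keys (perm.copc ys)"
      show "rho_pair N (bar (frag_of p) (bar (frag_of ([{Suc N}], [{Suc N}])) (frag_of q))) =
        frag_cmul 1 (cube.bar (rho_pair (N - 1) (bar (frag_of p) (bar (frag_of ([], [])) (frag_of q)))) (frag_of ([e], [e])))"
        using rho_pair_single[OF t[unfolded True] kx[OF pq(1)] ky(1,2)[OF pq(2)]] by (simp add: e_def)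
    qed
    then have "rho_pair N (perm.copc u) = cube.bar (rho_pair (N - 1) (perm.copc (xs @ ys))) (frag_of ([e], [e]))"
      by (simp add: cu True set_diag_singleton perm.copc_append)
    also have "\<dots> = cube.bar (cube.cop (rho_face (N - 1) (xs @ ys))) (frag_of ([e], [e]))"
      by (simp only: Suc.IH[OF xy])
    also have "\<dots> = cube.cop (snoc e (rho_face (N - 1) (xs @ ys)))"
      unfolding snoc_def cube.cop_concat_product by (simp add: cube.copc_Cons e_def)
    also have "snoc e (rho_face (N - 1) (xs @ ys)) = rho_face N u"
      unfolding u True e_def by (rule rho_face_single[OF t[unfolded True] xs ys, symmetric])
    finally show ?thesis
      by simp
  next
    case False
    define k :: int where "k = (if N \<in> U then (-1) ^ part_dim ys else 0)"
    have u0: "xs @ U # ys \<in> ordered_partitions {1..N}"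
      using three_parts_op[OF t xs _ ys, of "[U]"] False by simp
    have cu0: "perm.copc (xs @ U # ys) = bar (perm.copc xs) (bar (set_diag U) (perm.copc ys))"
      using D(2) False by (simp add: perm.copc_append perm.copc_Cons perm_diag_block_set_diag)
    have "rho_pair N (perm.copc u) = frag_cmul k (cube.bar (rho_pair (N - 1) (perm.copc (xs @ U # ys))) (interval_diag Edge))"
      unfolding cu cu0
    proof (rule rho_pair_bilinear)
      fix p q assume pq: "p \<in> Poly_Mapping.keys (perm.copc xs)" "q \<in> Poly_Mapping.keys (perm.copc ys)"
      show "rho_pair N (bar (frag_of p) (bar (set_diag (insert (Suc N) U)) (frag_of q))) =
        frag_cmul k (cube.bar (rho_pair (N - 1) (bar (frag_of p) (bar (set_diag U) (frag_of q)))) (interval_diag Edge))"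
        using rho_pair_insert[OF t False kx[OF pq(1)] ky[OF pq(2)]] by (simp add: k_def del: interval_diag.simps)
    qed
    also have "\<dots> = frag_cmul k (cube.bar (cube.cop (rho_face (N - 1) (xs @ U # ys))) (interval_diag Edge))"
      by (simp only: Suc.IH[OF u0])
    also have "\<dots> = cube.cop (frag_cmul k (snoc Edge (rho_face (N - 1) (xs @ U # ys))))"
      unfolding snoc_def frag_extend_cmul cube.cop_concat_product by (simp add: cube.copc_Cons del: interval_diag.simps)
    also have "frag_cmul k (snoc Edge (rho_face (N - 1) (xs @ U # ys))) = rho_face N u"
      using rho_face_insert_in[OF t _ xs ys] rho_face_insert_notin[OF False D(5), of N xs ys] by (simp add: u k_def)
    finally show ?thesis
      by simp
  qed
qed

theorem corollary1:
  fixes n :: nat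
  assumes "n \<ge> 1"
  shows "dg_coalgebra (perm_faces (n + 1)) part_dim perm_boundary perm_diag \<and>
    dg_coalgebra_map
      (perm_faces (n + 1)) part_dim perm_boundary perm_diag
      (cube_cells n) cube_dim cube_boundary cube_diag
      (rho_chain n)"
proof (intro conjI dg_coalgebra_map.intro dg_coalgebra_map_axioms.intro dg_coalgebra_perm dg_coalgebra_cube)
  have deg: "Poly_Mapping.keys (rho_face n u) \<subseteq> {c. length c = n \<and> cube_dim c = part_dim u}"
    if "u \<in> perm_faces (n + 1)" for u
    using rho_face_degree[of "n + 1" u] that by (simp add: perm_faces_def)
  show "rho_chain n \<in> hom (free_Abelian_group (perm_faces (n + 1))) (free_Abelian_group (cube_cells n))"
    unfolding rho_chain_face by (rule frag_extend_hom) (use deg in \<open>auto simp: cube_cells_def\<close>)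
  show "rho_chain n (frag_of u) \<in> carrier (free_Abelian_group {a \<in> cube_cells n. cube_dim a = part_dim u})"
    if "u \<in> perm_faces (n + 1)" for u
    unfolding rho_chain_face using deg[OF that] by (simp add: cube_cells_def)
  show "rho_chain n (perm_boundary c) = cube_boundary (rho_chain n c)"
    if c: "c \<in> carrier (free_Abelian_group (perm_faces (n + 1)))" for c
    unfolding rho_chain_face perm_diag_eq cube_diag_eq
  proof (rule frag_additive_eqI[where c = c])
    fix u assume "u \<in> Poly_Mapping.keys c"
    then have "u \<in> ordered_partitions {1..n + 1}"
      using c by (auto simp: perm_faces_def)
    then show "frag_extend (rho_face n) (perm.bd (frag_of u)) = cube.bd (frag_extend (rho_face n) (frag_of u))"
      using rho_face_boundary[of "n + 1" u] by simp
  qed (simp_all add: frag_extend_diff)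
  show "cube_diag (rho_chain n c) = tensor_map (rho_chain n) (rho_chain n) (perm_diag c)"
    if c: "c \<in> carrier (free_Abelian_group (perm_faces (n + 1)))" for c
  proof -
    have tm: "tensor_map (frag_extend (rho_face n)) (frag_extend (rho_face n)) = rho_pair n"
      by (simp add: tensor_map_def rho_pair_def)
    have "cube.cop (frag_extend (rho_face n) c) = rho_pair n (perm.cop c)"
    proof (rule frag_additive_eqI[where c = c])
      fix u assume "u \<in> Poly_Mapping.keys c"
      then have "u \<in> ordered_partitions {1..n + 1}"
        using c by (auto simp: perm_faces_def)
      then show "cube.cop (frag_extend (rho_face n) (frag_of u)) = rho_pair n (perm.cop (frag_of u))"
        using rho_face_diagonal[of "n + 1" u] by simp
    qed (simp_all add: frag_extend_diff rho_pair_simps)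
    then show ?thesis
      unfolding rho_chain_face perm_diag_eq cube_diag_eq tm .
  qed
qed

end
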